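(* Let $\alpha>0$. If $f\in L^2(\mathbb{Q}_S)$ is a complex valued square integrable function on $\mathbb{Q}_S$ which belongs to the domain $\mathrm{Dom}(D^\alpha)$ of $-D^\alpha$, then the Cauchy problem $$\begin{cases}\dfrac{\partial u(x,t)}{\partial t}+D^\alpha u(x,t)=0, & x\in\mathbb{Q}_S,\ t\ge 0,\\ u(x,0)=f(x),\end{cases}$$ has a classical solution $u(x,t)$, determined by the convolution of $f$ with the heat kernel $Z(x,t)$: $u(\cdot,t)=Z(\cdot,t)*f$ for $t>0$ and $u(\cdot,0)=f$. In addition, $Z(x,t)$ is the transition density (that is, $p(t,x,y)=Z(x-y,t)$) of a time and space homogeneous Markov process on $\mathbb{Q}_S$ which is bounded, right-continuous and has no discontinuities other than jumps.
   Context: Let $S$ be a nonempty finite set of prime numbers, $\mathbb{Q}_S=\prod_{p\in S}\mathbb{Q}_p$ with the product topology and componentwise operations, and $\mathbb{Z}_S=\prod_{p\in S}\mathbb{Z}_p$; $\mathbb{Q}$ is embedded diagonally in $\mathbb{Q}_S$. Let $dx$ be the Haar measure on $(\mathbb{Q}_S,+)$ with $\mathbb{Z}_S$ of measure $1$. Let $q_1<q_2<\cdots$ be the increasing enumeration of $\{p^l: p\in S,\ l\ge 1\}$ and let $p_k\in S$ be the prime of which $q_k$ is a power. Define $\psi:\mathbb{Z}\to\mathbb{R}$ by $\psi(0)=0$, $\psi(n)=\sum_{k=1}^n\log p_k$ and $\psi(-n)=-\psi(n)$ for $n\ge1$; thus $e^{\psi(n)}\in\mathbb{Q}$ and $\psi$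 is strictly increasing. Put $B_n=e^{-\psi(n)}\mathbb{Z}_S$ for $n\in\mathbb{Z}$. These are compact open subgroups with $B_{n-1}\subsetneq B_n$, $\bigcap_n B_n=\{0\}$, $\bigcup_n B_n=\mathbb{Q}_S$, and $B_n$ has Haar measure $e^{\psi(n)}$. Define $\|0\|=0$ and $\|x\|=e^{\psi(n)}$ if $x\in B_n\setminus B_{n-1}$; $d(x,y)=\|x-y\|$ is an ultrametric inducing the topology. Let $\chi(x)=\prod_{p\in S}\exp(2\pi i\{x_p\}_p)$ for $x=(x_p)_{p\in S}$, where $\{\cdot\}_p$ is the $p$-adic fractional part. The Fourier transform is $\mathcal{F}f(\xi)=\widehat f(\xi)=\int_{\mathbb{Q}_S}f(x)\chi(\xi x)\,dx$, extended to a unitary operator of $L^2(\mathbb{Q}_S)$. For $\alpha>0$, $D^\alpha$ is the unbounded operator on $L^2(\mathbb{Q}_S)$ given by $D^\alpha f=\mathcal{F}^{-1}(\|\xi\|^\alpha\widehat f(\xi))$ with $\mathrm{Dom}(D^\alpha)=\{f\in L^2(\mathbb{Q}_S):\|\xi\|^\alpha\widehat f\in L^2(\mathbb{Q}_S)\}$. The heat kernel is $Z(x,t)=\int_{\mathbb{Q}_S}\chi(-x\xi)\exp(-t\|\xi\|^\alpha)\,d\xi$ for $x\in\mathbb{Q}_S$, $t>0$. A classical solution is a function $u$ such that $t\mapsto u(\cdot,t)$ is continuously differentiable from $[0,\infty)$ to $L^2(\mathbb{Q}_S)$, $u(\cdot,t)\in\mathrm{Dom}(D^\alpha)$ for all $t\ge0$,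 and $u$ satisfies the equation (in $L^2(\mathbb{Q}_S)$) and the initial condition. Markov process terminology: the transition function is $P(t,x,B)=\int_B Z(x-y,t)\,dy$ for $t>0$ and $P(0,x,B)=1$ if $x\in B$, $0$ otherwise, for $B$ Borel. That $Z$ is the transition density of such a process means that $P$ is a transition function (time homogeneous, and space homogeneous: $P(t,x+h,B+h)=P(t,x,B)$) and that there is a Markov process $(X_t)_{t\ge0}$ with state space $\mathbb{Q}_S$, with a law $\mathbb{P}_x$ for each starting point $x\in\mathbb{Q}_S$, having $P$ as its transition function, whose paths are right-continuous, have left limits at every $t>0$ (no discontinuities other than jumps), and are bounded on every bounded time interval. *)

theory Defs
  imports
    "HOL-Probability.Probability"
    "HOL-Algebra.QuotRing"
    "HOL-Computational_Algebra.Primes"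
begin

section \<open>The field of p-adic numbers\<close>

text \<open>The field of p-adic numbers is the completion of the rationals for the p-adic absolute value:
  the ring of p-adic Cauchy sequences of rationals modulo the ideal of null sequences.  As \<open>p\<close> is a
  term, it is a ring on a carrier set, all primes sharing one type.\<close>

definition padic_abs :: "nat \<Rightarrow> rat \<Rightarrow> real" where
  "padic_abs p r = (if r = 0 then 0
     else real p powi (int (multiplicity (int p) (snd (quotient_of r)))
                     - int (multiplicity (int p) (fst (quotient_of r)))))"

definition padic_cauchy :: "nat \<Rightarrow> (nat \<Rightarrow> rat) \<Rightarrow> bool" where
  "padic_cauchy p s \<longleftrightarrow> (\<forall>e>0. \<exists>N. \<forall>m\<ge>N. \<forall>n\<ge>N. padic_abs p (s m - s n) < e)"

definition cauchy_ring :: "nat \<Rightarrow> (nat \<Rightarrow> rat) ring" where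
  "cauchy_ring p =
    \<lparr>carrier = {s. padic_cauchy p s}, mult = (\<lambda>s t n. s n * t n), one = (\<lambda>n. 1),
     zero = (\<lambda>n. 0), add = (\<lambda>s t n. s n + t n)\<rparr>"

definition padic_null :: "nat \<Rightarrow> (nat \<Rightarrow> rat) set" where
  "padic_null p = {s. (\<lambda>n. padic_abs p (s n)) \<longlonglongrightarrow> 0}"

type_synonym padic = "(nat \<Rightarrow> rat) set"

definition Qp :: "nat \<Rightarrow> padic ring" where
  "Qp p = cauchy_ring p Quot padic_null p"

definition padic_of_rat :: "nat \<Rightarrow> rat \<Rightarrow> padic" where
  "padic_of_rat p r = padic_null p +>\<^bsub>cauchy_ring p\<^esub> (\<lambda>n. r)"

definition padic_norm :: "nat \<Rightarrow> padic \<Rightarrow> real" where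
  "padic_norm p x = (THE l. \<forall>s\<in>x. (\<lambda>n. padic_abs p (s n)) \<longlonglongrightarrow> l)"

definition Zp :: "nat \<Rightarrow> padic set" where
  "Zp p = {x \<in> carrier (Qp p). padic_norm p x \<le> 1}"

text \<open>The value off the carrier is irrelevant; it is set to 0 because the locale
  \<^locale>\<open>Metric_space\<close> demands symmetry and nonnegativity on the whole type.\<close>

definition padic_dist :: "nat \<Rightarrow> padic \<Rightarrow> padic \<Rightarrow> real" where
  "padic_dist p x y = (if x \<in> carrier (Qp p) \<and> y \<in> carrier (Qp p)
     then padic_norm p (x \<ominus>\<^bsub>Qp p\<^esub> y) else 0)"

definition padic_topology :: "nat \<Rightarrow> padic topology" where
  "padic_topology p = Metric_space.mtopology (carrier (Qp p)) (padic_dist p)"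

text \<open>The fractional part of \<open>x\<close> is the representative of \<open>x\<close> modulo the p-adic integers in
  \<open>[0, 1)\<close> whose denominator is a power of \<open>p\<close>.\<close>

definition padic_frac :: "nat \<Rightarrow> padic \<Rightarrow> rat" where
  "padic_frac p x = (THE r. 0 \<le> r \<and> r < 1 \<and> (\<exists>k. r * of_nat p ^ k \<in> \<int>) \<and>
     x \<ominus>\<^bsub>Qp p\<^esub> padic_of_rat p r \<in> Zp p)"


section \<open>The ring \<open>Q\<^sub>S\<close>\<close>

type_synonym qs = "nat \<Rightarrow> padic"

definition QS :: "nat set \<Rightarrow> qs ring" where
  "QS S = \<lparr>carrier = (\<Pi>\<^sub>E p\<in>S. carrier (Qp p)),
     mult = (\<lambda>x y. \<lambda>p\<in>S. x p \<otimes>\<^bsub>Qp p\<^esub> y p), one = (\<lambda>p\<in>S. \<one>\<^bsub>Qp p\<^esub>),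
     zero = (\<lambda>p\<in>S. \<zero>\<^bsub>Qp p\<^esub>), add = (\<lambda>x y. \<lambda>p\<in>S. x p \<oplus>\<^bsub>Qp p\<^esub> y p)\<rparr>"

definition ZS :: "nat set \<Rightarrow> qs set" where
  "ZS S = (\<Pi>\<^sub>E p\<in>S. Zp p)"

definition QS_of_rat :: "nat set \<Rightarrow> rat \<Rightarrow> qs" where
  "QS_of_rat S r = (\<lambda>p\<in>S. padic_of_rat p r)"

definition QS_topology :: "nat set \<Rightarrow> qs topology" where
  "QS_topology S = product_topology padic_topology S"

definition QS_borel :: "nat set \<Rightarrow> qs measure" where
  "QS_borel S = sigma (carrier (QS S)) {U. openin (QS_topology S) U}"

text \<open>These conditions determine \<open>M\<close> uniquely: it is the Haar measure of the additive group.\<close>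

definition haar_measure :: "nat set \<Rightarrow> qs measure \<Rightarrow> bool" where
  "haar_measure S M \<longleftrightarrow> sets M = sets (QS_borel S) \<and>
     (\<forall>a\<in>carrier (QS S). \<forall>B\<in>sets M. emeasure M (B +>\<^bsub>QS S\<^esub> a) = emeasure M B) \<and>
     emeasure M (ZS S) = 1"

definition prime_powers :: "nat set \<Rightarrow> nat set" where
  "prime_powers S = {p ^ l | p l. p \<in> S \<and> 1 \<le> l}"

text \<open>\<^const>\<open>enumerate\<close> counts from 0, so that \<open>enumerate (prime_powers S) k\<close> is the
  \<open>(k + 1)\<close>-st prime power.\<close>

definition base_prime :: "nat set \<Rightarrow> nat \<Rightarrow> nat" where
  "base_prime S k = (THE p. p \<in> S \<and> (\<exists>l\<ge>1. enumerate (prime_powers S) k = p ^ l))"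

definition psi :: "nat set \<Rightarrow> int \<Rightarrow> real" where
  "psi S n = (if 0 \<le> n then \<Sum>k<nat n. ln (real (base_prime S k))
     else - (\<Sum>k<nat (- n). ln (real (base_prime S k))))"

definition QS_ball :: "nat set \<Rightarrow> int \<Rightarrow> qs set" where
  "QS_ball S n =
     (\<lambda>z. QS_of_rat S (THE r. real_of_rat r = exp (- psi S n)) \<otimes>\<^bsub>QS S\<^esub> z) ` ZS S"

definition QS_norm :: "nat set \<Rightarrow> qs \<Rightarrow> real" where
  "QS_norm S x = (if x = \<zero>\<^bsub>QS S\<^esub> then 0
     else exp (psi S (THE n. x \<in> QS_ball S n - QS_ball S (n - 1))))"

definition QS_char :: "nat set \<Rightarrow> qs \<Rightarrow> complex" where
  "QS_char S x =
     (\<Prod>p\<in>S. exp (2 * complex_of_real pi * \<i> * complex_of_real (real_of_rat (padic_frac p (x p)))))"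


section \<open>The Fourier transform and the operator \<open>D\<^sup>\<alpha>\<close>\<close>

text \<open>Elements of \<open>L\<^sup>2\<close> are represented by square integrable functions; equality in \<open>L\<^sup>2\<close> is
  equality almost everywhere.\<close>

definition L2 :: "'a measure \<Rightarrow> ('a \<Rightarrow> complex) set" where
  "L2 M = {f \<in> borel_measurable M. integrable M (\<lambda>x. (cmod (f x))\<^sup>2)}"

definition L2_norm :: "'a measure \<Rightarrow> ('a \<Rightarrow> complex) \<Rightarrow> real" where
  "L2_norm M f = sqrt (LINT x|M. (cmod (f x))\<^sup>2)"

definition fourier :: "nat set \<Rightarrow> qs measure \<Rightarrow> (qs \<Rightarrow> complex) \<Rightarrow> qs \<Rightarrow> complex" where
  "fourier S M f \<xi> = (LINT x|M. f x * QS_char S (\<xi> \<otimes>\<^bsub>QS S\<^esub> x))"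

text \<open>The extension by continuity of \<^const>\<open>fourier\<close> from the integrable elements of \<open>L\<^sup>2\<close> to
  \<open>L\<^sup>2\<close>.  The choice operator only picks a representative of a class in \<open>L\<^sup>2\<close>.\<close>

definition is_fourier_L2 ::
    "nat set \<Rightarrow> qs measure \<Rightarrow> (qs \<Rightarrow> complex) \<Rightarrow> (qs \<Rightarrow> complex) \<Rightarrow> bool" where
  "is_fourier_L2 S M f g \<longleftrightarrow> f \<in> L2 M \<and> g \<in> L2 M \<and>
     (\<exists>F :: nat \<Rightarrow> qs \<Rightarrow> complex.
        (\<forall>n. F n \<in> L2 M \<and> integrable M (F n) \<and> fourier S M (F n) \<in> L2 M) \<and>
        (\<lambda>n. L2_norm M (\<lambda>x. F n x - f x)) \<longlonglongrightarrow> 0 \<and>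
        (\<lambda>n. L2_norm M (\<lambda>\<xi>. fourier S M (F n) \<xi> - g \<xi>)) \<longlonglongrightarrow> 0)"

definition fourier_L2 :: "nat set \<Rightarrow> qs measure \<Rightarrow> (qs \<Rightarrow> complex) \<Rightarrow> qs \<Rightarrow> complex" where
  "fourier_L2 S M f = (SOME g. is_fourier_L2 S M f g)"

definition inv_fourier_L2 :: "nat set \<Rightarrow> qs measure \<Rightarrow> (qs \<Rightarrow> complex) \<Rightarrow> qs \<Rightarrow> complex" where
  "inv_fourier_L2 S M g = (SOME h. h \<in> L2 M \<and> (AE \<xi> in M. fourier_L2 S M h \<xi> = g \<xi>))"

definition D_mult ::
    "nat set \<Rightarrow> qs measure \<Rightarrow> real \<Rightarrow> (qs \<Rightarrow> complex) \<Rightarrow> qs \<Rightarrow> complex" where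
  "D_mult S M \<alpha> f = (\<lambda>\<xi>. complex_of_real (QS_norm S \<xi> powr \<alpha>) * fourier_L2 S M f \<xi>)"

definition D_dom :: "nat set \<Rightarrow> qs measure \<Rightarrow> real \<Rightarrow> (qs \<Rightarrow> complex) set" where
  "D_dom S M \<alpha> = {f \<in> L2 M. D_mult S M \<alpha> f \<in> L2 M}"

definition D_op ::
    "nat set \<Rightarrow> qs measure \<Rightarrow> real \<Rightarrow> (qs \<Rightarrow> complex) \<Rightarrow> qs \<Rightarrow> complex" where
  "D_op S M \<alpha> f = inv_fourier_L2 S M (D_mult S M \<alpha> f)"


section \<open>The Cauchy problem and the heat kernel\<close>

definition heat_kernel :: "nat set \<Rightarrow> qs measure \<Rightarrow> real \<Rightarrow> qs \<Rightarrow> real \<Rightarrow> complex" where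
  "heat_kernel S M \<alpha> x t = (LINT \<xi>|M. QS_char S ((\<ominus>\<^bsub>QS S\<^esub> x) \<otimes>\<^bsub>QS S\<^esub> \<xi>) *
     complex_of_real (exp (- t * QS_norm S \<xi> powr \<alpha>)))"

definition QS_convolution ::
    "nat set \<Rightarrow> qs measure \<Rightarrow> (qs \<Rightarrow> complex) \<Rightarrow> (qs \<Rightarrow> complex) \<Rightarrow> qs \<Rightarrow> complex" where
  "QS_convolution S M g f x = (LINT y|M. g (x \<ominus>\<^bsub>QS S\<^esub> y) * f y)"

text \<open>In the next definition \<open>u t\<close> is the function \<open>x \<mapsto> u(x, t)\<close>, and \<open>u'\<close> is the derivative
  of \<open>t \<mapsto> u(\<cdot>, t)\<close> as a map from \<open>[0, \<infinity>)\<close> to \<open>L\<^sup>2\<close>, one-sided at 0.\<close>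

definition classical_solution ::
    "nat set \<Rightarrow> qs measure \<Rightarrow> real \<Rightarrow> (qs \<Rightarrow> complex) \<Rightarrow> (real \<Rightarrow> qs \<Rightarrow> complex) \<Rightarrow> bool" where
  "classical_solution S M \<alpha> f u \<longleftrightarrow>
     (\<forall>t\<ge>0. u t \<in> D_dom S M \<alpha>) \<and>
     (\<exists>u'. (\<forall>t\<ge>0. u' t \<in> L2 M) \<and>
        (\<forall>t\<ge>0. ((\<lambda>s. L2_norm M (\<lambda>x. (u s x - u t x) / complex_of_real (s - t) - u' t x))
           \<longlongrightarrow> 0) (at t within {0..})) \<and>
        (\<forall>t\<ge>0. ((\<lambda>s. L2_norm M (\<lambda>x. u' s x - u' t x)) \<longlongrightarrow> 0) (at t within {0..})) \<and>
        (\<forall>t\<ge>0. AE x in M. u' t x + D_op S M \<alpha> (u t) x = 0)) \<and>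
     (AE x in M. u 0 x = f x)"


section \<open>Markov processes\<close>

definition heat_transition ::
    "nat set \<Rightarrow> qs measure \<Rightarrow> real \<Rightarrow> real \<Rightarrow> qs \<Rightarrow> qs set \<Rightarrow> complex" where
  "heat_transition S M \<alpha> t x B = (if t = 0 then indicator B x
     else (LINT y:B|M. heat_kernel S M \<alpha> (x \<ominus>\<^bsub>QS S\<^esub> y) t))"

text \<open>A time homogeneous transition function on the measurable space \<open>N\<close>: \<open>\<kappa> t x\<close> is the
  probability measure \<open>B \<mapsto> P(t, x, B)\<close>.  The last clause is the Chapman--Kolmogorov equation.\<close>

definition transition_function :: "'a measure \<Rightarrow> (real \<Rightarrow> 'a \<Rightarrow> 'a measure) \<Rightarrow> bool" where
  "transition_function N \<kappa> \<longleftrightarrow>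
     (\<forall>t\<ge>0. \<kappa> t \<in> N \<rightarrow>\<^sub>M prob_algebra N) \<and>
     (\<forall>x\<in>space N. \<kappa> 0 x = return N x) \<and>
     (\<forall>s\<ge>0. \<forall>t\<ge>0. \<forall>x\<in>space N. \<kappa> (s + t) x = \<kappa> s x \<bind> \<kappa> t)"

definition space_homogeneous :: "nat set \<Rightarrow> (real \<Rightarrow> qs \<Rightarrow> qs set \<Rightarrow> 'b) \<Rightarrow> bool" where
  "space_homogeneous S P \<longleftrightarrow>
     (\<forall>t\<ge>0. \<forall>x\<in>carrier (QS S). \<forall>h\<in>carrier (QS S). \<forall>B\<in>sets (QS_borel S).
        P t (x \<oplus>\<^bsub>QS S\<^esub> h) (B +>\<^bsub>QS S\<^esub> h) = P t x B)"

definition past_algebra :: "'w measure \<Rightarrow> 'a measure \<Rightarrow> (real \<Rightarrow> 'w \<Rightarrow> 'a) \<Rightarrow> real \<Rightarrow> 'w measure" where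
  "past_algebra W N X s =
     sigma (space W) (\<Union>r\<in>{0..s}. {X r -` B \<inter> space W | B. B \<in> sets N})"

text \<open>\<open>W\<close> is the sample space (only its \<open>\<sigma>\<close>-algebra matters) and \<open>Pr x\<close> is the law on it for
  the starting point \<open>x\<close>.\<close>

definition markov_process ::
    "'a measure \<Rightarrow> (real \<Rightarrow> 'a \<Rightarrow> 'a measure) \<Rightarrow> 'w measure \<Rightarrow> ('a \<Rightarrow> 'w measure) \<Rightarrow>
     (real \<Rightarrow> 'w \<Rightarrow> 'a) \<Rightarrow> bool" where
  "markov_process N \<kappa> W Pr X \<longleftrightarrow>
     (\<forall>t\<ge>0. X t \<in> W \<rightarrow>\<^sub>M N) \<and>
     (\<forall>x\<in>space N. prob_space (Pr x) \<and> sets (Pr x) = sets W \<and>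
        (AE w in Pr x. X 0 w = x) \<and>
        (\<forall>s\<ge>0. \<forall>t\<ge>0. \<forall>B\<in>sets N. AE w in Pr x.
           real_cond_exp (Pr x) (past_algebra W N X s) (\<lambda>v. indicator B (X (s + t) v)) w
             = measure (\<kappa> t (X s w)) B))"

definition right_continuous_path :: "nat set \<Rightarrow> (real \<Rightarrow> qs) \<Rightarrow> bool" where
  "right_continuous_path S \<gamma> \<longleftrightarrow> (\<forall>t\<ge>0. limitin (QS_topology S) \<gamma> (\<gamma> t) (at_right t))"

definition has_left_limits :: "nat set \<Rightarrow> (real \<Rightarrow> qs) \<Rightarrow> bool" where
  "has_left_limits S \<gamma> \<longleftrightarrow> (\<forall>t>0. \<exists>l. limitin (QS_topology S) \<gamma> l (at_left t))"

definition locally_bounded_path :: "nat set \<Rightarrow> (real \<Rightarrow> qs) \<Rightarrow> bool" where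
  "locally_bounded_path S \<gamma> \<longleftrightarrow> (\<forall>T\<ge>0. \<exists>C. \<forall>t\<in>{0..T}. QS_norm S (\<gamma> t) \<le> C)"

end

theory Submission imports Defs "HOL-Algebra.Multiplicative_Group" begin

text \<open>Only the ball filtration, its self-duality under the character and the measures of the balls
  matter, so the argument is carried out in an abstract ultrametric ring.  On the Fourier side the
  heat semigroup is multiplication by \<open>exp (- t \<parallel>\<xi>\<parallel>\<^sup>\<alpha>)\<close>, which reduces the Cauchy problem to
  dominated convergence in \<open>L\<^sup>2\<close>.

  With \<open>\<lambda>\<^sub>m = exp (- \<alpha> \<psi>(m))\<close>, the symbol is a combination of indicators of balls, and the
  heat kernel is the mixture over \<open>m\<close> of the uniform densities on \<open>B\<^sub>m\<close> with weights
  \<open>exp (- t \<lambda>\<^sub>m) - exp (- t \<lambda>\<^sub>m\<^sub>-\<^sub>1)\<close>.  This is the law of a sum of independent compound Poisson processes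
  in which level \<open>m\<close> jumps at rate \<open>\<lambda>\<^sub>m\<^sub>-\<^sub>1 - \<lambda>\<^sub>m\<close> by uniform elements of \<open>B\<^sub>m\<close>: the largest level
  that has jumped up to time \<open>t\<close> makes the sum uniform on its ball.  Almost surely only finitely many
  levels above any given one jump in bounded time, and the levels below contribute a small ball, so
  the sum converges locally uniformly in time.  Its paths therefore inherit right continuity, left
  limits and local boundedness, and the independence of its increments gives the Markov property.\<close>

section \<open>The p-adic absolute value and the p-adic numbers\<close>

text \<open>The L2 transform is handled as a relation and not through an inversion formula: a Bessel
  inequality on balls makes it a contraction, pairing with ball indicators determines its values
  almost everywhere, and applying it twice gives the reflection \<open>x \<mapsto> - x\<close>.
  Isometry and surjectivity follow from these three facts. On the probabilistic side, regularity is
  asked of every point of the sample space, and one space has to serve all starting points, while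
  the sum of the levels behaves well only almost surely. The process is therefore transported to a
  space of regular paths with coordinate maps, exceptional samples going to constant paths. The
  Markov property is first proved for a past larger than the one generated by the sum, the joint
  past of all levels: it is generated by boxes on which independence factors level by level, and
  every past event of the path agrees with one of its events on the good samples. Chapman-Kolmogorov
  is read off from the same identity, so the semigroup law of the kernels is not computed by
  convolution.\<close>

context
  fixes p :: nat
  assumes p: "prime p"
begin

lemma real_p_gt_1: "real p > 1"
  using p prime_gt_1_nat by auto

lemma p_powi_le_iff: "real p powi a \<le> real p powi b \<longleftrightarrow> a \<le> b"
  using real_p_gt_1 power_int_increasing[of a b "real p"] power_int_strict_increasing[of b a "real p"]
  by (cases "a \<le> b") auto

lemma prime_int_p: "prime (int p)"
  using p by simp

text \<open>Frees computations from lowest terms: cross multiplication with the reduced fraction and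
  additivity of the multiplicity of a prime give the same exponent for every representation.\<close>

lemma padic_abs_of_int_div:
  assumes "a \<noteq> 0" "b \<noteq> 0"
  shows "padic_abs p (of_int a / of_int b) =
    real p powi (int (multiplicity (int p) b) - int (multiplicity (int p) a))"
proof -
  obtain c d where cd: "quotient_of (of_int a / of_int b) = (c, d)"
    by (cases "quotient_of (of_int a / of_int b)")
  have d: "d > 0" using quotient_of_denom_pos[OF cd] .
  have "(of_int a / of_int b :: rat) = of_int c / of_int d" using quotient_of_div[OF cd] .
  then have "(of_int (a * d) :: rat) = of_int (c * b)"
    using assms d by (simp add: field_simps)
  then have eq: "a * d = c * b" by (simp only: of_int_eq_iff)
  with assms d have c: "c \<noteq> 0" by auto
  have "multiplicity (int p) (a * d) = multiplicity (int p) a + multiplicity (int p) d"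
    using prime_int_p assms d by (intro prime_elem_multiplicity_mult_distrib) auto
  moreover have "multiplicity (int p) (c * b) = multiplicity (int p) c + multiplicity (int p) b"
    using prime_int_p assms c by (intro prime_elem_multiplicity_mult_distrib) auto
  ultimately have "int (multiplicity (int p) d) - int (multiplicity (int p) c) =
      int (multiplicity (int p) b) - int (multiplicity (int p) a)"
    using eq by simp
  then show ?thesis using assms cd by (simp add: padic_abs_def)
qed

lemma padic_abs_0 [simp]: "padic_abs p 0 = 0"
  by (simp add: padic_abs_def)

lemma padic_abs_pos: "r \<noteq> 0 \<Longrightarrow> padic_abs p r > 0"
  using real_p_gt_1 by (simp add: padic_abs_def)

lemma padic_abs_nonneg [simp]: "padic_abs p r \<ge> 0"
  using padic_abs_pos[of r] by (cases "r = 0") auto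

lemma rat_as_quotient:
  fixes r :: rat
  obtains a b :: int where "r = of_int a / of_int b" "b \<noteq> 0"
  using quotient_of_div[of r] quotient_of_denom_pos[of r] by (cases "quotient_of r") fastforce

lemma padic_abs_mult: "padic_abs p (r * s) = padic_abs p r * padic_abs p s"
proof (cases "r = 0 \<or> s = 0")
  case False
  obtain a b where r: "r = of_int a / of_int b" "b \<noteq> 0" by (rule rat_as_quotient)
  obtain c d where s: "s = of_int c / of_int d" "d \<noteq> 0" by (rule rat_as_quotient)
  have n: "a \<noteq> 0" "c \<noteq> 0" using False r s by auto
  have "r * s = of_int (a * c) / of_int (b * d)" using r s by simp
  then have "padic_abs p (r * s) =
      real p powi (int (multiplicity (int p) (b * d)) - int (multiplicity (int p) (a * c)))"
    using padic_abs_of_int_div[of "a * c" "b * d"] n r s by simp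
  also have "multiplicity (int p) (a * c) = multiplicity (int p) a + multiplicity (int p) c"
    using prime_int_p n by (intro prime_elem_multiplicity_mult_distrib) auto
  also have "multiplicity (int p) (b * d) = multiplicity (int p) b + multiplicity (int p) d"
    using prime_int_p r s by (intro prime_elem_multiplicity_mult_distrib) auto
  also have "real p powi (int (multiplicity (int p) b + multiplicity (int p) d) -
        int (multiplicity (int p) a + multiplicity (int p) c)) =
      real p powi ((int (multiplicity (int p) b) - int (multiplicity (int p) a)) +
        (int (multiplicity (int p) d) - int (multiplicity (int p) c)))"
    by (simp add: algebra_simps)
  also have "\<dots> = padic_abs p r * padic_abs p s"
    using real_p_gt_1 by (simp add: power_int_add r s n padic_abs_of_int_div)
  finally show ?thesis .
qed auto

lemma padic_abs_1 [simp]: "padic_abs p 1 = 1"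
  using padic_abs_of_int_div[of 1 1] by simp

lemma padic_abs_minus [simp]: "padic_abs p (- r) = padic_abs p r"
proof -
  have "padic_abs p (-1) = 1"
    using padic_abs_of_int_div[of "-1" 1] by (simp add: multiplicity_unit_right)
  then show ?thesis using padic_abs_mult[of "-1" r] by simp
qed

lemma padic_abs_diff_commute: "padic_abs p (r - s) = padic_abs p (s - r)"
  using padic_abs_minus[of "r - s"] by simp

lemma padic_abs_inverse: "padic_abs p (inverse r) = inverse (padic_abs p r)"
proof (cases "r = 0")
  case False
  then have "padic_abs p r * padic_abs p (inverse r) = 1" using padic_abs_mult[of r "inverse r"] by simp
  then show ?thesis by (simp add: inverse_unique)
qed auto

text \<open>Turns estimates into divisibility, where the ultrametric inequality and questions of
  integrality are decided.\<close>

lemma padic_abs_of_int_le_iff: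
  "padic_abs p (of_int a) \<le> real p powi (- int k) \<longleftrightarrow> int p ^ k dvd a"
proof (cases "a = 0")
  case False
  have "padic_abs p (of_int a) = real p powi (- int (multiplicity (int p) a))"
    using padic_abs_of_int_div[of a 1] False by simp
  then have "padic_abs p (of_int a) \<le> real p powi (- int k) \<longleftrightarrow> k \<le> multiplicity (int p) a"
    by (simp add: p_powi_le_iff)
  also have "\<dots> \<longleftrightarrow> int p ^ k dvd a"
    using False prime_int_p by (intro power_dvd_iff_le_multiplicity[symmetric]) auto
  finally show ?thesis .
qed simp

lemma padic_abs_of_int_le_1: "padic_abs p (of_int a) \<le> 1"
  using padic_abs_of_int_le_iff[of a 0] by simp

text \<open>For integers, a power of \<open>p\<close> dividing both summands divides the sum;
  fractions reduce to this over a common denominator, whose absolute value factors out.\<close>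

lemma padic_abs_add_le: "padic_abs p (r + s) \<le> max (padic_abs p r) (padic_abs p s)"
proof -
  have int_case: "padic_abs p (of_int x + of_int y) \<le> max (padic_abs p (of_int x)) (padic_abs p (of_int y))"
    for x y :: int
  proof (cases "x = 0 \<or> y = 0")
    case False
    define k where "k = min (multiplicity (int p) x) (multiplicity (int p) y)"
    have "int p ^ k dvd x" "int p ^ k dvd y" by (auto simp: k_def intro: multiplicity_dvd')
    then have "int p ^ k dvd x + y" by simp
    then have "padic_abs p (of_int (x + y)) \<le> real p powi (- int k)"
      using padic_abs_of_int_le_iff by blast
    also have "\<dots> = max (padic_abs p (of_int x)) (padic_abs p (of_int y))"
      using padic_abs_of_int_div[of x 1] padic_abs_of_int_div[of y 1] False
      by (auto simp: k_def min_def max_def p_powi_le_iff)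
    finally show ?thesis by simp
  qed auto
  obtain a b where r: "r = of_int a / of_int b" "b \<noteq> 0" by (rule rat_as_quotient)
  obtain c d where s: "s = of_int c / of_int d" "d \<noteq> 0" by (rule rat_as_quotient)
  define e where "e = padic_abs p (inverse (of_int (b * d)))"
  have e: "e \<ge> 0" by (simp add: e_def)
  have "r = of_int (a * d) * inverse (of_int (b * d))" "s = of_int (c * b) * inverse (of_int (b * d))"
    using r s by (auto simp: field_simps)
  then have "padic_abs p r = padic_abs p (of_int (a * d)) * e" "padic_abs p s = padic_abs p (of_int (c * b)) * e"
    "padic_abs p (r + s) = padic_abs p (of_int (a * d) + of_int (c * b)) * e"
    by (simp_all only: e_def padic_abs_mult[symmetric] distrib_right)
  then show ?thesis using mult_right_mono[OF int_case e, of "a * d" "c * b"] e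
    by (simp add: max_mult_distrib_right)
qed

lemma padic_abs_add_le': "padic_abs p (r + s) \<le> padic_abs p r + padic_abs p s"
  using padic_abs_add_le[of r s] padic_abs_nonneg[of r] padic_abs_nonneg[of s] by linarith

lemma padic_abs_diff_abs: "\<bar>padic_abs p r - padic_abs p s\<bar> \<le> padic_abs p (r - s)"
  using padic_abs_add_le'[of "r - s" s] padic_abs_add_le'[of "s - r" r] padic_abs_diff_commute[of r s]
  by simp

lemma padic_cauchy_const [simp]: "padic_cauchy p (\<lambda>n. r)"
  by (simp add: padic_cauchy_def)

lemma padic_cauchy_minus: "padic_cauchy p s \<Longrightarrow> padic_cauchy p (\<lambda>n. - s n)"
  unfolding padic_cauchy_def by (simp add: padic_abs_diff_commute)

lemma padic_cauchy_add:
  assumes "padic_cauchy p s" "padic_cauchy p t"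
  shows "padic_cauchy p (\<lambda>n. s n + t n)"
  unfolding padic_cauchy_def
proof (intro allI impI)
  fix e :: real assume e: "e > 0"
  obtain N1 where N1: "\<forall>m\<ge>N1. \<forall>n\<ge>N1. padic_abs p (s m - s n) < e"
    using assms(1) e unfolding padic_cauchy_def by blast
  obtain N2 where N2: "\<forall>m\<ge>N2. \<forall>n\<ge>N2. padic_abs p (t m - t n) < e"
    using assms(2) e unfolding padic_cauchy_def by blast
  have "padic_abs p (s m + t m - (s n + t n)) < e" if "m \<ge> max N1 N2" "n \<ge> max N1 N2" for m n
  proof -
    have "padic_abs p ((s m - s n) + (t m - t n)) \<le> max (padic_abs p (s m - s n)) (padic_abs p (t m - t n))"
      by (rule padic_abs_add_le)
    also have "\<dots> < e" using N1 N2 that by simp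
    finally show ?thesis by (simp add: algebra_simps)
  qed
  then show "\<exists>N. \<forall>m\<ge>N. \<forall>n\<ge>N. padic_abs p (s m + t m - (s n + t n)) < e" by blast
qed

text \<open>What gives \<open>padic_norm\<close> a value: the reverse triangle inequality carries
  the Cauchy property over to the reals, where the absolute values converge.\<close>

lemma padic_cauchy_abs_Cauchy:
  assumes "padic_cauchy p s" shows "Cauchy (\<lambda>n. padic_abs p (s n))"
proof (rule CauchyI)
  fix e :: real assume "e > 0"
  then obtain N where "\<forall>m\<ge>N. \<forall>n\<ge>N. padic_abs p (s m - s n) < e"
    using assms unfolding padic_cauchy_def by blast
  then show "\<exists>M. \<forall>m\<ge>M. \<forall>n\<ge>M. norm (padic_abs p (s m) - padic_abs p (s n)) < e"
    using padic_abs_diff_abs by (metis order_le_less_trans real_norm_def)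
qed

lemma padic_cauchy_bounded:
  assumes "padic_cauchy p s" shows "\<exists>C>0. \<forall>n. padic_abs p (s n) \<le> C"
  using Cauchy_Bseq[OF padic_cauchy_abs_Cauchy[OF assms]] unfolding Bseq_def by auto

lemma padic_cauchy_mult:
  assumes "padic_cauchy p s" "padic_cauchy p t"
  shows "padic_cauchy p (\<lambda>n. s n * t n)"
  unfolding padic_cauchy_def
proof (intro allI impI)
  fix e :: real assume e: "e > 0"
  obtain C where C: "C > 0" "\<forall>n. padic_abs p (s n) \<le> C"
    using padic_cauchy_bounded[OF assms(1)] by blast
  obtain D where D: "D > 0" "\<forall>n. padic_abs p (t n) \<le> D"
    using padic_cauchy_bounded[OF assms(2)] by blast
  obtain N1 where N1: "\<forall>m\<ge>N1. \<forall>n\<ge>N1. padic_abs p (s m - s n) < e / D"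
    using assms(1) e D unfolding padic_cauchy_def by (meson divide_pos_pos)
  obtain N2 where N2: "\<forall>m\<ge>N2. \<forall>n\<ge>N2. padic_abs p (t m - t n) < e / C"
    using assms(2) e C unfolding padic_cauchy_def by (meson divide_pos_pos)
  have "padic_abs p (s m * t m - s n * t n) < e" if "m \<ge> max N1 N2" "n \<ge> max N1 N2" for m n
  proof -
    have "s m * t m - s n * t n = s m * (t m - t n) + (s m - s n) * t n" by (simp add: algebra_simps)
    then have "padic_abs p (s m * t m - s n * t n) \<le>
        max (padic_abs p (s m) * padic_abs p (t m - t n)) (padic_abs p (s m - s n) * padic_abs p (t n))"
      using padic_abs_add_le[of "s m * (t m - t n)" "(s m - s n) * t n"] by (simp add: padic_abs_mult)
    moreover have "padic_abs p (s m) * padic_abs p (t m - t n) \<le> C * padic_abs p (t m - t n)"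
      using C by (intro mult_right_mono) auto
    moreover have "C * padic_abs p (t m - t n) < e"
      using N2 that C by (simp add: field_simps)
    moreover have "padic_abs p (s m - s n) * padic_abs p (t n) \<le> padic_abs p (s m - s n) * D"
      using D by (intro mult_left_mono) auto
    moreover have "padic_abs p (s m - s n) * D < e"
      using N1 that D by (simp add: field_simps)
    ultimately show ?thesis by linarith
  qed
  then show "\<exists>N. \<forall>m\<ge>N. \<forall>n\<ge>N. padic_abs p (s m * t m - s n * t n) < e" by blast
qed

lemma padic_cauchy_diff:
  "padic_cauchy p s \<Longrightarrow> padic_cauchy p t \<Longrightarrow> padic_cauchy p (\<lambda>n. s n - t n)"
  using padic_cauchy_add[OF _ padic_cauchy_minus, of s t] by simp

section \<open>The completion: Cauchy sequences modulo null sequences\<close>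

lemma cring_cauchy_ring: "cring (cauchy_ring p)"
proof (intro cringI abelian_groupI comm_monoidI)
  fix s assume "s \<in> carrier (cauchy_ring p)"
  then show "\<exists>y\<in>carrier (cauchy_ring p). y \<oplus>\<^bsub>cauchy_ring p\<^esub> s = \<zero>\<^bsub>cauchy_ring p\<^esub>"
    by (intro bexI[of _ "\<lambda>n. - s n"]) (auto simp: cauchy_ring_def padic_cauchy_minus)
qed (auto simp: cauchy_ring_def padic_cauchy_add padic_cauchy_mult algebra_simps)

interpretation C: cring "cauchy_ring p" by (rule cring_cauchy_ring)

lemma carrier_cauchy_ring: "carrier (cauchy_ring p) = Collect (padic_cauchy p)"
  by (simp add: cauchy_ring_def)

lemma a_inv_cauchy_ring: "padic_cauchy p s \<Longrightarrow> \<ominus>\<^bsub>cauchy_ring p\<^esub> s = (\<lambda>n. - s n)"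
  by (rule C.minus_equality) (auto simp: cauchy_ring_def padic_cauchy_minus)

lemma padic_null_cauchy: "s \<in> padic_null p \<Longrightarrow> padic_cauchy p s"
  unfolding padic_cauchy_def
proof (intro allI impI)
  fix e :: real assume s: "s \<in> padic_null p" and e: "e > 0"
  obtain N where N: "\<forall>n\<ge>N. padic_abs p (s n) < e"
    using order_tendstoD(2)[of _ 0 sequentially e] s e by (auto simp: padic_null_def eventually_sequentially)
  have "padic_abs p (s m - s n) < e" if "m \<ge> N" "n \<ge> N" for m n
  proof -
    have "padic_abs p (s m - s n) \<le> max (padic_abs p (s m)) (padic_abs p (s n))"
      using padic_abs_add_le[of "s m" "- s n"] by simp
    also have "\<dots> < e" using N that by simp
    finally show ?thesis .
  qed
  then show "\<exists>N. \<forall>m\<ge>N. \<forall>n\<ge>N. padic_abs p (s m - s n) < e" by blast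
qed

lemma padic_null_mult:
  assumes "s \<in> padic_null p" "padic_cauchy p t"
  shows "(\<lambda>n. t n * s n) \<in> padic_null p"
proof -
  obtain C where C: "C > 0" "\<forall>n. padic_abs p (t n) \<le> C"
    using padic_cauchy_bounded[OF assms(2)] by blast
  have "(\<lambda>n. C * padic_abs p (s n)) \<longlonglongrightarrow> 0"
    using assms(1) unfolding padic_null_def by (auto intro: tendsto_eq_intros)
  then have "(\<lambda>n. padic_abs p (t n) * padic_abs p (s n)) \<longlonglongrightarrow> 0"
    by (rule tendsto_sandwich[OF _ _ tendsto_const, rotated 2])
      (auto intro!: always_eventually mult_right_mono simp: C)
  then show ?thesis by (simp add: padic_null_def padic_abs_mult)
qed

lemma ideal_padic_null: "ideal (padic_null p) (cauchy_ring p)"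
proof (rule idealI)
  show "ring (cauchy_ring p)" by (rule C.ring_axioms)
  show "subgroup (padic_null p) (add_monoid (cauchy_ring p))"
  proof (rule subgroup.intro)
    fix s t assume "s \<in> padic_null p" "t \<in> padic_null p"
    then have "(\<lambda>n. padic_abs p (s n) + padic_abs p (t n)) \<longlonglongrightarrow> 0"
      unfolding padic_null_def by (auto intro: tendsto_eq_intros)
    then have "(\<lambda>n. padic_abs p (s n + t n)) \<longlonglongrightarrow> 0"
      by (rule tendsto_sandwich[OF _ _ tendsto_const, rotated 2])
        (auto intro!: always_eventually padic_abs_add_le')
    then show "s \<otimes>\<^bsub>add_monoid (cauchy_ring p)\<^esub> t \<in> padic_null p"
      by (simp add: cauchy_ring_def padic_null_def)
  next
    fix s assume s: "s \<in> padic_null p"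
    then show "inv\<^bsub>add_monoid (cauchy_ring p)\<^esub> s \<in> padic_null p"
      using a_inv_cauchy_ring[OF padic_null_cauchy[OF s]] by (simp add: a_inv_def padic_null_def)
  qed (auto simp: cauchy_ring_def padic_null_cauchy, simp add: padic_null_def)
qed (use padic_null_mult in \<open>auto simp: cauchy_ring_def mult.commute\<close>)

interpretation N: ideal "padic_null p" "cauchy_ring p" by (rule ideal_padic_null)

lemma cring_Qp: "cring (Qp p)"
  unfolding Qp_def by (rule N.quotient_is_cring[OF cring_cauchy_ring])

interpretation Q: cring "Qp p" by (rule cring_Qp)

definition padic_class :: "(nat \<Rightarrow> rat) \<Rightarrow> padic" where
  "padic_class s = padic_null p +>\<^bsub>cauchy_ring p\<^esub> s"

lemma ring_hom_padic_class: "ring_hom_ring (cauchy_ring p) (Qp p) padic_class"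
  using N.rcos_ring_hom_ring unfolding Qp_def padic_class_def[abs_def] .

interpretation H: ring_hom_ring "cauchy_ring p" "Qp p" padic_class by (rule ring_hom_padic_class)

lemma carrier_Qp: "carrier (Qp p) = padic_class ` Collect (padic_cauchy p)"
  by (auto simp: Qp_def FactRing_def A_RCOSETS_def' carrier_cauchy_ring padic_class_def)

lemma padic_class_closed [simp]: "padic_cauchy p s \<Longrightarrow> padic_class s \<in> carrier (Qp p)"
  by (simp add: carrier_Qp)

lemma padic_class_cases:
  assumes "x \<in> carrier (Qp p)" obtains s where "padic_cauchy p s" "x = padic_class s"
  using assms by (auto simp: carrier_Qp)

lemma mem_padic_class_iff:
  assumes "padic_cauchy p s"
  shows "t \<in> padic_class s \<longleftrightarrow> (\<lambda>n. t n - s n) \<in> padic_null p"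
proof -
  have "t \<in> padic_class s \<longleftrightarrow> (\<exists>z\<in>padic_null p. t = (\<lambda>n. z n + s n))"
    by (simp add: padic_class_def a_r_coset_def' cauchy_ring_def)
  also have "\<dots> \<longleftrightarrow> (\<lambda>n. t n - s n) \<in> padic_null p"
    by (auto simp: fun_eq_iff intro!: bexI[of _ "\<lambda>n. t n - s n"])
  finally show ?thesis .
qed

text \<open>Justifies the definite description in \<open>padic_norm\<close>: representatives of one
  class differ by a null sequence, so their absolute values have the same limit. From here on norms
  are computed along any representative.\<close>

lemma padic_norm_class:
  assumes "padic_cauchy p s" shows "(\<lambda>n. padic_abs p (s n)) \<longlonglongrightarrow> padic_norm p (padic_class s)"
proof -
  obtain l where l: "(\<lambda>n. padic_abs p (s n)) \<longlonglongrightarrow> l"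
    using padic_cauchy_abs_Cauchy[OF assms] Cauchy_convergent_iff convergent_def by blast
  have *: "(\<lambda>n. padic_abs p (t n)) \<longlonglongrightarrow> l" if "t \<in> padic_class s" for t
  proof -
    have "(\<lambda>n. padic_abs p (t n - s n)) \<longlonglongrightarrow> 0"
      using that mem_padic_class_iff[OF assms] by (simp add: padic_null_def)
    then have "(\<lambda>n. padic_abs p (t n) - padic_abs p (s n)) \<longlonglongrightarrow> 0"
      by (rule tendsto_rabs_zero_cancel[OF tendsto_sandwich[OF _ _ tendsto_const, rotated 2]])
        (auto intro!: always_eventually padic_abs_diff_abs)
    from tendsto_add[OF this l] show ?thesis by simp
  qed
  have s: "s \<in> padic_class s" using mem_padic_class_iff[OF assms] by (simp add: padic_null_def)
  have "padic_norm p (padic_class s) = l"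
    unfolding padic_norm_def using * s by (intro the_equality) (auto intro: LIMSEQ_unique)
  with l show ?thesis by simp
qed

lemma padic_norm_eqI:
  "padic_cauchy p s \<Longrightarrow> (\<lambda>n. padic_abs p (s n)) \<longlonglongrightarrow> l \<Longrightarrow> padic_norm p (padic_class s) = l"
  using padic_norm_class LIMSEQ_unique by blast

lemma padic_class_add: "padic_cauchy p s \<Longrightarrow> padic_cauchy p t \<Longrightarrow>
    padic_class s \<oplus>\<^bsub>Qp p\<^esub> padic_class t = padic_class (\<lambda>n. s n + t n)"
  using H.hom_add[of s t] by (simp add: cauchy_ring_def)

lemma padic_class_mult: "padic_cauchy p s \<Longrightarrow> padic_cauchy p t \<Longrightarrow>
    padic_class s \<otimes>\<^bsub>Qp p\<^esub> padic_class t = padic_class (\<lambda>n. s n * t n)"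
  using H.hom_mult[of s t] by (simp add: cauchy_ring_def)

lemma padic_class_diff: "padic_cauchy p s \<Longrightarrow> padic_cauchy p t \<Longrightarrow>
    padic_class s \<ominus>\<^bsub>Qp p\<^esub> padic_class t = padic_class (\<lambda>n. s n - t n)"
  using H.hom_a_inv[of t] padic_class_add[of s "\<lambda>n. - t n"]
  by (simp add: a_minus_def carrier_cauchy_ring a_inv_cauchy_ring padic_cauchy_minus)

lemma padic_class_zero: "padic_class (\<lambda>n. 0) = \<zero>\<^bsub>Qp p\<^esub>"
  using H.hom_zero by (simp add: cauchy_ring_def)

lemma padic_class_one: "padic_class (\<lambda>n. 1) = \<one>\<^bsub>Qp p\<^esub>"
  using H.hom_one by (simp add: cauchy_ring_def)

lemma padic_norm_nonneg: "x \<in> carrier (Qp p) \<Longrightarrow> padic_norm p x \<ge> 0"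
  by (erule padic_class_cases) (auto intro!: LIMSEQ_le_const[OF padic_norm_class])

lemma padic_norm_mult:
  assumes "x \<in> carrier (Qp p)" "y \<in> carrier (Qp p)"
  shows "padic_norm p (x \<otimes>\<^bsub>Qp p\<^esub> y) = padic_norm p x * padic_norm p y"
proof -
  obtain s where s: "padic_cauchy p s" "x = padic_class s" using assms(1) by (rule padic_class_cases)
  obtain t where t: "padic_cauchy p t" "y = padic_class t" using assms(2) by (rule padic_class_cases)
  show ?thesis unfolding s t padic_class_mult[OF s(1) t(1)]
    using tendsto_mult[OF padic_norm_class[OF s(1)] padic_norm_class[OF t(1)]]
    by (intro padic_norm_eqI padic_cauchy_mult s t) (simp add: padic_abs_mult)
qed

lemma padic_norm_diff_commute:
  assumes "x \<in> carrier (Qp p)" "y \<in> carrier (Qp p)"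
  shows "padic_norm p (x \<ominus>\<^bsub>Qp p\<^esub> y) = padic_norm p (y \<ominus>\<^bsub>Qp p\<^esub> x)"
proof -
  obtain s where s: "padic_cauchy p s" "x = padic_class s" using assms(1) by (rule padic_class_cases)
  obtain t where t: "padic_cauchy p t" "y = padic_class t" using assms(2) by (rule padic_class_cases)
  show ?thesis unfolding s t padic_class_diff[OF s(1) t(1)] padic_class_diff[OF t(1) s(1)]
    using padic_norm_class[OF padic_cauchy_diff[OF t(1) s(1)]]
    by (intro padic_norm_eqI padic_cauchy_diff s t) (simp add: padic_abs_diff_commute)
qed

lemma padic_norm_add_le:
  assumes "x \<in> carrier (Qp p)" "y \<in> carrier (Qp p)"
  shows "padic_norm p (x \<oplus>\<^bsub>Qp p\<^esub> y) \<le> max (padic_norm p x) (padic_norm p y)"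
proof -
  obtain s where s: "padic_cauchy p s" "x = padic_class s" using assms(1) by (rule padic_class_cases)
  obtain t where t: "padic_cauchy p t" "y = padic_class t" using assms(2) by (rule padic_class_cases)
  show ?thesis unfolding s t padic_class_add[OF s(1) t(1)]
    by (rule LIMSEQ_le[OF padic_norm_class[OF padic_cauchy_add[OF s(1) t(1)]]
          tendsto_max[OF padic_norm_class[OF s(1)] padic_norm_class[OF t(1)]]])
      (auto intro: padic_abs_add_le)
qed

lemma padic_norm_eq_0_iff:
  assumes "x \<in> carrier (Qp p)" shows "padic_norm p x = 0 \<longleftrightarrow> x = \<zero>\<^bsub>Qp p\<^esub>"
proof -
  obtain s where s: "padic_cauchy p s" "x = padic_class s" using assms by (rule padic_class_cases)
  have "padic_norm p x = 0 \<longleftrightarrow> s \<in> padic_null p"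
    using padic_norm_class[OF s(1)] padic_norm_eqI[OF s(1), of 0] by (auto simp: s padic_null_def)
  also have "\<dots> \<longleftrightarrow> s \<in> padic_class (\<lambda>n. 0)" using mem_padic_class_iff[of "\<lambda>n. 0" s] by simp
  also have "\<dots> \<longleftrightarrow> padic_class s = padic_class (\<lambda>n. 0)"
  proof
    assume "s \<in> padic_class (\<lambda>n. 0)"
    then show "padic_class s = padic_class (\<lambda>n. 0)" unfolding padic_class_def
      by (rule N.a_repr_independence'[symmetric]) (simp add: carrier_cauchy_ring)
  next
    assume "padic_class s = padic_class (\<lambda>n. 0)"
    moreover have "s \<in> padic_class s" using mem_padic_class_iff[OF s(1), of s] by (simp add: padic_null_def)
    ultimately show "s \<in> padic_class (\<lambda>n. 0)" by simp
  qed
  also have "\<dots> \<longleftrightarrow> x = \<zero>\<^bsub>Qp p\<^esub>" by (simp add: s padic_class_zero)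
  finally show ?thesis .
qed

lemma padic_of_rat_class: "padic_of_rat p r = padic_class (\<lambda>n. r)"
  by (simp add: padic_of_rat_def padic_class_def)

lemma padic_of_rat_closed [simp]: "padic_of_rat p r \<in> carrier (Qp p)"
  by (simp add: padic_of_rat_class)

lemma padic_norm_of_rat [simp]: "padic_norm p (padic_of_rat p r) = padic_abs p r"
  unfolding padic_of_rat_class by (rule padic_norm_eqI) auto

lemma padic_of_rat_add: "padic_of_rat p (r + s) = padic_of_rat p r \<oplus>\<^bsub>Qp p\<^esub> padic_of_rat p s"
  and padic_of_rat_mult: "padic_of_rat p (r * s) = padic_of_rat p r \<otimes>\<^bsub>Qp p\<^esub> padic_of_rat p s"
  and padic_of_rat_diff: "padic_of_rat p (r - s) = padic_of_rat p r \<ominus>\<^bsub>Qp p\<^esub> padic_of_rat p s"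
  and padic_of_rat_0: "padic_of_rat p 0 = \<zero>\<^bsub>Qp p\<^esub>"
  and padic_of_rat_1: "padic_of_rat p 1 = \<one>\<^bsub>Qp p\<^esub>"
  by (simp_all add: padic_of_rat_class padic_class_add padic_class_mult padic_class_diff
      padic_class_zero padic_class_one)

lemma padic_rat_dense:
  assumes "x \<in> carrier (Qp p)" "e > 0"
  obtains r where "padic_norm p (x \<ominus>\<^bsub>Qp p\<^esub> padic_of_rat p r) < e"
proof -
  obtain s where s: "padic_cauchy p s" "x = padic_class s" using assms(1) by (rule padic_class_cases)
  \<comment> \<open>Half of \<open>e\<close>, because a strict bound becomes a weak one in the limit
    that defines the norm.\<close>
  obtain N where N: "\<forall>m\<ge>N. \<forall>n\<ge>N. padic_abs p (s m - s n) < e/2"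
    using s(1) assms(2) unfolding padic_cauchy_def by (meson half_gt_zero)
  have "padic_norm p (x \<ominus>\<^bsub>Qp p\<^esub> padic_of_rat p (s N)) \<le> e / 2"
    unfolding s(2) padic_of_rat_class padic_class_diff[OF s(1) padic_cauchy_const]
    using N by (intro LIMSEQ_le_const2[OF padic_norm_class[OF padic_cauchy_diff[OF s(1) padic_cauchy_const]]])
      (auto intro!: exI[of _ N] less_imp_le)
  then show thesis using assms(2) by (intro that[of "s N"]) auto
qed

lemma padic_norm_minus: "x \<in> carrier (Qp p) \<Longrightarrow> padic_norm p (\<ominus>\<^bsub>Qp p\<^esub> x) = padic_norm p x"
  using padic_norm_diff_commute[of "\<zero>\<^bsub>Qp p\<^esub>" x] by (simp add: a_minus_def)

lemma padic_norm_diff_le: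
  assumes "x \<in> carrier (Qp p)" "y \<in> carrier (Qp p)"
  shows "padic_norm p (x \<ominus>\<^bsub>Qp p\<^esub> y) \<le> max (padic_norm p x) (padic_norm p y)"
  using padic_norm_add_le[of x "\<ominus>\<^bsub>Qp p\<^esub> y"] assms by (simp add: padic_norm_minus a_minus_def)

text \<open>Diagonal argument: rationals \<open>r k\<close> within \<open>1 / Suc k\<close> of
  \<open>x k\<close> form a p-adic Cauchy sequence, and its class is the limit.\<close>

lemma padic_complete:
  fixes x :: "nat \<Rightarrow> padic"
  assumes x: "\<And>k. x k \<in> carrier (Qp p)"
    and cauchy: "\<And>e. e > 0 \<Longrightarrow> \<exists>K. \<forall>k\<ge>K. \<forall>l\<ge>K. padic_norm p (x k \<ominus>\<^bsub>Qp p\<^esub> x l) < e"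
  obtains z where "z \<in> carrier (Qp p)"
    "\<And>e. e > 0 \<Longrightarrow> \<exists>K. \<forall>k\<ge>K. padic_norm p (x k \<ominus>\<^bsub>Qp p\<^esub> z) < e"
proof -
  have "\<exists>r. padic_norm p (x k \<ominus>\<^bsub>Qp p\<^esub> padic_of_rat p r) < 1 / Suc k" for k
    using padic_rat_dense[OF x, of "1 / Suc k"] by auto
  then obtain r where r: "\<And>k. padic_norm p (x k \<ominus>\<^bsub>Qp p\<^esub> padic_of_rat p (r k)) < 1 / Suc k" by metis
  have small: "\<exists>K. \<forall>k\<ge>K. padic_norm p (x k \<ominus>\<^bsub>Qp p\<^esub> padic_of_rat p (r k)) < e" if e0: "e > 0" for e
  proof -
    obtain K where K: "1 / real (Suc K) < e" using reals_Archimedean[OF e0] by (auto simp: inverse_eq_divide)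
    have "padic_norm p (x k \<ominus>\<^bsub>Qp p\<^esub> padic_of_rat p (r k)) < e" if "k \<ge> K" for k
    proof -
      have "1 / real (Suc k) \<le> 1 / real (Suc K)" using that by (intro divide_left_mono) auto
      then show ?thesis using r[of k] K by linarith
    qed
    then show ?thesis by blast
  qed
  have tri: "padic_norm p (a \<ominus>\<^bsub>Qp p\<^esub> c) \<le> max (padic_norm p (a \<ominus>\<^bsub>Qp p\<^esub> b)) (padic_norm p (b \<ominus>\<^bsub>Qp p\<^esub> c))"
    if "a \<in> carrier (Qp p)" "b \<in> carrier (Qp p)" "c \<in> carrier (Qp p)" for a b c
  proof -
    have "a \<ominus>\<^bsub>Qp p\<^esub> c = (a \<ominus>\<^bsub>Qp p\<^esub> b) \<oplus>\<^bsub>Qp p\<^esub> (b \<ominus>\<^bsub>Qp p\<^esub> c)"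
      using that by algebra
    then show ?thesis using padic_norm_add_le[of "a \<ominus>\<^bsub>Qp p\<^esub> b" "b \<ominus>\<^bsub>Qp p\<^esub> c"] that by simp
  qed
  have rc: "padic_cauchy p r"
    unfolding padic_cauchy_def
  proof (intro allI impI)
    fix e :: real assume e: "e > 0"
    obtain K1 where K1: "\<forall>k\<ge>K1. \<forall>l\<ge>K1. padic_norm p (x k \<ominus>\<^bsub>Qp p\<^esub> x l) < e" using cauchy e by blast
    obtain K2 where K2: "\<forall>k\<ge>K2. padic_norm p (x k \<ominus>\<^bsub>Qp p\<^esub> padic_of_rat p (r k)) < e" using small e by blast
    have "padic_abs p (r m - r n) < e" if "m \<ge> max K1 K2" "n \<ge> max K1 K2" for m n
    proof -
      let ?R = "\<lambda>k. padic_of_rat p (r k)"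
      have "padic_abs p (r m - r n) = padic_norm p (?R m \<ominus>\<^bsub>Qp p\<^esub> ?R n)"
        by (simp add: padic_of_rat_diff[symmetric])
      also have "\<dots> \<le> max (padic_norm p (?R m \<ominus>\<^bsub>Qp p\<^esub> x m)) (padic_norm p (x m \<ominus>\<^bsub>Qp p\<^esub> ?R n))"
        by (rule tri) (auto simp: x)
      also have "\<dots> \<le> max (padic_norm p (?R m \<ominus>\<^bsub>Qp p\<^esub> x m))
          (max (padic_norm p (x m \<ominus>\<^bsub>Qp p\<^esub> x n)) (padic_norm p (x n \<ominus>\<^bsub>Qp p\<^esub> ?R n)))"
        using tri[of "x m" "x n" "?R n"] by (simp add: x max.coboundedI2)
      also have "\<dots> < e"
        using K1 K2 that by (simp add: padic_norm_diff_commute[of "?R m" "x m"] x)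
      finally show ?thesis .
    qed
    then show "\<exists>N. \<forall>m\<ge>N. \<forall>n\<ge>N. padic_abs p (r m - r n) < e" by blast
  qed
  show thesis
  proof (rule that[of "padic_class r"])
    show "padic_class r \<in> carrier (Qp p)" using rc by simp
    fix e :: real assume e: "e > 0"
    obtain K1 where K1: "\<forall>m\<ge>K1. \<forall>n\<ge>K1. padic_abs p (r m - r n) < e/2"
      using rc e unfolding padic_cauchy_def by (meson half_gt_zero)
    obtain K2 where K2: "\<forall>k\<ge>K2. padic_norm p (x k \<ominus>\<^bsub>Qp p\<^esub> padic_of_rat p (r k)) < e" using small e by blast
    have "padic_norm p (x k \<ominus>\<^bsub>Qp p\<^esub> padic_class r) < e" if k: "k \<ge> max K1 K2" for k
    proof -
      have "padic_norm p (padic_of_rat p (r k) \<ominus>\<^bsub>Qp p\<^esub> padic_class r) \<le> e/2"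
        unfolding padic_of_rat_class padic_class_diff[OF padic_cauchy_const rc]
        using K1 k by (intro LIMSEQ_le_const2[OF padic_norm_class[OF padic_cauchy_diff[OF padic_cauchy_const rc]]])
          (auto intro!: exI[of _ K1] less_imp_le)
      then show ?thesis
        using tri[of "x k" "padic_of_rat p (r k)" "padic_class r"] K2 k e rc by (fastforce simp: x)
    qed
    then show "\<exists>K. \<forall>k\<ge>K. padic_norm p (x k \<ominus>\<^bsub>Qp p\<^esub> padic_class r) < e" by blast
  qed
qed

end

section \<open>Fractional parts, the character of the p-adic numbers, and residue discs\<close>

context
  fixes p :: nat
  assumes p: "prime p"
begin

interpretation Q: cring "Qp p" by (rule cring_Qp[OF p])

text \<open>A denominator that is a power of \<open>p\<close> is fully visible to the p-adic
  absolute value, so p-adic integrality cancels it. The uniqueness of fractional parts rests on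
  this.\<close>

lemma padic_abs_le_1_imp_Ints:
  assumes "r * of_nat p ^ k \<in> \<int>" "padic_abs p r \<le> 1" shows "r \<in> \<int>"
proof -
  obtain c where c: "r * of_nat p ^ k = of_int c" using assms(1) by (rule Ints_cases)
  have pp: "padic_abs p (of_nat p ^ k) \<le> real p powi (- int k)"
    using padic_abs_of_int_le_iff[OF p, of "int p ^ k" k] by simp
  have "padic_abs p (of_int c) = padic_abs p r * padic_abs p (of_nat p ^ k)"
    by (simp add: c[symmetric] padic_abs_mult[OF p])
  also have "\<dots> \<le> 1 * real p powi (- int k)"
    using assms(2) pp padic_abs_nonneg[OF p] by (intro mult_mono) auto
  finally have "int p ^ k dvd c" using padic_abs_of_int_le_iff[OF p] by simp
  then obtain d where "c = int p ^ k * d" ..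
  then have "r * of_nat p ^ k = of_int d * of_nat p ^ k" using c by simp
  then have "r = of_int d" using p by simp
  then show ?thesis by simp
qed

text \<open>Partial fractions: approximate \<open>x\<close> by a rational with denominator
  \<open>p ^ k * b'\<close>, \<open>b'\<close> prime to \<open>p\<close>, and split off the summand
  with denominator \<open>p ^ k\<close>. What remains is a p-adic integer, and subtracting the floor
  moves the representative into the unit interval.\<close>

lemma padic_frac_exists:
  assumes x: "x \<in> carrier (Qp p)"
  shows "\<exists>r. 0 \<le> r \<and> r < 1 \<and> (\<exists>k. r * of_nat p ^ k \<in> \<int>) \<and> x \<ominus>\<^bsub>Qp p\<^esub> padic_of_rat p r \<in> Zp p"
proof -
  obtain q where q: "padic_norm p (x \<ominus>\<^bsub>Qp p\<^esub> padic_of_rat p q) < 1"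
    using padic_rat_dense[OF p x, of 1] by auto
  obtain a b where ab: "q = of_int a / of_int b" "b \<noteq> 0" by (rule rat_as_quotient[OF p])
  have nu: "\<not> is_unit (int p)" using prime_int_p[OF p] by (auto dest: not_prime_unit)
  obtain b' where b': "b = int p ^ multiplicity (int p) b * b'" "\<not> int p dvd b'"
    by (rule multiplicity_decompose'[OF ab(2) nu])
  define k where "k = multiplicity (int p) b"
  have bk: "b = int p ^ k * b'" using b' by (simp add: k_def)
  have "coprime b' (int p ^ k)"
    using b'(2) prime_int_p[OF p] by (metis coprime_commute coprime_power_right_iff prime_imp_coprime)
  then obtain u v where uv: "u * b' + v * int p ^ k = 1"
    using bezout_int[of b' "int p ^ k"] by auto
  \<comment> \<open>Since \<open>u * b' + v * int p ^ k = 1\<close>, the fraction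
    \<open>a / (p ^ k * b')\<close> equals \<open>a * u / p ^ k + a * v / b'\<close>.\<close>
  define c where "c = a * u"
  define r where "r = of_int c / of_nat p ^ k - (of_int \<lfloor>of_int c / of_nat p ^ k :: rat\<rfloor> :: rat)"
  have p0: "(of_nat p :: rat) \<noteq> 0" using p by auto
  have b0: "b' \<noteq> 0" using b'(2) by auto
  have 1: "0 \<le> r" "r < 1" unfolding r_def by linarith+
  have "r * of_nat p ^ k = of_int (c - \<lfloor>of_int c / of_nat p ^ k :: rat\<rfloor> * int p ^ k)"
    using p0 by (simp add: r_def left_diff_distrib)
  then have 2: "r * of_nat p ^ k \<in> \<int>" by simp
  have "a - c * b' = a * (u * b' + v * int p ^ k) - a * u * b'" by (simp add: c_def uv)
  then have e: "a - c * b' = a * v * int p ^ k" by (simp add: algebra_simps)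
  have "q - of_int c / of_nat p ^ k = of_int (a - c * b') / (of_nat p ^ k * of_int b')"
    using p0 b0 by (simp add: ab bk field_simps)
  also have "\<dots> = of_int (a * v) / of_int b'" using p0 by (simp add: e)
  finally have e2: "q - of_int c / of_nat p ^ k = of_int (a * v) * inverse (of_int b')"
    by (simp add: divide_inverse)
  have "padic_abs p (of_int b') = 1"
    using padic_abs_of_int_div[OF p, of b' 1] b0 b'(2) by (simp add: not_dvd_imp_multiplicity_0)
  then have "padic_abs p (q - of_int c / of_nat p ^ k) \<le> 1"
    unfolding e2 using padic_abs_of_int_le_1[OF p, of "a * v"]
    by (simp add: padic_abs_mult[OF p] padic_abs_inverse[OF p])
  moreover have qr: "q - r = (q - of_int c / of_nat p ^ k) + of_int \<lfloor>of_int c / of_nat p ^ k :: rat\<rfloor>"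
    by (simp add: r_def)
  ultimately have "padic_abs p (q - r) \<le> 1"
    unfolding qr
    using padic_abs_add_le[OF p, of "q - of_int c / of_nat p ^ k" "of_int \<lfloor>of_int c / of_nat p ^ k :: rat\<rfloor>"]
      padic_abs_of_int_le_1[OF p, of "\<lfloor>of_int c / of_nat p ^ k :: rat\<rfloor>"]
    by (meson max.boundedI order_trans)
  then have "padic_norm p (padic_of_rat p q \<ominus>\<^bsub>Qp p\<^esub> padic_of_rat p r) \<le> 1"
    by (simp add: padic_of_rat_diff[OF p, symmetric] padic_norm_of_rat[OF p])
  moreover have "x \<ominus>\<^bsub>Qp p\<^esub> padic_of_rat p r =
      (x \<ominus>\<^bsub>Qp p\<^esub> padic_of_rat p q) \<oplus>\<^bsub>Qp p\<^esub> (padic_of_rat p q \<ominus>\<^bsub>Qp p\<^esub> padic_of_rat p r)"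
    using x padic_of_rat_closed[OF p, of q] padic_of_rat_closed[OF p, of r] by algebra
  ultimately have "padic_norm p (x \<ominus>\<^bsub>Qp p\<^esub> padic_of_rat p r) \<le> 1"
    using padic_norm_add_le[OF p, of "x \<ominus>\<^bsub>Qp p\<^esub> padic_of_rat p q" "padic_of_rat p q \<ominus>\<^bsub>Qp p\<^esub> padic_of_rat p r"] q x
    by (simp add: padic_of_rat_closed[OF p])
  then have 3: "x \<ominus>\<^bsub>Qp p\<^esub> padic_of_rat p r \<in> Zp p"
    using x by (simp add: Zp_def padic_of_rat_closed[OF p])
  show ?thesis using 1 2 3 by blast
qed

text \<open>The difference of two candidates for the fractional part has absolute value at most 1
  and a power of \<open>p\<close> as denominator, so \<open>padic_abs_le_1_imp_Ints\<close>
  applies.\<close>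

lemma Ints_if_Zp_close:
  assumes x: "x \<in> carrier (Qp p)"
    and "r * of_nat p ^ k \<in> \<int>" "x \<ominus>\<^bsub>Qp p\<^esub> padic_of_rat p r \<in> Zp p"
    and "s * of_nat p ^ l \<in> \<int>" "x \<ominus>\<^bsub>Qp p\<^esub> padic_of_rat p s \<in> Zp p"
  shows "r - s \<in> \<int>"
proof (rule padic_abs_le_1_imp_Ints)
  have "(r - s) * of_nat p ^ (k + l) = (r * of_nat p ^ k) * of_nat p ^ l - (s * of_nat p ^ l) * of_nat p ^ k"
    by (simp add: algebra_simps power_add)
  then show "(r - s) * of_nat p ^ (k + l) \<in> \<int>"
    by (simp only:) (intro Ints_diff Ints_mult Ints_power Ints_of_nat assms)
  have "padic_of_rat p r \<ominus>\<^bsub>Qp p\<^esub> padic_of_rat p s =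
      (x \<ominus>\<^bsub>Qp p\<^esub> padic_of_rat p s) \<ominus>\<^bsub>Qp p\<^esub> (x \<ominus>\<^bsub>Qp p\<^esub> padic_of_rat p r)"
    using x padic_of_rat_closed[OF p, of r] padic_of_rat_closed[OF p, of s] by algebra
  then have "padic_abs p (r - s) = padic_norm p ((x \<ominus>\<^bsub>Qp p\<^esub> padic_of_rat p s) \<ominus>\<^bsub>Qp p\<^esub> (x \<ominus>\<^bsub>Qp p\<^esub> padic_of_rat p r))"
    using padic_norm_of_rat[OF p, of "r - s"] padic_of_rat_diff[OF p, of r s] by simp
  also have "\<dots> \<le> 1"
    using padic_norm_diff_le[OF p, of "x \<ominus>\<^bsub>Qp p\<^esub> padic_of_rat p s" "x \<ominus>\<^bsub>Qp p\<^esub> padic_of_rat p r"] assms(3,5)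
    by (auto simp: Zp_def)
  finally show "padic_abs p (r - s) \<le> 1" .
qed

lemma padic_frac:
  assumes x: "x \<in> carrier (Qp p)"
  shows "0 \<le> padic_frac p x" "padic_frac p x < 1" "\<exists>k. padic_frac p x * of_nat p ^ k \<in> \<int>"
    "x \<ominus>\<^bsub>Qp p\<^esub> padic_of_rat p (padic_frac p x) \<in> Zp p"
proof -
  let ?P = "\<lambda>r. 0 \<le> r \<and> r < 1 \<and> (\<exists>k. r * of_nat p ^ k \<in> \<int>) \<and> x \<ominus>\<^bsub>Qp p\<^esub> padic_of_rat p r \<in> Zp p"
  obtain r where r: "?P r" using padic_frac_exists[OF x] by blast
  have "s = r" if s: "?P s" for s
  proof -
    have "s - r \<in> \<int>" using Ints_if_Zp_close[OF x] r s by blast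
    then obtain d where d: "s - r = of_int d" by (rule Ints_cases)
    have "(of_int d :: rat) < of_int 1" "(of_int (-1) :: rat) < of_int d" using r s by (auto simp: d[symmetric])
    then have "d < 1" "-1 < d" by (simp_all only: of_int_less_iff)
    then show ?thesis using d by simp
  qed
  with r have "\<exists>!r. ?P r" by (intro ex1I[of ?P r])
  then have "?P (padic_frac p x)" unfolding padic_frac_def by (rule theI')
  then show "0 \<le> padic_frac p x" "padic_frac p x < 1" "\<exists>k. padic_frac p x * of_nat p ^ k \<in> \<int>"
    "x \<ominus>\<^bsub>Qp p\<^esub> padic_of_rat p (padic_frac p x) \<in> Zp p" by auto
qed

text \<open>The sum of the two fractional parts meets every requirement on the fractional part of
  the sum except lying below 1, so it can be off by an integer only.\<close>

lemma padic_frac_add_Ints: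
  assumes x: "x \<in> carrier (Qp p)" and y: "y \<in> carrier (Qp p)"
  shows "padic_frac p (x \<oplus>\<^bsub>Qp p\<^esub> y) - (padic_frac p x + padic_frac p y) \<in> \<int>"
proof -
  let ?r = "padic_frac p x" and ?s = "padic_frac p y"
  obtain k where k: "?r * of_nat p ^ k \<in> \<int>" using padic_frac(3)[OF x] by blast
  obtain l where l: "?s * of_nat p ^ l \<in> \<int>" using padic_frac(3)[OF y] by blast
  have "(?r + ?s) * of_nat p ^ (k + l) = (?r * of_nat p ^ k) * of_nat p ^ l + (?s * of_nat p ^ l) * of_nat p ^ k"
    by (simp add: algebra_simps power_add)
  then have kl: "(?r + ?s) * of_nat p ^ (k + l) \<in> \<int>"
    by (simp only:) (intro Ints_add Ints_mult Ints_power Ints_of_nat k l)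
  have e: "(x \<oplus>\<^bsub>Qp p\<^esub> y) \<ominus>\<^bsub>Qp p\<^esub> padic_of_rat p (?r + ?s) =
      (x \<ominus>\<^bsub>Qp p\<^esub> padic_of_rat p ?r) \<oplus>\<^bsub>Qp p\<^esub> (y \<ominus>\<^bsub>Qp p\<^esub> padic_of_rat p ?s)"
    unfolding padic_of_rat_add[OF p]
    using x y padic_of_rat_closed[OF p, of ?r] padic_of_rat_closed[OF p, of ?s] by algebra
  have "(x \<oplus>\<^bsub>Qp p\<^esub> y) \<ominus>\<^bsub>Qp p\<^esub> padic_of_rat p (?r + ?s) \<in> Zp p"
    unfolding e using padic_frac(4)[OF x] padic_frac(4)[OF y]
      padic_norm_add_le[OF p, of "x \<ominus>\<^bsub>Qp p\<^esub> padic_of_rat p ?r" "y \<ominus>\<^bsub>Qp p\<^esub> padic_of_rat p ?s"]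
    by (auto simp: Zp_def)
  moreover obtain m where m: "padic_frac p (x \<oplus>\<^bsub>Qp p\<^esub> y) * of_nat p ^ m \<in> \<int>"
    using padic_frac(3)[of "x \<oplus>\<^bsub>Qp p\<^esub> y"] x y by blast
  ultimately show ?thesis
    using Ints_if_Zp_close[OF _ m padic_frac(4) kl] x y by simp
qed

lemma padic_frac_eq_0_iff: "x \<in> carrier (Qp p) \<Longrightarrow> padic_frac p x = 0 \<longleftrightarrow> x \<in> Zp p"
proof
  assume x: "x \<in> carrier (Qp p)" and "padic_frac p x = 0"
  with padic_frac(4)[OF x] show "x \<in> Zp p" by (simp add: padic_of_rat_0[OF p] a_minus_def)
next
  assume x: "x \<in> carrier (Qp p)" and z: "x \<in> Zp p"
  have "0 * of_nat p ^ 0 \<in> (\<int> :: rat set)" "x \<ominus>\<^bsub>Qp p\<^esub> padic_of_rat p 0 \<in> Zp p"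
    using z x by (simp_all add: padic_of_rat_0[OF p] a_minus_def)
  then have "padic_frac p x - 0 \<in> \<int>" using padic_frac(3,4)[OF x] Ints_if_Zp_close[OF x] by blast
  then obtain d where d: "padic_frac p x = of_int d" by (auto elim: Ints_cases)
  have "(of_int d :: rat) < of_int 1" "(of_int 0 :: rat) \<le> of_int d"
    using padic_frac(1,2)[OF x] by (auto simp: d[symmetric])
  then have "d < 1" "0 \<le> d" by (simp_all only: of_int_less_iff of_int_le_iff)
  then show "padic_frac p x = 0" using d by simp
qed

definition padic_char :: "padic \<Rightarrow> complex" where
  "padic_char x = exp (2 * complex_of_real pi * \<i> * complex_of_real (real_of_rat (padic_frac p x)))"

lemma exp_2pi_Ints: "r \<in> \<int> \<Longrightarrow> exp (2 * complex_of_real pi * \<i> * complex_of_real (real_of_rat r)) = 1"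
  by (auto elim!: Ints_cases simp: exp_eq_1)

lemma padic_char_add:
  assumes x: "x \<in> carrier (Qp p)" and y: "y \<in> carrier (Qp p)"
  shows "padic_char (x \<oplus>\<^bsub>Qp p\<^esub> y) = padic_char x * padic_char y"
proof -
  have "padic_char (x \<oplus>\<^bsub>Qp p\<^esub> y) = padic_char x * padic_char y *
      exp (2 * complex_of_real pi * \<i> *
        complex_of_real (real_of_rat (padic_frac p (x \<oplus>\<^bsub>Qp p\<^esub> y) - (padic_frac p x + padic_frac p y))))"
    by (simp add: padic_char_def exp_add[symmetric] of_rat_diff of_rat_add algebra_simps)
  then show ?thesis using exp_2pi_Ints[OF padic_frac_add_Ints[OF x y]] by simp
qed

text \<open>The exponential is 1 only at integers, and a fractional part that is an integer is 0.
  That the kernel is exactly \<open>Zp p\<close> later makes balls dual to each other.\<close>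

lemma padic_char_eq_1_iff:
  assumes x: "x \<in> carrier (Qp p)" shows "padic_char x = 1 \<longleftrightarrow> x \<in> Zp p"
proof
  assume "padic_char x = 1"
  then obtain n :: int where n: "2 * pi * real_of_rat (padic_frac p x) = of_int (2 * n) * pi"
    by (auto simp: padic_char_def exp_eq_1)
  then have "real_of_rat (padic_frac p x) = real_of_rat (of_int n)" by simp
  then have n: "padic_frac p x = of_int n" by (simp only: of_rat_eq_iff)
  have "(of_int n :: rat) < of_int 1" "(of_int 0 :: rat) \<le> of_int n"
    using padic_frac(1,2)[OF x] by (auto simp: n[symmetric])
  then have "n < 1" "0 \<le> n" by (simp_all only: of_int_less_iff of_int_le_iff)
  then show "x \<in> Zp p" using n padic_frac_eq_0_iff[OF x] by simp
next
  assume "x \<in> Zp p"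
  then show "padic_char x = 1" using padic_frac_eq_0_iff[OF x] by (simp add: padic_char_def)
qed

lemma norm_padic_char: "cmod (padic_char x) = 1"
  by (simp add: padic_char_def norm_exp_eq_Re)

lemma padic_abs_p: "padic_abs p (of_nat p) = 1 / real p"
  using padic_abs_of_int_div[OF p, of "int p" 1] prime_int_p[OF p] p
  by (simp add: power_int_minus inverse_eq_divide not_prime_0 multiplicity_same_power[of "int p" 1, simplified])

lemma padic_abs_p_powi: "padic_abs p (of_nat p powi k) = real p powi (- k)"
proof -
  have pw: "padic_abs p (r ^ n) = padic_abs p r ^ n" for r n
    by (induction n) (simp_all add: padic_abs_mult[OF p] padic_abs_1[OF p])
  show ?thesis
  proof (cases "k \<ge> 0")
    case False
    then have "padic_abs p (of_nat p powi k) = padic_abs p (inverse (of_nat p)) ^ nat (- k)"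
      by (simp only: power_int_def pw if_False)
    also have "\<dots> = real p powi (- k)"
      using False by (simp add: padic_abs_inverse[OF p] padic_abs_p power_int_def)
    finally show ?thesis .
  qed (auto simp: power_int_def pw padic_abs_p power_divide field_simps)
qed

text \<open>After scaling by \<open>p powi (k - 1)\<close> the norm is at most \<open>p\<close>, so
  the fractional part is \<open>j / p\<close> with \<open>j < p\<close>; two admissible
  \<open>j\<close> are congruent modulo \<open>p\<close>. Hence a disc consists of exactly
  \<open>p\<close> discs of the next smaller radius, which fixes the ratio of consecutive
  volumes.\<close>

lemma padic_residue_exists:
  assumes x: "x \<in> carrier (Qp p)" and le: "padic_norm p x \<le> real p powi k"
  shows "\<exists>!j. j < p \<and> padic_norm p (x \<ominus>\<^bsub>Qp p\<^esub> padic_of_rat p (of_nat j * of_nat p powi (- k))) \<le> real p powi (k - 1)"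
proof -
  have p0: "(of_nat p :: rat) \<noteq> 0" "real p > 0" using p prime_gt_0_nat by auto
  define u where "u = padic_of_rat p (of_nat p powi (1 - k))"
  define w where "w = padic_of_rat p (of_nat p powi (k - 1))"
  have uw: "u \<in> carrier (Qp p)" "w \<in> carrier (Qp p)" by (simp_all add: u_def w_def padic_of_rat_closed[OF p])
  have nu: "padic_norm p w = real p powi (1 - k)"
    by (simp add: w_def padic_norm_of_rat[OF p] padic_abs_p_powi)
  define y where "y = x \<otimes>\<^bsub>Qp p\<^esub> w"
  have y: "y \<in> carrier (Qp p)" using x uw by (simp add: y_def)
  have uw1: "w \<otimes>\<^bsub>Qp p\<^esub> u = \<one>\<^bsub>Qp p\<^esub>"
    unfolding u_def w_def padic_of_rat_mult[OF p, symmetric] padic_of_rat_1[OF p, symmetric]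
    using p0 by (simp add: power_int_add[symmetric])
  have ny: "padic_norm p y \<le> real p"
  proof -
    have "padic_norm p y = padic_norm p x * real p powi (1 - k)"
      using x uw by (simp add: y_def padic_norm_mult[OF p] nu)
    also have "\<dots> \<le> real p powi k * real p powi (1 - k)" using le by (intro mult_right_mono) auto
    also have "\<dots> = real p" using p0 by (simp add: power_int_add[symmetric])
    finally show ?thesis .
  qed
  define r where "r = padic_frac p y"
  have "padic_of_rat p r = y \<ominus>\<^bsub>Qp p\<^esub> (y \<ominus>\<^bsub>Qp p\<^esub> padic_of_rat p r)"
    using y padic_of_rat_closed[OF p, of r] by algebra
  then have "padic_abs p r \<le> max (padic_norm p y) (padic_norm p (y \<ominus>\<^bsub>Qp p\<^esub> padic_of_rat p r))"
    using padic_norm_diff_le[OF p y, of "y \<ominus>\<^bsub>Qp p\<^esub> padic_of_rat p r"] padic_frac(4)[OF y]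
      padic_norm_of_rat[OF p, of r] by (simp add: Zp_def r_def)
  also have "\<dots> \<le> real p" using ny padic_frac(4)[OF y] prime_gt_1_nat[OF p] by (simp add: Zp_def r_def)
  finally have "padic_abs p r \<le> real p" .
  then have "padic_abs p (r * of_nat p) \<le> 1"
    using p0 by (simp add: padic_abs_mult[OF p] padic_abs_p field_simps)
  moreover obtain l where l: "r * of_nat p ^ l \<in> \<int>" using padic_frac(3)[OF y] by (auto simp: r_def)
  have "(r * of_nat p ^ l) * of_nat p \<in> \<int>" by (intro Ints_mult Ints_of_nat l)
  then have "r * of_nat p * of_nat p ^ l \<in> \<int>" by (simp only: ac_simps)
  ultimately have "r * of_nat p \<in> \<int>" using padic_abs_le_1_imp_Ints by blast
  then obtain j where j: "r * of_nat p = of_int j" by (rule Ints_cases)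
  have rb: "0 \<le> r" "r < 1" using padic_frac(1,2)[OF y] by (simp_all add: r_def)
  have "(of_int j :: rat) < of_int (int p)" "(of_int 0 :: rat) \<le> of_int j"
    using rb p0 unfolding j[symmetric] by auto
  then have jb: "j < int p" "0 \<le> j" by (simp_all only: of_int_less_iff of_int_le_iff)
  define j' where "j' = nat j"
  have j': "j' < p" "r * of_nat p = of_nat j'" using jb j by (auto simp: j'_def)
  have "of_nat j' * of_nat p powi (- k) = r * of_nat p powi (1 - k)"
    unfolding j'(2)[symmetric] using p0 by (simp add: power_int_diff power_int_minus field_simps)
  then have "padic_of_rat p (of_nat j' * of_nat p powi (- k)) = padic_of_rat p r \<otimes>\<^bsub>Qp p\<^esub> u"
    by (simp add: u_def padic_of_rat_mult[OF p, symmetric])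
  moreover have "x = y \<otimes>\<^bsub>Qp p\<^esub> u"
    unfolding y_def using x uw uw1 by (simp add: Q.m_assoc)
  moreover have "(y \<otimes>\<^bsub>Qp p\<^esub> u) \<ominus>\<^bsub>Qp p\<^esub> (padic_of_rat p r \<otimes>\<^bsub>Qp p\<^esub> u) = (y \<ominus>\<^bsub>Qp p\<^esub> padic_of_rat p r) \<otimes>\<^bsub>Qp p\<^esub> u"
    using y uw padic_of_rat_closed[OF p, of r] by algebra
  ultimately have "padic_norm p (x \<ominus>\<^bsub>Qp p\<^esub> padic_of_rat p (of_nat j' * of_nat p powi (- k))) =
      padic_norm p (y \<ominus>\<^bsub>Qp p\<^esub> padic_of_rat p r) * real p powi (k - 1)"
    using y uw padic_of_rat_closed[OF p, of r]
    by (simp add: padic_norm_mult[OF p]) (simp add: u_def padic_norm_of_rat[OF p] padic_abs_p_powi)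
  also have "\<dots> \<le> 1 * real p powi (k - 1)"
    using padic_frac(4)[OF y] by (intro mult_right_mono) (auto simp: Zp_def r_def)
  finally have ex: "padic_norm p (x \<ominus>\<^bsub>Qp p\<^esub> padic_of_rat p (of_nat j' * of_nat p powi (- k))) \<le> real p powi (k - 1)"
    by simp
  show ?thesis
  proof (rule ex1I[of _ j'])
    show "j' < p \<and> padic_norm p (x \<ominus>\<^bsub>Qp p\<^esub> padic_of_rat p (of_nat j' * of_nat p powi (- k))) \<le> real p powi (k - 1)"
      using ex j' by simp
    fix i assume i: "i < p \<and> padic_norm p (x \<ominus>\<^bsub>Qp p\<^esub> padic_of_rat p (of_nat i * of_nat p powi (- k))) \<le> real p powi (k - 1)"
    let ?I = "padic_of_rat p (of_nat i * of_nat p powi (- k))" and ?J = "padic_of_rat p (of_nat j' * of_nat p powi (- k))"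
    have "?J \<ominus>\<^bsub>Qp p\<^esub> ?I = (x \<ominus>\<^bsub>Qp p\<^esub> ?I) \<ominus>\<^bsub>Qp p\<^esub> (x \<ominus>\<^bsub>Qp p\<^esub> ?J)"
      using x padic_of_rat_closed[OF p, of "of_nat i * of_nat p powi (- k)"]
        padic_of_rat_closed[OF p, of "of_nat j' * of_nat p powi (- k)"] by algebra
    then have "padic_norm p (?J \<ominus>\<^bsub>Qp p\<^esub> ?I) \<le>
        max (padic_norm p (x \<ominus>\<^bsub>Qp p\<^esub> ?I)) (padic_norm p (x \<ominus>\<^bsub>Qp p\<^esub> ?J))"
      using padic_norm_diff_le[OF p, of "x \<ominus>\<^bsub>Qp p\<^esub> ?I" "x \<ominus>\<^bsub>Qp p\<^esub> ?J"] x
      by (simp add: padic_of_rat_closed[OF p])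
    also have "\<dots> \<le> real p powi (k - 1)" using i ex by (intro max.boundedI) auto
    finally have "padic_norm p (?J \<ominus>\<^bsub>Qp p\<^esub> ?I) \<le> real p powi (k - 1)" .
    then have "padic_abs p ((of_nat j' - of_nat i) * of_nat p powi (- k)) \<le> real p powi (k - 1)"
      by (simp add: padic_of_rat_diff[OF p, symmetric] padic_norm_of_rat[OF p] left_diff_distrib)
    then have "padic_abs p (of_nat j' - of_nat i) * real p powi k \<le> real p powi (k - 1)"
      by (simp add: padic_abs_mult[OF p] padic_abs_p_powi)
    also have "real p powi (k - 1) = real p powi (-1) * real p powi k"
      using p0 power_int_add[of "real p" "-1" k] by (simp add: add.commute)
    finally have "padic_abs p (of_int (int j' - int i)) \<le> real p powi (- int 1)"
      using p0 by simp
    then have "int p dvd int j' - int i" using padic_abs_of_int_le_iff[OF p, of "int j' - int i" 1] by simp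
    then have "int j' mod int p = int i mod int p" by (simp add: mod_eq_dvd_iff)
    then show "i = j'" using i j' by simp
  qed
qed

lemma Metric_space_padic: "Metric_space (carrier (Qp p)) (padic_dist p)"
proof
  fix x y z assume c: "x \<in> carrier (Qp p)" "y \<in> carrier (Qp p)" "z \<in> carrier (Qp p)"
  have "x \<ominus>\<^bsub>Qp p\<^esub> z = (x \<ominus>\<^bsub>Qp p\<^esub> y) \<oplus>\<^bsub>Qp p\<^esub> (y \<ominus>\<^bsub>Qp p\<^esub> z)" using c by algebra
  then show "padic_dist p x z \<le> padic_dist p x y + padic_dist p y z"
    using padic_norm_add_le[OF p, of "x \<ominus>\<^bsub>Qp p\<^esub> y" "y \<ominus>\<^bsub>Qp p\<^esub> z"] c
      padic_norm_nonneg[OF p, of "x \<ominus>\<^bsub>Qp p\<^esub> y"] padic_norm_nonneg[OF p, of "y \<ominus>\<^bsub>Qp p\<^esub> z"]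
    by (simp add: padic_dist_def)
next
  fix x y assume c: "x \<in> carrier (Qp p)" "y \<in> carrier (Qp p)"
  show "padic_dist p x y = 0 \<longleftrightarrow> x = y"
    using c by (simp add: padic_dist_def padic_norm_eq_0_iff[OF p] Q.r_right_minus_eq)
qed (auto simp: padic_dist_def padic_norm_nonneg[OF p] padic_norm_diff_commute[OF p])

lemma topspace_padic: "topspace (padic_topology p) = carrier (Qp p)"
  unfolding padic_topology_def by (rule Metric_space.topspace_mtopology[OF Metric_space_padic])

text \<open>Openness in spite of the weak inequality: around any point of the disc, the ball of the
  same radius stays inside by the ultrametric inequality.\<close>

lemma openin_padic_ball:
  assumes a: "a \<in> carrier (Qp p)" and r: "r > 0"
  shows "openin (padic_topology p) {y \<in> carrier (Qp p). padic_norm p (y \<ominus>\<^bsub>Qp p\<^esub> a) \<le> r}"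
proof -
  interpret Metric_space "carrier (Qp p)" "padic_dist p" by (rule Metric_space_padic)
  have "\<exists>e>0. mball y e \<subseteq> {y \<in> carrier (Qp p). padic_norm p (y \<ominus>\<^bsub>Qp p\<^esub> a) \<le> r}"
    if y: "y \<in> carrier (Qp p)" "padic_norm p (y \<ominus>\<^bsub>Qp p\<^esub> a) \<le> r" for y
  proof (intro exI[of _ r] conjI subsetI r)
    fix z assume z: "z \<in> mball y r"
    then have zc: "z \<in> carrier (Qp p)" "padic_norm p (z \<ominus>\<^bsub>Qp p\<^esub> y) < r"
      using y padic_norm_diff_commute[OF p, of y z] by (auto simp: padic_dist_def)
    have "z \<ominus>\<^bsub>Qp p\<^esub> a = (z \<ominus>\<^bsub>Qp p\<^esub> y) \<oplus>\<^bsub>Qp p\<^esub> (y \<ominus>\<^bsub>Qp p\<^esub> a)" using zc a y by algebra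
    then show "z \<in> {y \<in> carrier (Qp p). padic_norm p (y \<ominus>\<^bsub>Qp p\<^esub> a) \<le> r}"
      using padic_norm_add_le[OF p, of "z \<ominus>\<^bsub>Qp p\<^esub> y" "y \<ominus>\<^bsub>Qp p\<^esub> a"] zc a y by auto
  qed
  then show ?thesis unfolding padic_topology_def openin_mtopology by auto
qed

lemma openin_padic_contains_ball:
  assumes "openin (padic_topology p) U" "x \<in> U"
  shows "\<exists>e>0. {y \<in> carrier (Qp p). padic_norm p (y \<ominus>\<^bsub>Qp p\<^esub> x) < e} \<subseteq> U"
proof -
  interpret Metric_space "carrier (Qp p)" "padic_dist p" by (rule Metric_space_padic)
  obtain e where e: "e > 0" "mball x e \<subseteq> U" and U: "U \<subseteq> carrier (Qp p)"
    using assms unfolding padic_topology_def openin_mtopology by blast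
  have "{y \<in> carrier (Qp p). padic_norm p (y \<ominus>\<^bsub>Qp p\<^esub> x) < e} \<subseteq> mball x e"
    using U assms(2) padic_norm_diff_commute[OF p, of x] by (auto simp: padic_dist_def)
  with e show ?thesis by blast
qed

end

section \<open>The ring \<open>Q\<^sub>S\<close> and its filtration\<close>

lemma infinite_prime_powers:
  assumes "S \<noteq> {}" "\<And>p. p \<in> S \<Longrightarrow> prime p" shows "infinite (prime_powers S)"
proof -
  obtain p where p: "p \<in> S" using assms by auto
  have "inj (\<lambda>l. p ^ Suc l)" using prime_gt_1_nat[OF assms(2)[OF p]] by (auto simp: inj_on_def)
  then have "infinite (range (\<lambda>l. p ^ Suc l))" by (rule range_inj_infinite)
  moreover have "p ^ Suc l \<in> prime_powers S" for l
    unfolding prime_powers_def using p by (intro CollectI exI[of _ p] exI[of _ "Suc l"]) auto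
  then have "range (\<lambda>l. p ^ Suc l) \<subseteq> prime_powers S" by blast
  ultimately show ?thesis using infinite_super by blast
qed

locale prime_set =
  fixes S :: "nat set"
  assumes finite_S: "finite S" and S_ne: "S \<noteq> {}" and prime_S: "\<And>p. p \<in> S \<Longrightarrow> prime p"
begin

lemma carrier_QS: "carrier (QS S) = (\<Pi>\<^sub>E p\<in>S. carrier (Qp p))"
  by (simp add: QS_def)

lemma QS_component [simp]:
  assumes "p \<in> S"
  shows "(x \<oplus>\<^bsub>QS S\<^esub> y) p = x p \<oplus>\<^bsub>Qp p\<^esub> y p" "(x \<otimes>\<^bsub>QS S\<^esub> y) p = x p \<otimes>\<^bsub>Qp p\<^esub> y p"
    "\<zero>\<^bsub>QS S\<^esub> p = \<zero>\<^bsub>Qp p\<^esub>" "\<one>\<^bsub>QS S\<^esub> p = \<one>\<^bsub>Qp p\<^esub>"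
  using assms by (simp_all add: QS_def)

lemma QS_mem: "x \<in> carrier (QS S) \<Longrightarrow> p \<in> S \<Longrightarrow> x p \<in> carrier (Qp p)"
  by (auto simp: carrier_QS)

lemma QS_eqI: "x \<in> carrier (QS S) \<Longrightarrow> y \<in> carrier (QS S) \<Longrightarrow> (\<And>p. p \<in> S \<Longrightarrow> x p = y p) \<Longrightarrow> x = y"
  unfolding carrier_QS by (rule PiE_ext)

lemma QS_memI: "(\<And>p. p \<in> S \<Longrightarrow> f p \<in> carrier (Qp p)) \<Longrightarrow> (\<lambda>p\<in>S. f p) \<in> carrier (QS S)"
  by (auto simp: carrier_QS)

lemma p_powi_pos: "p \<in> S \<Longrightarrow> 0 < real p powi k"
  using prime_S prime_gt_0_nat by simp

lemma cring_Qp_S: "p \<in> S \<Longrightarrow> cring (Qp p)"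
  using cring_Qp prime_S by blast

lemmas Qp_simprules = cring.cring_simprules[OF cring_Qp_S]

lemma cring_QS: "cring (QS S)"
proof -
  have add: "x \<oplus>\<^bsub>QS S\<^esub> y \<in> carrier (QS S)" and mult: "x \<otimes>\<^bsub>QS S\<^esub> y \<in> carrier (QS S)"
    if "x \<in> carrier (QS S)" "y \<in> carrier (QS S)" for x y
    using QS_memI[of "\<lambda>p. x p \<oplus>\<^bsub>Qp p\<^esub> y p"] QS_memI[of "\<lambda>p. x p \<otimes>\<^bsub>Qp p\<^esub> y p"] that
    by (simp_all add: QS_def[of S] Qp_simprules QS_mem)
  have z: "\<zero>\<^bsub>QS S\<^esub> \<in> carrier (QS S)" and o: "\<one>\<^bsub>QS S\<^esub> \<in> carrier (QS S)"
    by (auto simp: QS_def Qp_simprules)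
  show ?thesis
  proof (intro cringI abelian_groupI comm_monoidI)
    fix x assume x: "x \<in> carrier (QS S)"
    have c: "(\<lambda>p\<in>S. \<ominus>\<^bsub>Qp p\<^esub> x p) \<in> carrier (QS S)"
      by (rule QS_memI) (simp add: Qp_simprules QS_mem x)
    moreover have "(\<lambda>p\<in>S. \<ominus>\<^bsub>Qp p\<^esub> x p) \<oplus>\<^bsub>QS S\<^esub> x = \<zero>\<^bsub>QS S\<^esub>"
      by (rule QS_eqI[OF add[OF c x] z]) (simp add: Qp_simprules QS_mem x)
    ultimately show "\<exists>y\<in>carrier (QS S). y \<oplus>\<^bsub>QS S\<^esub> x = \<zero>\<^bsub>QS S\<^esub>" by blast
  next
    fix x y z assume "x \<in> carrier (QS S)" "y \<in> carrier (QS S)" "z \<in> carrier (QS S)"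
    then show "(x \<oplus>\<^bsub>QS S\<^esub> y) \<otimes>\<^bsub>QS S\<^esub> z = x \<otimes>\<^bsub>QS S\<^esub> z \<oplus>\<^bsub>QS S\<^esub> y \<otimes>\<^bsub>QS S\<^esub> z"
      by (intro QS_eqI) (auto intro!: add mult simp: QS_mem Qp_simprules(13))
  next
    fix x y z assume "x \<in> carrier (QS S)" "y \<in> carrier (QS S)" "z \<in> carrier (QS S)"
    then show "x \<oplus>\<^bsub>QS S\<^esub> y \<oplus>\<^bsub>QS S\<^esub> z = x \<oplus>\<^bsub>QS S\<^esub> (y \<oplus>\<^bsub>QS S\<^esub> z)"
      "x \<otimes>\<^bsub>QS S\<^esub> y \<otimes>\<^bsub>QS S\<^esub> z = x \<otimes>\<^bsub>QS S\<^esub> (y \<otimes>\<^bsub>QS S\<^esub> z)"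
      by (auto intro!: QS_eqI add mult simp: QS_mem Qp_simprules)
  next
    fix x y assume "x \<in> carrier (QS S)" "y \<in> carrier (QS S)"
    then show "x \<oplus>\<^bsub>QS S\<^esub> y = y \<oplus>\<^bsub>QS S\<^esub> x" "x \<otimes>\<^bsub>QS S\<^esub> y = y \<otimes>\<^bsub>QS S\<^esub> x"
      by (auto intro!: QS_eqI add mult simp: QS_mem Qp_simprules)
  next
    fix x assume x: "x \<in> carrier (QS S)"
    then show "\<zero>\<^bsub>QS S\<^esub> \<oplus>\<^bsub>QS S\<^esub> x = x"
      by (intro QS_eqI) (simp_all add: add z QS_mem Qp_simprules)
    have "\<one>\<^bsub>Qp p\<^esub> \<otimes>\<^bsub>Qp p\<^esub> x p = x p" if p: "p \<in> S" for p
    proof -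
      interpret Q: cring "Qp p" by (rule cring_Qp_S[OF p])
      show ?thesis using QS_mem[OF x p] by simp
    qed
    then show "\<one>\<^bsub>QS S\<^esub> \<otimes>\<^bsub>QS S\<^esub> x = x"
      using x by (intro QS_eqI) (simp_all add: mult o)
  qed (auto intro: add mult z o)
qed

sublocale R: cring "QS S" by (rule cring_QS)

lemma QS_minus_component [simp]:
  assumes "x \<in> carrier (QS S)" "y \<in> carrier (QS S)" "p \<in> S"
  shows "(x \<ominus>\<^bsub>QS S\<^esub> y) p = x p \<ominus>\<^bsub>Qp p\<^esub> y p"
proof -
  have c: "(\<lambda>p\<in>S. \<ominus>\<^bsub>Qp p\<^esub> y p) \<in> carrier (QS S)"
    by (rule QS_memI) (simp add: Qp_simprules QS_mem assms)
  have "(\<lambda>p\<in>S. \<ominus>\<^bsub>Qp p\<^esub> y p) \<oplus>\<^bsub>QS S\<^esub> y = \<zero>\<^bsub>QS S\<^esub>"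
    using c assms by (intro QS_eqI) (simp_all add: Qp_simprules QS_mem)
  then have "\<ominus>\<^bsub>QS S\<^esub> y = (\<lambda>p\<in>S. \<ominus>\<^bsub>Qp p\<^esub> y p)"
    using c assms by (intro R.minus_equality) auto
  then show ?thesis using assms by (simp add: a_minus_def)
qed

section \<open>Prime powers and the exponents of the primes in \<open>exp (psi S n)\<close>\<close>

lemma infinite_PP: "infinite (prime_powers S)"
  using S_ne prime_S by (rule infinite_prime_powers)

text \<open>A prime power determines its prime, so \<open>base_prime\<close> can be read off from
  any representation.\<close>

lemma base_prime_eqI:
  assumes "p \<in> S" "l \<ge> 1" "enumerate (prime_powers S) k = p ^ l" shows "base_prime S k = p"
  unfolding base_prime_def
proof (rule the_equality)
  show "p \<in> S \<and> (\<exists>l\<ge>1. enumerate (prime_powers S) k = p ^ l)" using assms by blast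
  fix q assume "q \<in> S \<and> (\<exists>l\<ge>1. enumerate (prime_powers S) k = q ^ l)"
  then obtain m where q: "q \<in> S" "m \<ge> 1" "p ^ l = q ^ m" using assms by auto
  then have "q dvd p ^ l" by simp
  then have "q dvd p" using prime_S q by (blast intro: prime_dvd_power)
  then show "q = p" using prime_S q assms primes_dvd_imp_eq by blast
qed

lemma base_prime_mem: "base_prime S k \<in> S"
proof -
  have "enumerate (prime_powers S) k \<in> prime_powers S" by (rule enumerate_in_set[OF infinite_PP])
  then obtain p l where "p \<in> S" "l \<ge> 1" "enumerate (prime_powers S) k = p ^ l"
    by (auto simp: prime_powers_def)
  then show ?thesis using base_prime_eqI by metis
qed

lemma infinite_base_prime: assumes p: "p \<in> S" shows "infinite {k. base_prime S k = p}"
proof -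
  have "\<exists>k. enumerate (prime_powers S) k = p ^ Suc l" for l
  proof (rule enumerate_Ex[OF infinite_PP])
    show "p ^ Suc l \<in> prime_powers S"
      unfolding prime_powers_def using p by (intro CollectI exI[of _ p] exI[of _ "Suc l"]) auto
  qed
  then obtain k where k: "\<And>l. enumerate (prime_powers S) (k l) = p ^ Suc l" by metis
  have "inj k"
  proof (rule injI)
    fix l m assume "k l = k m"
    then have "p ^ Suc l = p ^ Suc m" using k by metis
    then show "l = m" using prime_gt_1_nat[OF prime_S[OF p]] by simp
  qed
  then have "infinite (range k)" by (rule range_inj_infinite)
  moreover have "range k \<subseteq> {k. base_prime S k = p}" using base_prime_eqI[OF p _ k] by auto
  ultimately show ?thesis using infinite_super by blast
qed

text \<open>The exponent of \<open>p\<close> in the rational number \<open>exp (psi S n)\<close>.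
  The component at \<open>p\<close> of the ball with index \<open>n\<close> will be the disc of
  radius \<open>p powi cnt p n\<close>.\<close>

definition cnt :: "nat \<Rightarrow> int \<Rightarrow> int" where
  "cnt p n = (if 0 \<le> n then int (card {k. k < nat n \<and> base_prime S k = p})
    else - int (card {k. k < nat (- n) \<and> base_prime S k = p}))"

text \<open>The prime by which \<open>exp (psi S n)\<close> is multiplied on passing from
  \<open>n\<close> to \<open>n + 1\<close>. As \<open>psi\<close> is odd, a step from a negative
  \<open>n\<close> mirrors the one from \<open>- n - 1\<close> to \<open>- n\<close>, whence the
  second index.\<close>

definition step_prime :: "int \<Rightarrow> nat" where
  "step_prime n = base_prime S (if 0 \<le> n then nat n else nat (- n - 1))"

lemma step_prime_mem: "step_prime n \<in> S"
  by (simp add: step_prime_def base_prime_mem)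

lemma card_less_Suc:
  "card {k. k < Suc m \<and> P k} = card {k. k < m \<and> P k} + of_bool (P m)"
proof -
  have "{k. k < Suc m \<and> P k} = (if P m then insert m {k. k < m \<and> P k} else {k. k < m \<and> P k})"
    by (auto simp: less_Suc_eq)
  then show ?thesis by simp
qed

lemma cnt_step: "cnt p (n + 1) = cnt p n + of_bool (step_prime n = p)"
proof (cases "n \<ge> 0")
  case True
  then have "nat (n + 1) = Suc (nat n)" by simp
  then show ?thesis using True by (simp add: cnt_def step_prime_def card_less_Suc)
next
  case False
  then have "nat (- n) = Suc (nat (- n - 1))" "nat (- (n + 1)) = nat (- n - 1)" by simp_all
  then show ?thesis using False
    by (cases "n = -1") (auto simp: cnt_def step_prime_def card_less_Suc simp del: less_Suc0)
qed

lemma psi_step: "psi S (n + 1) = psi S n + ln (real (step_prime n))"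
proof (cases "n \<ge> 0")
  case True
  then have "nat (n + 1) = Suc (nat n)" by simp
  then show ?thesis using True by (simp add: psi_def step_prime_def)
next
  case False
  then have "nat (- n) = Suc (nat (- n - 1))" "nat (- (n + 1)) = nat (- n - 1)" by simp_all
  then show ?thesis using False by (cases "n = -1") (auto simp: psi_def step_prime_def)
qed

lemma cnt_minus: "cnt p (- n) = - cnt p n"
  by (cases "n = 0") (auto simp: cnt_def)

lemma psi_minus: "psi S (- n) = - psi S n"
  by (cases "n = 0") (auto simp: psi_def)

lemma cnt_0 [simp]: "cnt p 0 = 0" by (simp add: cnt_def)
lemma psi_0 [simp]: "psi S 0 = 0" by (simp add: psi_def)

lemma cnt_mono: "m \<le> n \<Longrightarrow> cnt p m \<le> cnt p n"
  by (induction n rule: int_ge_induct) (auto simp: cnt_step)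

lemma cnt_unbounded: assumes "p \<in> S" shows "\<exists>n. cnt p n \<ge> c"
proof -
  obtain F where F: "finite F" "card F = nat c" "F \<subseteq> {k. base_prime S k = p}"
    using infinite_arbitrarily_large[OF infinite_base_prime[OF assms]] by blast
  obtain N where N: "\<And>k. k \<in> F \<Longrightarrow> k < N"
    using F(1) finite_nat_iff_bounded by auto
  have "card F \<le> card {k. k < N \<and> base_prime S k = p}" using N F by (intro card_mono) auto
  then have "cnt p (int N) \<ge> c" using F by (simp add: cnt_def)
  then show ?thesis by blast
qed

text \<open>The maximum of the separate indices serves all primes, \<open>cnt\<close> being monotone
  and \<open>S\<close> finite.\<close>

lemma cnt_unbounded_all: "\<exists>n. \<forall>p\<in>S. cnt p n \<ge> c"
proof -
  have "\<forall>p\<in>S. \<exists>n. cnt p n \<ge> c" using cnt_unbounded by blast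
  then obtain n where n: "\<And>p. p \<in> S \<Longrightarrow> cnt p (n p) \<ge> c" by metis
  have "cnt p (Max (n ` S)) \<ge> c" if "p \<in> S" for p
    using n[OF that] cnt_mono[of "n p" "Max (n ` S)" p] finite_S that by (meson Max_ge finite_imageI imageI order_trans)
  then show ?thesis by blast
qed

text \<open>Regroups the logarithms by primes; each step of the induction changes exactly one
  summand.\<close>

lemma psi_eq_sum: "psi S n = (\<Sum>p\<in>S. real_of_int (cnt p n) * ln (real p))"
proof (induction n rule: int_induct[where k = 0])
  case (step1 i)
  have "(\<Sum>p\<in>S. of_bool (step_prime i = p) * ln (real p)) = ln (real (step_prime i))"
    using finite_S step_prime_mem[of i] by (simp add: of_bool_def if_distrib[of "\<lambda>x. x * _"] cong: if_cong)
  then show ?case using step1 by (simp add: psi_step cnt_step distrib_right sum.distrib)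
next
  case (step2 i)
  have "(\<Sum>p\<in>S. of_bool (step_prime (i - 1) = p) * ln (real p)) = ln (real (step_prime (i - 1)))"
    using finite_S step_prime_mem[of "i - 1"] by (simp add: of_bool_def if_distrib[of "\<lambda>x. x * _"] cong: if_cong)
  then show ?case using step2 psi_step[of "i - 1"]
    by (simp add: cnt_step[of _ "i - 1", simplified] distrib_right sum.distrib)
qed simp

definition rad :: "int \<Rightarrow> rat" where "rad n = (\<Prod>q\<in>S. of_nat q powi (- cnt q n))"

lemma real_of_rat_powi: "real_of_rat (x powi k) = real_of_rat x powi k"
  by (simp add: power_int_def of_rat_power of_rat_inverse)

lemma real_of_rat_rad: "real_of_rat (rad n) = exp (- psi S n)"
proof -
  have "real_of_rat (rad n) = (\<Prod>q\<in>S. real q powi (- cnt q n))"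
    by (simp add: rad_def of_rat_prod real_of_rat_powi)
  also have "\<dots> = (\<Prod>q\<in>S. exp (- (real_of_int (cnt q n) * ln (real q))))"
  proof (rule prod.cong)
    fix q assume "q \<in> S"
    then have "real q = exp (ln (real q))" using prime_S[of q] prime_gt_0_nat by simp
    then have "real q powi (- cnt q n) = exp (ln (real q)) powi (- cnt q n)" by simp
    also have "\<dots> = exp (real_of_int (- cnt q n) * ln (real q))" by (rule exp_power_int)
    finally show "real q powi (- cnt q n) = exp (- (real_of_int (cnt q n) * ln (real q)))" by simp
  qed simp
  also have "\<dots> = exp (- psi S n)"
    using finite_S by (simp add: exp_sum[symmetric] psi_eq_sum sum_negf)
  finally show ?thesis .
qed

lemma rad_nonzero: "rad n \<noteq> 0"
  using real_of_rat_rad[of n] by (metis exp_not_eq_zero of_rat_0)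

text \<open>The other primes of \<open>S\<close> are units at \<open>p\<close>, so only the factor
  with \<open>q = p\<close> contributes.\<close>

lemma padic_abs_rad: assumes "p \<in> S" shows "padic_abs p (rad n) = real p powi (cnt p n)"
proof -
  note p = prime_S[OF assms]
  have pr: "padic_abs p (prod f A) = (\<Prod>q\<in>A. padic_abs p (f q))" for f :: "nat \<Rightarrow> rat" and A
    by (induction A rule: infinite_finite_induct) (simp_all add: padic_abs_1[OF p] padic_abs_mult[OF p])
  have pw: "padic_abs p (r ^ k) = padic_abs p r ^ k" for r k
    by (induction k) (simp_all add: padic_abs_mult[OF p] padic_abs_1[OF p])
  have "padic_abs p (rad n) = (\<Prod>q\<in>S. padic_abs p (of_nat q powi (- cnt q n)))"
    by (simp add: rad_def pr)
  also have "\<dots> = (\<Prod>q\<in>S. if q = p then real p powi (cnt p n) else 1)"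
  proof (rule prod.cong)
    fix q assume q: "q \<in> S"
    show "padic_abs p (of_nat q powi (- cnt q n)) = (if q = p then real p powi (cnt p n) else 1)"
    proof (cases "q = p")
      case True
      then show ?thesis using padic_abs_p_powi[OF p, of "- cnt p n"] by simp
    next
      case False
      then have "\<not> p dvd q" using prime_S q p primes_dvd_imp_eq by blast
      then have "padic_abs p (of_nat q) = 1"
        using padic_abs_of_int_div[OF p, of "int q" 1] prime_S[OF q]
        by (simp add: not_dvd_imp_multiplicity_0 not_prime_0 prime_gt_0_nat)
      then have "padic_abs p (of_nat q powi k) = 1" for k
        by (simp add: power_int_def pw padic_abs_inverse[OF p] del: power_inverse)
      then show ?thesis using False by simp
    qed
  qed simp
  also have "\<dots> = real p powi (cnt p n)" using finite_S assms by simp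
  finally show ?thesis .
qed

lemma QS_of_rat_closed [simp]: "QS_of_rat S r \<in> carrier (QS S)"
  unfolding QS_of_rat_def by (rule QS_memI) (simp add: padic_of_rat_closed prime_S)

lemma QS_of_rat_component [simp]: "p \<in> S \<Longrightarrow> QS_of_rat S r p = padic_of_rat p r"
  by (simp add: QS_of_rat_def)

text \<open>Multiplication by the rational \<open>rad n\<close> is invertible and scales the norm at
  \<open>p\<close> by \<open>p powi cnt p n\<close>. The later facts on balls are read off component
  by component from this description.\<close>

lemma QS_ball_eq: "QS_ball S n = {x \<in> carrier (QS S). \<forall>p\<in>S. padic_norm p (x p) \<le> real p powi (cnt p n)}"
proof -
  have r: "(THE r. real_of_rat r = exp (- psi S n)) = rad n"
  proof (rule the_equality)
    fix r assume "real_of_rat r = exp (- psi S n)"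
    then have "real_of_rat r = real_of_rat (rad n)" by (simp add: real_of_rat_rad)
    then show "r = rad n" by (simp only: of_rat_eq_iff)
  qed (rule real_of_rat_rad)
  have ppos: "real p powi k > 0" if "p \<in> S" for p k using prime_S[OF that] prime_gt_0_nat by simp
  show ?thesis unfolding QS_ball_def r
  proof (intro Set.set_eqI iffI)
    fix x assume "x \<in> (\<lambda>z. QS_of_rat S (rad n) \<otimes>\<^bsub>QS S\<^esub> z) ` ZS S"
    then obtain z where z: "z \<in> ZS S" "x = QS_of_rat S (rad n) \<otimes>\<^bsub>QS S\<^esub> z" by auto
    have zc: "z \<in> carrier (QS S)" using z by (auto simp: ZS_def carrier_QS Zp_def)
    have "padic_norm p (x p) \<le> real p powi (cnt p n)" if p: "p \<in> S" for p
    proof -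
      have zp: "z p \<in> carrier (Qp p)" "padic_norm p (z p) \<le> 1" using z(1) p by (auto simp: ZS_def Zp_def)
      then have "padic_norm p (x p) = real p powi (cnt p n) * padic_norm p (z p)"
        using p by (simp add: z padic_norm_mult prime_S padic_of_rat_closed padic_norm_of_rat padic_abs_rad)
      also have "\<dots> \<le> real p powi (cnt p n) * 1" using zp ppos[OF p] by (intro mult_left_mono) (auto intro: less_imp_le)
      finally show ?thesis by simp
    qed
    then show "x \<in> {x \<in> carrier (QS S). \<forall>p\<in>S. padic_norm p (x p) \<le> real p powi (cnt p n)}"
      using z zc by simp
  next
    fix x assume x: "x \<in> {x \<in> carrier (QS S). \<forall>p\<in>S. padic_norm p (x p) \<le> real p powi (cnt p n)}"
    define z where "z = QS_of_rat S (inverse (rad n)) \<otimes>\<^bsub>QS S\<^esub> x"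
    have zc: "z \<in> carrier (QS S)" using x by (simp add: z_def)
    have "padic_norm p (z p) \<le> 1" if p: "p \<in> S" for p
    proof -
      have "padic_norm p (z p) = inverse (real p powi (cnt p n)) * padic_norm p (x p)"
        using p x by (simp add: z_def padic_norm_mult prime_S padic_of_rat_closed padic_norm_of_rat
            padic_abs_rad padic_abs_inverse QS_mem)
      also have "\<dots> \<le> inverse (real p powi (cnt p n)) * real p powi (cnt p n)"
        using x p ppos[OF p] by (intro mult_left_mono) (auto intro: less_imp_le)
      also have "\<dots> = 1" by (rule left_inverse) (metis ppos[OF p] less_irrefl)
      finally show ?thesis .
    qed
    then have "z \<in> ZS S" using zc by (auto simp: ZS_def Zp_def carrier_QS)
    moreover have "QS_of_rat S (rad n) \<otimes>\<^bsub>QS S\<^esub> QS_of_rat S (inverse (rad n)) = \<one>\<^bsub>QS S\<^esub>"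
      using rad_nonzero by (intro QS_eqI) (auto simp: padic_of_rat_mult[symmetric] prime_S padic_of_rat_1)
    then have "x = QS_of_rat S (rad n) \<otimes>\<^bsub>QS S\<^esub> z"
      using x by (simp add: z_def R.m_assoc[symmetric])
    ultimately show "x \<in> (\<lambda>z. QS_of_rat S (rad n) \<otimes>\<^bsub>QS S\<^esub> z) ` ZS S" by blast
  qed
qed

lemma QS_ball_0: "QS_ball S 0 = ZS S"
  unfolding QS_ball_eq by (auto simp: ZS_def Zp_def carrier_QS)

lemma additive_subgroup_ball: "additive_subgroup (QS_ball S n) (QS S)"
proof (rule additive_subgroupI, rule subgroup.intro)
  have pos: "0 \<le> real p powi k" for p k by simp
  fix x y assume x: "x \<in> QS_ball S n" and y: "y \<in> QS_ball S n"
  have "padic_norm p (x p \<oplus>\<^bsub>Qp p\<^esub> y p) \<le> real p powi (cnt p n)" if "p \<in> S" for p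
    using padic_norm_add_le[OF prime_S[OF that], of "x p" "y p"] x y that by (fastforce simp: QS_ball_eq QS_mem)
  then show "x \<otimes>\<^bsub>add_monoid (QS S)\<^esub> y \<in> QS_ball S n" using x y by (simp add: QS_ball_eq)
  have "padic_norm p ((\<zero>\<^bsub>QS S\<^esub> \<ominus>\<^bsub>QS S\<^esub> x) p) \<le> real p powi (cnt p n)" if p: "p \<in> S" for p
    using x p padic_norm_minus[OF prime_S[OF p], of "x p"]
    by (simp add: QS_ball_eq QS_mem a_minus_def[of "Qp p"] Qp_simprules)
  then have "\<zero>\<^bsub>QS S\<^esub> \<ominus>\<^bsub>QS S\<^esub> x \<in> QS_ball S n" using x by (simp add: QS_ball_eq)
  moreover have "\<zero>\<^bsub>QS S\<^esub> \<ominus>\<^bsub>QS S\<^esub> x = \<ominus>\<^bsub>QS S\<^esub> x" using x by (simp add: QS_ball_eq a_minus_def)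
  ultimately show "inv\<^bsub>add_monoid (QS S)\<^esub> x \<in> QS_ball S n" by (simp add: a_inv_def)
next
  show "\<one>\<^bsub>add_monoid (QS S)\<^esub> \<in> QS_ball S n"
    by (simp add: QS_ball_eq padic_of_rat_0[symmetric] prime_S padic_norm_of_rat padic_abs_0)
qed (auto simp: QS_ball_eq)

lemma QS_ball_mono: assumes "m \<le> n" shows "QS_ball S m \<subseteq> QS_ball S n"
proof -
  have "real p powi (cnt p m) \<le> real p powi (cnt p n)" if "p \<in> S" for p
    using cnt_mono[OF assms] by (simp add: p_powi_le_iff[OF prime_S[OF that]])
  then show ?thesis by (fastforce simp: QS_ball_eq)
qed

lemma powi_less_small: assumes "e > 0" shows "\<exists>n. \<forall>p\<in>S. real p powi (cnt p n) < e"
proof -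
  obtain k where k: "(1/2) ^ k < e" using real_arch_pow_inv[OF assms, of "1/2"] by auto
  obtain n where n: "\<forall>p\<in>S. cnt p n \<ge> int k" using cnt_unbounded_all by blast
  \<comment> \<open>The index is \<open>- n\<close>: as \<open>cnt\<close> is odd, large exponents
    at \<open>n\<close> mean small radii at \<open>- n\<close>. Every prime is at least 2, hence the
    comparison with powers of 1/2.\<close>
  have "real p powi (cnt p (- n)) < e" if p: "p \<in> S" for p
  proof -
    have "real p powi (cnt p (- n)) \<le> real p powi (- int k)"
      using n p by (simp add: p_powi_le_iff[OF prime_S[OF p]] cnt_minus)
    also have "\<dots> = inverse (real p ^ k)" by (simp add: power_int_minus)
    also have "\<dots> \<le> inverse (2 ^ k)" using prime_ge_2_nat[OF prime_S[OF p]]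
      by (intro le_imp_inverse_le power_mono) auto
    also have "\<dots> < e" using k by (simp add: power_one_over inverse_eq_divide)
    finally show ?thesis .
  qed
  then show ?thesis by blast
qed

lemma QS_ball_Inter: assumes "x \<in> carrier (QS S)" "\<And>n. x \<in> QS_ball S n" shows "x = \<zero>\<^bsub>QS S\<^esub>"
proof (rule QS_eqI)
  fix p assume p: "p \<in> S"
  have "padic_norm p (x p) \<le> 0 + e" if e: "e > 0" for e
  proof -
    obtain n where "\<forall>p\<in>S. real p powi (cnt p n) < e" using powi_less_small[OF e] by blast
    then show ?thesis using assms(2)[of n] p by (fastforce simp: QS_ball_eq)
  qed
  then have "padic_norm p (x p) \<le> 0" by (rule field_le_epsilon)
  then have "padic_norm p (x p) = 0"
    using padic_norm_nonneg[OF prime_S[OF p] QS_mem[OF assms(1) p]] by simp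
  then show "x p = \<zero>\<^bsub>QS S\<^esub> p"
    using padic_norm_eq_0_iff[OF prime_S[OF p] QS_mem[OF assms(1) p]] p by simp
qed (use assms in auto)

lemma QS_ball_Union: assumes x: "x \<in> carrier (QS S)" shows "\<exists>n. x \<in> QS_ball S n"
proof -
  have "\<exists>k. \<forall>p\<in>S. padic_norm p (x p) < 2 ^ k"
  proof -
    obtain k where "Max ((\<lambda>p. padic_norm p (x p)) ` S) < 2 ^ k" using real_arch_pow[of 2] by auto
    then show ?thesis using finite_S S_ne by (auto simp: Max_less_iff)
  qed
  then obtain k where k: "\<forall>p\<in>S. padic_norm p (x p) < 2 ^ k" by blast
  obtain n where n: "\<forall>p\<in>S. cnt p n \<ge> int k" using cnt_unbounded_all by blast
  have "padic_norm p (x p) \<le> real p powi (cnt p n)" if p: "p \<in> S" for p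
  proof -
    have "padic_norm p (x p) \<le> 2 ^ k" using k p by force
    also have "\<dots> \<le> real p ^ k" using prime_ge_2_nat[OF prime_S[OF p]] by (intro power_mono) auto
    also have "\<dots> = real p powi (int k)" by simp
    also have "\<dots> \<le> real p powi (cnt p n)" using n p by (simp only: p_powi_le_iff[OF prime_S[OF p]])
    finally show ?thesis .
  qed
  then show ?thesis using x by (auto simp: QS_ball_eq)
qed

lemma QS_ball_mult:
  assumes x: "x \<in> QS_ball S (- n)" and y: "y \<in> QS_ball S n" shows "x \<otimes>\<^bsub>QS S\<^esub> y \<in> QS_ball S 0"
proof -
  have "padic_norm p (x p \<otimes>\<^bsub>Qp p\<^esub> y p) \<le> 1" if p: "p \<in> S" for p
  proof -
    have "padic_norm p (x p \<otimes>\<^bsub>Qp p\<^esub> y p) = padic_norm p (x p) * padic_norm p (y p)"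
      using x y p by (simp add: QS_ball_eq padic_norm_mult prime_S QS_mem)
    also have "\<dots> \<le> real p powi (- cnt p n) * real p powi (cnt p n)"
      using x y p by (intro mult_mono) (auto simp: QS_ball_eq cnt_minus QS_mem padic_norm_nonneg prime_S)
    also have "\<dots> = 1" using prime_gt_0_nat[OF prime_S[OF p]] by (simp add: power_int_minus)
    finally show ?thesis .
  qed
  then show ?thesis using x y by (simp add: QS_ball_eq)
qed

lemma QS_char_eq: "QS_char S x = (\<Prod>p\<in>S. padic_char p (x p))"
  by (simp add: QS_char_def padic_char_def prime_S cong: prod.cong)

lemma QS_char_add:
  "x \<in> carrier (QS S) \<Longrightarrow> y \<in> carrier (QS S) \<Longrightarrow> QS_char S (x \<oplus>\<^bsub>QS S\<^esub> y) = QS_char S x * QS_char S y"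
  by (simp add: QS_char_eq padic_char_add prime_S QS_mem prod.distrib cong: prod.cong)

lemma norm_QS_char: "cmod (QS_char S x) = 1"
  by (simp add: QS_char_eq prod_norm[symmetric] norm_padic_char prime_S cong: prod.cong)

lemma QS_char_ball_0: "x \<in> QS_ball S 0 \<Longrightarrow> QS_char S x = 1"
  unfolding QS_char_eq
  by (rule prod.neutral) (auto simp: QS_ball_0 ZS_def PiE_def Pi_def padic_char_eq_1_iff prime_S Zp_def)

text \<open>Test \<open>x\<close> at a prime \<open>p\<close> where its component is too large:
  \<open>y\<close> has there a component of norm exactly \<open>p powi cnt p n\<close> and is 0
  elsewhere, so the product has a single nontrivial component, and that one lies outside
  \<open>Zp p\<close>.\<close>

lemma QS_char_nontrivial:
  assumes x: "x \<in> carrier (QS S)" and "x \<notin> QS_ball S (- n)"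
  shows "\<exists>y\<in>QS_ball S n. QS_char S (x \<otimes>\<^bsub>QS S\<^esub> y) \<noteq> 1"
proof -
  obtain p where p: "p \<in> S" "padic_norm p (x p) > real p powi (- cnt p n)"
    using assms by (force simp: QS_ball_eq cnt_minus)
  note pp = prime_S[OF p(1)]
  define w where "w = padic_of_rat p (of_nat p powi (- cnt p n))"
  have w: "w \<in> carrier (Qp p)" "padic_norm p w = real p powi (cnt p n)"
    by (simp_all add: w_def padic_of_rat_closed[OF pp] padic_norm_of_rat[OF pp] padic_abs_p_powi[OF pp])
  define y where "y = (\<lambda>q\<in>S. if q = p then w else \<zero>\<^bsub>Qp q\<^esub>)"
  have yc: "y \<in> carrier (QS S)" unfolding y_def by (rule QS_memI) (auto simp: w Qp_simprules)
  have n0: "padic_norm q \<zero>\<^bsub>Qp q\<^esub> = 0" if "q \<in> S" for q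
    using that by (simp add: padic_norm_eq_0_iff prime_S Qp_simprules)
  have "y \<in> QS_ball S n" using yc by (auto simp: QS_ball_eq y_def w n0)
  moreover have "QS_char S (x \<otimes>\<^bsub>QS S\<^esub> y) = (\<Prod>q\<in>S. if q = p then padic_char p (x p \<otimes>\<^bsub>Qp p\<^esub> w) else 1)"
    unfolding QS_char_eq
  proof (rule prod.cong)
    fix q assume q: "q \<in> S"
    have "padic_char q \<zero>\<^bsub>Qp q\<^esub> = 1"
      using q by (simp add: padic_char_eq_1_iff prime_S Qp_simprules Zp_def n0)
    then show "padic_char q ((x \<otimes>\<^bsub>QS S\<^esub> y) q) = (if q = p then padic_char p (x p \<otimes>\<^bsub>Qp p\<^esub> w) else 1)"
      using q x by (auto simp: y_def Qp_simprules QS_mem)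
  qed simp
  then have "QS_char S (x \<otimes>\<^bsub>QS S\<^esub> y) = padic_char p (x p \<otimes>\<^bsub>Qp p\<^esub> w)" using finite_S p by simp
  moreover have "padic_char p (x p \<otimes>\<^bsub>Qp p\<^esub> w) \<noteq> 1"
  proof -
    have "padic_norm p (x p \<otimes>\<^bsub>Qp p\<^esub> w) = padic_norm p (x p) * real p powi (cnt p n)"
      using x p w by (simp add: padic_norm_mult[OF pp] QS_mem)
    also have "\<dots> > real p powi (- cnt p n) * real p powi (cnt p n)"
      using p prime_gt_0_nat[OF pp] by (intro mult_strict_right_mono) auto
    also have "real p powi (- cnt p n) * real p powi (cnt p n) = 1"
      using prime_gt_0_nat[OF pp] by (simp add: power_int_minus)
    finally show ?thesis
      using x p w by (simp add: padic_char_eq_1_iff[OF pp] Qp_simprules QS_mem Zp_def)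
  qed
  ultimately show ?thesis by metis
qed

lemma QS_complete:
  fixes x :: "nat \<Rightarrow> qs"
  assumes x: "\<And>k. x k \<in> carrier (QS S)"
    and cauchy: "\<And>n. \<exists>K. \<forall>k\<ge>K. \<forall>l\<ge>K. x k \<ominus>\<^bsub>QS S\<^esub> x l \<in> QS_ball S n"
  shows "\<exists>z\<in>carrier (QS S). \<forall>n. \<exists>K. \<forall>k\<ge>K. x k \<ominus>\<^bsub>QS S\<^esub> z \<in> QS_ball S n"
proof -
  have "\<exists>z. z \<in> carrier (Qp p) \<and> (\<forall>e>0. \<exists>K. \<forall>k\<ge>K. padic_norm p (x k p \<ominus>\<^bsub>Qp p\<^esub> z) < e)" if p: "p \<in> S" for p
  proof -
    have c: "\<exists>K. \<forall>k\<ge>K. \<forall>l\<ge>K. padic_norm p (x k p \<ominus>\<^bsub>Qp p\<^esub> x l p) < e" if e: "e > 0" for e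
    proof -
      obtain n where n: "\<forall>p\<in>S. real p powi (cnt p n) < e" using powi_less_small[OF e] by blast
      obtain K where "\<forall>k\<ge>K. \<forall>l\<ge>K. x k \<ominus>\<^bsub>QS S\<^esub> x l \<in> QS_ball S n" using cauchy by blast
      then have "\<forall>k\<ge>K. \<forall>l\<ge>K. padic_norm p (x k p \<ominus>\<^bsub>Qp p\<^esub> x l p) \<le> real p powi (cnt p n)"
        using p x by (auto simp: QS_ball_eq)
      then show ?thesis using n p by (meson order_le_less_trans)
    qed
    show ?thesis
      by (rule padic_complete[OF prime_S[OF p], of "\<lambda>k. x k p"]) (use c x p in \<open>auto simp: QS_mem\<close>)
  qed
  then obtain z where z: "\<And>p. p \<in> S \<Longrightarrow> z p \<in> carrier (Qp p)"
    "\<And>p e. p \<in> S \<Longrightarrow> e > 0 \<Longrightarrow> \<exists>K. \<forall>k\<ge>K. padic_norm p (x k p \<ominus>\<^bsub>Qp p\<^esub> z p) < e" by metis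
  define y where "y = (\<lambda>p\<in>S. z p)"
  have y: "y \<in> carrier (QS S)" unfolding y_def by (rule QS_memI) (rule z)
  have "\<exists>K. \<forall>k\<ge>K. x k \<ominus>\<^bsub>QS S\<^esub> y \<in> QS_ball S n" for n
  proof -
    have "\<forall>p\<in>S. eventually (\<lambda>k. padic_norm p (x k p \<ominus>\<^bsub>Qp p\<^esub> z p) < real p powi (cnt p n)) sequentially"
      using z(2) prime_S prime_gt_0_nat unfolding eventually_sequentially
      by (metis of_nat_0_less_iff zero_less_power_int)
    then have "eventually (\<lambda>k. \<forall>p\<in>S. padic_norm p (x k p \<ominus>\<^bsub>Qp p\<^esub> z p) < real p powi (cnt p n)) sequentially"
      using finite_S by (simp add: eventually_ball_finite)
    then show ?thesis unfolding eventually_sequentially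
      using x y by (fastforce simp: QS_ball_eq y_def less_imp_le)
  qed
  with y show ?thesis by blast
qed

section \<open>Topology and Borel sets in terms of balls\<close>

definition cball :: "qs \<Rightarrow> int \<Rightarrow> qs set" where
  "cball a n = {y \<in> carrier (QS S). y \<ominus>\<^bsub>QS S\<^esub> a \<in> QS_ball S n}"

text \<open>Rationals chosen independently at each prime, so that density holds component by
  component; for the diagonal rationals it would rest on weak approximation.\<close>

definition QS_dense :: "qs set" where
  "QS_dense = (\<lambda>r. \<lambda>p\<in>S. padic_of_rat p (r p)) ` (\<Pi>\<^sub>E p\<in>S. UNIV)"

lemma countable_QS_dense: "countable QS_dense"
  unfolding QS_dense_def using finite_S by (intro countable_image countable_PiE) auto

lemma QS_dense_carrier: "QS_dense \<subseteq> carrier (QS S)"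
  unfolding QS_dense_def by (auto intro!: QS_memI padic_of_rat_closed prime_S)

lemma QS_dense:
  assumes x: "x \<in> carrier (QS S)" shows "\<exists>d\<in>QS_dense. x \<ominus>\<^bsub>QS S\<^esub> d \<in> QS_ball S n"
proof -
  have "\<exists>r. padic_norm p (x p \<ominus>\<^bsub>Qp p\<^esub> padic_of_rat p r) < real p powi (cnt p n)" if p: "p \<in> S" for p
    using prime_gt_0_nat[OF prime_S[OF p]]
    by (metis padic_rat_dense[OF prime_S[OF p] QS_mem[OF x p]] of_nat_0_less_iff zero_less_power_int)
  then obtain r where r: "\<And>p. p \<in> S \<Longrightarrow> padic_norm p (x p \<ominus>\<^bsub>Qp p\<^esub> padic_of_rat p (r p)) < real p powi (cnt p n)"
    by metis
  define d where "d = (\<lambda>p\<in>S. padic_of_rat p (restrict r S p))"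
  have d: "d \<in> QS_dense" unfolding d_def QS_dense_def by (intro imageI) auto
  then have dc: "d \<in> carrier (QS S)" using QS_dense_carrier by auto
  have "x \<ominus>\<^bsub>QS S\<^esub> d \<in> QS_ball S n"
    using x dc r by (auto simp: QS_ball_eq d_def less_imp_le)
  with d show ?thesis by blast
qed

lemma topspace_QS: "topspace (QS_topology S) = carrier (QS S)"
  using topspace_padic[OF prime_S]
  by (simp add: QS_topology_def carrier_QS cong: PiE_cong)

lemma openin_cball: assumes a: "a \<in> carrier (QS S)" shows "openin (QS_topology S) (cball a n)"
proof -
  have "cball a n = (\<Pi>\<^sub>E p\<in>S. {y \<in> carrier (Qp p). padic_norm p (y \<ominus>\<^bsub>Qp p\<^esub> a p) \<le> real p powi (cnt p n)})"
    (is "_ = ?P")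
  proof (intro Set.set_eqI iffI)
    fix x assume x: "x \<in> cball a n"
    then have xc: "x \<in> carrier (QS S)" by (simp add: cball_def)
    then have "x \<in> extensional S" by (simp add: carrier_QS PiE_def)
    then show "x \<in> ?P" using x xc a by (auto simp: cball_def QS_ball_eq PiE_iff QS_mem)
  next
    fix x assume x: "x \<in> ?P"
    then have xc: "x \<in> carrier (QS S)" by (auto simp: carrier_QS PiE_iff)
    then show "x \<in> cball a n" using x a by (auto simp: cball_def QS_ball_eq PiE_iff)
  qed
  then show ?thesis
    unfolding QS_topology_def using finite_S
    by (auto simp: openin_PiE_gen intro!: openin_padic_ball prime_S QS_mem[OF a] p_powi_pos)
qed

lemma openin_contains_cball:
  assumes U: "openin (QS_topology S) U" and x: "x \<in> U" shows "\<exists>n. cball x n \<subseteq> U"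
proof -
  have xc: "x \<in> carrier (QS S)" using openin_subset[OF U] x topspace_QS by auto
  have "\<forall>x\<in>U. \<exists>V. finite {i \<in> S. V i \<noteq> topspace (padic_topology i)} \<and>
      (\<forall>i\<in>S. openin (padic_topology i) (V i)) \<and> x \<in> PiE S V \<and> PiE S V \<subseteq> U"
    using U unfolding QS_topology_def openin_product_topology_alt .
  from bspec[OF this x] obtain V where V: "\<forall>p\<in>S. openin (padic_topology p) (V p)" "x \<in> PiE S V" "PiE S V \<subseteq> U"
    by (elim exE conjE)
  have "\<forall>p\<in>S. \<exists>e>0. {y \<in> carrier (Qp p). padic_norm p (y \<ominus>\<^bsub>Qp p\<^esub> x p) < e} \<subseteq> V p"
    using V by (intro ballI openin_padic_contains_ball prime_S) auto
  from bchoice[OF this] obtain e where e: "\<And>p. p \<in> S \<Longrightarrow> e p > 0"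
    "\<And>p. p \<in> S \<Longrightarrow> {y \<in> carrier (Qp p). padic_norm p (y \<ominus>\<^bsub>Qp p\<^esub> x p) < e p} \<subseteq> V p" by blast
  define e' where "e' = Min (e ` S)"
  have "e' > 0" using e finite_S S_ne by (simp add: e'_def)
  then obtain n where n: "\<forall>p\<in>S. real p powi (cnt p n) < e'" using powi_less_small by blast
  have "cball x n \<subseteq> PiE S V"
  proof
    fix y assume y: "y \<in> cball x n"
    then have yc: "y \<in> carrier (QS S)" by (simp add: cball_def)
    have "y p \<in> V p" if p: "p \<in> S" for p
    proof -
      have "padic_norm p (y p \<ominus>\<^bsub>Qp p\<^esub> x p) \<le> real p powi (cnt p n)"
        using y xc p by (auto simp: cball_def QS_ball_eq)
      also have "\<dots> < e'" using n p by blast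
      also have "e' \<le> e p" using finite_S p by (simp add: e'_def)
      finally show ?thesis using e(2)[OF p] QS_mem[OF yc p] by auto
    qed
    then show "y \<in> PiE S V" using yc by (auto simp: carrier_QS)
  qed
  with V show ?thesis by blast
qed

text \<open>Balls are cosets of the subgroup \<open>QS_ball S n\<close>, so every point of a ball is
  a centre of it.\<close>

lemma cball_eq_cball:
  assumes "a \<in> carrier (QS S)" "b \<in> cball a n" shows "cball b n = cball a n"
proof -
  interpret B: additive_subgroup "QS_ball S n" "QS S" by (rule additive_subgroup_ball)
  have b: "b \<in> carrier (QS S)" "b \<ominus>\<^bsub>QS S\<^esub> a \<in> QS_ball S n" using assms by (auto simp: cball_def)
  have "y \<ominus>\<^bsub>QS S\<^esub> b \<in> QS_ball S n \<longleftrightarrow> y \<ominus>\<^bsub>QS S\<^esub> a \<in> QS_ball S n" if y: "y \<in> carrier (QS S)" for y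
  proof -
    have "y \<ominus>\<^bsub>QS S\<^esub> a = (y \<ominus>\<^bsub>QS S\<^esub> b) \<oplus>\<^bsub>QS S\<^esub> (b \<ominus>\<^bsub>QS S\<^esub> a)"
      "y \<ominus>\<^bsub>QS S\<^esub> b = (y \<ominus>\<^bsub>QS S\<^esub> a) \<oplus>\<^bsub>QS S\<^esub> (\<ominus>\<^bsub>QS S\<^esub> (b \<ominus>\<^bsub>QS S\<^esub> a))"
      using y b assms by algebra+
    then show ?thesis using b B.a_closed B.a_inv_closed by metis
  qed
  then show ?thesis by (auto simp: cball_def)
qed

text \<open>An open set is the union of the balls inside it; recentring these at points of
  \<open>QS_dense\<close> leaves only countably many, so the balls generate the Borel sets.\<close>

lemma sets_QS_borel:
  "sets (QS_borel S) = sigma_sets (carrier (QS S)) {cball a n | a n. a \<in> carrier (QS S)}" (is "_ = ?\<B>")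
  and space_QS_borel: "space (QS_borel S) = carrier (QS S)"
proof -
  have sub: "{U. openin (QS_topology S) U} \<subseteq> Pow (carrier (QS S))"
    using openin_subset topspace_QS by blast
  show "space (QS_borel S) = carrier (QS S)" unfolding QS_borel_def by (simp add: space_measure_of[OF sub])
  have s: "sets (QS_borel S) = sigma_sets (carrier (QS S)) {U. openin (QS_topology S) U}"
    unfolding QS_borel_def by (rule sets_measure_of[OF sub])
  have "U \<in> ?\<B>" if U: "openin (QS_topology S) U" for U
  proof -
    let ?I = "{(d, n). d \<in> QS_dense \<and> cball d n \<subseteq> U}"
    have "U = (\<Union>(d, n)\<in>?I. cball d n)"
    proof (intro equalityI subsetI)
      fix x assume x: "x \<in> U"
      then have xc: "x \<in> carrier (QS S)" using sub U by auto
      obtain n where n: "cball x n \<subseteq> U" using openin_contains_cball[OF U x] by blast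
      obtain d where d: "d \<in> QS_dense" "x \<ominus>\<^bsub>QS S\<^esub> d \<in> QS_ball S n" using QS_dense[OF xc] by blast
      have dc: "d \<in> carrier (QS S)" using d QS_dense_carrier by auto
      have xd: "x \<in> cball d n" using d xc by (simp add: cball_def)
      then have "cball d n \<subseteq> U" using cball_eq_cball[OF dc xd] n by simp
      then show "x \<in> (\<Union>(d, n)\<in>?I. cball d n)" using xd d by blast
    qed auto
    moreover have "countable ?I"
      by (rule countable_subset[of _ "QS_dense \<times> UNIV"]) (auto intro: countable_QS_dense)
    then have "(\<Union>(d, n)\<in>?I. cball d n) \<in> ?\<B>"
      using QS_dense_carrier by (intro sigma_sets_UNION) (auto intro!: sigma_sets.Basic)
    ultimately show ?thesis by simp
  qed
  then have "sigma_sets (carrier (QS S)) {U. openin (QS_topology S) U} \<subseteq> ?\<B>"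
    by (intro sigma_sets_mono) auto
  moreover have "?\<B> \<subseteq> sigma_sets (carrier (QS S)) {U. openin (QS_topology S) U}"
    by (intro sigma_sets_subseteq) (auto intro!: openin_cball)
  ultimately show "sets (QS_borel S) = ?\<B>" using s by simp
qed

lemma limitin_QS_iff:
  assumes l: "l \<in> carrier (QS S)" and f: "\<And>x. f x \<in> carrier (QS S)"
  shows "limitin (QS_topology S) f l F \<longleftrightarrow> (\<forall>n. eventually (\<lambda>x. f x \<ominus>\<^bsub>QS S\<^esub> l \<in> QS_ball S n) F)"
proof
  assume L: "limitin (QS_topology S) f l F"
  show "\<forall>n. eventually (\<lambda>x. f x \<ominus>\<^bsub>QS S\<^esub> l \<in> QS_ball S n) F"
  proof
    fix n
    interpret B: additive_subgroup "QS_ball S n" "QS S" by (rule additive_subgroup_ball)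
    have "l \<in> cball l n" using l B.zero_closed by (simp add: cball_def a_minus_def R.r_neg)
    then have "eventually (\<lambda>x. f x \<in> cball l n) F"
      using L openin_cball[OF l] by (auto simp: limitin_def)
    then show "eventually (\<lambda>x. f x \<ominus>\<^bsub>QS S\<^esub> l \<in> QS_ball S n) F"
      by eventually_elim (simp add: cball_def)
  qed
next
  assume *: "\<forall>n. eventually (\<lambda>x. f x \<ominus>\<^bsub>QS S\<^esub> l \<in> QS_ball S n) F"
  show "limitin (QS_topology S) f l F"
    unfolding limitin_def
  proof (intro conjI allI impI)
    show "l \<in> topspace (QS_topology S)" using l topspace_QS by simp
    fix U assume "openin (QS_topology S) U \<and> l \<in> U"
    then obtain n where "cball l n \<subseteq> U" using openin_contains_cball by blast
    with *[rule_format, of n] show "eventually (\<lambda>x. f x \<in> U) F"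
      by (auto elim!: eventually_mono simp: cball_def f)
  qed
qed

lemma QS_norm_0: "QS_norm S \<zero>\<^bsub>QS S\<^esub> = 0"
  by (simp add: QS_norm_def)

lemma QS_norm_eq:
  assumes "x \<in> QS_ball S n" "x \<notin> QS_ball S (n - 1)" shows "QS_norm S x = exp (psi S n)"
proof -
  interpret B: additive_subgroup "QS_ball S (n - 1)" "QS S" by (rule additive_subgroup_ball)
  have "(THE n. x \<in> QS_ball S n - QS_ball S (n - 1)) = n"
  proof (rule the_equality)
    fix m assume m: "x \<in> QS_ball S m - QS_ball S (m - 1)"
    show "m = n"
    proof (rule ccontr)
      assume "m \<noteq> n"
      then consider "m \<le> n - 1" | "n \<le> m - 1" by linarith
      then show False using QS_ball_mono m assms by cases blast+
    qed
  qed (use assms in auto)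
  moreover have "x \<noteq> \<zero>\<^bsub>QS S\<^esub>" using assms B.zero_closed by auto
  ultimately show ?thesis by (simp add: QS_norm_def)
qed

end

section \<open>Haar measure of the balls\<close>

locale haar_QS = prime_set +
  fixes \<mu> :: "qs measure"
  assumes haar: "haar_measure S \<mu>"
begin

lemma sets_mu: "sets \<mu> = sigma_sets (carrier (QS S)) {cball a n | a n. a \<in> carrier (QS S)}"
  using haar sets_QS_borel by (simp add: haar_measure_def)

lemma cball_eq_coset:
  assumes a: "a \<in> carrier (QS S)" shows "cball a n = QS_ball S n +>\<^bsub>QS S\<^esub> a"
proof -
  have bc: "QS_ball S n \<subseteq> carrier (QS S)" by (auto simp: QS_ball_eq)
  show ?thesis
  proof (intro Set.set_eqI iffI)
    fix y assume y: "y \<in> cball a n"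
    then have yc: "y \<in> carrier (QS S)" by (simp add: cball_def)
    have "y = (y \<ominus>\<^bsub>QS S\<^esub> a) \<oplus>\<^bsub>QS S\<^esub> a" using yc a by algebra
    then show "y \<in> QS_ball S n +>\<^bsub>QS S\<^esub> a" using y by (auto simp: a_r_coset_def' cball_def)
  next
    fix y assume "y \<in> QS_ball S n +>\<^bsub>QS S\<^esub> a"
    then obtain b where b: "b \<in> QS_ball S n" "y = b \<oplus>\<^bsub>QS S\<^esub> a" by (auto simp: a_r_coset_def')
    then have bc': "b \<in> carrier (QS S)" using bc by auto
    have "(b \<oplus>\<^bsub>QS S\<^esub> a) \<ominus>\<^bsub>QS S\<^esub> a = b" using bc' a by algebra
    then show "y \<in> cball a n" using b bc' a by (simp add: cball_def)
  qed
qed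

lemma cball_in_sets: "a \<in> carrier (QS S) \<Longrightarrow> cball a n \<in> sets \<mu>"
  by (auto simp: sets_mu)

lemma QS_ball_eq_cball: "QS_ball S n = cball \<zero>\<^bsub>QS S\<^esub> n"
proof -
  have "x \<ominus>\<^bsub>QS S\<^esub> \<zero>\<^bsub>QS S\<^esub> = x" if "x \<in> carrier (QS S)" for x using that by algebra
  then show ?thesis by (auto simp: cball_def) (simp_all add: QS_ball_eq)
qed

lemma emeasure_cball_eq: "a \<in> carrier (QS S) \<Longrightarrow> emeasure \<mu> (cball a n) = emeasure \<mu> (QS_ball S n)"
  using haar cball_in_sets[of "\<zero>\<^bsub>QS S\<^esub>" n] by (simp add: cball_eq_coset haar_measure_def QS_ball_eq_cball[symmetric])

text \<open>From \<open>n\<close> to \<open>n + 1\<close> only the disc at the prime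
  \<open>step_prime n\<close> grows, by one power of that prime. It splits into residue discs, so
  the larger ball is a disjoint union of translates of the smaller one, which have equal Haar
  measure.\<close>

lemma emeasure_ball_step:
  "emeasure \<mu> (QS_ball S (n + 1)) = of_nat (step_prime n) * emeasure \<mu> (QS_ball S n)"
proof -
  define q where "q = step_prime n"
  have q: "q \<in> S" "prime q" using step_prime_mem prime_S by (auto simp: q_def)
  define k where "k = cnt q (n + 1)"
  have kq: "cnt q n = k - 1" by (simp add: k_def cnt_step q_def)
  have other: "cnt p (n + 1) = cnt p n" if "p \<noteq> q" for p using that by (simp add: cnt_step q_def)
  \<comment> \<open>Centres of the translates: a residue representative at \<open>q\<close>, zero at
    the other primes.\<close>
  define e where "e j = (\<lambda>p\<in>S. if p = q then padic_of_rat q (of_nat j * of_nat q powi (- k)) else \<zero>\<^bsub>Qp p\<^esub>)" for j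
  have ec: "e j \<in> carrier (QS S)" for j
    unfolding e_def by (rule QS_memI) (auto simp: padic_of_rat_closed[OF q(2)] Qp_simprules)
  have iff: "x \<in> cball (e j) n \<longleftrightarrow> x \<in> carrier (QS S) \<and> (\<forall>p\<in>S - {q}. padic_norm p (x p) \<le> real p powi cnt p n) \<and>
      padic_norm q (x q \<ominus>\<^bsub>Qp q\<^esub> padic_of_rat q (of_nat j * of_nat q powi (- k))) \<le> real q powi (k - 1)" for x j
  proof -
    have "x \<in> cball (e j) n \<longleftrightarrow> x \<in> carrier (QS S) \<and>
        (\<forall>p\<in>S. padic_norm p (x p \<ominus>\<^bsub>Qp p\<^esub> e j p) \<le> real p powi cnt p n)"
      using ec by (auto simp: cball_def QS_ball_eq)
    also have "\<dots> \<longleftrightarrow> x \<in> carrier (QS S) \<and> (\<forall>p\<in>S - {q}. padic_norm p (x p \<ominus>\<^bsub>Qp p\<^esub> e j p) \<le> real p powi cnt p n)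
        \<and> padic_norm q (x q \<ominus>\<^bsub>Qp q\<^esub> e j q) \<le> real q powi cnt q n" using q by blast
    also have "\<dots> \<longleftrightarrow> x \<in> carrier (QS S) \<and> (\<forall>p\<in>S - {q}. padic_norm p (x p) \<le> real p powi cnt p n) \<and>
      padic_norm q (x q \<ominus>\<^bsub>Qp q\<^esub> padic_of_rat q (of_nat j * of_nat q powi (- k))) \<le> real q powi (k - 1)"
      using q by (auto simp: e_def kq QS_mem Qp_simprules a_minus_def)
    finally show ?thesis .
  qed
  have ball: "x \<in> QS_ball S (n + 1) \<longleftrightarrow> x \<in> carrier (QS S) \<and> (\<forall>p\<in>S - {q}. padic_norm p (x p) \<le> real p powi cnt p n)
      \<and> padic_norm q (x q) \<le> real q powi k" for x
  proof -
    have "x \<in> QS_ball S (n + 1) \<longleftrightarrow> x \<in> carrier (QS S) \<and> (\<forall>p\<in>S - {q}. padic_norm p (x p) \<le> real p powi cnt p (n + 1))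
        \<and> padic_norm q (x q) \<le> real q powi cnt q (n + 1)" using q by (auto simp: QS_ball_eq)
    then show ?thesis by (auto simp: other k_def)
  qed
  have small: "padic_norm q (padic_of_rat q (of_nat j * of_nat q powi (- k))) \<le> real q powi k" for j
  proof -
    have "padic_abs q (of_nat j) \<le> 1" using padic_abs_of_int_le_1[OF q(2), of "int j"] by simp
    then have "padic_abs q (of_nat j) * real q powi k \<le> 1 * real q powi k" by (rule mult_right_mono) simp
    then show ?thesis
      by (simp add: padic_norm_of_rat[OF q(2)] padic_abs_mult[OF q(2)] padic_abs_p_powi[OF q(2)])
  qed
  have "QS_ball S (n + 1) = (\<Union>j<q. cball (e j) n)"
  proof (intro Set.set_eqI iffI)
    fix x assume "x \<in> QS_ball S (n + 1)"
    then show "x \<in> (\<Union>j<q. cball (e j) n)"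
      using padic_residue_exists[OF q(2) QS_mem[OF _ q(1)], of x k] unfolding ball by (auto simp: iff)
  next
    fix x assume "x \<in> (\<Union>j<q. cball (e j) n)"
    then obtain j where j: "x \<in> cball (e j) n" by blast
    let ?j = "padic_of_rat q (of_nat j * of_nat q powi (- k))"
    have xc: "x q \<in> carrier (Qp q)" "?j \<in> carrier (Qp q)"
      using j q by (auto simp: iff QS_mem padic_of_rat_closed)
    interpret Q: cring "Qp q" by (rule cring_Qp[OF q(2)])
    have "x q = (x q \<ominus>\<^bsub>Qp q\<^esub> ?j) \<oplus>\<^bsub>Qp q\<^esub> ?j" using xc by algebra
    then have "padic_norm q (x q) \<le> max (padic_norm q (x q \<ominus>\<^bsub>Qp q\<^esub> ?j)) (padic_norm q ?j)"
      using padic_norm_add_le[OF q(2), of "x q \<ominus>\<^bsub>Qp q\<^esub> ?j" ?j] xc by simp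
    also have "\<dots> \<le> real q powi k"
    proof (rule max.boundedI)
      have "real q powi (k - 1) \<le> real q powi k" by (simp add: p_powi_le_iff[OF q(2)])
      then show "padic_norm q (x q \<ominus>\<^bsub>Qp q\<^esub> ?j) \<le> real q powi k" using j by (simp add: iff)
    qed (rule small)
    finally show "x \<in> QS_ball S (n + 1)" using j unfolding ball iff by blast
  qed
  moreover have "disjoint_family_on (\<lambda>j. cball (e j) n) {..<q}"
  proof (unfold disjoint_family_on_def, intro ballI impI, rule ccontr)
    fix i j assume ij: "i \<in> {..<q}" "j \<in> {..<q}" "i \<noteq> j" and "cball (e i) n \<inter> cball (e j) n \<noteq> {}"
    then obtain x where x: "x \<in> cball (e i) n" "x \<in> cball (e j) n" by blast
    then have "x \<in> carrier (QS S)" by (simp add: cball_def)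
    moreover have "x \<in> (\<Union>j<q. cball (e j) n)" using x ij by blast
    then have "padic_norm q (x q) \<le> real q powi k" using calculation ball by (metis \<open>QS_ball S (n + 1) = _\<close>)
    ultimately show False
      using padic_residue_exists[OF q(2) QS_mem[OF _ q(1)], of x k] x ij by (auto simp: iff)
  qed
  ultimately have "emeasure \<mu> (QS_ball S (n + 1)) = (\<Sum>j<q. emeasure \<mu> (cball (e j) n))"
    using cball_in_sets ec by (simp add: sum_emeasure image_subset_iff)
  then show ?thesis by (simp add: emeasure_cball_eq ec q_def[symmetric])
qed

lemma emeasure_ball: "emeasure \<mu> (QS_ball S n) = ennreal (exp (psi S n))"
proof (induction n rule: int_induct[where k = 0])
  case base
  show ?case using haar by (simp add: QS_ball_0 haar_measure_def)
next
  case (step1 i)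
  have "real (step_prime i) > 0" using prime_S[OF step_prime_mem[of i]] prime_gt_0_nat by simp
  then show ?case using step1
    by (simp add: emeasure_ball_step psi_step exp_add ennreal_mult[symmetric] ennreal_of_nat_eq_real_of_nat mult.commute)
next
  case (step2 i)
  have pos: "real (step_prime (i - 1)) > 0" using prime_S[OF step_prime_mem] prime_gt_0_nat by simp
  have "ennreal (exp (psi S i)) = of_nat (step_prime (i - 1)) * emeasure \<mu> (QS_ball S (i - 1))"
    using step2 emeasure_ball_step[of "i - 1"] by simp
  moreover have "exp (psi S i) = real (step_prime (i - 1)) * exp (psi S (i - 1))"
    using psi_step[of "i - 1"] pos by (simp add: exp_add)
  ultimately have "of_nat (step_prime (i - 1)) * emeasure \<mu> (QS_ball S (i - 1)) =
      of_nat (step_prime (i - 1)) * ennreal (exp (psi S (i - 1)))"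
    by (simp add: ennreal_mult ennreal_of_nat_eq_real_of_nat)
  then show ?case using pos by (simp add: ennreal_mult_cancel_left)
qed

lemma emeasure_cball: "a \<in> carrier (QS S) \<Longrightarrow> emeasure \<mu> (cball a n) = ennreal (exp (psi S n))"
  by (simp add: emeasure_cball_eq emeasure_ball)

end

section \<open>Square integrable functions\<close>

lemma L2_measurable: "f \<in> L2 M \<Longrightarrow> f \<in> borel_measurable M"
  and L2_integrable: "f \<in> L2 M \<Longrightarrow> integrable M (\<lambda>x. (cmod (f x))\<^sup>2)"
  by (simp_all add: L2_def)

lemma L2_bound:
  assumes "integrable M h" "f \<in> borel_measurable M" "AE x in M. (cmod (f x))\<^sup>2 \<le> h x"
  shows "f \<in> L2 M"
proof -
  have "integrable M (\<lambda>x. (cmod (f x))\<^sup>2)"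
    by (rule Bochner_Integration.integrable_bound[OF assms(1)]) (use assms in auto)
  then show ?thesis using assms by (simp add: L2_def)
qed

lemma cmod_mult_le: "cmod (a * b) \<le> (cmod a)\<^sup>2 + (cmod b)\<^sup>2"
proof -
  have "2 * (cmod a * cmod b) \<le> (cmod a)\<^sup>2 + (cmod b)\<^sup>2"
    using sum_squares_bound[of "cmod a" "cmod b"] by simp
  moreover have "0 \<le> cmod a * cmod b" by simp
  ultimately show ?thesis unfolding norm_mult by linarith
qed

lemma cmod_add_sq_le: "(cmod (a + b))\<^sup>2 \<le> 2 * (cmod a)\<^sup>2 + 2 * (cmod b)\<^sup>2"
proof -
  have "(cmod (a + b))\<^sup>2 \<le> (cmod a + cmod b)\<^sup>2" by (intro power_mono norm_triangle_ineq) auto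
  also have "\<dots> \<le> 2 * (cmod a)\<^sup>2 + 2 * (cmod b)\<^sup>2"
    using sum_squares_bound[of "cmod a" "cmod b"] by (simp add: power2_sum)
  finally show ?thesis .
qed

lemma L2_add: assumes "f \<in> L2 M" "g \<in> L2 M" shows "(\<lambda>x. f x + g x) \<in> L2 M"
  by (rule L2_bound[where h = "\<lambda>x. 2 * (cmod (f x))\<^sup>2 + 2 * (cmod (g x))\<^sup>2"])
    (use assms in \<open>auto simp: L2_def cmod_add_sq_le\<close>)

lemma L2_cmult: assumes "f \<in> L2 M" shows "(\<lambda>x. c * f x) \<in> L2 M"
  using assms by (auto simp: L2_def norm_mult power_mult_distrib)

lemma L2_uminus: "f \<in> L2 M \<Longrightarrow> (\<lambda>x. - f x) \<in> L2 M"
  using L2_cmult[of f M "-1"] by simp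

lemma L2_diff: "f \<in> L2 M \<Longrightarrow> g \<in> L2 M \<Longrightarrow> (\<lambda>x. f x - g x) \<in> L2 M"
  using L2_add[OF _ L2_uminus, of f M g] by simp

lemma L2_mult_bounded:
  assumes "f \<in> L2 M" "h \<in> borel_measurable M" "\<And>x. x \<in> space M \<Longrightarrow> cmod (h x) \<le> 1"
  shows "(\<lambda>x. f x * h x) \<in> L2 M"
proof (rule L2_bound[OF L2_integrable[OF assms(1)]])
  show "AE x in M. (cmod (f x * h x))\<^sup>2 \<le> (cmod (f x))\<^sup>2"
  proof (rule AE_I2)
    fix x assume "x \<in> space M"
    then have "cmod (f x) * cmod (h x) \<le> cmod (f x) * 1" using assms(3) by (intro mult_left_mono) auto
    then show "(cmod (f x * h x))\<^sup>2 \<le> (cmod (f x))\<^sup>2" unfolding norm_mult by (intro power_mono) auto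
  qed
qed (use assms in \<open>auto simp: L2_def\<close>)

lemma L2_cong_AE:
  assumes "f \<in> L2 M" "g \<in> borel_measurable M" "AE x in M. f x = g x" shows "g \<in> L2 M"
  using assms(3) by (intro L2_bound[OF L2_integrable[OF assms(1)] assms(2)]) auto

lemma L2_mult_integrable:
  assumes "f \<in> L2 M" "g \<in> L2 M" shows "integrable M (\<lambda>x. f x * g x)"
  by (rule Bochner_Integration.integrable_bound[where f = "\<lambda>x. (cmod (f x))\<^sup>2 + (cmod (g x))\<^sup>2"])
    (use assms cmod_mult_le in \<open>auto simp: L2_def\<close>)

lemma L2_norm_nonneg [simp]: "L2_norm M f \<ge> 0"
  by (simp add: L2_norm_def)

lemma L2_norm_sq: "(L2_norm M f)\<^sup>2 = (LINT x|M. (cmod (f x))\<^sup>2)"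
  by (simp add: L2_norm_def)

lemma L2_norm_cong_AE:
  assumes "f \<in> borel_measurable M" "g \<in> borel_measurable M" "AE x in M. f x = g x"
  shows "L2_norm M f = L2_norm M g"
  unfolding L2_norm_def using assms(3) by (subst integral_cong_AE[OF _ _ ]) (use assms in auto)

lemma L2_norm_cong: "(\<And>x. x \<in> space M \<Longrightarrow> f x = g x) \<Longrightarrow> L2_norm M f = L2_norm M g"
  unfolding L2_norm_def by (auto intro!: arg_cong[where f = sqrt] Bochner_Integration.integral_cong)

lemma L2_norm_minus_commute: "L2_norm M (\<lambda>x. f x - g x) = L2_norm M (\<lambda>x. g x - f x)"
  by (simp add: L2_norm_def norm_minus_commute)

lemma ennreal_L2_norm_sq:
  "f \<in> L2 M \<Longrightarrow> (\<integral>\<^sup>+x. ennreal ((cmod (f x))\<^sup>2) \<partial>M) = ennreal ((L2_norm M f)\<^sup>2)"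
  unfolding L2_norm_sq by (rule nn_integral_eq_integral) (auto simp: L2_def)

text \<open>The inequality between arithmetic and geometric mean with a free weight
  \<open>c\<close>, integrated and then optimized over \<open>c\<close>.\<close>

lemma Cauchy_Schwarz_L2:
  assumes f: "f \<in> L2 M" and g: "g \<in> L2 M"
  shows "cmod (LINT x|M. f x * g x) \<le> L2_norm M f * L2_norm M g"
proof -
  define X where "X = cmod (LINT x|M. f x * g x)"
  let ?A = "L2_norm M f" and ?B = "L2_norm M g"
  have *: "2 * X \<le> c * ?A\<^sup>2 + ?B\<^sup>2 / c" if c: "c > 0" for c
  proof -
    have "X \<le> (LINT x|M. cmod (f x * g x))" unfolding X_def by (rule integral_norm_bound)
    also have "\<dots> \<le> (LINT x|M. (c * (cmod (f x))\<^sup>2 + (cmod (g x))\<^sup>2 / c) / 2)"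
    proof (rule integral_mono)
      fix x
      have "2 * (sqrt c * cmod (f x)) * (cmod (g x) / sqrt c) \<le> (sqrt c * cmod (f x))\<^sup>2 + (cmod (g x) / sqrt c)\<^sup>2"
        by (rule sum_squares_bound)
      then show "cmod (f x * g x) \<le> (c * (cmod (f x))\<^sup>2 + (cmod (g x))\<^sup>2 / c) / 2"
        using c by (simp add: norm_mult power_mult_distrib power_divide)
    qed (use f g L2_mult_integrable[OF f g] in \<open>auto simp: L2_def\<close>)
    also have "\<dots> = (c * ?A\<^sup>2 + ?B\<^sup>2 / c) / 2"
      using f g by (simp add: L2_norm_sq L2_def)
    finally show ?thesis by simp
  qed
  \<comment> \<open>The optimal weight is the quotient of the norms; adding \<open>e\<close> to both
    keeps it positive and finite when a norm vanishes.\<close>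
  have le: "X \<le> (?A + e) * (?B + e)" if e: "e > 0" for e
  proof -
    have AB: "?A + e > 0" "?B + e > 0" using e by (auto intro: add_nonneg_pos)
    have "2 * X \<le> (?B + e) / (?A + e) * ?A\<^sup>2 + ?B\<^sup>2 / ((?B + e) / (?A + e))" using AB by (intro *) auto
    also have "\<dots> \<le> (?B + e) / (?A + e) * (?A + e)\<^sup>2 + (?B + e)\<^sup>2 / ((?B + e) / (?A + e))"
      using AB e by (intro add_mono mult_left_mono divide_right_mono power_mono) auto
    also have "\<dots> = 2 * ((?A + e) * (?B + e))" using AB by (simp add: power2_eq_square)
    finally show ?thesis by simp
  qed
  have "((\<lambda>e. (?A + e) * (?B + e)) \<longlongrightarrow> (?A + 0) * (?B + 0)) (at_right 0)"
    by (intro tendsto_intros)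
  then have "X \<le> (?A + 0) * (?B + 0)"
    by (rule tendsto_lowerbound) (auto simp: eventually_at_right_less le intro!: eventually_at_rightI[of 0 1])
  then show ?thesis by (simp add: X_def)
qed

lemma borel_measurable_cnj [measurable (raw)]:
  "f \<in> borel_measurable M \<Longrightarrow> (\<lambda>x. cnj (f x)) \<in> borel_measurable M"
  by (rule borel_measurable_continuous_on[OF continuous_on_cnj[OF continuous_on_id]])

lemma L2_cnj: "f \<in> L2 M \<Longrightarrow> (\<lambda>x. cnj (f x)) \<in> L2 M"
  by (auto simp: L2_def borel_measurable_cnj)

lemma L2_norm_triangle:
  assumes f: "f \<in> L2 M" and g: "g \<in> L2 M"
  shows "L2_norm M (\<lambda>x. f x + g x) \<le> L2_norm M f + L2_norm M g"
proof -
  have cg: "(\<lambda>x. cnj (g x)) \<in> L2 M" using g by (rule L2_cnj)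
  have ng: "L2_norm M (\<lambda>x. cnj (g x)) = L2_norm M g" by (simp add: L2_norm_def)
  note i = L2_mult_integrable[OF f cg]
  have sq: "(cmod (f x + g x))\<^sup>2 = (cmod (f x))\<^sup>2 + (cmod (g x))\<^sup>2 + 2 * Re (f x * cnj (g x))" for x
    unfolding cmod_power2 by (simp add: power2_eq_square algebra_simps)
  define h where "h x = Re (f x * cnj (g x))" for x
  have h: "integrable M h" unfolding h_def[abs_def] using i by (rule integrable_Re)
  have "(L2_norm M (\<lambda>x. f x + g x))\<^sup>2 = (L2_norm M f)\<^sup>2 + (L2_norm M g)\<^sup>2 + 2 * (LINT x|M. h x)"
    unfolding L2_norm_sq sq h_def[symmetric] using f g h by (simp add: L2_def)
  also have "(LINT x|M. h x) = Re (LINT x|M. f x * cnj (g x))"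
    unfolding h_def using i by (rule integral_Re)
  also have "Re (LINT x|M. f x * cnj (g x)) \<le> L2_norm M f * L2_norm M g"
    using Cauchy_Schwarz_L2[OF f cg] complex_Re_le_cmod order_trans by (fastforce simp: ng)
  finally have "(L2_norm M (\<lambda>x. f x + g x))\<^sup>2 \<le> (L2_norm M f + L2_norm M g)\<^sup>2"
    by (simp add: power2_sum algebra_simps)
  then show ?thesis by (rule power2_le_imp_le) (auto intro: add_nonneg_nonneg)
qed

lemma L2_norm_triangle_diff:
  assumes "f \<in> L2 M" "g \<in> L2 M" "h \<in> L2 M"
  shows "L2_norm M (\<lambda>x. f x - h x) \<le> L2_norm M (\<lambda>x. f x - g x) + L2_norm M (\<lambda>x. g x - h x)"
  using L2_norm_triangle[OF L2_diff[OF assms(1,2)] L2_diff[OF assms(2,3)]] by simp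

lemma L2_mult_tendsto:
  assumes F: "\<And>n. F n \<in> L2 M" and f: "f \<in> L2 M" and h: "h \<in> L2 M"
    and lim: "(\<lambda>n. L2_norm M (\<lambda>x. F n x - f x)) \<longlonglongrightarrow> 0"
  shows "(\<lambda>n. LINT x|M. F n x * h x) \<longlonglongrightarrow> (LINT x|M. f x * h x)"
proof -
  have "cmod ((LINT x|M. F n x * h x) - (LINT x|M. f x * h x)) \<le> L2_norm M (\<lambda>x. F n x - f x) * L2_norm M h" for n
    using Cauchy_Schwarz_L2[OF L2_diff[OF F f] h]
    by (simp add: left_diff_distrib L2_mult_integrable F f h)
  moreover have "(\<lambda>n. L2_norm M (\<lambda>x. F n x - f x) * L2_norm M h) \<longlonglongrightarrow> 0"
    using tendsto_mult_right[OF lim, of "L2_norm M h"] by simp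
  ultimately have "(\<lambda>n. (LINT x|M. F n x * h x) - (LINT x|M. f x * h x)) \<longlonglongrightarrow> 0"
    by (rule Lim_null_comparison[OF always_eventually[OF allI]])
  then show ?thesis by (rule LIM_zero_cancel)
qed

text \<open>The weight is what lets a bound on squares control the terms themselves: it forces
  \<open>d j\<close> below \<open>sqrt C * (1 / sqrt 2) ^ j\<close>.\<close>

lemma norm_summable_if_weighted_squares:
  fixes d :: "nat \<Rightarrow> real"
  assumes "\<And>j. d j \<ge> 0" "\<And>j. 2 ^ j * (d j)\<^sup>2 \<le> C" shows "summable d"
proof (rule summable_comparison_test')
  have C: "C \<ge> 0" using order_trans[OF _ assms(2)[of 0]] by simp
  show "summable (\<lambda>j. sqrt C * (1 / sqrt 2) ^ j)" by (intro summable_mult summable_geometric) simp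
  fix j :: nat
  have "((1 / sqrt 2) ^ j)\<^sup>2 = ((1 / sqrt 2)\<^sup>2) ^ j" by (simp only: power_mult[symmetric] mult.commute)
  then have "((1 / sqrt 2) ^ j)\<^sup>2 = 1 / 2 ^ j" by (simp add: power_divide)
  then have "(sqrt C * (1 / sqrt 2) ^ j)\<^sup>2 = C / 2 ^ j" using C by (simp add: power_mult_distrib)
  moreover have "(d j)\<^sup>2 \<le> C / 2 ^ j" using assms(2)[of j] by (simp add: pos_le_divide_eq mult.commute)
  ultimately have "(d j)\<^sup>2 \<le> (sqrt C * (1 / sqrt 2) ^ j)\<^sup>2" by simp
  then have "d j \<le> sqrt C * (1 / sqrt 2) ^ j" by (rule power2_le_imp_le) (simp add: C)
  then show "norm (d j) \<le> sqrt C * (1 / sqrt 2) ^ j" using assms(1) by simp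
qed

lemma ennreal_finite_ex: "x \<noteq> (\<infinity> :: ennreal) \<Longrightarrow> \<exists>C\<ge>0. x = ennreal C"
  by (cases x) auto

lemma ennreal_le_suminf: "(f j :: ennreal) \<le> (\<Sum>j. f j)"
  using sum_le_suminf[OF summableI, of "{j}" f] by simp

text \<open>Riesz-Fischer: along a subsequence whose steps have norm below \<open>(1/2) ^ j\<close>
  the functions converge almost everywhere, and Fatou's lemma turns the pointwise limit into a limit
  in norm.\<close>

lemma L2_complete:
  assumes F: "\<And>n. F n \<in> L2 M"
    and cauchy: "\<And>e. e > 0 \<Longrightarrow> \<exists>N. \<forall>m\<ge>N. \<forall>n\<ge>N. L2_norm M (\<lambda>x. F m x - F n x) < e"
  obtains g where "g \<in> L2 M" "(\<lambda>n. L2_norm M (\<lambda>x. F n x - g x)) \<longlonglongrightarrow> 0"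
proof -
  have "\<exists>N. \<forall>m\<ge>N. \<forall>n\<ge>N. L2_norm M (\<lambda>x. F m x - F n x) < (1/2) ^ j" for j :: nat
    by (rule cauchy) simp
  then obtain N where N: "\<And>j m n. m \<ge> N j \<Longrightarrow> n \<ge> N j \<Longrightarrow> L2_norm M (\<lambda>x. F m x - F n x) < (1/2) ^ j"
    by metis
  \<comment> \<open>The sum dominates \<open>N j\<close> and makes \<open>r\<close> monotone; the
    extra \<open>j\<close> makes it tend to infinity.\<close>
  define r where "r j = (\<Sum>i\<le>j. N i) + j" for j
  have rN: "r j \<ge> N j" for j unfolding r_def by (simp add: member_le_sum trans_le_add1)
  have rmono: "r j \<le> r (Suc j)" for j unfolding r_def by simp
  have rj: "r j \<ge> j" for j unfolding r_def by simp
  define d where "d j x = cmod (F (r (Suc j)) x - F (r j) x)" for j x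
  have F_meas [measurable]: "F n \<in> borel_measurable M" for n using F L2_measurable by blast
  have d_meas [measurable]: "d j \<in> borel_measurable M" for j unfolding d_def by measurable
  have "(\<integral>\<^sup>+x. (\<Sum>j. ennreal (2 ^ j * (d j x)\<^sup>2)) \<partial>M) = (\<Sum>j. \<integral>\<^sup>+x. ennreal (2 ^ j * (d j x)\<^sup>2) \<partial>M)"
    by (rule nn_integral_suminf) measurable
  \<comment> \<open>The squared norms are below \<open>(1/4) ^ j\<close>, so even with the weight
    \<open>2 ^ j\<close> the integrals stay summable; this leaves room for
    \<open>norm_summable_if_weighted_squares\<close>.\<close>
  also have "\<dots> \<le> (\<Sum>j. ennreal ((1/2) ^ j))"
  proof (rule suminf_le)
    fix j
    have "(\<integral>\<^sup>+x. ennreal (2 ^ j * (d j x)\<^sup>2) \<partial>M) = ennreal (2 ^ j) * (\<integral>\<^sup>+x. ennreal ((d j x)\<^sup>2) \<partial>M)"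
      by (subst nn_integral_cmult[symmetric]) (auto simp: ennreal_mult)
    also have "(\<integral>\<^sup>+x. ennreal ((d j x)\<^sup>2) \<partial>M) = ennreal ((L2_norm M (\<lambda>x. F (r (Suc j)) x - F (r j) x))\<^sup>2)"
      unfolding d_def by (rule ennreal_L2_norm_sq[OF L2_diff[OF F F]])
    also have "\<dots> \<le> ennreal (((1/2) ^ j)\<^sup>2)"
      using N[of j "r (Suc j)" "r j"] rN[of j] rmono[of j]
      by (intro ennreal_leI power_mono) (auto intro: less_imp_le)
    also have "ennreal (2 ^ j) * ennreal (((1/2) ^ j)\<^sup>2) = ennreal ((1/2) ^ j)"
      by (simp add: ennreal_mult[symmetric] power2_eq_square power_mult_distrib[symmetric] mult.assoc[symmetric])
    finally show "(\<integral>\<^sup>+x. ennreal (2 ^ j * (d j x)\<^sup>2) \<partial>M) \<le> ennreal ((1/2) ^ j)"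
      by (simp add: mult_left_mono)
  qed auto
  also have "\<dots> = ennreal (\<Sum>j. (1/2) ^ j)" by (rule suminf_ennreal2) (auto intro: summable_geometric)
  finally have "(\<integral>\<^sup>+x. (\<Sum>j. ennreal (2 ^ j * (d j x)\<^sup>2)) \<partial>M) < \<infinity>" by (rule le_less_trans) simp
  then have "AE x in M. (\<Sum>j. ennreal (2 ^ j * (d j x)\<^sup>2)) \<noteq> \<infinity>"
    by (intro nn_integral_PInf_AE) auto
  then have conv: "AE x in M. convergent (\<lambda>j. F (r j) x)"
  proof eventually_elim
    fix x assume fin: "(\<Sum>j. ennreal (2 ^ j * (d j x)\<^sup>2)) \<noteq> \<infinity>"
    obtain C where C: "(\<Sum>j. ennreal (2 ^ j * (d j x)\<^sup>2)) = ennreal C" "C \<ge> 0"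
      using ennreal_finite_ex[OF fin] by (elim exE conjE)
    have "2 ^ j * (d j x)\<^sup>2 \<le> C" for j
    proof -
      have "ennreal (2 ^ j * (d j x)\<^sup>2) \<le> (\<Sum>j. ennreal (2 ^ j * (d j x)\<^sup>2))"
        by (rule ennreal_le_suminf)
      then have "ennreal (2 ^ j * (d j x)\<^sup>2) \<le> ennreal C" unfolding C(1) .
      then show ?thesis using C(2) by (simp only: ennreal_le_iff)
    qed
    then have "summable (\<lambda>j. d j x)"
      by (intro norm_summable_if_weighted_squares[where C = C]) (auto simp: d_def)
    then have "summable (\<lambda>j. F (r (Suc j)) x - F (r j) x)"
      by (intro summable_norm_cancel[of "\<lambda>j. F (r (Suc j)) x - F (r j) x"]) (simp add: d_def)
    then have "convergent (\<lambda>n. \<Sum>j<n. F (r (Suc j)) x - F (r j) x)" by (simp add: summable_iff_convergent)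
    then have "convergent (\<lambda>n. F (r n) x - F (r 0) x)" by (simp only: sum_lessThan_telescope[of "\<lambda>j. F (r j) x"])
    then show "convergent (\<lambda>j. F (r j) x)"
      using convergent_add[OF _ convergent_const, of "\<lambda>n. F (r n) x - F (r 0) x" "F (r 0) x"] by simp
  qed
  define g where "g x = lim (\<lambda>j. F (r j) x)" for x
  have g_meas [measurable]: "g \<in> borel_measurable M"
    unfolding g_def by (rule borel_measurable_lim_metric) measurable
  have lim: "AE x in M. (\<lambda>j. F (r j) x) \<longlonglongrightarrow> g x"
    using conv by eventually_elim (simp add: g_def convergent_LIMSEQ_iff)
  have bound: "(\<integral>\<^sup>+x. ennreal ((cmod (F n x - g x))\<^sup>2) \<partial>M) \<le> ennreal (((1/2) ^ j)\<^sup>2)" if n: "n \<ge> N j" for n j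
  proof -
    have "(\<integral>\<^sup>+x. ennreal ((cmod (F n x - g x))\<^sup>2) \<partial>M) =
        (\<integral>\<^sup>+x. liminf (\<lambda>i. ennreal ((cmod (F n x - F (r i) x))\<^sup>2)) \<partial>M)"
    proof (rule nn_integral_cong_AE)
      show "AE x in M. ennreal ((cmod (F n x - g x))\<^sup>2) = liminf (\<lambda>i. ennreal ((cmod (F n x - F (r i) x))\<^sup>2))"
        using lim
      proof eventually_elim
        fix x assume "(\<lambda>j. F (r j) x) \<longlonglongrightarrow> g x"
        then have "(\<lambda>i. ennreal ((cmod (F n x - F (r i) x))\<^sup>2)) \<longlonglongrightarrow> ennreal ((cmod (F n x - g x))\<^sup>2)"
          by (intro tendsto_intros)
        then show "ennreal ((cmod (F n x - g x))\<^sup>2) = liminf (\<lambda>i. ennreal ((cmod (F n x - F (r i) x))\<^sup>2))"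
          by (rule lim_imp_Liminf[OF trivial_limit_sequentially, symmetric])
      qed
    qed
    also have "\<dots> \<le> liminf (\<lambda>i. \<integral>\<^sup>+x. ennreal ((cmod (F n x - F (r i) x))\<^sup>2) \<partial>M)"
      by (rule nn_integral_liminf) measurable
    also have "\<dots> = liminf (\<lambda>i. ennreal ((L2_norm M (\<lambda>x. F n x - F (r i) x))\<^sup>2))"
      by (simp add: ennreal_L2_norm_sq L2_diff F)
    also have "\<dots> \<le> ennreal (((1/2) ^ j)\<^sup>2)"
    proof (rule Liminf_le)
      have "ennreal ((L2_norm M (\<lambda>x. F n x - F (r i) x))\<^sup>2) \<le> ennreal (((1/2) ^ j)\<^sup>2)" if i: "i \<ge> N j" for i
      proof -
        have "r i \<ge> N j" using rj[of i] i by linarith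
        then have "L2_norm M (\<lambda>x. F n x - F (r i) x) \<le> (1/2) ^ j" using N[OF n] by (meson less_imp_le)
        then show ?thesis by (intro ennreal_leI power_mono) auto
      qed
      then show "\<forall>\<^sub>F i in sequentially. ennreal ((L2_norm M (\<lambda>x. F n x - F (r i) x))\<^sup>2) \<le> ennreal (((1/2) ^ j)\<^sup>2)"
        unfolding eventually_sequentially by blast
    qed simp
    finally show ?thesis .
  qed
  have diffL2: "(\<lambda>x. F n x - g x) \<in> L2 M" if n: "n \<ge> N j" for n j
  proof -
    have "(\<integral>\<^sup>+x. ennreal ((cmod (F n x - g x))\<^sup>2) \<partial>M) < \<infinity>"
      using bound[OF n] by (rule le_less_trans) simp
    then show ?thesis unfolding L2_def by (auto intro!: integrableI_bounded)
  qed
  have g: "g \<in> L2 M"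
    using L2_diff[OF F[of "N 0"] diffL2[of 0 "N 0"]] by simp
  have "(\<lambda>n. L2_norm M (\<lambda>x. F n x - g x)) \<longlonglongrightarrow> 0"
  proof (rule LIMSEQ_I)
    fix e :: real assume "e > 0"
    then obtain j where j: "(1/2) ^ j < e" using real_arch_pow_inv[of e "1/2"] by auto
    have "L2_norm M (\<lambda>x. F n x - g x) \<le> (1/2) ^ j" if n: "n \<ge> N j" for n
    proof (rule power2_le_imp_le)
      have "ennreal ((L2_norm M (\<lambda>x. F n x - g x))\<^sup>2) \<le> ennreal (((1/2) ^ j)\<^sup>2)"
        using bound[OF n] ennreal_L2_norm_sq[OF diffL2[OF n]] by simp
      then show "(L2_norm M (\<lambda>x. F n x - g x))\<^sup>2 \<le> ((1/2) ^ j)\<^sup>2" by (subst (asm) ennreal_le_iff) auto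
    qed simp
    then show "\<exists>no. \<forall>n\<ge>no. norm (L2_norm M (\<lambda>x. F n x - g x) - 0) < e"
      using j by (auto intro!: exI[of _ "N j"] intro: le_less_trans)
  qed
  with g show thesis by (rule that)
qed

section \<open>Ultrametric rings\<close>

text \<open>Stands outside the locale because the locale's assumptions on the measure are phrased
  with it.\<close>

definition coset_ball :: "('a, 'b) ring_scheme \<Rightarrow> (int \<Rightarrow> 'a set) \<Rightarrow> 'a \<Rightarrow> int \<Rightarrow> 'a set" where
  "coset_ball R B a n = {y \<in> carrier R. y \<ominus>\<^bsub>R\<^esub> a \<in> B n}"

text \<open>Under \<open>ch\<close> the balls \<open>B n\<close> and \<open>B (- n)\<close>
  annihilate each other: \<open>B_mult\<close> with \<open>ch_B0\<close> gives one inclusion,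
  \<open>ch_nontrivial\<close> the other. The summand \<open>ln 2\<close> says that volumes at least
  double from one ball to the next, so that sums over balls compare with geometric series; oddness
  of \<open>\<psi>\<close> makes the volumes of dual balls reciprocal.\<close>

locale ultrametric_ring = cring R for R :: "('a, 'b) ring_scheme" (structure) +
  fixes B :: "int \<Rightarrow> 'a set" and ch :: "'a \<Rightarrow> complex" and \<psi> :: "int \<Rightarrow> real"
    and M :: "'a measure" and D :: "'a set"
  assumes B_subgroup: "additive_subgroup (B n) R"
    and B_mono: "m \<le> n \<Longrightarrow> B m \<subseteq> B n"
    and B_Inter: "x \<in> carrier R \<Longrightarrow> (\<And>n. x \<in> B n) \<Longrightarrow> x = \<zero>"
    and B_Union: "x \<in> carrier R \<Longrightarrow> \<exists>n. x \<in> B n"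
    and B_complete: "(\<And>k. s k \<in> carrier R) \<Longrightarrow> (\<And>n. \<exists>K. \<forall>k\<ge>K. \<forall>l\<ge>K. s k \<ominus> s l \<in> B n) \<Longrightarrow>
      \<exists>z\<in>carrier R. \<forall>n. \<exists>K. \<forall>k\<ge>K. (s :: nat \<Rightarrow> 'a) k \<ominus> z \<in> B n"
    and B_mult: "x \<in> B (- n) \<Longrightarrow> y \<in> B n \<Longrightarrow> x \<otimes> y \<in> B 0"
    and D_countable: "countable D" and D_carrier: "D \<subseteq> carrier R"
    and D_dense: "x \<in> carrier R \<Longrightarrow> \<exists>d\<in>D. x \<ominus> d \<in> B n"
    and ch_add: "x \<in> carrier R \<Longrightarrow> y \<in> carrier R \<Longrightarrow> ch (x \<oplus> y) = ch x * ch y"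
    and ch_norm [simp]: "cmod (ch x) = 1"
    and ch_B0: "x \<in> B 0 \<Longrightarrow> ch x = 1"
    and ch_nontrivial: "x \<in> carrier R \<Longrightarrow> x \<notin> B (- n) \<Longrightarrow> \<exists>y\<in>B n. ch (x \<otimes> y) \<noteq> 1"
    and \<psi>_step: "\<psi> n + ln 2 \<le> \<psi> (n + 1)"
    and \<psi>_minus: "\<psi> (- n) = - \<psi> n"
    and sets_M: "sets M = sigma_sets (carrier R) {coset_ball R B a n | a n. a \<in> carrier R}"
    and emeasure_ball: "a \<in> carrier R \<Longrightarrow> emeasure M (coset_ball R B a n) = ennreal (exp (\<psi> n))"
begin

abbreviation "bl \<equiv> coset_ball R B"

lemma B_carrier: "x \<in> B n \<Longrightarrow> x \<in> carrier R"
  using additive_subgroup.a_subset[OF B_subgroup] by auto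

lemma B_zero [simp]: "\<zero> \<in> B n"
  by (rule additive_subgroup.zero_closed[OF B_subgroup])

lemma B_add: "x \<in> B n \<Longrightarrow> y \<in> B n \<Longrightarrow> x \<oplus> y \<in> B n"
  by (rule additive_subgroup.a_closed[OF B_subgroup])

lemma B_neg: "x \<in> B n \<Longrightarrow> \<ominus> x \<in> B n"
  by (rule additive_subgroup.a_inv_closed[OF B_subgroup])

lemma B_minus: "x \<in> B n \<Longrightarrow> y \<in> B n \<Longrightarrow> x \<ominus> y \<in> B n"
  by (simp add: a_minus_def B_add B_neg)

lemma B_le: "x \<in> B m \<Longrightarrow> m \<le> n \<Longrightarrow> x \<in> B n"
  using B_mono by blast

lemma B_neg_iff: "x \<in> carrier R \<Longrightarrow> \<ominus> x \<in> B n \<longleftrightarrow> x \<in> B n"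
  using B_neg[of x n] B_neg[of "\<ominus> x" n] by auto

lemma bl_iff: "y \<in> bl a n \<longleftrightarrow> y \<in> carrier R \<and> y \<ominus> a \<in> B n"
  by (simp add: coset_ball_def)

lemma bl_carrier: "y \<in> bl a n \<Longrightarrow> y \<in> carrier R"
  by (simp add: bl_iff)

lemma minus_self [simp]: "x \<in> carrier R \<Longrightarrow> x \<ominus> x = \<zero>"
  by (simp add: a_minus_def r_neg)

lemma minus_zero_right [simp]: "x \<in> carrier R \<Longrightarrow> x \<ominus> \<zero> = x"
  by (simp add: a_minus_def)

lemma bl_zero: "bl \<zero> n = B n"
  using B_carrier by (auto simp: bl_iff)

lemma bl_self: "a \<in> carrier R \<Longrightarrow> a \<in> bl a n"
  by (simp add: bl_iff)

lemma bl_sym: assumes "a \<in> carrier R" "b \<in> bl a n" shows "a \<in> bl b n"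
proof -
  have b: "b \<in> carrier R" using assms bl_carrier by blast
  have "a \<ominus> b = \<ominus> (b \<ominus> a)" using assms(1) b by algebra
  then show ?thesis using assms b B_neg by (auto simp: bl_iff)
qed

lemma bl_trans: assumes "a \<in> carrier R" "b \<in> bl a n" "c \<in> bl b n" shows "c \<in> bl a n"
proof -
  have bc: "b \<in> carrier R" "c \<in> carrier R" using assms bl_carrier by blast+
  have "c \<ominus> a = (c \<ominus> b) \<oplus> (b \<ominus> a)" using assms(1) bc by algebra
  then show ?thesis using assms bc B_add by (auto simp: bl_iff)
qed

lemma bl_eq: assumes "a \<in> carrier R" "b \<in> bl a n" shows "bl b n = bl a n"
  using assms bl_sym bl_trans bl_carrier by blast

lemma bl_mono: "m \<le> n \<Longrightarrow> bl a m \<subseteq> bl a n"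
  by (auto simp: bl_iff intro: B_le)

text \<open>Two balls that meet can be given a common centre, and concentric balls are nested. With
  the empty set added, the balls are thus a generator stable under intersection.\<close>

lemma bl_Int:
  assumes "a \<in> carrier R" "b \<in> carrier R"
  shows "bl a m \<inter> bl b n = {} \<or> (\<exists>c\<in>carrier R. bl a m \<inter> bl b n = bl c (min m n))"
proof (cases "bl a m \<inter> bl b n = {}")
  case False
  then obtain c where c: "c \<in> bl a m" "c \<in> bl b n" by blast
  have "bl a m = bl c m" "bl b n = bl c n" using bl_eq assms c by blast+
  moreover have "bl c m \<inter> bl c n = bl c (min m n)"
    using bl_mono[of m n c] bl_mono[of n m c] by (auto simp: min_def)
  ultimately show ?thesis using c bl_carrier by metis
qed simp

lemma bl_add: assumes "x' \<in> bl x n" "y' \<in> bl y n" "x \<in> carrier R" "y \<in> carrier R"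
  shows "x' \<oplus> y' \<in> bl (x \<oplus> y) n"
proof -
  have c: "x' \<in> carrier R" "y' \<in> carrier R" using assms bl_carrier by blast+
  have "(x' \<oplus> y') \<ominus> (x \<oplus> y) = (x' \<ominus> x) \<oplus> (y' \<ominus> y)" using assms(3,4) c by algebra
  then show ?thesis using assms c B_add by (auto simp: bl_iff)
qed

lemma bl_minus: assumes "x' \<in> bl x n" "y' \<in> bl y n" "x \<in> carrier R" "y \<in> carrier R"
  shows "x' \<ominus> y' \<in> bl (x \<ominus> y) n"
proof -
  have c: "x' \<in> carrier R" "y' \<in> carrier R" using assms bl_carrier by blast+
  have "(x' \<ominus> y') \<ominus> (x \<ominus> y) = (x' \<ominus> x) \<ominus> (y' \<ominus> y)" using assms(3,4) c by algebra
  then show ?thesis using assms c B_minus by (auto simp: bl_iff)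
qed

lemma space_M: "space M = carrier R"
proof -
  have "carrier R \<in> sets M" unfolding sets_M by (rule sigma_sets_top)
  moreover have "space M \<in> sigma_sets (carrier R) {bl a n | a n. a \<in> carrier R}"
    using sets.top[of M] unfolding sets_M .
  then have "space M \<subseteq> carrier R"
    by (rule sigma_sets_into_sp[rotated]) (auto simp: bl_iff)
  ultimately show ?thesis using sets.sets_into_space by blast
qed

lemma bl_sets [measurable]: "a \<in> carrier R \<Longrightarrow> bl a n \<in> sets M"
  unfolding sets_M by (rule sigma_sets.Basic) blast

lemma B_sets [measurable]: "B n \<in> sets M"
  using bl_sets[of \<zero> n] by (simp add: bl_zero)

lemma emeasure_B: "emeasure M (B n) = ennreal (exp (\<psi> n))"
  using emeasure_ball[of \<zero> n] by (simp add: bl_zero)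

lemma measure_bl: "a \<in> carrier R \<Longrightarrow> measure M (bl a n) = exp (\<psi> n)"
  by (simp add: measure_def emeasure_ball)

lemma measure_B: "measure M (B n) = exp (\<psi> n)"
  by (simp add: measure_def emeasure_B)

lemma B_UN: "(\<Union>i::nat. B (int i)) = carrier R"
proof (intro equalityI subsetI)
  fix x assume "x \<in> carrier R"
  then obtain n where "x \<in> B n" using B_Union by blast
  then have "x \<in> B (int (nat n))" by (rule B_le) simp
  then show "x \<in> (\<Union>i::nat. B (int i))" by blast
qed (auto intro: B_carrier)

lemma measure_eqI_balls:
  assumes N: "sets N = sets M" and N': "sets N' = sets M"
    and eq: "\<And>a n. a \<in> carrier R \<Longrightarrow> emeasure N (bl a n) = emeasure N' (bl a n)"
    and fin: "\<And>n. emeasure N (B n) \<noteq> \<infinity>"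
  shows "N = N'"
proof -
  let ?E = "insert {} {bl a n | a n. a \<in> carrier R}"
  have s: "sets M = sigma_sets (carrier R) ?E"
    unfolding sets_M by (intro sigma_sets_eqI) (auto intro: sigma_sets.Basic sigma_sets.Empty)
  show ?thesis
  proof (rule measure_eqI_generator_eq[where E = ?E and \<Omega> = "carrier R" and A = "\<lambda>i. B (int i)"])
    show "Int_stable ?E"
    proof (rule Int_stableI)
      fix X Y assume "X \<in> ?E" "Y \<in> ?E"
      then show "X \<inter> Y \<in> ?E" using bl_Int by (elim insertE CollectE exE) (simp, simp, simp, blast)
    qed
    show "?E \<subseteq> Pow (carrier R)" by (auto simp: bl_iff)
    show "range (\<lambda>i. B (int i)) \<subseteq> ?E" using bl_zero by blast
  qed (use assms s B_UN in auto)
qed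

sublocale sigma_finite_measure M
proof
  show "\<exists>A. countable A \<and> A \<subseteq> sets M \<and> \<Union> A = space M \<and> (\<forall>a\<in>A. emeasure M a \<noteq> \<infinity>)"
    by (rule exI[of _ "range (\<lambda>i. B (int i))"]) (auto simp: B_UN space_M emeasure_B)
qed

sublocale pair: pair_sigma_finite M M ..

text \<open>The substitute for continuity: recentred at points of \<open>D\<close>, only countably
  many boxes of balls occur, and the preimage of a set is the union of those boxes that it
  contains.\<close>

lemma locally_constant_pair_measurable:
  assumes sp: "\<And>x y. x \<in> carrier R \<Longrightarrow> y \<in> carrier R \<Longrightarrow> h (x, y) \<in> space N"
    and lc: "\<And>x y. x \<in> carrier R \<Longrightarrow> y \<in> carrier R \<Longrightarrow> \<exists>n. \<forall>x'\<in>bl x n. \<forall>y'\<in>bl y n. h (x', y') = h (x, y)"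
  shows "h \<in> measurable (M \<Otimes>\<^sub>M M) N"
proof (rule measurableI)
  fix z assume "z \<in> space (M \<Otimes>\<^sub>M M)"
  then show "h z \<in> space N" using sp by (cases z) (auto simp: space_pair_measure space_M)
next
  fix A assume "A \<in> sets N"
  let ?J = "{(d, d', n). d \<in> D \<and> d' \<in> D \<and> (\<forall>x\<in>bl d n. \<forall>y\<in>bl d' n. h (x, y) \<in> A)}"
  have "h -` A \<inter> space (M \<Otimes>\<^sub>M M) = (\<Union>(d, d', n)\<in>?J. bl d n \<times> bl d' n)"
  proof (intro equalityI subsetI)
    fix z assume z: "z \<in> h -` A \<inter> space (M \<Otimes>\<^sub>M M)"
    obtain x y where xy: "z = (x, y)" "x \<in> carrier R" "y \<in> carrier R"
      using z by (cases z) (auto simp: space_pair_measure space_M)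
    obtain n where n: "\<forall>x'\<in>bl x n. \<forall>y'\<in>bl y n. h (x', y') = h (x, y)" using lc xy by blast
    obtain d d' where d: "d \<in> D" "x \<ominus> d \<in> B n" "d' \<in> D" "y \<ominus> d' \<in> B n" using D_dense xy by meson
    then have xd: "x \<in> bl d n" "y \<in> bl d' n" using xy by (auto simp: bl_iff)
    have dc: "d \<in> carrier R" "d' \<in> carrier R" using d D_carrier by auto
    have "bl x n = bl d n" "bl y n = bl d' n" using bl_eq xd dc by blast+
    then have "(d, d', n) \<in> ?J" using d n z xy by auto
    then show "z \<in> (\<Union>(d, d', n)\<in>?J. bl d n \<times> bl d' n)" using xd xy by blast
  qed (auto simp: space_pair_measure space_M bl_iff)
  moreover have "countable ?J"
    by (rule countable_subset[of _ "D \<times> D \<times> UNIV"]) (auto intro: D_countable)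
  moreover have "(case i of (d, d', n) \<Rightarrow> bl d n \<times> bl d' n) \<in> sets (M \<Otimes>\<^sub>M M)" if "i \<in> ?J" for i
    using that by (auto intro!: pair_measureI bl_sets D_carrier[THEN subsetD])
  ultimately show "h -` A \<inter> space (M \<Otimes>\<^sub>M M) \<in> sets (M \<Otimes>\<^sub>M M)"
    by (simp only:) (intro sets.countable_UN' image_subsetI)
qed

lemma locally_constant_measurable:
  assumes sp: "\<And>x. x \<in> carrier R \<Longrightarrow> h x \<in> space N"
    and lc: "\<And>x. x \<in> carrier R \<Longrightarrow> \<exists>n. \<forall>x'\<in>bl x n. h x' = h x"
  shows "h \<in> measurable M N"
proof -
  have "(\<lambda>z. h (fst z)) \<in> measurable (M \<Otimes>\<^sub>M M) N"
  proof (rule locally_constant_pair_measurable)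
    fix x y assume "x \<in> carrier R" "y \<in> carrier R"
    then obtain n where "\<forall>x'\<in>bl x n. h x' = h x" using lc by blast
    then show "\<exists>n. \<forall>x'\<in>bl x n. \<forall>y'\<in>bl y n. h (fst (x', y')) = h (fst (x, y))" by auto
  qed (use sp in auto)
  then have "(\<lambda>x. h (fst (x, x))) \<in> measurable M N"
    by (rule measurable_compose[rotated]) measurable
  then show ?thesis by simp
qed

lemma measurable_ballI:
  assumes "\<And>x. x \<in> space N \<Longrightarrow> f x \<in> carrier R"
    and "\<And>a n. a \<in> carrier R \<Longrightarrow> {x \<in> space N. f x \<in> bl a n} \<in> sets N"
  shows "f \<in> measurable N M"
proof (rule measurable_sigma_sets[OF sets_M])
  show "{bl a n |a n. a \<in> carrier R} \<subseteq> Pow (carrier R)" by (auto simp: bl_iff)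
  fix y assume "y \<in> {bl a n |a n. a \<in> carrier R}"
  then obtain a n where y: "y = bl a n" "a \<in> carrier R" by blast
  have "f -` y \<inter> space N = {x \<in> space N. f x \<in> bl a n}" using y by auto
  then show "f -` y \<inter> space N \<in> sets N" using assms(2) y by simp
qed (use assms in auto)

text \<open>Whether \<open>x \<ominus> y\<close> lies in a ball of index \<open>n\<close> does not
  change when \<open>x\<close> and \<open>y\<close> move within balls of index \<open>n\<close>.
  Subtraction comes first because negation and addition are obtained from it.\<close>

lemma measurable_minus_pair: "(\<lambda>z. fst z \<ominus> snd z) \<in> measurable (M \<Otimes>\<^sub>M M) M"
proof (rule measurable_ballI)
  fix a n assume a: "a \<in> carrier R"
  have "(\<lambda>z. fst z \<ominus> snd z \<in> bl a n) \<in> measurable (M \<Otimes>\<^sub>M M) (count_space UNIV)"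
  proof (rule locally_constant_pair_measurable)
    fix x y assume xy: "x \<in> carrier R" "y \<in> carrier R"
    have "x' \<ominus> y' \<in> bl a n \<longleftrightarrow> x \<ominus> y \<in> bl a n" if "x' \<in> bl x n" "y' \<in> bl y n" for x' y'
      using bl_minus[OF that xy] bl_eq[of a "x \<ominus> y" n] bl_trans[OF a] bl_sym xy by (metis minus_closed)
    then show "\<exists>n'. \<forall>x'\<in>bl x n'. \<forall>y'\<in>bl y n'. (fst (x', y') \<ominus> snd (x', y') \<in> bl a n) = (fst (x, y) \<ominus> snd (x, y) \<in> bl a n)"
      by auto
  qed simp
  then show "{x \<in> space (M \<Otimes>\<^sub>M M). fst x \<ominus> snd x \<in> bl a n} \<in> sets (M \<Otimes>\<^sub>M M)" by measurable
qed (auto simp: space_pair_measure space_M)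

lemma measurable_rminus [measurable (raw)]:
  "f \<in> measurable N M \<Longrightarrow> g \<in> measurable N M \<Longrightarrow> (\<lambda>x. f x \<ominus> g x) \<in> measurable N M"
  using measurable_compose[OF measurable_Pair measurable_minus_pair, of f N g] by simp

lemma measurable_rneg [measurable (raw)]:
  assumes "f \<in> measurable N M" shows "(\<lambda>x. \<ominus> f x) \<in> measurable N M"
proof -
  have "(\<lambda>x. \<zero> \<ominus> f x) \<in> measurable N M" using assms by (intro measurable_rminus) (auto simp: space_M)
  moreover have "\<zero> \<ominus> f x = \<ominus> f x" if "x \<in> space N" for x
    using measurable_space[OF assms that] by (simp add: a_minus_def space_M)
  ultimately show ?thesis by (simp cong: measurable_cong)
qed

lemma measurable_rplus [measurable (raw)]:
  assumes f: "f \<in> measurable N M" and g: "g \<in> measurable N M" shows "(\<lambda>x. f x \<oplus> g x) \<in> measurable N M"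
proof -
  have "(\<lambda>x. f x \<ominus> \<ominus> g x) \<in> measurable N M" using assms by measurable
  moreover have "f x \<ominus> \<ominus> g x = f x \<oplus> g x" if "x \<in> space N" for x
    using measurable_space[OF f that] measurable_space[OF g that] by (simp add: a_minus_def space_M)
  ultimately show ?thesis by (simp cong: measurable_cong)
qed

lemma measurable_const_carrier: "a \<in> carrier R \<Longrightarrow> (\<lambda>x. a) \<in> measurable N M"
  by (simp add: space_M)

lemma B_nonneg_mult:
  assumes "x \<in> B n" "h \<in> B (- n)" shows "h \<otimes> x \<in> B 0" "x \<otimes> h \<in> B 0"
  using assms B_mult[of h n x] B_carrier m_comm by metis+

text \<open>If both factors lie in \<open>B n\<close>, moving them by elements of
  \<open>B (- n)\<close> changes the product by an element of \<open>B 0\<close>, on which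
  \<open>ch\<close> is trivial. The map is therefore locally constant.\<close>

lemma ch_mult_pair_measurable: "(\<lambda>z. ch (fst z \<otimes> snd z)) \<in> borel_measurable (M \<Otimes>\<^sub>M M)"
proof (rule locally_constant_pair_measurable)
  fix x y assume x: "x \<in> carrier R" and y: "y \<in> carrier R"
  obtain i j where ij: "x \<in> B i" "y \<in> B j" using B_Union x y by meson
  \<comment> \<open>Taking \<open>n\<close> nonnegative puts \<open>B (- n)\<close> inside
    \<open>B n\<close>, which handles the product of the two perturbations.\<close>
  define n where "n = max 0 (max i j)"
  have xy: "x \<in> B n" "y \<in> B n" using ij by (auto intro: B_le simp: n_def)
  have "ch (x' \<otimes> y') = ch (x \<otimes> y)" if x': "x' \<in> bl x (- n)" and y': "y' \<in> bl y (- n)" for x' y'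
  proof -
    have c: "x' \<in> carrier R" "y' \<in> carrier R" using x' y' bl_carrier by blast+
    have h: "x' \<ominus> x \<in> B (- n)" "y' \<ominus> y \<in> B (- n)" using x' y' by (auto simp: bl_iff)
    have "x' \<otimes> y' = (x \<otimes> y) \<oplus> ((x' \<ominus> x) \<otimes> y \<oplus> x \<otimes> (y' \<ominus> y) \<oplus> (x' \<ominus> x) \<otimes> (y' \<ominus> y))"
      using x y c by algebra
    moreover have "y' \<ominus> y \<in> B n" using h(2) by (rule B_le) (simp add: n_def)
    then have "(x' \<ominus> x) \<otimes> y \<oplus> x \<otimes> (y' \<ominus> y) \<oplus> (x' \<ominus> x) \<otimes> (y' \<ominus> y) \<in> B 0"
      using xy h by (intro B_add B_nonneg_mult(1)[OF _ h(1)] B_nonneg_mult(2)[OF _ h(2)])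
    ultimately show ?thesis
      using x y c B_carrier by (simp add: ch_add ch_B0)
  qed
  then show "\<exists>n. \<forall>x'\<in>bl x n. \<forall>y'\<in>bl y n. ch (fst (x', y') \<otimes> snd (x', y')) = ch (fst (x, y) \<otimes> snd (x, y))"
    by auto
qed simp

lemma measurable_ch_mult [measurable (raw)]:
  "f \<in> measurable N M \<Longrightarrow> g \<in> measurable N M \<Longrightarrow> (\<lambda>x. ch (f x \<otimes> g x)) \<in> borel_measurable N"
  using measurable_compose[OF measurable_Pair ch_mult_pair_measurable, of f N g] by simp

lemma ch_zero: "ch \<zero> = 1"
  by (simp add: ch_B0)

lemma ch_neg: assumes "x \<in> carrier R" shows "ch (\<ominus> x) = cnj (ch x)"
proof -
  have "ch x * ch (\<ominus> x) = 1" using assms by (simp add: ch_add[symmetric] r_neg ch_zero)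
  moreover have "ch x * cnj (ch x) = 1" by (simp add: complex_norm_square[symmetric])
  ultimately have "ch x * ch (\<ominus> x) = ch x * cnj (ch x)" by simp
  moreover have "ch x \<noteq> 0" using ch_norm[of x] by (metis norm_zero zero_neq_one)
  ultimately show ?thesis by simp
qed

text \<open>This reflection pulls balls back to balls of the same index. Negation is the case
  \<open>a = \<zero>\<close>, and composing with it yields the translations.\<close>

lemma distr_minus_from: assumes a: "a \<in> carrier R" shows "distr M M (\<lambda>x. a \<ominus> x) = M"
proof -
  have m: "(\<lambda>x. a \<ominus> x) \<in> measurable M M" using a by (intro measurable_rminus) (auto simp: space_M)
  have v: "(\<lambda>x. a \<ominus> x) -` bl b n \<inter> space M = bl (a \<ominus> b) n" if b: "b \<in> carrier R" for b n
  proof -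
    have "a \<ominus> x \<ominus> b = \<ominus> (x \<ominus> (a \<ominus> b))" if "x \<in> carrier R" for x using a b that by algebra
    then show ?thesis using a b by (auto simp: bl_iff space_M B_neg_iff)
  qed
  have e: "emeasure (distr M M (\<lambda>x. a \<ominus> x)) (bl b n) = emeasure M (bl b n)" if "b \<in> carrier R" for b n
    using that a m by (simp add: emeasure_distr v emeasure_ball)
  show ?thesis
    by (rule measure_eqI_balls) (use e e[of \<zero>] in \<open>auto simp: bl_zero emeasure_B\<close>)
qed

lemma distr_neg: "distr M M (\<lambda>x. \<ominus> x) = M"
proof -
  have "distr M M (\<lambda>x. \<ominus> x) = distr M M (\<lambda>x. \<zero> \<ominus> x)"
    by (rule distr_cong) (auto simp: space_M a_minus_def)
  then show ?thesis using distr_minus_from[of \<zero>] by simp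
qed

lemma distr_add: assumes a: "a \<in> carrier R" shows "distr M M (\<lambda>x. x \<oplus> a) = M"
proof -
  have m: "(\<lambda>x. a \<ominus> x) \<in> measurable M M" using a by (intro measurable_rminus) (auto simp: space_M)
  have "distr (distr M M (\<lambda>x. \<ominus> x)) M (\<lambda>x. a \<ominus> x) = distr M M ((\<lambda>x. a \<ominus> x) \<circ> (\<lambda>x. \<ominus> x))"
    by (rule distr_distr[OF m]) simp
  also have "\<dots> = distr M M (\<lambda>x. x \<oplus> a)"
    using a by (intro distr_cong) (auto simp: space_M a_minus_def a_comm)
  finally show ?thesis by (simp add: distr_neg distr_minus_from[OF a])
qed

lemma measurable_radd: "a \<in> carrier R \<Longrightarrow> (\<lambda>x. x \<oplus> a) \<in> measurable M M"
  by (intro measurable_rplus measurable_const_carrier measurable_ident_sets) auto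

lemma measurable_rsub: "a \<in> carrier R \<Longrightarrow> (\<lambda>x. a \<ominus> x) \<in> measurable M M"
  by (intro measurable_rminus measurable_const_carrier measurable_ident_sets) auto

lemma integral_neg:
  fixes f :: "'a \<Rightarrow> complex"
  assumes "f \<in> borel_measurable M" shows "(LINT x|M. f (\<ominus> x)) = (LINT x|M. f x)"
  using integral_distr[of "\<lambda>x. \<ominus> x" M M f] assms by (simp add: distr_neg)

lemma integral_add:
  fixes f :: "'a \<Rightarrow> complex"
  assumes "a \<in> carrier R" "f \<in> borel_measurable M" shows "(LINT x|M. f (x \<oplus> a)) = (LINT x|M. f x)"
  using integral_distr[OF measurable_radd[OF assms(1)] assms(2)] assms by (simp add: distr_add)

lemma integrable_neg_iff:
  fixes f :: "'a \<Rightarrow> 'c::{banach, second_countable_topology}"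
  assumes "f \<in> borel_measurable M" shows "integrable M (\<lambda>x. f (\<ominus> x)) \<longleftrightarrow> integrable M f"
  using integrable_distr_eq[of "\<lambda>x. \<ominus> x" M M f] assms by (simp add: distr_neg)

lemma \<psi>_strict: assumes "m < n" shows "\<psi> m < \<psi> n"
proof -
  have "\<psi> m + ln 2 \<le> \<psi> n" using assms
  proof (induction n rule: int_gr_induct)
    case (step i)
    then show ?case using \<psi>_step[of i] ln_gt_zero[of "2::real"] by linarith
  qed (rule \<psi>_step)
  then show ?thesis using ln_gt_zero[of "2::real"] by linarith
qed

lemma \<psi>_0: "\<psi> 0 = 0"
  using \<psi>_minus[of 0] by simp

lemma \<psi>_ge: "\<psi> (int n) \<ge> real n * ln 2"
proof (induction n)
  case (Suc n)
  then show ?case using \<psi>_step[of "int n"] by (simp add: algebra_simps)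
qed (simp add: \<psi>_0)

end

section \<open>The Fourier transform\<close>

context ultrametric_ring
begin

definition ft :: "('a \<Rightarrow> complex) \<Rightarrow> 'a \<Rightarrow> complex" where
  "ft f \<xi> = (LINT x|M. f x * ch (\<xi> \<otimes> x))"

text \<open>A modulated ball indicator. Up to a positive factor its transform is the indicator of a
  translated ball, and it is itself the transform of such an indicator, so Fourier inversion is
  explicit on these functions.\<close>

definition wave :: "'a \<Rightarrow> int \<Rightarrow> 'a \<Rightarrow> complex" where
  "wave a n \<xi> = indicator (B n) \<xi> * ch (\<ominus> a \<otimes> \<xi>)"

lemma ch_mult_measurable: "\<xi> \<in> carrier R \<Longrightarrow> (\<lambda>x. ch (\<xi> \<otimes> x)) \<in> borel_measurable M"
  by (intro measurable_ch_mult measurable_const_carrier measurable_ident_sets) auto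

lemma integrable_ch_mult:
  assumes f: "integrable M f" and \<xi>: "\<xi> \<in> carrier R"
  shows "integrable M (\<lambda>x. f x * ch (\<xi> \<otimes> x))"
  by (rule Bochner_Integration.integrable_bound[OF f])
    (use f ch_mult_measurable[OF \<xi>] in \<open>auto simp: norm_mult\<close>)

lemma ft_measurable: assumes f [measurable]: "f \<in> borel_measurable M" shows "ft f \<in> borel_measurable M"
proof -
  have "(\<lambda>z. f (snd z) * ch (fst z \<otimes> snd z)) \<in> borel_measurable (M \<Otimes>\<^sub>M M)" by measurable
  then show ?thesis
    unfolding ft_def[abs_def] by (intro borel_measurable_lebesgue_integral) (simp add: split_beta')
qed

lemma ft_bound: "cmod (ft f \<xi>) \<le> (LINT x|M. cmod (f x))"
  unfolding ft_def using integral_norm_bound[of M "\<lambda>x. f x * ch (\<xi> \<otimes> x)"] by (simp add: norm_mult)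

lemma ft_diff:
  assumes "integrable M f" "integrable M g" "\<xi> \<in> carrier R"
  shows "ft (\<lambda>x. f x - g x) \<xi> = ft f \<xi> - ft g \<xi>"
  using assms by (simp add: ft_def left_diff_distrib integrable_ch_mult)

text \<open>Fubini for \<open>F x * G \<xi> * ch (\<xi> \<otimes> x)\<close>, whose absolute value
  is a product of integrable functions. It moves the transform from one factor to the other, the
  weak form on which the L2 theory rests.\<close>

lemma ft_multiplication_formula:
  assumes F: "integrable M F" and G: "integrable M G"
  shows "(LINT \<xi>|M. ft F \<xi> * G \<xi>) = (LINT x|M. F x * ft G x)"
proof -
  define h where "h = (\<lambda>x \<xi>. F x * G \<xi> * ch (\<xi> \<otimes> x))"
  have [measurable]: "F \<in> borel_measurable M" "G \<in> borel_measurable M" using F G by auto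
  have "integrable (M \<Otimes>\<^sub>M M) (\<lambda>z. h (fst z) (snd z))"
  proof (rule pair.Fubini_integrable)
    show "(\<lambda>z. h (fst z) (snd z)) \<in> borel_measurable (M \<Otimes>\<^sub>M M)" unfolding h_def by measurable
    show "integrable M (\<lambda>x. LINT y|M. norm (h (fst (x, y)) (snd (x, y))))"
      using F by (simp add: h_def norm_mult)
    show "AE x in M. integrable M (\<lambda>y. h (fst (x, y)) (snd (x, y)))"
    proof (rule AE_I2)
      fix x assume "x \<in> space M"
      then have "integrable M (\<lambda>\<xi>. F x * (G \<xi> * ch (x \<otimes> \<xi>)))"
        using integrable_ch_mult[OF G, of x] by (intro integrable_mult_right) (auto simp: space_M)
      moreover have "integrable M (\<lambda>y. h (fst (x, y)) (snd (x, y))) \<longleftrightarrow> integrable M (\<lambda>\<xi>. F x * (G \<xi> * ch (x \<otimes> \<xi>)))"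
        using \<open>x \<in> space M\<close>
        by (intro Bochner_Integration.integrable_cong[OF refl]) (simp add: h_def mult.assoc space_M m_comm)
      ultimately show "integrable M (\<lambda>y. h (fst (x, y)) (snd (x, y)))" by simp
    qed
  qed
  then have "integrable (M \<Otimes>\<^sub>M M) (case_prod h)" by (simp add: split_beta')
  then have eq: "(LINT \<xi>|M. LINT x|M. h x \<xi>) = (LINT x|M. LINT \<xi>|M. h x \<xi>)"
    by (rule pair.Fubini_integral)
  have "(LINT \<xi>|M. ft F \<xi> * G \<xi>) = (LINT \<xi>|M. LINT x|M. h x \<xi>)"
  proof (rule Bochner_Integration.integral_cong[OF refl])
    fix \<xi> assume "\<xi> \<in> space M"
    have "(LINT x|M. h x \<xi>) = (LINT x|M. (F x * ch (\<xi> \<otimes> x)) * G \<xi>)"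
      by (simp add: h_def ac_simps)
    then show "ft F \<xi> * G \<xi> = (LINT x|M. h x \<xi>)" by (simp add: ft_def)
  qed
  also note eq
  also have "(LINT x|M. LINT \<xi>|M. h x \<xi>) = (LINT x|M. F x * ft G x)"
  proof (rule Bochner_Integration.integral_cong[OF refl])
    fix x assume x: "x \<in> space M"
    have "(LINT \<xi>|M. h x \<xi>) = (LINT \<xi>|M. F x * (G \<xi> * ch (x \<otimes> \<xi>)))"
      using x by (intro Bochner_Integration.integral_cong[OF refl]) (simp add: h_def space_M m_comm ac_simps)
    then show "(LINT \<xi>|M. h x \<xi>) = F x * ft G x" by (simp add: ft_def)
  qed
  finally show ?thesis .
qed

lemma bounded_on_finite_L1_L2:
  assumes "A \<in> sets M" "emeasure M A < \<infinity>" "h \<in> borel_measurable M"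
    "\<And>x. x \<in> carrier R \<Longrightarrow> cmod (h x) \<le> c * indicator A x"
  shows "integrable M h" "h \<in> L2 M"
proof -
  have i: "integrable M (\<lambda>x. indicator A x :: real)" using assms by simp
  show "integrable M h"
    by (rule Bochner_Integration.integrable_bound[where f = "\<lambda>x. c * indicator A x"])
      (use i assms in \<open>auto simp: space_M intro!: AE_I2 order_trans[OF assms(4)]\<close>)
  show "h \<in> L2 M"
  proof (rule L2_bound[where h = "\<lambda>x. c\<^sup>2 * indicator A x"])
    show "AE x in M. (cmod (h x))\<^sup>2 \<le> c\<^sup>2 * indicator A x"
    proof (rule AE_I2)
      fix x assume "x \<in> space M"
      then have "(cmod (h x))\<^sup>2 \<le> (c * indicator A x)\<^sup>2" using assms(4) by (intro power_mono) (auto simp: space_M)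
      also have "\<dots> = c\<^sup>2 * indicator A x" by (simp add: power_mult_distrib indicator_def)
      finally show "(cmod (h x))\<^sup>2 \<le> c\<^sup>2 * indicator A x" .
    qed
  qed (use i assms in auto)
qed

lemma ind_bl_L1_L2:
  assumes "a \<in> carrier R"
  shows "integrable M (indicator (bl a n) :: 'a \<Rightarrow> complex)" "(indicator (bl a n) :: 'a \<Rightarrow> complex) \<in> L2 M"
proof -
  have *: "(indicator (bl a n) :: 'a \<Rightarrow> complex) \<in> borel_measurable M" using assms by measurable
  show "integrable M (indicator (bl a n) :: 'a \<Rightarrow> complex)" "(indicator (bl a n) :: 'a \<Rightarrow> complex) \<in> L2 M"
    by (rule bounded_on_finite_L1_L2[of "bl a n" _ 1]; use * assms in \<open>auto simp: emeasure_ball split: split_indicator\<close>)+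
qed

lemma wave_L1_L2:
  assumes a: "a \<in> carrier R" shows "integrable M (wave a n)" "wave a n \<in> L2 M"
proof -
  have "(\<lambda>\<xi>. ch (\<ominus> a \<otimes> \<xi>)) \<in> borel_measurable M" using a by (intro ch_mult_measurable) simp
  then have *: "wave a n \<in> borel_measurable M" unfolding wave_def[abs_def] by measurable
  show "integrable M (wave a n)" "wave a n \<in> L2 M"
    by (rule bounded_on_finite_L1_L2[of "B n" _ 1]; use * in \<open>auto simp: emeasure_B wave_def norm_mult split: split_indicator\<close>)+
qed

text \<open>Orthogonality of characters: for \<open>\<xi>\<close> in \<open>B (- n)\<close> the
  character is 1 on \<open>B n\<close>; otherwise translation by some \<open>y\<close> in
  \<open>B n\<close> multiplies the integral by a number other than 1, so it vanishes.\<close>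

lemma integral_ch_ball:
  assumes \<xi>: "\<xi> \<in> carrier R"
  shows "(LINT x|M. indicator (B n) x * ch (\<xi> \<otimes> x)) = complex_of_real (exp (\<psi> n)) * indicator (B (- n)) \<xi>"
proof (cases "\<xi> \<in> B (- n)")
  case True
  have "(LINT x|M. indicator (B n) x * ch (\<xi> \<otimes> x)) = (LINT x|M. indicator (B n) x :: complex)"
    using True by (intro Bochner_Integration.integral_cong) (auto simp: ch_B0 B_mult split: split_indicator)
  also have "\<dots> = (LINT x|M. complex_of_real (indicator (B n) x))"
    by (intro Bochner_Integration.integral_cong) (auto split: split_indicator)
  also have "\<dots> = exp (\<psi> n)"
    by (simp add: measure_B sets.Int_space_eq2)
  finally show ?thesis using True by simp
next
  case False
  obtain y where y: "y \<in> B n" "ch (\<xi> \<otimes> y) \<noteq> 1" using ch_nontrivial[OF \<xi> False] by blast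
  have yc: "y \<in> carrier R" using y B_carrier by blast
  let ?f = "\<lambda>x. indicator (B n) x * ch (\<xi> \<otimes> x)"
  have fm: "?f \<in> borel_measurable M"
    using ch_mult_measurable[OF \<xi>] by (intro borel_measurable_times borel_measurable_indicator) auto
  have "(LINT x|M. ?f x) = (LINT x|M. ?f (x \<oplus> y))" using integral_add[OF yc fm] by simp
  also have "\<dots> = (LINT x|M. ch (\<xi> \<otimes> y) * ?f x)"
  proof (rule Bochner_Integration.integral_cong[OF refl])
    fix x assume "x \<in> space M"
    then have x: "x \<in> carrier R" by (simp add: space_M)
    have "x \<oplus> y \<ominus> y = x" using x yc by algebra
    then have "x \<oplus> y \<in> B n \<longleftrightarrow> x \<in> B n" using B_add[of x n y] B_minus[of "x \<oplus> y" n y] y by auto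
    then show "?f (x \<oplus> y) = ch (\<xi> \<otimes> y) * ?f x"
      using x yc \<xi> by (simp add: r_distr ch_add indicator_def)
  qed
  also have "\<dots> = ch (\<xi> \<otimes> y) * (LINT x|M. ?f x)" by simp
  finally have "(1 - ch (\<xi> \<otimes> y)) * (LINT x|M. ?f x) = 0" by (simp add: left_diff_distrib)
  then show ?thesis using y False by simp
qed

lemma ft_wave:
  assumes a: "a \<in> carrier R" and x: "x \<in> carrier R"
  shows "ft (wave a n) x = complex_of_real (exp (\<psi> n)) * indicator (B (- n)) (x \<ominus> a)"
proof -
  have "ft (wave a n) x = (LINT \<xi>|M. indicator (B n) \<xi> * ch ((x \<ominus> a) \<otimes> \<xi>))"
    unfolding ft_def
  proof (rule Bochner_Integration.integral_cong[OF refl])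
    fix \<xi> assume "\<xi> \<in> space M"
    then have \<xi>: "\<xi> \<in> carrier R" by (simp add: space_M)
    have "(x \<ominus> a) \<otimes> \<xi> = \<ominus> a \<otimes> \<xi> \<oplus> x \<otimes> \<xi>" using a x \<xi> by algebra
    then show "wave a n \<xi> * ch (x \<otimes> \<xi>) = indicator (B n) \<xi> * ch ((x \<ominus> a) \<otimes> \<xi>)"
      using a x \<xi> by (simp add: wave_def ch_add)
  qed
  then show ?thesis using integral_ch_ball[of "x \<ominus> a" n] a x by simp
qed

lemma ft_ind_bl:
  assumes a: "a \<in> carrier R" and \<xi>: "\<xi> \<in> carrier R"
  shows "ft (indicator (bl a n)) \<xi> = complex_of_real (exp (\<psi> n)) * wave (\<ominus> a) (- n) \<xi>"
proof -
  let ?f = "\<lambda>x. indicator (bl a n) x * ch (\<xi> \<otimes> x)"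
  have fm: "?f \<in> borel_measurable M"
    using ch_mult_measurable[OF \<xi>] bl_sets[OF a] by (intro borel_measurable_times borel_measurable_indicator) auto
  have "ft (indicator (bl a n)) \<xi> = (LINT x|M. ?f (x \<oplus> a))"
    using integral_add[OF a fm] by (simp add: ft_def)
  also have "\<dots> = (LINT x|M. (indicator (B n) x * ch (\<xi> \<otimes> x)) * ch (\<xi> \<otimes> a))"
  proof (rule Bochner_Integration.integral_cong[OF refl])
    fix x assume "x \<in> space M"
    then have x: "x \<in> carrier R" by (simp add: space_M)
    have "x \<oplus> a \<ominus> a = x" using x a by algebra
    then have "x \<oplus> a \<in> bl a n \<longleftrightarrow> x \<in> B n" using x a by (simp add: bl_iff)
    then show "?f (x \<oplus> a) = (indicator (B n) x * ch (\<xi> \<otimes> x)) * ch (\<xi> \<otimes> a)"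
      using x a \<xi> by (simp add: r_distr ch_add indicator_def)
  qed
  also have "\<dots> = complex_of_real (exp (\<psi> n)) * indicator (B (- n)) \<xi> * ch (\<xi> \<otimes> a)"
    using integral_ch_ball[OF \<xi>] by simp
  finally show ?thesis using a \<xi> by (simp add: wave_def m_comm)
qed

lemma nn_integral_ball_kernel:
  assumes "x \<in> carrier R" shows "(\<integral>\<^sup>+y. indicator (B n) (y \<ominus> x) \<partial>M) = ennreal (exp (\<psi> n))"
proof -
  have "(\<integral>\<^sup>+y. indicator (B n) (y \<ominus> x) \<partial>M) = (\<integral>\<^sup>+y. indicator (bl x n) y \<partial>M)"
    by (intro nn_integral_cong) (auto simp: bl_iff space_M split: split_indicator)
  then show ?thesis using assms by (simp add: emeasure_ball)
qed

lemma ind_B_swap: "x \<in> carrier R \<Longrightarrow> y \<in> carrier R \<Longrightarrow> indicator (B n) (y \<ominus> x) = indicator (B n) (x \<ominus> y)"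
proof -
  assume xy: "x \<in> carrier R" "y \<in> carrier R"
  have "x \<ominus> y = \<ominus> (y \<ominus> x)" using xy by algebra
  then show ?thesis using xy B_neg_iff[of "y \<ominus> x" n] by (simp add: indicator_def)
qed

text \<open>With \<open>V = exp (\<psi> n)\<close>, the integral of \<open>\<bar>ft F\<bar>\<^sup>2\<close> over \<open>B n\<close> is the double integral of
  \<open>V F(x) cnj F(y)\<close> over \<open>x - y \<in> B (- n)\<close>; estimate the product by half the sum of the squares.\<close>

lemma ft_ball_bessel:
  assumes F: "F \<in> L2 M" "integrable M F"
  shows "(\<integral>\<^sup>+\<xi>. ennreal (indicator (B n) \<xi> * (cmod (ft F \<xi>))\<^sup>2) \<partial>M) \<le> (\<integral>\<^sup>+x. ennreal ((cmod (F x))\<^sup>2) \<partial>M)"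
proof -
  define V where "V = exp (\<psi> n)"
  have V: "V > 0" "V * exp (\<psi> (- n)) = 1" by (simp_all add: V_def \<psi>_minus exp_minus)
  have Fm [measurable]: "F \<in> borel_measurable M" using F by auto
  have ftm [measurable]: "ft F \<in> borel_measurable M" by (rule ft_measurable) simp
  define C where "C = (LINT x|M. cmod (F x))"
  \<comment> \<open>Chosen so that integrating \<open>ft F * G\<close> gives the quantity to be
    bounded; it is integrable because \<open>ft F\<close> is bounded and the ball has finite
    volume.\<close>
  define G where "G \<xi> = indicator (B n) \<xi> * cnj (ft F \<xi>)" for \<xi>
  have Gm [measurable]: "G \<in> borel_measurable M" unfolding G_def[abs_def] by measurable
  have G: "integrable M G"
  proof (rule bounded_on_finite_L1_L2(1)[OF B_sets[of n] _ Gm, of C])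
    show "emeasure M (B n) < \<infinity>" by (simp add: emeasure_B)
    show "cmod (G x) \<le> C * indicator (B n) x" for x
      using ft_bound[of F x] by (simp add: G_def C_def norm_mult indicator_def)
  qed
  \<comment> \<open>Up to conjugation the transform of \<open>G\<close> at \<open>x\<close> pairs
    \<open>ft F\<close> with \<open>wave x n\<close>; the multiplication formula replaces this by
    averaging \<open>F\<close> over the ball of index \<open>- n\<close> around
    \<open>x\<close>.\<close>
  have ftG: "cmod (ft G x) \<le> (LINT y|M. V * indicator (B (- n)) (y \<ominus> x) * cmod (F y))" if x: "x \<in> carrier R" for x
  proof -
    have "ft G x = (LINT \<xi>|M. cnj (ft F \<xi> * wave x n \<xi>))"
      unfolding ft_def[of G]
    proof (rule Bochner_Integration.integral_cong[OF refl])
      fix \<xi> assume "\<xi> \<in> space M"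
      then have \<xi>: "\<xi> \<in> carrier R" by (simp add: space_M)
      have "\<ominus> x \<otimes> \<xi> = \<ominus> (x \<otimes> \<xi>)" using x \<xi> by algebra
      then show "G \<xi> * ch (x \<otimes> \<xi>) = cnj (ft F \<xi> * wave x n \<xi>)"
        using x \<xi> by (simp add: G_def wave_def ch_neg indicator_def)
    qed
    then have "ft G x = cnj (LINT \<xi>|M. ft F \<xi> * wave x n \<xi>)" by (simp only: Bochner_Integration.integral_cnj)
    then have "cmod (ft G x) = cmod (LINT \<xi>|M. ft F \<xi> * wave x n \<xi>)" by simp
    also have "(LINT \<xi>|M. ft F \<xi> * wave x n \<xi>) = (LINT y|M. F y * ft (wave x n) y)"
      by (rule ft_multiplication_formula[OF F(2) wave_L1_L2(1)[OF x]])
    also have "cmod \<dots> \<le> (LINT y|M. cmod (F y * ft (wave x n) y))" by (rule integral_norm_bound)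
    also have "\<dots> = (LINT y|M. V * indicator (B (- n)) (y \<ominus> x) * cmod (F y))"
      using x by (intro Bochner_Integration.integral_cong[OF refl])
        (auto simp: ft_wave space_M norm_mult V_def indicator_def)
    finally show ?thesis .
  qed
  let ?k = "\<lambda>x y. indicator (B (- n)) (y \<ominus> x) :: real"
  let ?S = "\<integral>\<^sup>+x. ennreal ((cmod (F x))\<^sup>2) \<partial>M"
  have k_int: "(\<integral>\<^sup>+y. ennreal (V * ?k x y) \<partial>M) = 1" if x: "x \<in> carrier R" for x
  proof -
    have [measurable]: "(\<lambda>y. y \<ominus> x) \<in> measurable M M"
      using x by (intro measurable_rminus measurable_const_carrier measurable_ident_sets) auto
    have "(\<integral>\<^sup>+y. ennreal (V * ?k x y) \<partial>M) = (\<integral>\<^sup>+y. ennreal V * indicator (B (- n)) (y \<ominus> x) \<partial>M)"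
      using V by (intro nn_integral_cong) (auto split: split_indicator)
    also have "\<dots> = ennreal V * (\<integral>\<^sup>+y. indicator (B (- n)) (y \<ominus> x) \<partial>M)" by (rule nn_integral_cmult) measurable
    finally show ?thesis using V by (simp add: nn_integral_ball_kernel[OF x] ennreal_mult[symmetric])
  qed
  have I1: "(\<integral>\<^sup>+x. \<integral>\<^sup>+y. ennreal (V * ?k x y * (cmod (F x))\<^sup>2 / 2) \<partial>M \<partial>M) = ?S / 2"
  proof -
    have "(\<integral>\<^sup>+x. \<integral>\<^sup>+y. ennreal (V * ?k x y * (cmod (F x))\<^sup>2 / 2) \<partial>M \<partial>M) = (\<integral>\<^sup>+x. ennreal ((cmod (F x))\<^sup>2) / 2 \<partial>M)"
    proof (rule nn_integral_cong)
      fix x assume "x \<in> space M"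
      then have x: "x \<in> carrier R" by (simp add: space_M)
      have [measurable]: "(\<lambda>y. y \<ominus> x) \<in> measurable M M"
        using x by (intro measurable_rminus measurable_const_carrier measurable_ident_sets) auto
      have "(\<integral>\<^sup>+y. ennreal (V * ?k x y * (cmod (F x))\<^sup>2 / 2) \<partial>M) =
          (\<integral>\<^sup>+y. ennreal ((cmod (F x))\<^sup>2 / 2) * ennreal (V * ?k x y) \<partial>M)"
        using V by (intro nn_integral_cong) (simp add: ennreal_mult[symmetric] ac_simps)
      also have "\<dots> = ennreal ((cmod (F x))\<^sup>2 / 2) * (\<integral>\<^sup>+y. ennreal (V * ?k x y) \<partial>M)"
        by (rule nn_integral_cmult) measurable
      finally show "(\<integral>\<^sup>+y. ennreal (V * ?k x y * (cmod (F x))\<^sup>2 / 2) \<partial>M) = ennreal ((cmod (F x))\<^sup>2) / 2"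
        by (simp add: k_int[OF x] divide_ennreal[symmetric])
    qed
    also have "\<dots> = ?S / 2" by (rule nn_integral_divide) measurable
    finally show ?thesis .
  qed
  have "(\<integral>\<^sup>+x. \<integral>\<^sup>+y. ennreal (V * ?k x y * (cmod (F y))\<^sup>2 / 2) \<partial>M \<partial>M) =
      (\<integral>\<^sup>+y. \<integral>\<^sup>+x. ennreal (V * ?k x y * (cmod (F y))\<^sup>2 / 2) \<partial>M \<partial>M)"
    by (rule pair.Fubini') measurable
  also have "\<dots> = (\<integral>\<^sup>+y. \<integral>\<^sup>+x. ennreal (V * ?k y x * (cmod (F y))\<^sup>2 / 2) \<partial>M \<partial>M)"
    by (intro nn_integral_cong) (simp add: space_M ind_B_swap)
  also note I1
  finally have I2: "(\<integral>\<^sup>+x. \<integral>\<^sup>+y. ennreal (V * ?k x y * (cmod (F y))\<^sup>2 / 2) \<partial>M \<partial>M) = ?S / 2" .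
  have integ: "integrable M (\<lambda>\<xi>. indicator (B n) \<xi> * (cmod (ft F \<xi>))\<^sup>2)"
  proof -
    have "integrable M (\<lambda>\<xi>. complex_of_real (indicator (B n) \<xi> * (cmod (ft F \<xi>))\<^sup>2))"
    proof (rule bounded_on_finite_L1_L2(1)[OF B_sets[of n], of _ "C\<^sup>2"])
      show "emeasure M (B n) < \<infinity>" by (simp add: emeasure_B)
      show "cmod (complex_of_real (indicator (B n) x * (cmod (ft F x))\<^sup>2)) \<le> C\<^sup>2 * indicator (B n) x" for x
        using power_mono[OF ft_bound[of F x], of 2] by (simp add: C_def norm_mult norm_power indicator_def)
    qed measurable
    from integrable_Re[OF this] show ?thesis by simp
  qed
  define I where "I = (LINT \<xi>|M. indicator (B n) \<xi> * (cmod (ft F \<xi>))\<^sup>2)"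
  have "complex_of_real I = (LINT \<xi>|M. ft F \<xi> * G \<xi>)"
  proof -
    have "complex_of_real I = (LINT \<xi>|M. complex_of_real (indicator (B n) \<xi> * (cmod (ft F \<xi>))\<^sup>2))"
      unfolding I_def by (rule Bochner_Integration.integral_of_real[symmetric]) (rule integ)
    also have "\<dots> = (LINT \<xi>|M. ft F \<xi> * G \<xi>)"
    proof (rule Bochner_Integration.integral_cong[OF refl])
      fix \<xi>
      show "complex_of_real (indicator (B n) \<xi> * (cmod (ft F \<xi>))\<^sup>2) = ft F \<xi> * G \<xi>"
        using complex_norm_square[of "ft F \<xi>"] by (simp add: G_def indicator_def)
    qed
    finally show ?thesis .
  qed
  also have "\<dots> = (LINT x|M. F x * ft G x)" by (rule ft_multiplication_formula[OF F(2) G])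
  finally have "ennreal \<bar>I\<bar> = ennreal (cmod (LINT x|M. F x * ft G x))" by (metis norm_of_real)
  also have "\<dots> \<le> (\<integral>\<^sup>+x. ennreal (cmod (F x * ft G x)) \<partial>M)"
  proof (cases "integrable M (\<lambda>x. F x * ft G x)")
    case True
    then show ?thesis by (rule integral_norm_bound_ennreal)
  qed (simp add: not_integrable_integral_eq)
  also have "\<dots> \<le> (\<integral>\<^sup>+x. \<integral>\<^sup>+y. ennreal (V * ?k x y * (cmod (F x))\<^sup>2 / 2) + ennreal (V * ?k x y * (cmod (F y))\<^sup>2 / 2) \<partial>M \<partial>M)"
  proof (rule nn_integral_mono)
    fix x assume "x \<in> space M"
    then have x: "x \<in> carrier R" by (simp add: space_M)
    have [measurable]: "(\<lambda>y. y \<ominus> x) \<in> measurable M M"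
      using x by (intro measurable_rminus measurable_const_carrier measurable_ident_sets) auto
    have int: "integrable M (\<lambda>y. V * ?k x y * cmod (F y))"
      by (rule Bochner_Integration.integrable_bound[of M "\<lambda>y. V * cmod (F y)"])
        (use F V in \<open>auto simp: indicator_def\<close>)
    have "ennreal (cmod (F x * ft G x)) \<le> ennreal (cmod (F x) * (LINT y|M. V * ?k x y * cmod (F y)))"
      unfolding norm_mult using ftG[OF x] by (intro ennreal_leI mult_left_mono) auto
    also have "\<dots> = ennreal (LINT y|M. cmod (F x) * (V * ?k x y * cmod (F y)))" by simp
    also have "\<dots> = (\<integral>\<^sup>+y. ennreal (cmod (F x) * (V * ?k x y * cmod (F y))) \<partial>M)"
      using int V by (intro nn_integral_eq_integral[symmetric]) auto
    also have "\<dots> \<le> (\<integral>\<^sup>+y. ennreal (V * ?k x y * (cmod (F x))\<^sup>2 / 2) + ennreal (V * ?k x y * (cmod (F y))\<^sup>2 / 2) \<partial>M)"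
    proof (rule nn_integral_mono)
      fix y
      have "2 * cmod (F x) * cmod (F y) \<le> (cmod (F x))\<^sup>2 + (cmod (F y))\<^sup>2" by (rule sum_squares_bound)
      then have "V * ?k x y * (cmod (F x) * cmod (F y)) \<le> V * ?k x y * (((cmod (F x))\<^sup>2 + (cmod (F y))\<^sup>2) / 2)"
        using V by (intro mult_left_mono) auto
      then have "cmod (F x) * (V * ?k x y * cmod (F y)) \<le> V * ?k x y * (cmod (F x))\<^sup>2 / 2 + V * ?k x y * (cmod (F y))\<^sup>2 / 2"
        by (simp add: algebra_simps add_divide_distrib)
      then have "ennreal (cmod (F x) * (V * ?k x y * cmod (F y))) \<le>
          ennreal (V * ?k x y * (cmod (F x))\<^sup>2 / 2 + V * ?k x y * (cmod (F y))\<^sup>2 / 2)" by (rule ennreal_leI)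
      also have "\<dots> = ennreal (V * ?k x y * (cmod (F x))\<^sup>2 / 2) + ennreal (V * ?k x y * (cmod (F y))\<^sup>2 / 2)"
        using V by (intro ennreal_plus) auto
      finally show "ennreal (cmod (F x) * (V * ?k x y * cmod (F y))) \<le>
          ennreal (V * ?k x y * (cmod (F x))\<^sup>2 / 2) + ennreal (V * ?k x y * (cmod (F y))\<^sup>2 / 2)" .
    qed
    finally show "ennreal (cmod (F x * ft G x)) \<le>
      (\<integral>\<^sup>+y. ennreal (V * ?k x y * (cmod (F x))\<^sup>2 / 2) + ennreal (V * ?k x y * (cmod (F y))\<^sup>2 / 2) \<partial>M)" .
  qed
  also have "\<dots> = (\<integral>\<^sup>+x. (\<integral>\<^sup>+y. ennreal (V * ?k x y * (cmod (F x))\<^sup>2 / 2) \<partial>M) + (\<integral>\<^sup>+y. ennreal (V * ?k x y * (cmod (F y))\<^sup>2 / 2) \<partial>M) \<partial>M)"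
  proof (rule nn_integral_cong)
    fix x assume "x \<in> space M"
    then have x: "x \<in> carrier R" by (simp add: space_M)
    have [measurable]: "(\<lambda>y. y \<ominus> x) \<in> measurable M M"
      using x by (intro measurable_rminus measurable_const_carrier measurable_ident_sets) auto
    show "(\<integral>\<^sup>+y. ennreal (V * ?k x y * (cmod (F x))\<^sup>2 / 2) + ennreal (V * ?k x y * (cmod (F y))\<^sup>2 / 2) \<partial>M) =
      (\<integral>\<^sup>+y. ennreal (V * ?k x y * (cmod (F x))\<^sup>2 / 2) \<partial>M) + (\<integral>\<^sup>+y. ennreal (V * ?k x y * (cmod (F y))\<^sup>2 / 2) \<partial>M)"
      by (rule nn_integral_add) measurable
  qed
  also have "\<dots> = (\<integral>\<^sup>+x. \<integral>\<^sup>+y. ennreal (V * ?k x y * (cmod (F x))\<^sup>2 / 2) \<partial>M \<partial>M) +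
      (\<integral>\<^sup>+x. \<integral>\<^sup>+y. ennreal (V * ?k x y * (cmod (F y))\<^sup>2 / 2) \<partial>M \<partial>M)"
    by (rule nn_integral_add) measurable
  also have "\<dots> = ?S" unfolding I1 I2 ennreal_L2_norm_sq[OF F(1)]
    by (simp add: ennreal_divide_numeral ennreal_plus[symmetric] del: ennreal_plus)
  finally have "ennreal \<bar>I\<bar> \<le> ?S" .
  moreover have "I \<ge> 0" unfolding I_def by (intro Bochner_Integration.integral_nonneg) simp
  moreover have "(\<integral>\<^sup>+\<xi>. ennreal (indicator (B n) \<xi> * (cmod (ft F \<xi>))\<^sup>2) \<partial>M) = ennreal I"
    unfolding I_def by (rule nn_integral_eq_integral[OF integ]) simp
  ultimately show ?thesis by simp
qed

text \<open>The bound of \<open>ft_ball_bessel\<close> is the same for all balls, so Fatou's lemma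
  over the exhaustion by balls extends it to the whole ring.\<close>

lemma ft_bessel:
  assumes F: "F \<in> L2 M" "integrable M F"
  shows "ft F \<in> L2 M" "L2_norm M (ft F) \<le> L2_norm M F"
proof -
  let ?S = "\<integral>\<^sup>+x. ennreal ((cmod (F x))\<^sup>2) \<partial>M"
  have Fm [measurable]: "F \<in> borel_measurable M" using F by auto
  have ftm [measurable]: "ft F \<in> borel_measurable M" by (rule ft_measurable) simp
  have "(\<integral>\<^sup>+\<xi>. ennreal ((cmod (ft F \<xi>))\<^sup>2) \<partial>M) =
      (\<integral>\<^sup>+\<xi>. liminf (\<lambda>k. ennreal (indicator (B (int k)) \<xi> * (cmod (ft F \<xi>))\<^sup>2)) \<partial>M)"
  proof (rule nn_integral_cong)
    fix \<xi> assume "\<xi> \<in> space M"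
    then obtain j where j: "\<xi> \<in> B (int j)" using B_UN by (auto simp: space_M)
    have "\<forall>\<^sub>F k in sequentially. ennreal (indicator (B (int k)) \<xi> * (cmod (ft F \<xi>))\<^sup>2) = ennreal ((cmod (ft F \<xi>))\<^sup>2)"
      unfolding eventually_sequentially using j B_le[of \<xi> "int j"] by (intro exI[of _ j]) auto
    then have "(\<lambda>k. ennreal (indicator (B (int k)) \<xi> * (cmod (ft F \<xi>))\<^sup>2)) \<longlonglongrightarrow> ennreal ((cmod (ft F \<xi>))\<^sup>2)"
      by (rule tendsto_eventually)
    then show "ennreal ((cmod (ft F \<xi>))\<^sup>2) = liminf (\<lambda>k. ennreal (indicator (B (int k)) \<xi> * (cmod (ft F \<xi>))\<^sup>2))"
      by (rule lim_imp_Liminf[OF trivial_limit_sequentially, symmetric])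
  qed
  also have "\<dots> \<le> liminf (\<lambda>k. \<integral>\<^sup>+\<xi>. ennreal (indicator (B (int k)) \<xi> * (cmod (ft F \<xi>))\<^sup>2) \<partial>M)"
    by (rule nn_integral_liminf) measurable
  also have "\<dots> \<le> ?S"
    by (rule Liminf_le) (use ft_ball_bessel[OF F] in auto)
  finally have le: "(\<integral>\<^sup>+\<xi>. ennreal ((cmod (ft F \<xi>))\<^sup>2) \<partial>M) \<le> ?S" .
  also have S: "?S = ennreal ((L2_norm M F)\<^sup>2)" by (rule ennreal_L2_norm_sq[OF F(1)])
  finally have "(\<integral>\<^sup>+\<xi>. ennreal ((cmod (ft F \<xi>))\<^sup>2) \<partial>M) < \<infinity>" by (rule le_less_trans) simp
  then show L2: "ft F \<in> L2 M" unfolding L2_def by (auto intro!: integrableI_bounded)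
  have "ennreal ((L2_norm M (ft F))\<^sup>2) \<le> ennreal ((L2_norm M F)\<^sup>2)"
    using le S ennreal_L2_norm_sq[OF L2] by simp
  then have "(L2_norm M (ft F))\<^sup>2 \<le> (L2_norm M F)\<^sup>2" by (subst (asm) ennreal_le_iff) auto
  then show "L2_norm M (ft F) \<le> L2_norm M F" by (rule power2_le_imp_le) simp
qed

end

section \<open>The Fourier transform on L2 as a relation\<close>

context ultrametric_ring
begin

text \<open>Cut off to a ball, the positive and negative parts of \<open>h\<close> are densities of
  finite measures that agree on balls and hence everywhere. Uniqueness of densities makes the two
  parts equal, which is possible only if both vanish.\<close>

lemma real_ae_zero_if_ball_integrals_zero:
  fixes h :: "'a \<Rightarrow> real"
  assumes h [measurable]: "h \<in> borel_measurable M"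
    and int: "\<And>n. integrable M (\<lambda>x. indicator (B n) x * h x)"
    and zero: "\<And>a n. a \<in> carrier R \<Longrightarrow> (LINT x|M. indicator (bl a n) x * h x) = 0"
  shows "AE x in M. h x = 0"
proof -
  have "AE x in M. indicator (B N) x * h x = 0" for N
  proof -
    define k where "k x = indicator (B N) x * h x" for x
    have k: "integrable M k" and [measurable]: "k \<in> borel_measurable M"
      using int[of N] by (simp_all add: k_def[abs_def])
    have em: "emeasure (density M (\<lambda>x. ennreal (c * k x))) A = (\<integral>\<^sup>+x. ennreal (c * (indicator A x * k x)) \<partial>M)"
      if "A \<in> sets M" for A c
      using that by (subst emeasure_density) (auto intro!: nn_integral_cong split: split_indicator)
    have fin: "(\<integral>\<^sup>+x. ennreal (c * (indicator A x * k x)) \<partial>M) < \<infinity>" if A: "A \<in> sets M" and c: "\<bar>c\<bar> = 1" for A c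
    proof -
      have "(\<integral>\<^sup>+x. ennreal (c * (indicator A x * k x)) \<partial>M) \<le> (\<integral>\<^sup>+x. ennreal (norm (k x)) \<partial>M)"
      proof (intro nn_integral_mono ennreal_leI)
        fix x
        have "c * (indicator A x * k x) \<le> \<bar>c * (indicator A x * k x)\<bar>" by (rule abs_ge_self)
        also have "\<dots> \<le> norm (k x)" using c by (simp add: abs_mult split: split_indicator)
        finally show "c * (indicator A x * k x) \<le> norm (k x)" .
      qed
      also have "\<dots> < \<infinity>" using k by (simp add: integrable_iff_bounded)
      finally show ?thesis .
    qed
    have "density M (\<lambda>x. ennreal (1 * k x)) = density M (\<lambda>x. ennreal ((-1) * k x))"
    proof (rule measure_eqI_balls)
      fix a n assume a: "a \<in> carrier R"
      define k' where "k' x = indicator (bl a n) x * k x" for x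
      have k'int: "integrable M k'"
        unfolding k'_def by (rule Bochner_Integration.integrable_bound[OF k]) (use a in \<open>auto split: split_indicator\<close>)
      have "(LINT x|M. k' x) = (LINT x|M. indicator (bl a n \<inter> B N) x * h x)"
        by (simp add: k'_def k_def indicator_inter_arith mult.assoc)
      also have "\<dots> = 0"
      proof -
        consider "bl a n \<inter> bl \<zero> N = {}" | c where "c \<in> carrier R" "bl a n \<inter> bl \<zero> N = bl c (min n N)"
          using bl_Int[OF a zero_closed] by blast
        then show ?thesis by cases (simp_all add: bl_zero zero)
      qed
      finally have "enn2real (\<integral>\<^sup>+x. ennreal (k' x) \<partial>M) = enn2real (\<integral>\<^sup>+x. ennreal (- k' x) \<partial>M)"
        by (simp add: real_lebesgue_integral_def[OF k'int])
      moreover have "(\<integral>\<^sup>+x. ennreal (k' x) \<partial>M) < \<infinity>" "(\<integral>\<^sup>+x. ennreal (- k' x) \<partial>M) < \<infinity>"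
        using fin[OF bl_sets[OF a], of 1 n] fin[OF bl_sets[OF a], of "-1" n] by (simp_all add: k'_def)
      ultimately have "(\<integral>\<^sup>+x. ennreal (k' x) \<partial>M) = (\<integral>\<^sup>+x. ennreal (- k' x) \<partial>M)"
        by (metis ennreal_enn2real infinity_ennreal_def)
      then show "emeasure (density M (\<lambda>x. ennreal (1 * k x))) (bl a n) = emeasure (density M (\<lambda>x. ennreal ((-1) * k x))) (bl a n)"
        using em[OF bl_sets[OF a], of 1 n] em[OF bl_sets[OF a], of "-1" n] by (simp add: k'_def)
    next
      show "emeasure (density M (\<lambda>x. ennreal (1 * k x))) (B n) \<noteq> \<infinity>" for n
        using em[OF B_sets, of 1] fin[OF B_sets, of 1] by (simp add: less_top)
    qed auto
    then have "AE x in M. ennreal (1 * k x) = ennreal ((-1) * k x)"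
      by (intro density_unique) auto
    then show ?thesis
    proof eventually_elim
      fix x assume e: "ennreal (1 * k x) = ennreal ((-1) * k x)"
      have "k x = 0"
      proof (cases "k x \<ge> 0")
        case True
        then have "ennreal (k x) = 0" using e by (simp add: ennreal_neg)
        then show ?thesis using True by simp
      next
        case False
        then have "ennreal (- k x) = 0" using e by (simp add: ennreal_neg)
        then show ?thesis using False by simp
      qed
      then show "indicator (B N) x * h x = 0" by (simp add: k_def)
    qed
  qed
  then have "AE x in M. \<forall>N::nat. indicator (B (int N)) x * h x = 0"
    by (subst AE_all_countable) blast
  then show ?thesis using AE_space
  proof eventually_elim
    fix x assume x: "\<forall>N::nat. indicator (B (int N)) x * h x = 0" "x \<in> space M"
    then obtain N where "x \<in> B (int N)" using B_UN by (auto simp: space_M)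
    then show "h x = 0" using x(1)[rule_format, of N] by simp
  qed
qed

lemma ae_eq_if_ball_integrals_eq:
  assumes f: "f \<in> L2 M" and g: "g \<in> L2 M"
    and eq: "\<And>a n. a \<in> carrier R \<Longrightarrow> (LINT x|M. f x * indicator (bl a n) x) = (LINT x|M. g x * indicator (bl a n) x)"
  shows "AE x in M. f x = g x"
proof -
  define d where "d x = f x - g x" for x
  have d: "d \<in> L2 M" unfolding d_def[abs_def] by (rule L2_diff[OF f g])
  have [measurable]: "d \<in> borel_measurable M" using d by (rule L2_measurable)
  have int: "integrable M (\<lambda>x. d x * indicator (bl a n) x)" if "a \<in> carrier R" for a n
    by (rule L2_mult_integrable[OF d ind_bl_L1_L2(2)[OF that]])
  have zero: "(LINT x|M. d x * indicator (bl a n) x) = 0" if a: "a \<in> carrier R" for a n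
    using eq[OF a, of n] L2_mult_integrable[OF f ind_bl_L1_L2(2)[OF a]] L2_mult_integrable[OF g ind_bl_L1_L2(2)[OF a]]
    by (simp add: d_def left_diff_distrib)
  have re: "indicator (bl a n) x * Re (d x) = Re (d x * indicator (bl a n) x)"
    and im: "indicator (bl a n) x * Im (d x) = Im (d x * indicator (bl a n) x)" for a n x
    by (simp_all add: indicator_def)
  have "AE x in M. Re (d x) = 0"
  proof (rule real_ae_zero_if_ball_integrals_zero)
    show "integrable M (\<lambda>x. indicator (B n) x * Re (d x))" for n
      using integrable_Re[OF int[OF zero_closed, of n]] by (simp only: re[of \<zero> n, symmetric]) (simp only: bl_zero)
    show "(LINT x|M. indicator (bl a n) x * Re (d x)) = 0" if "a \<in> carrier R" for a n
      unfolding re using integral_Re[OF int[OF that, of n]] zero[OF that, of n] by simp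
  qed measurable
  moreover have "AE x in M. Im (d x) = 0"
  proof (rule real_ae_zero_if_ball_integrals_zero)
    show "integrable M (\<lambda>x. indicator (B n) x * Im (d x))" for n
      using integrable_Im[OF int[OF zero_closed, of n]] by (simp only: im[of \<zero> n, symmetric]) (simp only: bl_zero)
    show "(LINT x|M. indicator (bl a n) x * Im (d x)) = 0" if "a \<in> carrier R" for a n
      unfolding im using integral_Im[OF int[OF that, of n]] zero[OF that, of n] by simp
  qed measurable
  ultimately show ?thesis
    by eventually_elim (auto simp: d_def complex_eq_iff)
qed

text \<open>The counterpart of \<open>is_fourier_L2\<close> over the abstract ring. Working with the
  relation keeps the choice of representatives out of the analysis.\<close>

definition isF :: "('a \<Rightarrow> complex) \<Rightarrow> ('a \<Rightarrow> complex) \<Rightarrow> bool" where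
  "isF f g \<longleftrightarrow> f \<in> L2 M \<and> g \<in> L2 M \<and>
     (\<exists>F :: nat \<Rightarrow> 'a \<Rightarrow> complex.
        (\<forall>n. F n \<in> L2 M \<and> integrable M (F n) \<and> ft (F n) \<in> L2 M) \<and>
        (\<lambda>n. L2_norm M (\<lambda>x. F n x - f x)) \<longlonglongrightarrow> 0 \<and>
        (\<lambda>n. L2_norm M (\<lambda>\<xi>. ft (F n) \<xi> - g \<xi>)) \<longlonglongrightarrow> 0)"

lemma isF_L2: "isF f g \<Longrightarrow> f \<in> L2 M" "isF f g \<Longrightarrow> g \<in> L2 M"
  by (auto simp: isF_def)

text \<open>The multiplication formula holds for the approximants and survives the limit on both
  sides by Cauchy-Schwarz, \<open>h\<close> and its transform being in L2. With ball indicators for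
  \<open>h\<close> it determines \<open>g\<close> almost everywhere.\<close>

lemma isF_weak:
  assumes fg: "isF f g" and h: "h \<in> L2 M" "integrable M h"
  shows "(LINT x|M. g x * h x) = (LINT x|M. f x * ft h x)"
proof -
  obtain F where F: "\<And>n. F n \<in> L2 M" "\<And>n. integrable M (F n)" "\<And>n. ft (F n) \<in> L2 M"
    "(\<lambda>n. L2_norm M (\<lambda>x. F n x - f x)) \<longlonglongrightarrow> 0"
    "(\<lambda>n. L2_norm M (\<lambda>\<xi>. ft (F n) \<xi> - g \<xi>)) \<longlonglongrightarrow> 0" and L2: "f \<in> L2 M" "g \<in> L2 M"
    using fg unfolding isF_def by blast
  have lim: "(\<lambda>n. LINT x|M. ft (F n) x * h x) \<longlonglongrightarrow> (LINT x|M. g x * h x)"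
    by (rule L2_mult_tendsto[OF F(3) L2(2) h(1) F(5)])
  have lim': "(\<lambda>n. LINT x|M. F n x * ft h x) \<longlonglongrightarrow> (LINT x|M. f x * ft h x)"
    by (rule L2_mult_tendsto[OF F(1) L2(1) ft_bessel(1)[OF h] F(4)])
  have "(LINT x|M. ft (F n) x * h x) = (LINT x|M. F n x * ft h x)" for n
    by (rule ft_multiplication_formula[OF F(2) h(2)])
  with lim' have "(\<lambda>n. LINT x|M. ft (F n) x * h x) \<longlonglongrightarrow> (LINT x|M. f x * ft h x)" by simp
  with lim show ?thesis by (rule LIMSEQ_unique)
qed

lemma isF_unique:
  assumes "isF f g" "isF f g'" shows "AE x in M. g x = g' x"
proof (rule ae_eq_if_ball_integrals_eq)
  fix a n assume "a \<in> carrier R"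
  note i = ind_bl_L1_L2[OF this, of n]
  show "(LINT x|M. g x * indicator (bl a n) x) = (LINT x|M. g' x * indicator (bl a n) x)"
    unfolding isF_weak[OF assms(1) i(2,1)] isF_weak[OF assms(2) i(2,1)] ..
qed (rule isF_L2(2)[OF assms(1)], rule isF_L2(2)[OF assms(2)])

lemma L2_truncation_tendsto:
  assumes f: "f \<in> L2 M"
  shows "(\<lambda>k. L2_norm M (\<lambda>x. f x * indicator (B (int k)) x - f x)) \<longlonglongrightarrow> 0"
proof -
  have [measurable]: "f \<in> borel_measurable M" using f by (rule L2_measurable)
  have "(\<lambda>k. LINT x|M. (cmod (f x * indicator (B (int k)) x - f x))\<^sup>2) \<longlonglongrightarrow> (LINT x|M. 0)"
  proof (rule integral_dominated_convergence[where w = "\<lambda>x. (cmod (f x))\<^sup>2"])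
    show "AE x in M. (\<lambda>k. (cmod (f x * indicator (B (int k)) x - f x))\<^sup>2) \<longlonglongrightarrow> 0"
    proof (rule AE_I2)
      fix x assume "x \<in> space M"
      then obtain j where j: "x \<in> B (int j)" using B_UN by (auto simp: space_M)
      have "\<forall>\<^sub>F k in sequentially. (cmod (f x * indicator (B (int k)) x - f x))\<^sup>2 = 0"
        unfolding eventually_sequentially using j B_le[of x "int j"] by (intro exI[of _ j]) auto
      then show "(\<lambda>k. (cmod (f x * indicator (B (int k)) x - f x))\<^sup>2) \<longlonglongrightarrow> 0"
        by (rule tendsto_eventually)
    qed
    show "AE x in M. norm ((cmod (f x * indicator (B (int k)) x - f x))\<^sup>2) \<le> (cmod (f x))\<^sup>2" for k
      by (auto split: split_indicator)
  qed (use f in \<open>auto simp: L2_def\<close>)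
  then show ?thesis unfolding L2_norm_def using tendsto_real_sqrt by fastforce
qed

text \<open>Truncations to growing balls are integrable and converge to \<open>f\<close>; the Bessel
  inequality makes their transforms a Cauchy sequence.\<close>

lemma isF_exists: assumes f: "f \<in> L2 M" shows "\<exists>g. isF f g"
proof -
  define F where "F k x = f x * indicator (B (int k)) x" for k x
  have ind: "(indicator (B n) :: 'a \<Rightarrow> complex) \<in> L2 M" for n
    using ind_bl_L1_L2(2)[OF zero_closed, of n] by (simp add: bl_zero)
  have F1: "integrable M (F k)" for k
    unfolding F_def[abs_def] by (rule L2_mult_integrable[OF f ind])
  have F2: "F k \<in> L2 M" for k
    unfolding F_def[abs_def] by (rule L2_mult_bounded[OF f]) (auto split: split_indicator)
  have F3: "ft (F k) \<in> L2 M" for k by (rule ft_bessel(1)[OF F2 F1])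
  have lim: "(\<lambda>k. L2_norm M (\<lambda>x. F k x - f x)) \<longlonglongrightarrow> 0"
    unfolding F_def by (rule L2_truncation_tendsto[OF f])
  obtain g where g: "g \<in> L2 M" "(\<lambda>k. L2_norm M (\<lambda>x. ft (F k) x - g x)) \<longlonglongrightarrow> 0"
  proof (rule L2_complete[of "\<lambda>k. ft (F k)" M])
    fix e :: real assume "e > 0"
    then obtain N where N: "\<And>k. k \<ge> N \<Longrightarrow> L2_norm M (\<lambda>x. F k x - f x) < e / 2"
      using LIMSEQ_D[OF lim, of "e / 2"] by auto
    have "L2_norm M (\<lambda>x. ft (F m) x - ft (F n) x) < e" if "m \<ge> N" "n \<ge> N" for m n
    proof -
      have "L2_norm M (\<lambda>x. ft (F m) x - ft (F n) x) = L2_norm M (ft (\<lambda>x. F m x - F n x))"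
        by (rule L2_norm_cong) (simp add: ft_diff F1 space_M)
      also have "\<dots> \<le> L2_norm M (\<lambda>x. F m x - F n x)"
        by (rule ft_bessel(2)) (auto intro: L2_diff F1 F2)
      also have "\<dots> \<le> L2_norm M (\<lambda>x. F m x - f x) + L2_norm M (\<lambda>x. f x - F n x)"
        by (rule L2_norm_triangle_diff[OF F2 f F2])
      also have "\<dots> < e"
        using N[OF that(1)] N[OF that(2)] L2_norm_minus_commute[of M f "F n"] by simp
      finally show ?thesis .
    qed
    then show "\<exists>N. \<forall>m\<ge>N. \<forall>n\<ge>N. L2_norm M (\<lambda>x. ft (F m) x - ft (F n) x) < e" by blast
  qed (use F3 in auto)
  then show ?thesis unfolding isF_def using f g F1 F2 F3 lim by blast
qed

lemma isF_cong_AE: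
  assumes fg: "isF f g" and f': "f' \<in> borel_measurable M" "AE x in M. f x = f' x"
    and g': "g' \<in> borel_measurable M" "AE x in M. g x = g' x"
  shows "isF f' g'"
proof -
  obtain F where F: "\<And>n. F n \<in> L2 M" "\<And>n. integrable M (F n)" "\<And>n. ft (F n) \<in> L2 M"
    "(\<lambda>n. L2_norm M (\<lambda>x. F n x - f x)) \<longlonglongrightarrow> 0"
    "(\<lambda>n. L2_norm M (\<lambda>\<xi>. ft (F n) \<xi> - g \<xi>)) \<longlonglongrightarrow> 0" and L2: "f \<in> L2 M" "g \<in> L2 M"
    using fg unfolding isF_def by blast
  have "L2_norm M (\<lambda>x. F n x - f' x) = L2_norm M (\<lambda>x. F n x - f x)" for n
    using f' L2_measurable[OF F(1)[of n]] L2_measurable[OF L2(1)] by (intro L2_norm_cong_AE) auto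
  moreover have "L2_norm M (\<lambda>x. ft (F n) x - g' x) = L2_norm M (\<lambda>x. ft (F n) x - g x)" for n
    using g' L2_measurable[OF F(3)[of n]] L2_measurable[OF L2(2)] by (intro L2_norm_cong_AE) auto
  moreover have "f' \<in> L2 M" "g' \<in> L2 M"
    using L2_cong_AE[OF L2(1) f'] L2_cong_AE[OF L2(2) g'] by blast+
  ultimately show ?thesis unfolding isF_def using F by (intro conjI exI[of _ F]) auto
qed

text \<open>Converse of \<open>isF_weak\<close>: some transform of \<open>f\<close> exists, and the
  tests identify it with \<open>g\<close> almost everywhere. Linearity, reflection and the double
  transform thereby reduce to identities between integrals over balls.\<close>

lemma isF_I:
  assumes f: "f \<in> L2 M" and g: "g \<in> L2 M"
    and eq: "\<And>a n. a \<in> carrier R \<Longrightarrow>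
      (LINT x|M. g x * indicator (bl a n) x) = (LINT x|M. f x * ft (indicator (bl a n)) x)"
  shows "isF f g"
proof -
  obtain g' where g': "isF f g'" using isF_exists[OF f] by blast
  have "AE x in M. g' x = g x"
  proof (rule ae_eq_if_ball_integrals_eq[OF isF_L2(2)[OF g'] g])
    fix a n assume a: "a \<in> carrier R"
    note i = ind_bl_L1_L2[OF a, of n]
    show "(LINT x|M. g' x * indicator (bl a n) x) = (LINT x|M. g x * indicator (bl a n) x)"
      unfolding isF_weak[OF g' i(2,1)] eq[OF a] ..
  qed
  with L2_measurable[OF f] L2_measurable[OF g] show ?thesis by (intro isF_cong_AE[OF g']) simp_all
qed

lemma isF_linear:
  assumes 1: "isF f g" and 2: "isF f' g'"
  shows "isF (\<lambda>x. c * f x + c' * f' x) (\<lambda>x. c * g x + c' * g' x)"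
proof (rule isF_I)
  fix a n assume a: "a \<in> carrier R"
  note i = ind_bl_L1_L2[OF a, of n]
  note j = ft_bessel(1)[OF i(2,1)]
  have "(LINT x|M. (c * g x + c' * g' x) * indicator (bl a n) x) =
      c * (LINT x|M. g x * indicator (bl a n) x) + c' * (LINT x|M. g' x * indicator (bl a n) x)"
    using L2_mult_integrable[OF isF_L2(2)[OF 1] i(2)] L2_mult_integrable[OF isF_L2(2)[OF 2] i(2)]
    by (simp add: distrib_right mult.assoc)
  also have "\<dots> = c * (LINT x|M. f x * ft (indicator (bl a n)) x) + c' * (LINT x|M. f' x * ft (indicator (bl a n)) x)"
    using isF_weak[OF 1 i(2,1)] isF_weak[OF 2 i(2,1)] by simp
  also have "\<dots> = (LINT x|M. (c * f x + c' * f' x) * ft (indicator (bl a n)) x)"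
    using L2_mult_integrable[OF isF_L2(1)[OF 1] j] L2_mult_integrable[OF isF_L2(1)[OF 2] j]
    by (simp add: distrib_right mult.assoc)
  finally show "(LINT x|M. (c * g x + c' * g' x) * indicator (bl a n) x) =
    (LINT x|M. (c * f x + c' * f' x) * ft (indicator (bl a n)) x)" .
next
  show "(\<lambda>x. c * f x + c' * f' x) \<in> L2 M"
    by (intro L2_add L2_cmult isF_L2(1)[OF 1] isF_L2(1)[OF 2])
  show "(\<lambda>x. c * g x + c' * g' x) \<in> L2 M"
    by (intro L2_add L2_cmult isF_L2(2)[OF 1] isF_L2(2)[OF 2])
qed

lemma isF_diff: "isF f g \<Longrightarrow> isF f' g' \<Longrightarrow> isF (\<lambda>x. f x - f' x) (\<lambda>x. g x - g' x)"
  using isF_linear[of f g f' g' 1 "-1"] by simp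

lemma isF_norm_le:
  assumes fg: "isF f g" shows "L2_norm M g \<le> L2_norm M f"
proof -
  obtain F where F: "\<And>n. F n \<in> L2 M" "\<And>n. integrable M (F n)" "\<And>n. ft (F n) \<in> L2 M"
    "(\<lambda>n. L2_norm M (\<lambda>x. F n x - f x)) \<longlonglongrightarrow> 0"
    "(\<lambda>n. L2_norm M (\<lambda>\<xi>. ft (F n) \<xi> - g \<xi>)) \<longlonglongrightarrow> 0" and L2: "f \<in> L2 M" "g \<in> L2 M"
    using fg unfolding isF_def by blast
  have "L2_norm M g \<le> L2_norm M (\<lambda>\<xi>. ft (F n) \<xi> - g \<xi>) + (L2_norm M (\<lambda>x. F n x - f x) + L2_norm M f)" for n
  proof -
    have z: "(\<lambda>x. 0) \<in> L2 M" by (simp add: L2_def)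
    have "L2_norm M g \<le> L2_norm M (\<lambda>x. g x - ft (F n) x) + L2_norm M (ft (F n))"
      using L2_norm_triangle_diff[OF L2(2) F(3)[of n] z] by simp
    moreover have "L2_norm M (ft (F n)) \<le> L2_norm M (F n)" by (rule ft_bessel(2)[OF F(1,2)])
    moreover have "L2_norm M (F n) \<le> L2_norm M (\<lambda>x. F n x - f x) + L2_norm M f"
      using L2_norm_triangle_diff[OF F(1)[of n] L2(1) z] by simp
    ultimately show ?thesis using L2_norm_minus_commute[of M g "ft (F n)"] by simp
  qed
  moreover have "(\<lambda>n. L2_norm M (\<lambda>\<xi>. ft (F n) \<xi> - g \<xi>) + (L2_norm M (\<lambda>x. F n x - f x) + L2_norm M f))
      \<longlonglongrightarrow> 0 + (0 + L2_norm M f)"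
    by (intro tendsto_intros F)
  ultimately show ?thesis by (intro LIMSEQ_le_const[of _ "L2_norm M f"]) auto
qed

lemma neg_measurable: "(\<lambda>x. \<ominus> x) \<in> measurable M M"
  by (rule measurable_rneg) simp

lemma L2_neg: assumes f: "f \<in> L2 M" shows "(\<lambda>x. f (\<ominus> x)) \<in> L2 M"
  using integrable_neg_iff[of "\<lambda>x. (cmod (f x))\<^sup>2"] measurable_compose[OF neg_measurable L2_measurable[OF f]] f
  by (auto simp: L2_def)

lemma L2_norm_neg: "f \<in> borel_measurable M \<Longrightarrow> L2_norm M (\<lambda>x. f (\<ominus> x)) = L2_norm M f"
  using integral_distr[of "\<lambda>x. \<ominus> x" M M "\<lambda>x. (cmod (f x))\<^sup>2"] by (simp add: L2_norm_def distr_neg)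

lemma ind_bl_neg:
  assumes a: "a \<in> carrier R" and x: "x \<in> carrier R"
  shows "indicator (bl a n) (\<ominus> x) = indicator (bl (\<ominus> a) n) x"
proof -
  have "\<ominus> x \<ominus> a = \<ominus> (x \<ominus> \<ominus> a)" using a x by algebra
  then show ?thesis using a x by (simp add: bl_iff B_neg_iff indicator_def)
qed

lemma integral_neg_ind_bl:
  assumes a: "a \<in> carrier R" and f: "f \<in> borel_measurable M"
  shows "(LINT x|M. f (\<ominus> x) * indicator (bl a n) x) = (LINT x|M. (f x :: complex) * indicator (bl (\<ominus> a) n) x)"
proof -
  have m: "(\<lambda>x. f x * indicator (bl (\<ominus> a) n) x) \<in> borel_measurable M"
    by (intro borel_measurable_times borel_measurable_indicator f bl_sets) (use a in simp)
  have "(LINT x|M. f x * indicator (bl (\<ominus> a) n) x) = (LINT x|M. f (\<ominus> x) * indicator (bl (\<ominus> a) n) (\<ominus> x))"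
    using integral_neg[OF m] by simp
  also have "\<dots> = (LINT x|M. f (\<ominus> x) * indicator (bl a n) x)"
    using a by (intro Bochner_Integration.integral_cong[OF refl]) (simp add: ind_bl_neg space_M)
  finally show ?thesis by simp
qed

lemma wave_neg:
  assumes "a \<in> carrier R" "x \<in> carrier R" shows "wave a n (\<ominus> x) = wave (\<ominus> a) n x"
proof -
  have "\<ominus> a \<otimes> \<ominus> x = \<ominus> (\<ominus> a) \<otimes> x" using assms by algebra
  then show ?thesis using assms by (simp add: wave_def B_neg_iff indicator_def)
qed

lemma isF_reflect: assumes fg: "isF f g" shows "isF (\<lambda>x. f (\<ominus> x)) (\<lambda>x. g (\<ominus> x))"
proof (rule isF_I)
  note L = isF_L2[OF fg]
  show "(\<lambda>x. f (\<ominus> x)) \<in> L2 M" "(\<lambda>x. g (\<ominus> x)) \<in> L2 M" using L L2_neg by auto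
  fix a n assume a: "a \<in> carrier R"
  then have na: "\<ominus> a \<in> carrier R" by simp
  note i = ind_bl_L1_L2[OF na, of n]
  have "(LINT x|M. g (\<ominus> x) * indicator (bl a n) x) = (LINT x|M. g x * indicator (bl (\<ominus> a) n) x)"
    by (rule integral_neg_ind_bl[OF a L2_measurable[OF L(2)]])
  also have "\<dots> = (LINT x|M. f x * ft (indicator (bl (\<ominus> a) n)) x)" by (rule isF_weak[OF fg i(2,1)])
  also have "\<dots> = (LINT x|M. f (\<ominus> x) * ft (indicator (bl (\<ominus> a) n)) (\<ominus> x))"
    using L2_measurable[OF L(1)] L2_measurable[OF ft_bessel(1)[OF i(2,1)]]
    by (intro integral_neg[symmetric, where f = "\<lambda>x. f x * ft (indicator (bl (\<ominus> a) n)) x"]) auto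
  also have "\<dots> = (LINT x|M. f (\<ominus> x) * ft (indicator (bl a n)) x)"
    using a by (intro Bochner_Integration.integral_cong[OF refl]) (simp add: ft_ind_bl wave_neg space_M)
  finally show "(LINT x|M. g (\<ominus> x) * indicator (bl a n) x) = (LINT x|M. f (\<ominus> x) * ft (indicator (bl a n)) x)" .
qed

text \<open>Tested on a ball indicator, whose double transform is the indicator of the reflected
  ball: the volume factors \<open>exp (\<psi> n)\<close> and \<open>exp (\<psi> (- n))\<close>
  cancel.\<close>

lemma isF_twice: assumes fg: "isF f g" shows "isF g (\<lambda>x. f (\<ominus> x))"
proof (rule isF_I)
  note L = isF_L2[OF fg]
  show "g \<in> L2 M" "(\<lambda>x. f (\<ominus> x)) \<in> L2 M" using L L2_neg by auto
  fix a n assume a: "a \<in> carrier R"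
  then have na: "\<ominus> a \<in> carrier R" by simp
  note w = wave_L1_L2[OF na, of "- n"]
  let ?c = "complex_of_real (exp (\<psi> n))"
  have "(LINT x|M. g x * ft (indicator (bl a n)) x) = (LINT x|M. ?c * (g x * wave (\<ominus> a) (- n) x))"
    using a by (intro Bochner_Integration.integral_cong[OF refl]) (simp add: ft_ind_bl space_M)
  also have "\<dots> = ?c * (LINT x|M. g x * wave (\<ominus> a) (- n) x)" by simp
  also have "(LINT x|M. g x * wave (\<ominus> a) (- n) x) = (LINT x|M. f x * ft (wave (\<ominus> a) (- n)) x)"
    by (rule isF_weak[OF fg w(2,1)])
  also have "\<dots> = (LINT x|M. complex_of_real (exp (\<psi> (- n))) * (f x * indicator (bl (\<ominus> a) n) x))"
    using a by (intro Bochner_Integration.integral_cong[OF refl]) (auto simp: ft_wave space_M bl_iff indicator_def)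
  also have "\<dots> = complex_of_real (exp (\<psi> (- n))) * (LINT x|M. f x * indicator (bl (\<ominus> a) n) x)" by simp
  also have "?c * \<dots> = (LINT x|M. f x * indicator (bl (\<ominus> a) n) x)"
    by (simp add: \<psi>_minus exp_minus mult.assoc[symmetric] of_real_mult[symmetric] del: of_real_mult)
  also have "\<dots> = (LINT x|M. f (\<ominus> x) * indicator (bl a n) x)"
    by (rule integral_neg_ind_bl[OF a L2_measurable[OF L(1)], symmetric])
  finally show "(LINT x|M. f (\<ominus> x) * indicator (bl a n) x) = (LINT x|M. g x * ft (indicator (bl a n)) x)" by simp
qed

text \<open>The transform is a contraction, and its second application returns \<open>f\<close> up
  to a reflection that preserves the norm, so no norm can have been lost.\<close>

lemma isF_norm_eq: assumes fg: "isF f g" shows "L2_norm M g = L2_norm M f"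
  using isF_norm_le[OF fg] isF_norm_le[OF isF_twice[OF fg]] L2_norm_neg[OF L2_measurable[OF isF_L2(1)[OF fg]]]
  by simp

lemma isF_inverse: assumes fg: "isF f g" shows "isF (\<lambda>x. g (\<ominus> x)) f"
proof -
  have m: "f \<in> borel_measurable M" "(\<lambda>x. g (\<ominus> x)) \<in> borel_measurable M"
    by (intro L2_measurable isF_L2(1)[OF fg], intro L2_measurable L2_neg isF_L2(2)[OF fg])
  have "isF (\<lambda>x. g (\<ominus> x)) (\<lambda>x. f (\<ominus> (\<ominus> x)))" by (rule isF_reflect[OF isF_twice[OF fg]])
  then show ?thesis
    by (rule isF_cong_AE[OF _ m(2) _ m(1)]) (auto simp: space_M)
qed

lemma isF_surj: assumes "g \<in> L2 M" shows "\<exists>f. isF f g"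
  using isF_exists[OF assms] isF_inverse by blast

lemma isF_ft: "f \<in> L2 M \<Longrightarrow> integrable M f \<Longrightarrow> isF f (ft f)"
  unfolding isF_def using ft_bessel(1)[of f] by (auto intro!: exI[of _ "\<lambda>n. f"] simp: L2_norm_def)

text \<open>The reflected and translated \<open>ft E\<close> is the transform of \<open>E\<close>
  times a character, so \<open>isF_weak\<close> moves the transform over to \<open>f\<close>. This
  evaluates the convolution at every point although \<open>f\<close> is merely square
  integrable.\<close>

lemma convolution_ft:
  assumes fg: "isF f g" and E: "E \<in> L2 M" "integrable M E" and x: "x \<in> carrier R"
  shows "(LINT y|M. ft E (\<ominus> (x \<ominus> y)) * f y) = ft (\<lambda>\<xi>. g \<xi> * E \<xi>) (\<ominus> x)"
proof -
  define h where "h \<xi> = E \<xi> * ch (\<ominus> x \<otimes> \<xi>)" for \<xi>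
  have nx: "\<ominus> x \<in> carrier R" using x by simp
  have h: "integrable M h" "h \<in> L2 M"
    unfolding h_def[abs_def] using integrable_ch_mult[OF E(2) nx] L2_mult_bounded[OF E(1) ch_mult_measurable[OF nx]] by simp_all
  have "(LINT y|M. ft E (\<ominus> (x \<ominus> y)) * f y) = (LINT y|M. f y * ft h y)"
  proof (rule Bochner_Integration.integral_cong[OF refl])
    fix y assume "y \<in> space M"
    then have y: "y \<in> carrier R" by (simp add: space_M)
    have "ft h y = ft E (\<ominus> (x \<ominus> y))"
      unfolding ft_def h_def
    proof (rule Bochner_Integration.integral_cong[OF refl])
      fix \<xi> assume "\<xi> \<in> space M"
      then have \<xi>: "\<xi> \<in> carrier R" by (simp add: space_M)
      have "\<ominus> (x \<ominus> y) \<otimes> \<xi> = \<ominus> x \<otimes> \<xi> \<oplus> y \<otimes> \<xi>" using x y \<xi> by algebra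
      then show "E \<xi> * ch (\<ominus> x \<otimes> \<xi>) * ch (y \<otimes> \<xi>) = E \<xi> * ch (\<ominus> (x \<ominus> y) \<otimes> \<xi>)"
        using x y \<xi> by (simp add: ch_add)
    qed
    then show "ft E (\<ominus> (x \<ominus> y)) * f y = f y * ft h y" by simp
  qed
  also have "\<dots> = (LINT \<xi>|M. g \<xi> * h \<xi>)" by (rule isF_weak[OF fg h(2,1), symmetric])
  also have "\<dots> = ft (\<lambda>\<xi>. g \<xi> * E \<xi>) (\<ominus> x)" by (simp add: ft_def h_def mult.assoc)
  finally show ?thesis .
qed

text \<open>The product of \<open>g\<close> and \<open>E\<close> is integrable as well as square
  integrable, so its inverse transform is an honest integral, and \<open>convolution_ft\<close>
  recognizes it as \<open>u\<close>.\<close>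

lemma isF_convolution:
  assumes fg: "isF f g" and E: "E \<in> L2 M" "integrable M E" "\<And>x. cmod (E x) \<le> 1"
    and u: "\<And>x. x \<in> carrier R \<Longrightarrow> u x = (LINT y|M. ft E (\<ominus> (x \<ominus> y)) * f y)"
  shows "isF u (\<lambda>\<xi>. g \<xi> * E \<xi>)"
proof -
  define h where "h \<xi> = g \<xi> * E \<xi>" for \<xi>
  have h: "h \<in> L2 M" "integrable M h"
    unfolding h_def[abs_def]
    by (intro L2_mult_bounded isF_L2(2)[OF fg] L2_measurable[OF E(1)] E(3),
        intro L2_mult_integrable isF_L2(2)[OF fg] E(1))
  have F: "isF (\<lambda>x. ft h (\<ominus> x)) h" by (rule isF_inverse[OF isF_ft[OF h]])
  have eq: "ft h (\<ominus> x) = u x" if "x \<in> carrier R" for x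
    using convolution_ft[OF fg E(1,2) that] u[OF that] by (simp add: h_def[abs_def])
  have "u \<in> borel_measurable M"
    using L2_measurable[OF isF_L2(1)[OF F]] measurable_cong[of M "\<lambda>x. ft h (\<ominus> x)" u borel] eq
    by (simp add: space_M)
  moreover have "AE x in M. ft h (\<ominus> x) = u x" by (rule AE_I2) (simp add: eq space_M)
  ultimately have "isF u h" using isF_cong_AE[OF F, of u h] L2_measurable[OF h(1)] by simp
  then show ?thesis by (simp add: h_def[abs_def])
qed

end

section \<open>The heat equation\<close>

locale heat = ultrametric_ring +
  fixes nrm :: "'a \<Rightarrow> real" and \<alpha> :: real
  assumes nrm_zero: "nrm \<zero> = 0"
    and nrm_shell: "x \<in> B n \<Longrightarrow> x \<notin> B (n - 1) \<Longrightarrow> nrm x = exp (\<psi> n)"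
    and \<alpha>_pos: "\<alpha> > 0"
begin

text \<open>Without such a shell, membership would descend through all balls, and
  \<open>B_Inter\<close> would make \<open>x\<close> zero.\<close>

lemma shell_exists:
  assumes x: "x \<in> carrier R" "x \<noteq> \<zero>" shows "\<exists>n. x \<in> B n \<and> x \<notin> B (n - 1)"
proof (rule ccontr)
  assume "\<not> ?thesis"
  then have step: "x \<in> B n \<Longrightarrow> x \<in> B (n - 1)" for n by blast
  obtain m where m: "x \<in> B m" using B_Union x by blast
  have "x \<in> B k" for k
  proof (cases "k \<le> m")
    case True
    then show ?thesis by (induction k rule: int_le_induct) (use m step in auto)
  next
    case False
    then show ?thesis using B_le[OF m] by simp
  qed
  then show False using B_Inter x by blast
qed

lemma nrm_le_iff: assumes x: "x \<in> carrier R" shows "nrm x \<le> exp (\<psi> n) \<longleftrightarrow> x \<in> B n"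
proof (cases "x = \<zero>")
  case False
  then obtain k where k: "x \<in> B k" "x \<notin> B (k - 1)" using shell_exists x by blast
  have "nrm x \<le> exp (\<psi> n) \<longleftrightarrow> k \<le> n"
    using nrm_shell[OF k] \<psi>_strict[of k n] \<psi>_strict[of n k] by (cases k n rule: linorder_cases) auto
  also have "\<dots> \<longleftrightarrow> x \<in> B n" using k B_le[of x k n] B_le[of x n "k - 1"] by force
  finally show ?thesis .
qed (simp add: nrm_zero)

text \<open>The norm is locally constant away from zero; set to 0 on \<open>B (- int k)\<close> it
  becomes locally constant everywhere, and these cutoffs converge to it.\<close>

lemma nrm_measurable [measurable]: "nrm \<in> borel_measurable M"
proof (rule borel_measurable_LIMSEQ_real)
  fix x assume "x \<in> space M"
  then have x: "x \<in> carrier R" by (simp add: space_M)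
  show "(\<lambda>k. if x \<in> B (- int k) then 0 else nrm x) \<longlonglongrightarrow> nrm x"
  proof (cases "x = \<zero>")
    case False
    then obtain n where n: "x \<in> B n" "x \<notin> B (n - 1)" using shell_exists x by blast
    have "x \<notin> B (- int k)" if "k \<ge> nat (1 - n)" for k
      using n(2) B_le[of x "- int k" "n - 1"] that by (auto simp: nat_le_iff)
    then have "\<forall>k\<ge>nat (1 - n). (if x \<in> B (- int k) then 0 else nrm x) = nrm x" by simp
    then show ?thesis by (intro tendsto_eventually) (unfold eventually_sequentially, blast)
  qed (simp add: nrm_zero)
next
  fix k
  show "(\<lambda>x. if x \<in> B (- int k) then 0 else nrm x) \<in> borel_measurable M"
  proof (rule locally_constant_measurable)
    fix x assume x: "x \<in> carrier R"
    show "\<exists>n. \<forall>x'\<in>bl x n. (if x' \<in> B (- int k) then 0 else nrm x') = (if x \<in> B (- int k) then 0 else nrm x)"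
    proof (cases "x \<in> B (- int k)")
      case True
      have "x' \<in> B (- int k)" if "x' \<in> bl x (- int k)" for x'
        using bl_trans[OF zero_closed, of x "- int k" x'] True that by (simp add: bl_zero)
      then show ?thesis using True by auto
    next
      case False
      then have "x \<noteq> \<zero>" by auto
      then obtain n where n: "x \<in> B n" "x \<notin> B (n - 1)" using shell_exists x by blast
      have nk: "- int k \<le> n - 1" using False n B_le[of x n "- int k"] by linarith
      have "nrm x' = nrm x \<and> x' \<notin> B (- int k)" if x': "x' \<in> bl x (n - 1)" for x'
      proof -
        have "x' \<in> B n" using bl_trans[OF zero_closed, of x n x'] n(1) bl_mono[of "n - 1" n x] x' by (auto simp: bl_zero)
        moreover have "x' \<notin> B (n - 1)"
          using bl_trans[OF zero_closed, of x' "n - 1" x] bl_sym[OF x x'] n(2) by (auto simp: bl_zero)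
        ultimately show ?thesis using nrm_shell n nk B_le by metis
      qed
      then show ?thesis using False by (intro exI[of _ "n - 1"]) auto
    qed
  qed simp
qed

definition symb :: "'a \<Rightarrow> real" where "symb \<xi> = nrm \<xi> powr \<alpha>"

definition E :: "real \<Rightarrow> 'a \<Rightarrow> complex" where "E t \<xi> = complex_of_real (exp (- t * symb \<xi>))"

lemma symb_nonneg [simp]: "symb \<xi> \<ge> 0"
  by (simp add: symb_def)

lemma symb_measurable [measurable]: "symb \<in> borel_measurable M"
  unfolding symb_def[abs_def] by measurable

lemma E_measurable [measurable]: "E t \<in> borel_measurable M"
  unfolding E_def[abs_def] by measurable

lemma E_le_1: "t \<ge> 0 \<Longrightarrow> cmod (E t \<xi>) \<le> 1"
  by (simp add: E_def)

lemma E_0 [simp]: "E 0 \<xi> = 1"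
  by (simp add: E_def)

text \<open>Choose \<open>k\<close> with \<open>\<alpha> * k \<ge> 2\<close>; the inequality
  \<open>z / k \<le> exp (z / k)\<close>, raised to the power \<open>k\<close>, bounds the square of
  \<open>y\<close> by a multiple of \<open>exp (t * y powr \<alpha>)\<close>. With \<open>y\<close>
  the volume of a ball, value times volume on its shell is at most \<open>C\<close> divided by the
  volume.\<close>

lemma exp_neg_powr_bound:
  assumes t: "t > 0" shows "\<exists>C>0. \<forall>y\<ge>1. exp (- t * y powr \<alpha>) * y \<le> C / y"
proof -
  obtain k where k: "real k > 2 / \<alpha>" using reals_Archimedean2 by blast
  have k0: "real k > 0" using k \<alpha>_pos by (meson divide_pos_pos less_trans zero_less_numeral)
  have ka: "\<alpha> * real k \<ge> 2" using k \<alpha>_pos by (simp add: divide_less_eq mult.commute)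
  define C where "C = (real k / t) ^ k"
  have C: "C > 0" using k0 t by (simp add: C_def)
  have "exp (- t * y powr \<alpha>) * y \<le> C / y" if y: "y \<ge> 1" for y
  proof -
    let ?z = "t * y powr \<alpha>"
    have z: "?z \<ge> 0" using t by simp
    have "(t / real k) ^ k * y\<^sup>2 \<le> (t / real k) ^ k * y powr (\<alpha> * real k)"
      using powr_mono[OF ka y] y t by (intro mult_left_mono) (auto simp: powr_numeral)
    also have "\<dots> = (?z / real k) ^ k"
      using y by (simp add: power_mult_distrib[symmetric] powr_realpow[symmetric] powr_powr[symmetric] power_divide)
        (simp add: powr_realpow power_mult_distrib)
    also have "\<dots> \<le> exp (?z / real k) ^ k"
    proof (rule power_mono)
      show "?z / real k \<le> exp (?z / real k)" using exp_ge_add_one_self[of "?z / real k"] by linarith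
      show "0 \<le> ?z / real k" using z by simp
    qed
    also have "\<dots> = exp ?z" using k0 by (simp add: exp_of_nat_mult[symmetric])
    finally have "(t / real k) ^ k * y\<^sup>2 \<le> exp ?z" .
    then have "y\<^sup>2 \<le> C * exp ?z"
      using t k0 by (simp add: C_def power_divide field_simps)
    then have "y * y * exp (- ?z) \<le> C"
      by (simp add: exp_minus power2_eq_square divide_inverse[symmetric] pos_divide_le_eq)
    then show ?thesis using y by (simp add: field_simps)
  qed
  then show ?thesis using C by blast
qed

lemma exp_\<psi>_ge: "exp (\<psi> (int n)) \<ge> 2 ^ n"
proof -
  have "(2::real) ^ n = exp (real n * ln 2)" by (simp add: exp_of_nat_mult)
  then show ?thesis using \<psi>_ge[of n] by simp
qed

text \<open>The integrand is covered by a sum of multiples of ball indicators, one for each shell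
  outside \<open>B 0\<close>; the integrals of the terms decay geometrically.\<close>

lemma E_integrable: assumes t: "t > 0" shows "integrable M (E t)"
proof -
  obtain C where C: "C > 0" "\<And>y. y \<ge> 1 \<Longrightarrow> exp (- t * y powr \<alpha>) * y \<le> C / y"
    using exp_neg_powr_bound[OF t] by blast
  \<comment> \<open>The index 0 gets coefficient 1 because \<open>B 0\<close> collects zero and all
    shells of nonpositive index, where \<open>E t\<close> is merely bounded by 1.\<close>
  define c where "c n = (if n = 0 then 1 else exp (- t * exp (\<psi> (int n)) powr \<alpha>))" for n :: nat
  have c: "c n * exp (\<psi> (int n)) \<le> (C + 1) * (1 / 2) ^ n" for n
  proof (cases "n = 0")
    case False
    have y: "exp (\<psi> (int n)) \<ge> 1" using exp_\<psi>_ge[of n] one_le_power[of "2::real" n] by linarith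
    have "c n * exp (\<psi> (int n)) \<le> C / exp (\<psi> (int n))" using C(2)[OF y] False by (simp add: c_def)
    also have "\<dots> \<le> C / 2 ^ n" using C exp_\<psi>_ge[of n] by (intro divide_left_mono) auto
    also have "\<dots> \<le> (C + 1) * (1 / 2) ^ n" by (simp add: power_divide divide_right_mono)
    finally show ?thesis .
  qed (use C in \<open>simp add: c_def \<psi>_0\<close>)
  have "(\<integral>\<^sup>+\<xi>. ennreal (cmod (E t \<xi>)) \<partial>M) \<le> (\<integral>\<^sup>+\<xi>. (\<Sum>n. ennreal (c n) * indicator (B (int n)) \<xi>) \<partial>M)"
  proof (rule nn_integral_mono)
    fix \<xi> assume "\<xi> \<in> space M"
    then have \<xi>: "\<xi> \<in> carrier R" by (simp add: space_M)
    show "ennreal (cmod (E t \<xi>)) \<le> (\<Sum>n. ennreal (c n) * indicator (B (int n)) \<xi>)"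
    proof (cases "\<xi> \<in> B 0")
      case True
      then have "ennreal (cmod (E t \<xi>)) \<le> ennreal (c 0) * indicator (B (int 0)) \<xi>"
        using t E_le_1[of t \<xi>] by (simp add: c_def)
      also have "\<dots> \<le> (\<Sum>n. ennreal (c n) * indicator (B (int n)) \<xi>)" by (rule ennreal_le_suminf)
      finally show ?thesis .
    next
      case False
      then have "\<xi> \<noteq> \<zero>" by auto
      then obtain j where j: "\<xi> \<in> B j" "\<xi> \<notin> B (j - 1)" using shell_exists \<xi> by blast
      have j0: "j > 0" using False B_le[OF j(1), of 0] by linarith
      then have jn: "int (nat j) = j" by simp
      have "ennreal (cmod (E t \<xi>)) = ennreal (c (nat j)) * indicator (B (int (nat j))) \<xi>"
        using j0 j by (simp add: E_def symb_def nrm_shell[OF j] c_def)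
      also have "\<dots> \<le> (\<Sum>n. ennreal (c n) * indicator (B (int n)) \<xi>)" by (rule ennreal_le_suminf)
      finally show ?thesis .
    qed
  qed
  also have "\<dots> = (\<Sum>n. \<integral>\<^sup>+\<xi>. ennreal (c n) * indicator (B (int n)) \<xi> \<partial>M)"
    by (rule nn_integral_suminf) measurable
  also have "\<dots> = (\<Sum>n. ennreal (c n * exp (\<psi> (int n))))"
    by (simp add: nn_integral_cmult_indicator emeasure_B ennreal_mult c_def)
  also have "\<dots> \<le> (\<Sum>n. ennreal ((C + 1) * (1 / 2) ^ n))"
    by (intro suminf_le summableI ennreal_leI c)
  also have "\<dots> = ennreal (\<Sum>n. (C + 1) * (1 / 2) ^ n)"
    using C by (intro suminf_ennreal2) (auto intro!: summable_mult summable_geometric)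
  finally have "(\<integral>\<^sup>+\<xi>. ennreal (cmod (E t \<xi>)) \<partial>M) < \<infinity>" by (rule le_less_trans) simp
  then show ?thesis by (auto intro!: integrableI_bounded)
qed

lemma E_L2: assumes t: "t > 0" shows "E t \<in> L2 M"
proof (rule L2_bound[OF integrable_norm[OF E_integrable[OF t]] E_measurable])
  show "AE x in M. (cmod (E t x))\<^sup>2 \<le> norm (E t x)"
    using E_le_1[of t] t by (intro AE_I2) (simp add: power2_eq_square mult_left_le)
qed

lemma exp_diff_le: assumes "a \<ge> 0" "b \<ge> 0" shows "\<bar>exp (- a) - exp (- b)\<bar> \<le> \<bar>a - b :: real\<bar>"
proof -
  have *: "exp (- a) - exp (- b) \<le> b - a" if "0 \<le> a" "a \<le> b" for a b :: real
  proof -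
    have "exp (- a) - exp (- b) = exp (- a) * (1 - exp (a - b))" by (simp add: right_diff_distrib exp_add[symmetric])
    also have "\<dots> \<le> 1 * (1 - exp (a - b))" using that by (intro mult_right_mono) auto
    also have "\<dots> \<le> b - a" unfolding mult_1 using exp_ge_add_one_self[of "a - b"] by linarith
    finally show ?thesis .
  qed
  show ?thesis using *[of a b] *[of b a] assms by (cases "a \<le> b") (auto simp: abs_real_def)
qed

text \<open>Dominated convergence is about sequences, so the limit within \<open>{0..}\<close> is
  tested along sequences that avoid \<open>t\<close>.\<close>

lemma L2_norm_tendsto_0_dominated:
  fixes d :: "real \<Rightarrow> 'a \<Rightarrow> complex" and t :: real
  assumes meas: "\<And>s. s \<ge> 0 \<Longrightarrow> d s \<in> borel_measurable M" and w: "integrable M w"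
    and lim: "\<And>x. x \<in> carrier R \<Longrightarrow> ((\<lambda>s. d s x) \<longlongrightarrow> 0) (at t within {0..})"
    and bound: "\<And>s x. s \<ge> 0 \<Longrightarrow> s \<noteq> t \<Longrightarrow> x \<in> carrier R \<Longrightarrow> (cmod (d s x))\<^sup>2 \<le> w x"
  shows "((\<lambda>s. L2_norm M (d s)) \<longlongrightarrow> 0) (at t within {0..})"
  unfolding tendsto_at_iff_sequentially
proof (intro allI impI)
  fix X :: "nat \<Rightarrow> real" assume X: "\<forall>i. X i \<in> {0..} - {t}" "X \<longlonglongrightarrow> t"
  have "(\<lambda>i. LINT x|M. (cmod (d (X i) x))\<^sup>2) \<longlonglongrightarrow> (LINT x|M. 0)"
  proof (rule integral_dominated_convergence[where w = w])
    show "AE x in M. (\<lambda>i. (cmod (d (X i) x))\<^sup>2) \<longlonglongrightarrow> 0"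
    proof (rule AE_I2)
      fix x assume "x \<in> space M"
      then have "((\<lambda>s. d s x) \<circ> X) \<longlonglongrightarrow> 0"
        using lim[of x] X unfolding tendsto_at_iff_sequentially by (simp add: space_M)
      then have "(\<lambda>i. (cmod (d (X i) x))\<^sup>2) \<longlonglongrightarrow> (cmod 0)\<^sup>2"
        unfolding comp_def by (intro tendsto_intros)
      then show "(\<lambda>i. (cmod (d (X i) x))\<^sup>2) \<longlonglongrightarrow> 0" by simp
    qed
    show "AE x in M. norm ((cmod (d (X i) x))\<^sup>2) \<le> w x" for i
      using bound[of "X i"] X by (intro AE_I2) (auto simp: space_M)
    show "(\<lambda>x. (cmod (d (X i) x))\<^sup>2) \<in> borel_measurable M" for i
    proof -
      have "d (X i) \<in> borel_measurable M" using X by (intro meas) auto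
      then show ?thesis by measurable
    qed
  qed (use w in auto)
  then have "(\<lambda>i. sqrt (LINT x|M. (cmod (d (X i) x))\<^sup>2)) \<longlonglongrightarrow> sqrt 0"
    by (intro tendsto_real_sqrt) simp
  then show "((\<lambda>s. L2_norm M (d s)) \<circ> X) \<longlonglongrightarrow> 0" by (simp add: L2_norm_def comp_def)
qed

text \<open>By isometry the norm can be computed on the Fourier side. There the function is
  \<open>g\<close> times a difference quotient of an exponential minus its derivative: it tends to 0
  pointwise, and quotient and derivative are both bounded by \<open>symb\<close>, so the hypothesis
  on \<open>symb * g\<close> supplies the dominating function.\<close>

lemma heat_solution_differentiable:
  fixes g :: "'a \<Rightarrow> complex" and t :: real
  assumes g: "g \<in> L2 M" and mg: "(\<lambda>\<xi>. symb \<xi> * g \<xi>) \<in> L2 M" and t: "t \<ge> 0"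
    and u: "\<And>s. s \<ge> 0 \<Longrightarrow> isF (u s) (\<lambda>\<xi>. g \<xi> * E s \<xi>)"
    and v: "isF v (\<lambda>\<xi>. symb \<xi> * g \<xi> * E t \<xi>)"
  shows "((\<lambda>s. L2_norm M (\<lambda>x. (u s x - u t x) / complex_of_real (s - t) - (- v x))) \<longlongrightarrow> 0) (at t within {0..})"
proof -
  define d where "d s \<xi> = 1 / complex_of_real (s - t) * (g \<xi> * E s \<xi> - g \<xi> * E t \<xi>) + 1 * (symb \<xi> * g \<xi> * E t \<xi>)" for s \<xi>
  have d: "isF (\<lambda>x. 1 / complex_of_real (s - t) * (u s x - u t x) + 1 * v x) (d s)" if "s \<ge> 0" for s
    unfolding d_def[abs_def] by (rule isF_linear[OF isF_diff[OF u[OF that] u[OF t]] v])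
  have eq: "L2_norm M (\<lambda>x. (u s x - u t x) / complex_of_real (s - t) - (- v x)) = L2_norm M (d s)" if "s \<ge> 0" for s
    using isF_norm_eq[OF d[OF that]] by simp
  have "((\<lambda>s. L2_norm M (d s)) \<longlongrightarrow> 0) (at t within {0..})"
  proof (rule L2_norm_tendsto_0_dominated[where w = "\<lambda>\<xi>. 4 * (cmod (symb \<xi> * g \<xi>))\<^sup>2"])
    show "d s \<in> borel_measurable M" if "s \<ge> 0" for s using isF_L2(2)[OF d[OF that]] by (rule L2_measurable)
    show "integrable M (\<lambda>\<xi>. 4 * (cmod (symb \<xi> * g \<xi>))\<^sup>2)" using mg by (intro integrable_mult_right L2_integrable)
  next
    fix \<xi> assume "\<xi> \<in> carrier R"
    have "((\<lambda>s. exp (- s * symb \<xi>)) has_real_derivative (- symb \<xi> * exp (- t * symb \<xi>))) (at t within {0..})"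
      by (auto intro!: derivative_eq_intros)
    then have "((\<lambda>s. (exp (- s * symb \<xi>) - exp (- t * symb \<xi>)) / (s - t)) \<longlongrightarrow> - symb \<xi> * exp (- t * symb \<xi>)) (at t within {0..})"
      by (simp add: has_field_derivative_iff)
    then have "((\<lambda>s. g \<xi> * complex_of_real ((exp (- s * symb \<xi>) - exp (- t * symb \<xi>)) / (s - t)) + symb \<xi> * g \<xi> * E t \<xi>)
        \<longlongrightarrow> g \<xi> * complex_of_real (- symb \<xi> * exp (- t * symb \<xi>)) + symb \<xi> * g \<xi> * E t \<xi>) (at t within {0..})"
      by (intro tendsto_intros)
    then show "((\<lambda>s. d s \<xi>) \<longlongrightarrow> 0) (at t within {0..})"
      by (simp add: d_def E_def right_diff_distrib diff_divide_distrib)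
  next
    fix s \<xi> assume s: "s \<ge> 0" "s \<noteq> t"
    have "\<bar>exp (- (s * symb \<xi>)) - exp (- (t * symb \<xi>))\<bar> \<le> \<bar>s * symb \<xi> - t * symb \<xi>\<bar>"
      using s t by (intro exp_diff_le) auto
    also have "\<dots> = \<bar>s - t\<bar> * symb \<xi>" by (simp add: left_diff_distrib[symmetric] abs_mult)
    finally have "\<bar>exp (- (s * symb \<xi>)) - exp (- (t * symb \<xi>))\<bar> / \<bar>s - t\<bar> \<le> symb \<xi>"
      using s by (simp add: pos_divide_le_eq mult.commute)
    then have "cmod (1 / complex_of_real (s - t) * (E s \<xi> - E t \<xi>)) \<le> symb \<xi>"
      by (simp add: E_def norm_mult norm_divide of_real_diff[symmetric] del: of_real_diff)
    then have 1: "cmod (g \<xi>) * cmod (1 / complex_of_real (s - t) * (E s \<xi> - E t \<xi>)) \<le> cmod (g \<xi>) * symb \<xi>"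
      by (rule mult_left_mono) simp
    have "symb \<xi> * cmod (g \<xi>) * cmod (E t \<xi>) \<le> symb \<xi> * cmod (g \<xi>) * 1"
      using E_le_1[OF t] by (intro mult_left_mono) auto
    then have 2: "cmod (symb \<xi> * g \<xi> * E t \<xi>) \<le> cmod (g \<xi>) * symb \<xi>" by (simp add: norm_mult mult.commute)
    have "d s \<xi> = g \<xi> * (1 / complex_of_real (s - t) * (E s \<xi> - E t \<xi>)) + symb \<xi> * g \<xi> * E t \<xi>"
      by (simp add: d_def algebra_simps)
    then have "cmod (d s \<xi>) \<le> 2 * (cmod (g \<xi>) * symb \<xi>)"
      using norm_triangle_ineq[of "g \<xi> * (1 / complex_of_real (s - t) * (E s \<xi> - E t \<xi>))" "symb \<xi> * g \<xi> * E t \<xi>"] 1 2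
      unfolding norm_mult[of "g \<xi>"] by simp
    then have "(cmod (d s \<xi>))\<^sup>2 \<le> (2 * (cmod (g \<xi>) * symb \<xi>))\<^sup>2" by (rule power_mono) simp
    then show "(cmod (d s \<xi>))\<^sup>2 \<le> 4 * (cmod (symb \<xi> * g \<xi>))\<^sup>2"
      by (simp add: norm_mult power_mult_distrib mult.commute)
  qed
  then show ?thesis
    by (rule Lim_transform_eventually)
      (unfold eventually_at_filter, intro always_eventually allI impI, rule eq[symmetric], simp)
qed

text \<open>Isometry and domination again; \<open>E s\<close> is continuous in \<open>s\<close> and
  bounded by 1, which bounds the difference by twice \<open>symb * g\<close>.\<close>

lemma heat_solution_derivative_continuous:
  fixes g :: "'a \<Rightarrow> complex" and t :: real
  assumes mg: "(\<lambda>\<xi>. symb \<xi> * g \<xi>) \<in> L2 M" and t: "t \<ge> 0"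
    and v: "\<And>s. s \<ge> 0 \<Longrightarrow> isF (v s) (\<lambda>\<xi>. symb \<xi> * g \<xi> * E s \<xi>)"
  shows "((\<lambda>s. L2_norm M (\<lambda>x. - v s x - (- v t x))) \<longlongrightarrow> 0) (at t within {0..})"
proof -
  define d where "d s \<xi> = symb \<xi> * g \<xi> * E t \<xi> - symb \<xi> * g \<xi> * E s \<xi>" for s \<xi>
  have d: "isF (\<lambda>x. v t x - v s x) (d s)" if "s \<ge> 0" for s
    unfolding d_def[abs_def] by (rule isF_diff[OF v[OF t] v[OF that]])
  have eq: "L2_norm M (\<lambda>x. - v s x - (- v t x)) = L2_norm M (d s)" if "s \<ge> 0" for s
    using isF_norm_eq[OF d[OF that]] by simp
  have "((\<lambda>s. L2_norm M (d s)) \<longlongrightarrow> 0) (at t within {0..})"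
  proof (rule L2_norm_tendsto_0_dominated[where w = "\<lambda>\<xi>. 4 * (cmod (symb \<xi> * g \<xi>))\<^sup>2"])
    show "d s \<in> borel_measurable M" if "s \<ge> 0" for s using isF_L2(2)[OF d[OF that]] by (rule L2_measurable)
    show "integrable M (\<lambda>\<xi>. 4 * (cmod (symb \<xi> * g \<xi>))\<^sup>2)" using mg by (intro integrable_mult_right L2_integrable)
  next
    fix \<xi> assume "\<xi> \<in> carrier R"
    have "((\<lambda>s. d s \<xi>) \<longlongrightarrow> symb \<xi> * g \<xi> * E t \<xi> - symb \<xi> * g \<xi> * E t \<xi>) (at t within {0..})"
      unfolding d_def E_def by (intro tendsto_intros)
    then show "((\<lambda>s. d s \<xi>) \<longlongrightarrow> 0) (at t within {0..})" by simp
  next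
    fix s \<xi> assume s: "(0::real) \<le> s"
    have le: "cmod (symb \<xi> * g \<xi> * E r \<xi>) \<le> cmod (symb \<xi> * g \<xi>)" if "r \<ge> 0" for r
      using mult_left_mono[OF E_le_1[OF that, of \<xi>], of "cmod (symb \<xi> * g \<xi>)"] by (simp add: norm_mult)
    have "cmod (d s \<xi>) \<le> 2 * cmod (symb \<xi> * g \<xi>)"
      unfolding d_def using norm_triangle_ineq4[of "symb \<xi> * g \<xi> * E t \<xi>" "symb \<xi> * g \<xi> * E s \<xi>"] le[OF t] le[OF s] by linarith
    then have "(cmod (d s \<xi>))\<^sup>2 \<le> (2 * cmod (symb \<xi> * g \<xi>))\<^sup>2" by (rule power_mono) simp
    then show "(cmod (d s \<xi>))\<^sup>2 \<le> 4 * (cmod (symb \<xi> * g \<xi>))\<^sup>2" by (simp add: power_mult_distrib)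
  qed
  then show ?thesis
    by (rule Lim_transform_eventually)
      (unfold eventually_at_filter, intro always_eventually allI impI, rule eq[symmetric], simp)
qed

subsection \<open>The heat kernel as a mixture of uniform densities\<close>

text \<open>The value of \<open>symb\<close> on the shell between \<open>B (- m - 1)\<close> and
  \<open>B (- m)\<close>, by oddness of \<open>\<psi>\<close>. It decreases to 0 as \<open>m\<close>
  grows and is unbounded as \<open>m\<close> tends to minus infinity.\<close>

definition rate :: "int \<Rightarrow> real" where "rate m = exp (- \<alpha> * \<psi> m)"

definition weight :: "real \<Rightarrow> int \<Rightarrow> real" where
  "weight t m = exp (- t * rate m) - exp (- t * rate (m - 1))"

lemma rate_pos: "rate m > 0"
  by (simp add: rate_def)

lemma rate_strict: "m < n \<Longrightarrow> rate n < rate m"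
  using \<psi>_strict[of m n] \<alpha>_pos by (simp add: rate_def)

lemma weight_nonneg: "t \<ge> 0 \<Longrightarrow> weight t m \<ge> 0"
  using rate_strict[of "m - 1" m] by (simp add: weight_def mult_left_mono less_imp_le)

lemma sum_int_telescope:
  fixes a b :: int
  assumes "a \<le> b + 1" shows "(\<Sum>m\<in>{a..b}. f m - f (m - 1)) = f b - (f (a - 1) :: real)"
proof -
  have "a - 1 \<le> b" using assms by simp
  then show ?thesis
  proof (induction b rule: int_ge_induct)
  case (step b)
  have "{a..b + 1} = insert (b + 1) {a..b}" using step.hyps by auto
  then show ?case using step by simp
  qed simp
qed

lemma sum_weight: "a \<le> b + 1 \<Longrightarrow> (\<Sum>m\<in>{a..b}. weight t m) = exp (- t * rate b) - exp (- t * rate (a - 1))"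
  unfolding weight_def by (rule sum_int_telescope)

lemma rate_tendsto_0: "(\<lambda>k. rate (int k)) \<longlonglongrightarrow> 0"
proof (rule tendsto_sandwich[OF _ _ tendsto_const])
  have "rate (int k) \<le> exp (- \<alpha> * ln 2) ^ k" for k
    using mult_left_mono[OF \<psi>_ge[of k], of \<alpha>] \<alpha>_pos
    by (simp add: rate_def exp_of_nat_mult[symmetric] mult.commute mult.left_commute)
  then show "\<forall>\<^sub>F k in sequentially. rate (int k) \<le> exp (- \<alpha> * ln 2) ^ k" by simp
  show "(\<lambda>k. exp (- \<alpha> * ln 2) ^ k) \<longlonglongrightarrow> 0"
    using \<alpha>_pos by (intro LIMSEQ_power_zero) simp
qed (use rate_pos in \<open>auto intro!: always_eventually less_imp_le\<close>)

lemma rate_minus: "rate (- m) = inverse (rate m)"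
  by (simp add: rate_def \<psi>_minus exp_minus)

lemma rate_at_top: "filterlim (\<lambda>k. rate (- int k)) at_top sequentially"
  unfolding rate_minus
  by (rule filterlim_inverse_at_top[OF rate_tendsto_0]) (simp add: rate_pos)

lemma exp_rate_tendsto_1: "(\<lambda>k. exp (- t * rate (int k))) \<longlonglongrightarrow> 1"
proof -
  have "(\<lambda>k. exp (- t * rate (int k))) \<longlonglongrightarrow> exp (- t * 0)"
    by (intro tendsto_intros rate_tendsto_0)
  then show ?thesis by simp
qed

lemma exp_rate_tendsto_0: assumes "t > 0" shows "(\<lambda>k. exp (- t * rate (- int k))) \<longlonglongrightarrow> 0"
proof -
  have "filterlim (\<lambda>k. t * rate (- int k)) at_top sequentially"
    by (rule filterlim_tendsto_pos_mult_at_top[OF tendsto_const assms rate_at_top])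
  then have "filterlim (\<lambda>k. - (t * rate (- int k))) at_bot sequentially"
    by (simp add: filterlim_uminus_at_bot)
  then show ?thesis using filterlim_compose[OF exp_at_bot] by simp
qed

lemma B_minus_swap:
  assumes "x \<in> carrier R" "y \<in> carrier R" shows "x \<ominus> y \<in> B n \<longleftrightarrow> y \<ominus> x \<in> B n"
proof -
  have "x \<ominus> y = \<ominus> (y \<ominus> x)" using assms by algebra
  then show ?thesis using assms by (simp add: B_neg_iff)
qed

text \<open>The mixture truncated to finitely many levels; it is the transform of
  \<open>symb_trunc\<close>. The approximation is dominated by \<open>E t\<close> on the Fourier
  side and increasing on this side, so a convergence theorem is available on each.\<close>

definition zk :: "real \<Rightarrow> nat \<Rightarrow> 'a \<Rightarrow> real" where
  "zk t k x = (\<Sum>m\<in>{- int k..int k}. weight t m * exp (- \<psi> m) * indicator (B m) x)"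

definition symb_trunc :: "real \<Rightarrow> nat \<Rightarrow> 'a \<Rightarrow> real" where
  "symb_trunc t k \<xi> = (\<Sum>m\<in>{- int k..int k}. weight t m * indicator (B (- m)) \<xi>)"

text \<open>\<open>B (- m)\<close> contains \<open>\<xi>\<close> exactly when
  \<open>m \<le> j\<close>, so the weights telescope; for large \<open>k\<close> only the boundary
  term at the lower end separates the sum from \<open>exp (- t * rate j)\<close>.\<close>

lemma symb_trunc_eq:
  assumes j: "\<xi> \<in> B (- j)" "\<xi> \<notin> B (- j - 1)"
  shows "symb_trunc t k \<xi> = (if j < - int k then 0 else exp (- t * rate (min j (int k))) - exp (- t * rate (- int k - 1)))"
proof -
  have iff: "\<xi> \<in> B (- m) \<longleftrightarrow> m \<le> j" for m
    using B_le[OF j(1), of "- m"] B_le[of \<xi> "- m" "- j - 1"] j(2) by force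
  have "symb_trunc t k \<xi> = (\<Sum>m\<in>{- int k..int k} \<inter> {..j}. weight t m)"
    unfolding symb_trunc_def by (rule sum.mono_neutral_cong_right) (auto simp: iff)
  also have "{- int k..int k} \<inter> {..j} = {- int k..min j (int k)}" by auto
  finally show ?thesis by (simp add: sum_weight)
qed

lemma E_shell: "\<xi> \<in> B (- j) \<Longrightarrow> \<xi> \<notin> B (- j - 1) \<Longrightarrow> E t \<xi> = complex_of_real (exp (- t * rate j))"
  using nrm_shell[of \<xi> "- j"] by (simp add: E_def symb_def rate_def \<psi>_minus powr_def)

lemma symb_trunc_tendsto:
  assumes t: "t > 0" and \<xi>: "\<xi> \<in> carrier R"
  shows "(\<lambda>k. complex_of_real (symb_trunc t k \<xi>)) \<longlonglongrightarrow> E t \<xi>"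
    and "\<bar>symb_trunc t k \<xi>\<bar> \<le> cmod (E t \<xi>)"
proof -
  have l0: "(\<lambda>k. exp (- t * rate (- int k - 1))) \<longlonglongrightarrow> 0"
  proof -
    have "- int (Suc k) = - int k - 1" for k by simp
    then show ?thesis using LIMSEQ_Suc[OF exp_rate_tendsto_0[OF t]] by (simp only:)
  qed
  have "(\<lambda>k. complex_of_real (symb_trunc t k \<xi>)) \<longlonglongrightarrow> E t \<xi> \<and> \<bar>symb_trunc t k \<xi>\<bar> \<le> cmod (E t \<xi>)"
  proof (cases "\<xi> = \<zero>")
    case True
    \<comment> \<open>Zero lies in no shell: all indicators are 1 there, and the sum is the total
      weight.\<close>
    have eq: "symb_trunc t k \<xi> = exp (- t * rate (int k)) - exp (- t * rate (- int k - 1))" for k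
      unfolding symb_trunc_def using True by (simp add: sum_weight)
    have E: "E t \<xi> = 1" using True \<alpha>_pos by (simp add: E_def symb_def nrm_zero)
    have "(\<lambda>k. complex_of_real (symb_trunc t k \<xi>)) \<longlonglongrightarrow> complex_of_real (1 - 0)"
      unfolding eq by (intro tendsto_of_real tendsto_diff exp_rate_tendsto_1 l0)
    moreover have "\<bar>symb_trunc t k \<xi>\<bar> \<le> 1"
    proof -
      have "exp (- t * rate (- int k - 1)) \<le> exp (- t * rate (int k))" "exp (- t * rate (int k)) \<le> 1"
        using t rate_strict[of "- int k - 1" "int k"] rate_pos[of "int k"] by (auto simp: mult_left_mono)
      moreover have "0 < exp (- t * rate (- int k - 1))" by simp
      ultimately show ?thesis unfolding eq abs_le_iff by linarith
    qed
    ultimately show ?thesis by (simp add: E)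
  next
    case False
    then obtain n where n: "\<xi> \<in> B n" "\<xi> \<notin> B (n - 1)" using shell_exists \<xi> by blast
    define j where "j = - n"
    have j: "\<xi> \<in> B (- j)" "\<xi> \<notin> B (- j - 1)" using n by (simp_all add: j_def)
    note E = E_shell[OF j, of t]
    have "\<forall>\<^sub>F k in sequentially. exp (- t * rate j) - exp (- t * rate (- int k - 1)) = symb_trunc t k \<xi>"
      unfolding eventually_sequentially by (rule exI[of _ "nat \<bar>j\<bar>"]) (auto simp: symb_trunc_eq[OF j] min_def)
    moreover have "(\<lambda>k. exp (- t * rate j) - exp (- t * rate (- int k - 1))) \<longlonglongrightarrow> exp (- t * rate j) - 0"
      by (intro tendsto_diff tendsto_const l0)
    ultimately have "(\<lambda>k. symb_trunc t k \<xi>) \<longlonglongrightarrow> exp (- t * rate j)"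
      by (simp add: Lim_transform_eventually)
    then have "(\<lambda>k. complex_of_real (symb_trunc t k \<xi>)) \<longlonglongrightarrow> E t \<xi>" unfolding E by (rule tendsto_of_real)
    moreover have "\<bar>symb_trunc t k \<xi>\<bar> \<le> exp (- t * rate j)"
    proof (cases "j < - int k")
      case False
      have "rate j \<le> rate (min j (int k))" using rate_strict[of "int k" j] by (auto simp: min_def)
      then have "exp (- t * rate (min j (int k))) \<le> exp (- t * rate j)" using t by simp
      moreover have "rate (min j (int k)) \<le> rate (- int k - 1)"
        using rate_strict[of "- int k - 1" "min j (int k)"] False by auto
      then have "exp (- t * rate (- int k - 1)) \<le> exp (- t * rate (min j (int k)))" using t by simp
      moreover have "0 < exp (- t * rate (- int k - 1))" by simp
      ultimately show ?thesis unfolding symb_trunc_eq[OF j] abs_le_iff using False by (simp only: if_False) linarith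
    qed (simp add: symb_trunc_eq[OF j])
    ultimately show ?thesis by (simp add: E)
  qed
  then show "(\<lambda>k. complex_of_real (symb_trunc t k \<xi>)) \<longlonglongrightarrow> E t \<xi>" "\<bar>symb_trunc t k \<xi>\<bar> \<le> cmod (E t \<xi>)"
    by blast+
qed

lemma ft_symb_trunc:
  assumes x: "x \<in> carrier R"
  shows "ft (\<lambda>\<xi>. complex_of_real (symb_trunc t k \<xi>)) x = complex_of_real (zk t k x)"
proof -
  have int: "integrable M (\<lambda>\<xi>. indicator (B m) \<xi> * ch (x \<otimes> \<xi>))" for m
    using integrable_ch_mult[OF ind_bl_L1_L2(1)[OF zero_closed, of m] x] by (simp add: bl_zero)
  have ind: "complex_of_real (indicator (B m) \<xi>) = indicator (B m) \<xi>" for m \<xi>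
    by (simp add: indicator_def)
  have "ft (\<lambda>\<xi>. complex_of_real (symb_trunc t k \<xi>)) x =
      (LINT \<xi>|M. (\<Sum>m\<in>{- int k..int k}. complex_of_real (weight t m) * (indicator (B (- m)) \<xi> * ch (x \<otimes> \<xi>))))"
    unfolding ft_def symb_trunc_def
    by (intro Bochner_Integration.integral_cong[OF refl])
      (simp only: of_real_sum of_real_mult sum_distrib_right mult.assoc ind)
  also have "\<dots> = (\<Sum>m\<in>{- int k..int k}. complex_of_real (weight t m) * (LINT \<xi>|M. indicator (B (- m)) \<xi> * ch (x \<otimes> \<xi>)))"
    using int by (subst Bochner_Integration.integral_sum) auto
  also have "\<dots> = complex_of_real (zk t k x)"
    unfolding zk_def by (simp only: integral_ch_ball[OF x] of_real_sum of_real_mult ind mult.assoc \<psi>_minus group_add_class.minus_minus)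
  finally show ?thesis .
qed

lemma zk_tendsto:
  assumes t: "t > 0" and x: "x \<in> carrier R"
  shows "(\<lambda>k. complex_of_real (zk t k x)) \<longlonglongrightarrow> ft (E t) x"
proof -
  have meas: "(\<lambda>\<xi>. complex_of_real (symb_trunc t k \<xi>)) \<in> borel_measurable M" for k
    unfolding symb_trunc_def by measurable
  have "(\<lambda>k. ft (\<lambda>\<xi>. complex_of_real (symb_trunc t k \<xi>)) x) \<longlonglongrightarrow> ft (E t) x"
    unfolding ft_def
  proof (rule integral_dominated_convergence[where w = "\<lambda>\<xi>. cmod (E t \<xi>)"])
    show "AE \<xi> in M. (\<lambda>k. complex_of_real (symb_trunc t k \<xi>) * ch (x \<otimes> \<xi>)) \<longlonglongrightarrow> E t \<xi> * ch (x \<otimes> \<xi>)"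
      using symb_trunc_tendsto(1)[OF t] by (intro AE_I2 tendsto_intros) (simp add: space_M)
    show "AE \<xi> in M. norm (complex_of_real (symb_trunc t k \<xi>) * ch (x \<otimes> \<xi>)) \<le> cmod (E t \<xi>)" for k
      using symb_trunc_tendsto(2)[OF t] by (intro AE_I2) (simp add: norm_mult space_M)
    show "(\<lambda>\<xi>. complex_of_real (symb_trunc t k \<xi>) * ch (x \<otimes> \<xi>)) \<in> borel_measurable M" for k
      by (intro borel_measurable_times meas ch_mult_measurable[OF x])
    show "(\<lambda>\<xi>. E t \<xi> * ch (x \<otimes> \<xi>)) \<in> borel_measurable M"
      by (intro borel_measurable_times E_measurable ch_mult_measurable[OF x])
    show "integrable M (\<lambda>\<xi>. cmod (E t \<xi>))" using E_integrable[OF t] by simp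
  qed
  then show ?thesis by (simp add: ft_symb_trunc[OF x])
qed

text \<open>Taking the real part loses nothing: \<open>zk_tendsto_Z\<close> exhibits the complex
  value as a limit of real numbers.\<close>

definition Z :: "real \<Rightarrow> 'a \<Rightarrow> real" where "Z t x = Re (ft (E t) (\<ominus> x))"

lemma zk_neg: "x \<in> carrier R \<Longrightarrow> zk t k (\<ominus> x) = zk t k x"
  by (simp add: zk_def B_neg_iff indicator_def)

lemma zk_tendsto_Z:
  assumes t: "t > 0" and x: "x \<in> carrier R"
  shows "(\<lambda>k. zk t k x) \<longlonglongrightarrow> Z t x" and "ft (E t) (\<ominus> x) = complex_of_real (Z t x)"
proof -
  have l: "(\<lambda>k. complex_of_real (zk t k x)) \<longlonglongrightarrow> ft (E t) (\<ominus> x)"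
    using zk_tendsto[OF t, of "\<ominus> x"] x by (simp add: zk_neg)
  from tendsto_Re[OF this] show 1: "(\<lambda>k. zk t k x) \<longlonglongrightarrow> Z t x" by (simp add: Z_def)
  from tendsto_of_real[OF this, where 'a = complex] l show "ft (E t) (\<ominus> x) = complex_of_real (Z t x)"
    by (rule LIMSEQ_unique[rotated])
qed

lemma zk_mono: assumes "t \<ge> 0" "k \<le> l" shows "zk t k x \<le> zk t l x"
  unfolding zk_def using assms weight_nonneg[OF assms(1)] by (intro sum_mono2) auto

lemma Z_measurable: assumes "t > 0" shows "Z t \<in> borel_measurable M"
proof (rule borel_measurable_LIMSEQ_real)
  show "(\<lambda>k. zk t k x) \<longlonglongrightarrow> Z t x" if "x \<in> space M" for x
    using zk_tendsto_Z(1)[OF assms] that by (simp add: space_M)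
  show "zk t k \<in> borel_measurable M" for k unfolding zk_def[abs_def] by measurable
qed

text \<open>Monotone convergence: the weights are nonnegative, so \<open>zk\<close> increases with
  \<open>k\<close>, and the masses stay below 1 because the weights telescope. The same sums
  reappear as probabilities in \<open>Xp_law\<close>.\<close>

lemma kernel_mass:
  assumes t: "t > 0" and x: "x \<in> carrier R" and A [measurable]: "A \<in> sets M"
  shows "(\<lambda>k. \<Sum>m\<in>{- int k..int k}. weight t m * (measure M (bl x m \<inter> A) / exp (\<psi> m)))
      \<longlonglongrightarrow> (LINT y|M. indicator A y * Z t (x \<ominus> y))"
    and "integrable M (\<lambda>y. indicator A y * Z t (x \<ominus> y))"
proof -
  let ?f = "\<lambda>k y. indicator A y * zk t k (x \<ominus> y)"
  let ?s = "\<lambda>k. \<Sum>m\<in>{- int k..int k}. weight t m * (measure M (bl x m \<inter> A) / exp (\<psi> m))"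
  have fin: "emeasure M (bl x m \<inter> A) < \<infinity>" for m
    using emeasure_mono[of "bl x m \<inter> A" "bl x m" M] bl_sets[OF x] emeasure_ball[OF x, of m]
    by (metis Int_lower1 ennreal_less_top infinity_ennreal_def le_less_trans)
  have set: "bl x m \<inter> A \<in> sets M" for m using bl_sets[OF x] A by blast
  have ff: "?f k y = (\<Sum>m\<in>{- int k..int k}. weight t m * exp (- \<psi> m) * indicator (bl x m \<inter> A) y)"
    if "y \<in> carrier R" for k y
    using that x B_minus_swap[of x y]
    by (auto simp: zk_def sum_distrib_left bl_iff indicator_def intro!: sum.cong)
  have i: "integrable M (\<lambda>y. \<Sum>m\<in>{- int k..int k}. weight t m * exp (- \<psi> m) * indicator (bl x m \<inter> A) y)" for k
    using fin set by (intro Bochner_Integration.integrable_sum integrable_mult_right integrable_real_indicator)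
  have int: "integrable M (?f k)" for k
    using i[of k] ff[of _ k] by (subst Bochner_Integration.integrable_cong[OF refl ff]) (auto simp: space_M)
  have val: "(LINT y|M. ?f k y) = ?s k" for k
  proof -
    have "(LINT y|M. ?f k y) = (LINT y|M. (\<Sum>m\<in>{- int k..int k}. weight t m * exp (- \<psi> m) * indicator (bl x m \<inter> A) y))"
      by (rule Bochner_Integration.integral_cong[OF refl]) (simp add: ff space_M)
    also have "\<dots> = (\<Sum>m\<in>{- int k..int k}. weight t m * exp (- \<psi> m) * measure M (bl x m \<inter> A))"
      using fin set by (subst Bochner_Integration.integral_sum)
        (auto intro!: integrable_mult_right integrable_real_indicator sum.cong simp: sets.Int_space_eq2)
    finally show ?thesis by (simp add: exp_minus divide_inverse ac_simps)
  qed
  have mono: "incseq ?s"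
    unfolding incseq_def using weight_nonneg[of t] t by (auto intro!: sum_mono2)
  have "?s k \<le> 1" for k
  proof -
    have "?s k \<le> (\<Sum>m\<in>{- int k..int k}. weight t m * 1)"
    proof (intro sum_mono mult_left_mono)
      fix m
      have "measure M (bl x m \<inter> A) \<le> measure M (bl x m)"
        using x by (intro measure_mono_fmeasurable fmeasurableI) (auto simp: emeasure_ball set)
      then show "measure M (bl x m \<inter> A) / exp (\<psi> m) \<le> 1" by (simp add: measure_bl[OF x])
    qed (use weight_nonneg t in auto)
    also have "\<dots> = exp (- t * rate (int k)) - exp (- t * rate (- int k - 1))" by (simp add: sum_weight)
    also have "\<dots> \<le> 1"
    proof -
      have "exp (- t * rate (int k)) \<le> 1" using t rate_pos[of "int k"] by simp
      moreover have "0 < exp (- t * rate (- int k - 1))" by simp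
      ultimately show ?thesis by linarith
    qed
    finally show ?thesis .
  qed
  then obtain L where L: "?s \<longlonglongrightarrow> L" using incseq_convergent[OF mono] by blast
  have Zm: "(\<lambda>y. indicator A y * Z t (x \<ominus> y)) \<in> borel_measurable M"
    using measurable_compose[OF measurable_rsub[OF x] Z_measurable[OF t]]
    by (intro borel_measurable_times borel_measurable_indicator A)
  have lim: "AE y in M. (\<lambda>k. ?f k y) \<longlonglongrightarrow> indicator A y * Z t (x \<ominus> y)"
    using zk_tendsto_Z(1)[OF t] x by (intro AE_I2 tendsto_mult tendsto_const) (simp add: space_M)
  have mono': "AE y in M. mono (\<lambda>k. ?f k y)"
    using t by (intro AE_I2 monoI mult_left_mono zk_mono) auto
  have L': "(\<lambda>k. LINT y|M. ?f k y) \<longlonglongrightarrow> L" using L by (simp only: val)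
  note mc = int mono' lim L' Zm
  show "integrable M (\<lambda>y. indicator A y * Z t (x \<ominus> y))" by (rule integrable_monotone_convergence[OF mc])
  have "(LINT y|M. indicator A y * Z t (x \<ominus> y)) = L" by (rule integral_monotone_convergence[OF mc])
  with L show "?s \<longlonglongrightarrow> (LINT y|M. indicator A y * Z t (x \<ominus> y))" by simp
qed

end

section \<open>Compound Poisson processes\<close>

context ultrametric_ring
begin

text \<open>A sample \<open>\<omega>\<close> lists waiting times and jumps.  Absolute values make the arrival times monotone
  for every sample.\<close>

definition arr :: "nat \<Rightarrow> (nat \<Rightarrow> real \<times> 'a) \<Rightarrow> real" where
  "arr n \<omega> = (\<Sum>i<n. \<bar>fst (\<omega> i)\<bar>)"

primrec psum :: "nat \<Rightarrow> (nat \<Rightarrow> real \<times> 'a) \<Rightarrow> 'a" where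
  "psum 0 \<omega> = \<zero>"
| "psum (Suc n) \<omega> = psum n \<omega> \<oplus> snd (\<omega> n)"

text \<open>The strict inequality counts a jump at time \<open>s\<close> itself, which makes
  \<open>cpp\<close> right continuous.\<close>

definition jumps :: "real \<Rightarrow> (nat \<Rightarrow> real \<times> 'a) \<Rightarrow> nat" where
  "jumps s \<omega> = (LEAST n. s < arr (Suc n) \<omega>)"

definition cpp :: "real \<Rightarrow> (nat \<Rightarrow> real \<times> 'a) \<Rightarrow> 'a" where
  "cpp s \<omega> = psum (jumps s \<omega>) \<omega>"

definition vals :: "(nat \<Rightarrow> real \<times> 'a) \<Rightarrow> bool" where
  "vals \<omega> \<longleftrightarrow> (\<forall>i. snd (\<omega> i) \<in> carrier R)"

definition nonexp :: "(nat \<Rightarrow> real \<times> 'a) \<Rightarrow> bool" where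
  "nonexp \<omega> \<longleftrightarrow> (\<forall>s. \<exists>n. s < arr n \<omega>)"

lemma arr_0 [simp]: "arr 0 \<omega> = 0" and arr_Suc: "arr (Suc n) \<omega> = arr n \<omega> + \<bar>fst (\<omega> n)\<bar>"
  by (simp_all add: arr_def)

lemma arr_mono: "m \<le> n \<Longrightarrow> arr m \<omega> \<le> arr n \<omega>"
  unfolding arr_def by (intro sum_mono2) auto

lemma arr_nonneg: "arr n \<omega> \<ge> 0"
  using arr_mono[of 0 n \<omega>] by simp

lemma psum_closed: "vals \<omega> \<Longrightarrow> psum n \<omega> \<in> carrier R"
  by (induction n) (auto simp: vals_def)

lemma cpp_closed: "vals \<omega> \<Longrightarrow> cpp s \<omega> \<in> carrier R"
  by (simp add: cpp_def psum_closed)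

lemma jumps_eq: assumes "arr n \<omega> \<le> s" "s < arr (Suc n) \<omega>" shows "jumps s \<omega> = n"
  unfolding jumps_def
proof (rule Least_equality)
  fix k assume "s < arr (Suc k) \<omega>"
  then show "n \<le> k" using assms(1) arr_mono[of "Suc k" n \<omega>] by (meson not_less_eq_eq not_le order_trans)
qed (rule assms)

lemma jumps_bounds:
  assumes "nonexp \<omega>" "s \<ge> 0" shows "arr (jumps s \<omega>) \<omega> \<le> s" "s < arr (Suc (jumps s \<omega>)) \<omega>"
proof -
  obtain n where "s < arr n \<omega>" using assms by (auto simp: nonexp_def)
  then have "s < arr (Suc n) \<omega>" using arr_mono[of n "Suc n" \<omega>] by simp
  then show "s < arr (Suc (jumps s \<omega>)) \<omega>" unfolding jumps_def by (rule LeastI)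
  show "arr (jumps s \<omega>) \<omega> \<le> s"
  proof (cases "jumps s \<omega>")
    case (Suc k)
    then have "\<not> s < arr (Suc k) \<omega>" using not_less_Least[of k "\<lambda>n. s < arr (Suc n) \<omega>"] by (simp add: jumps_def)
    then show ?thesis using Suc by simp
  qed (use assms in simp)
qed

lemma arr_comb1: "k \<le> n \<Longrightarrow> arr k (comb_seq n \<omega> \<omega>') = arr k \<omega>"
  by (simp add: arr_def comb_seq_def)

lemma arr_comb2: "arr (n + j) (comb_seq n \<omega> \<omega>') = arr n \<omega> + arr j \<omega>'"
proof (induction j)
  case (Suc j)
  then show ?case by (simp add: arr_Suc) (simp add: comb_seq_def)
qed (simp add: arr_comb1)

lemma psum_comb1: "k \<le> n \<Longrightarrow> psum k (comb_seq n \<omega> \<omega>') = psum k \<omega>"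
  by (induction k) (auto simp: comb_seq_def)

lemma psum_comb2:
  assumes "vals \<omega>" "vals \<omega>'" shows "psum (n + j) (comb_seq n \<omega> \<omega>') = psum n \<omega> \<oplus> psum j \<omega>'"
proof (induction j)
  case (Suc j)
  have "snd (\<omega>' j) \<in> carrier R" using assms by (simp add: vals_def)
  then show ?case using Suc psum_closed[OF assms(1), of n] psum_closed[OF assms(2), of j]
    by (simp add: comb_seq_def a_assoc)
qed (simp add: psum_comb1 psum_closed assms)

lemma vals_comb: "vals \<omega> \<Longrightarrow> vals \<omega>' \<Longrightarrow> vals (comb_seq n \<omega> \<omega>')"
  by (simp add: vals_def comb_seq_def)

text \<open>The sample as seen after a time \<open>c\<close> without a jump: only the first waiting
  time is shortened.\<close>

definition red :: "real \<Rightarrow> (nat \<Rightarrow> real \<times> 'a) \<Rightarrow> nat \<Rightarrow> real \<times> 'a" where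
  "red c \<omega> = case_nat (\<bar>fst (\<omega> 0)\<bar> - c, snd (\<omega> 0)) (\<lambda>i. \<omega> (Suc i))"

lemma arr_red: assumes "c \<le> \<bar>fst (\<omega> 0)\<bar>" shows "arr (Suc j) (red c \<omega>) = arr (Suc j) \<omega> - c"
proof (induction j)
  case 0
  then show ?case using assms by (simp add: arr_Suc red_def)
next
  case (Suc j)
  then show ?case by (simp add: arr_Suc[of "Suc j"] red_def)
qed

lemma psum_red: "psum j (red c \<omega>) = psum j \<omega>"
  by (induction j) (auto simp: red_def split: nat.split)

text \<open>\<open>\<omega>'\<close> is spliced behind the first \<open>n\<close> entries of
  \<open>\<omega>\<close>. With exactly \<open>n\<close> jumps up to \<open>s\<close>, the current
  waiting time has already lasted \<open>s - arr n \<omega>\<close>, so the path after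
  \<open>s\<close> runs through \<open>\<omega>'\<close> with its first waiting time reduced by that
  amount.\<close>

lemma cpp_flow:
  assumes v: "vals \<omega>" "vals \<omega>'" and ne: "nonexp \<omega>'" and n: "arr n \<omega> \<le> s" "s < arr n \<omega> + \<bar>fst (\<omega>' 0)\<bar>" and t: "t \<ge> 0"
  shows "cpp (s + t) (comb_seq n \<omega> \<omega>') \<ominus> cpp s (comb_seq n \<omega> \<omega>') = cpp t (red (s - arr n \<omega>) \<omega>')"
proof -
  let ?c = "comb_seq n \<omega> \<omega>'" and ?d = "s - arr n \<omega>"
  have d: "?d \<le> \<bar>fst (\<omega>' 0)\<bar>" using n by simp
  have js: "jumps s ?c = n"
  proof (rule jumps_eq)
    show "arr n ?c \<le> s" using n by (simp add: arr_comb1)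
    show "s < arr (Suc n) ?c" using n arr_comb2[of n 1 \<omega> \<omega>'] by (simp add: arr_Suc)
  qed
  obtain k where k: "s + t < arr k ?c"
  proof -
    obtain i where "s + t < arr i \<omega>'" using ne by (auto simp: nonexp_def)
    then have "s + t < arr (n + i) ?c" using arr_nonneg[of n \<omega>] by (simp add: arr_comb2)
    then show ?thesis by (rule that)
  qed
  have nr: "nonexp (red ?d \<omega>')"
    unfolding nonexp_def
  proof
    fix q
    obtain i where "q + ?d < arr i \<omega>'" using ne by (auto simp: nonexp_def)
    then have "q + ?d < arr (Suc i) \<omega>'" using arr_mono[of i "Suc i" \<omega>'] by simp
    then have "q < arr (Suc i) (red ?d \<omega>')" using arr_red[of ?d \<omega>' i, OF d] by simp
    then show "\<exists>n. q < arr n (red ?d \<omega>')" by blast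
  qed
  define j where "j = jumps t (red ?d \<omega>')"
  have j: "arr j (red ?d \<omega>') \<le> t" "t < arr (Suc j) (red ?d \<omega>')"
    using jumps_bounds[OF nr t] by (simp_all add: j_def)
  have jst: "jumps (s + t) ?c = n + j"
  proof (rule jumps_eq)
    show "arr (n + j) ?c \<le> s + t"
    proof (cases j)
      case 0
      then show ?thesis using n t by (simp add: arr_comb1)
    next
      case (Suc i)
      then show ?thesis using j(1) arr_red[of ?d \<omega>' i, OF d] by (simp add: arr_comb2 del: add_Suc_right)
    qed
    show "s + t < arr (Suc (n + j)) ?c"
      using j(2) arr_red[of ?d \<omega>' j, OF d] arr_comb2[of n "Suc j" \<omega> \<omega>'] by simp
  qed
  have c: "psum n \<omega> \<in> carrier R" "psum j \<omega>' \<in> carrier R" using v psum_closed by auto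
  have "(psum n \<omega> \<oplus> psum j \<omega>') \<ominus> psum n \<omega> = psum j \<omega>'" using c by algebra
  then show ?thesis
    unfolding cpp_def js jst psum_comb2[OF v] psum_comb1[OF order_refl] by (simp add: j_def[symmetric] psum_red)
qed

text \<open>As long as the next jump comes after \<open>s\<close>, the path up to \<open>s\<close>
  reads only the first \<open>n\<close> entries, whatever tail is spliced on.\<close>

lemma cpp_freeze:
  assumes n: "arr n \<omega> \<le> s" and 1: "s < arr n \<omega> + \<bar>fst (\<omega>1 0)\<bar>" and 2: "s < arr n \<omega> + \<bar>fst (\<omega>2 0)\<bar>"
    and r: "0 \<le> r" "r \<le> s"
  shows "cpp r (comb_seq n \<omega> \<omega>1) = cpp r (comb_seq n \<omega> \<omega>2)"
proof -
  \<comment> \<open>\<open>k\<close> counts the jumps up to \<open>r\<close>; it is found from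
    \<open>\<omega>\<close> alone and is therefore common to both tails.\<close>
  have *: "\<exists>k\<le>n. arr k \<omega> \<le> r \<and> (\<forall>\<omega>'. s < arr n \<omega> + \<bar>fst (\<omega>' 0)\<bar> \<longrightarrow> r < arr (Suc k) (comb_seq n \<omega> \<omega>'))"
  proof (cases "arr n \<omega> \<le> r")
    case True
    have "r < arr (Suc n) (comb_seq n \<omega> \<omega>')" if "s < arr n \<omega> + \<bar>fst (\<omega>' 0)\<bar>" for \<omega>'
      using that r arr_comb2[of n 1 \<omega> \<omega>'] by (simp add: arr_Suc)
    then show ?thesis using True by blast
  next
    case False
    define k where "k = (LEAST k. r < arr (Suc k) \<omega>)"
    have n0: "n \<noteq> 0" using False r by (intro notI) simp
    then have "r < arr (Suc (n - 1)) \<omega>" using False by simp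
    then have k: "r < arr (Suc k) \<omega>" "k \<le> n - 1" unfolding k_def by (rule LeastI, rule Least_le)
    have "arr k \<omega> \<le> r"
    proof (cases k)
      case (Suc i)
      then have "\<not> r < arr (Suc i) \<omega>" using not_less_Least[of i "\<lambda>k. r < arr (Suc k) \<omega>"] by (simp add: k_def)
      then show ?thesis using Suc by simp
    qed (use r in simp)
    moreover have "r < arr (Suc k) (comb_seq n \<omega> \<omega>')" for \<omega>'
      using k n0 by (simp add: arr_comb1)
    ultimately show ?thesis using k(2) by (intro exI[of _ k]) auto
  qed
  then obtain k where k: "k \<le> n" "arr k \<omega> \<le> r"
    "r < arr (Suc k) (comb_seq n \<omega> \<omega>1)" "r < arr (Suc k) (comb_seq n \<omega> \<omega>2)" using 1 2 by blast
  have "jumps r (comb_seq n \<omega> \<omega>1) = k" "jumps r (comb_seq n \<omega> \<omega>2) = k"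
    using k by (auto intro!: jumps_eq simp: arr_comb1)
  then show ?thesis using k(1) by (simp add: cpp_def psum_comb1)
qed

lemma arr_case_nat: "arr (Suc k) (case_nat x \<omega>) = \<bar>fst x\<bar> + arr k \<omega>"
  by (induction k) (auto simp: arr_Suc)

lemma psum_case_nat:
  assumes "snd x \<in> carrier R" "vals \<omega>" shows "psum (Suc k) (case_nat x \<omega>) = snd x \<oplus> psum k \<omega>"
proof (induction k)
  case (Suc k)
  have "snd (\<omega> k) \<in> carrier R" using assms by (simp add: vals_def)
  then show ?case using Suc assms psum_closed[OF assms(2), of k] by (simp add: a_assoc)
qed (use assms in simp)

lemma cpp_case_nat:
  assumes "snd x \<in> carrier R" "vals \<omega>" "nonexp \<omega>" "\<bar>fst x\<bar> \<le> t"
  shows "cpp t (case_nat x \<omega>) = snd x \<oplus> cpp (t - \<bar>fst x\<bar>) \<omega>"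
proof -
  have j: "arr (jumps (t - \<bar>fst x\<bar>) \<omega>) \<omega> \<le> t - \<bar>fst x\<bar>" "t - \<bar>fst x\<bar> < arr (Suc (jumps (t - \<bar>fst x\<bar>) \<omega>)) \<omega>"
    using jumps_bounds[OF assms(3), of "t - \<bar>fst x\<bar>"] assms(4) by auto
  have "jumps t (case_nat x \<omega>) = Suc (jumps (t - \<bar>fst x\<bar>) \<omega>)"
    by (rule jumps_eq) (use j in \<open>simp_all add: arr_case_nat\<close>)
  then show ?thesis by (simp only: cpp_def psum_case_nat[OF assms(1,2)])
qed

lemma cpp_before_first: assumes "0 \<le> t" "t < \<bar>fst (\<omega> 0)\<bar>" shows "cpp t \<omega> = \<zero>"
  using jumps_eq[of 0 \<omega> t] assms by (simp add: cpp_def arr_Suc)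

lemma cpp_mem_B: assumes "\<And>i. snd (\<omega> i) \<in> B m" shows "cpp t \<omega> \<in> B m"
proof -
  have "psum n \<omega> \<in> B m" for n by (induction n) (auto intro: B_add assms)
  then show ?thesis by (simp add: cpp_def)
qed

lemma cpp_right_locally_constant:
  assumes "nonexp \<omega>" "t \<ge> 0" shows "\<forall>\<^sub>F r in at_right t. cpp r \<omega> = cpp t \<omega>"
proof -
  have "cpp r \<omega> = cpp t \<omega>" if "t < r" "r < arr (Suc (jumps t \<omega>)) \<omega>" for r
    using that jumps_bounds[OF assms] jumps_eq[of "jumps t \<omega>" \<omega> r] by (simp add: cpp_def)
  then show ?thesis
    using jumps_bounds(2)[OF assms] unfolding eventually_at_right_field by blast
qed

lemma cpp_left_locally_constant:
  assumes "nonexp \<omega>" "t > 0" shows "\<exists>n. \<forall>\<^sub>F r in at_left t. cpp r \<omega> = psum n \<omega>"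
proof -
  define k where "k = (LEAST k. t \<le> arr (Suc k) \<omega>)"
  obtain i where "t < arr i \<omega>" using assms by (auto simp: nonexp_def)
  then have "t \<le> arr (Suc i) \<omega>" using arr_mono[of i "Suc i" \<omega>] by simp
  then have k: "t \<le> arr (Suc k) \<omega>" unfolding k_def by (rule LeastI)
  have k': "arr k \<omega> < t"
  proof (cases k)
    case (Suc i)
    then have "\<not> t \<le> arr (Suc i) \<omega>" using not_less_Least[of i "\<lambda>k. t \<le> arr (Suc k) \<omega>"] by (simp add: k_def)
    then show ?thesis using Suc by simp
  qed (use assms in simp)
  have "cpp r \<omega> = psum k \<omega>" if "arr k \<omega> < r" "r < t" for r
    using that k jumps_eq[of k \<omega> r] by (simp add: cpp_def)
  then show ?thesis using k' unfolding eventually_at_left_field by blast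
qed

end

section \<open>The law of a single compound Poisson process and its independent increments\<close>

locale compound_poisson = ultrametric_ring +
  fixes \<rho> :: real and U :: "'a measure"
  assumes \<rho>_pos: "\<rho> > 0" and U_prob: "prob_space U" and sets_U: "sets U = sets M"
begin

definition Exp :: "real measure" where "Exp = density lborel (exponential_density \<rho>)"

definition Q1 :: "(real \<times> 'a) measure" where "Q1 = Exp \<Otimes>\<^sub>M U"

definition Q :: "(nat \<Rightarrow> real \<times> 'a) measure" where "Q = (\<Pi>\<^sub>M i\<in>(UNIV::nat set). Q1)"

lemma sets_EX [measurable_cong]: "sets Exp = sets borel"
  by (simp add: Exp_def)

lemma sets_U' [measurable_cong]: "sets U = sets M" by (rule sets_U)

lemma space_U: "space U = carrier R"
  using sets_eq_imp_space_eq[OF sets_U] by (simp add: space_M)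

lemma sets_Q1 [measurable_cong]: "sets Q1 = sets (borel \<Otimes>\<^sub>M M)"
  unfolding Q1_def by (intro sets_pair_measure_cong sets_EX sets_U)

lemma sets_Q [measurable_cong]: "sets Q = sets (\<Pi>\<^sub>M i\<in>(UNIV::nat set). (borel \<Otimes>\<^sub>M M))"
  unfolding Q_def by (intro sets_PiM_cong refl sets_Q1)

lemma space_Q: "space Q = {\<omega>. vals \<omega>}"
  using sets_eq_imp_space_eq[OF sets_Q]
  by (auto simp: space_PiM space_pair_measure space_M vals_def PiE_UNIV_domain Pi_iff mem_Times_iff)

lemma EX_prob: "prob_space Exp"
  unfolding Exp_def by (rule prob_space_exponential_density[OF \<rho>_pos])

sublocale Exp: prob_space Exp by (rule EX_prob)
sublocale U: prob_space U by (rule U_prob)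
sublocale EXU: pair_prob_space Exp U ..
sublocale Q1: prob_space Q1 unfolding Q1_def by (rule EXU.prob_space_axioms)
sublocale seq: sequence_space Q1 ..

lemma Q_prob: "prob_space Q"
  unfolding Q_def by (rule seq.P.prob_space_axioms)

sublocale Q: prob_space Q by (rule Q_prob)
sublocale QQ: pair_prob_space Q Q ..
sublocale UQ: pair_prob_space U Q ..

lemma component_measurable: "(\<lambda>\<omega>. \<omega> i) \<in> measurable Q (borel \<Otimes>\<^sub>M M)"
proof -
  have "(\<lambda>\<omega>. \<omega> i) \<in> measurable (\<Pi>\<^sub>M i\<in>(UNIV::nat set). (borel \<Otimes>\<^sub>M M)) (borel \<Otimes>\<^sub>M M)"
    by (rule measurable_component_singleton) simp
  then show ?thesis by (simp cong: measurable_cong_sets add: sets_Q)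
qed

lemma fst_component [measurable]: "(\<lambda>\<omega>. fst (\<omega> i)) \<in> borel_measurable Q"
  by (rule measurable_compose[OF component_measurable measurable_fst])

lemma snd_component [measurable]: "(\<lambda>\<omega>. snd (\<omega> i)) \<in> measurable Q M"
  by (rule measurable_compose[OF component_measurable measurable_snd])

lemma arr_measurable [measurable]: "arr n \<in> borel_measurable Q"
  unfolding arr_def[abs_def] by measurable

lemma psum_measurable [measurable]: "psum n \<in> measurable Q M"
proof (induction n)
  case 0
  have "psum 0 = (\<lambda>\<omega>. \<zero>)" by auto
  then show ?case by (simp add: space_M)
next
  case (Suc n)
  have "psum (Suc n) = (\<lambda>\<omega>. psum n \<omega> \<oplus> snd (\<omega> n))" by auto
  then show ?case using measurable_rplus[OF Suc snd_component] by simp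
qed

lemma jumps_measurable [measurable]: "jumps s \<in> measurable Q (count_space UNIV)"
  unfolding jumps_def[abs_def] by measurable

lemma cpp_measurable [measurable]: "cpp s \<in> measurable Q M"
  unfolding cpp_def[abs_def] by (rule measurable_compose_countable) measurable

lemma nonexp_sets [measurable]: "Measurable.pred Q nonexp"
proof -
  have "nonexp \<omega> \<longleftrightarrow> (\<forall>s::nat. \<exists>n. real s < arr n \<omega>)" for \<omega>
  proof
    assume *: "\<forall>s::nat. \<exists>n. real s < arr n \<omega>"
    show "nonexp \<omega>" unfolding nonexp_def
    proof
      fix s
      obtain m :: nat where "s < real m" using reals_Archimedean2 by blast
      moreover obtain n where "real m < arr n \<omega>" using * by blast
      ultimately show "\<exists>n. s < arr n \<omega>" by (intro exI[of _ n]) simp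
    qed
  qed (auto simp: nonexp_def)
  then have eq: "nonexp = (\<lambda>\<omega>. \<forall>s::nat. \<exists>n. real s < arr n \<omega>)" by auto
  show ?thesis unfolding eq by measurable
qed

lemma EX_abs: "AE e in Exp. \<bar>e\<bar> = e"
  unfolding Exp_def by (subst AE_density) (auto simp: exponential_density_def)

lemma emeasure_EX_gt: assumes "c \<ge> 0" shows "emeasure Exp {e. c < \<bar>e\<bar>} = ennreal (exp (- \<rho> * c))"
proof -
  have D: "distributed Exp lborel (\<lambda>x. x) (exponential_density \<rho>)"
    unfolding distributed_def Exp_def
    by (auto simp: distr_id2 exponential_density_nonneg \<rho>_pos intro!: AE_I2)
  have "emeasure Exp {e. c < \<bar>e\<bar>} = emeasure Exp {e. c < e}"
    using EX_abs by (intro emeasure_eq_AE) auto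
  also have "\<dots> = ennreal (measure Exp {e. c < e})" by (rule Exp.emeasure_eq_measure)
  also have "measure Exp {e. c < e} = exp (- c * \<rho>)"
    using Exp.exponential_distributedD_gt[OF D assms \<rho>_pos] by (simp add: Exp_def)
  finally show ?thesis by (simp add: mult.commute)
qed

text \<open>Substitute \<open>c + e\<close> for \<open>e\<close>: the exponential density picks up
  the factor \<open>exp (- \<rho> * c)\<close>.\<close>

lemma EX_memoryless:
  assumes c: "c \<ge> 0" and g [measurable]: "g \<in> borel_measurable borel"
  shows "(\<integral>\<^sup>+e. indicator {e. c < \<bar>e\<bar>} e * g (\<bar>e\<bar> - c) \<partial>Exp) = ennreal (exp (- \<rho> * c)) * (\<integral>\<^sup>+e. g e \<partial>Exp)"
proof -
  let ?d = "\<lambda>e. ennreal (exponential_density \<rho> e)"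
  have "(\<integral>\<^sup>+e. indicator {e. c < \<bar>e\<bar>} e * g (\<bar>e\<bar> - c) \<partial>Exp) =
      (\<integral>\<^sup>+e. ?d e * (indicator {e. c < \<bar>e\<bar>} e * g (\<bar>e\<bar> - c)) \<partial>lborel)"
    unfolding Exp_def by (rule nn_integral_density) auto
  also have "\<dots> = (\<integral>\<^sup>+e. ?d (c + 1 * e) * (indicator {e. c < \<bar>e\<bar>} (c + 1 * e) * g (\<bar>c + 1 * e\<bar> - c)) \<partial>lborel)"
    by (subst nn_integral_real_affine[where c = 1 and t = c]) auto
  also have "\<dots> = (\<integral>\<^sup>+e. ennreal (exp (- \<rho> * c)) * (?d e * g e) \<partial>lborel)"
  proof (rule nn_integral_cong_AE)
    \<comment> \<open>At \<open>e = 0\<close> the indicator vanishes while the density does not, so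
      this null set is put aside.\<close>
    have "AE e in lborel. e \<noteq> (0::real)" by (rule AE_lborel_singleton)
    then show "AE e in lborel. ?d (c + 1 * e) * (indicator {e. c < \<bar>e\<bar>} (c + 1 * e) * g (\<bar>c + 1 * e\<bar> - c)) =
        ennreal (exp (- \<rho> * c)) * (?d e * g e)"
    proof eventually_elim
      fix e :: real assume "e \<noteq> 0"
      show "?d (c + 1 * e) * (indicator {e. c < \<bar>e\<bar>} (c + 1 * e) * g (\<bar>c + 1 * e\<bar> - c)) =
        ennreal (exp (- \<rho> * c)) * (?d e * g e)"
      proof (cases "e > 0")
        case True
        have "?d (c + e) = ennreal (exp (- \<rho> * c)) * ?d e"
          using True c \<rho>_pos by (simp add: exponential_density_def ennreal_mult[symmetric] exp_add[symmetric] algebra_simps)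
        then show ?thesis using True c by (simp add: mult.assoc)
      next
        case False
        then have "e < 0" using \<open>e \<noteq> 0\<close> by simp
        moreover have "?d (c + e) = 0 \<or> \<bar>c + e\<bar> \<le> c"
          using \<open>e < 0\<close> c by (cases "c + e < 0") (auto simp: exponential_density_def)
        ultimately show ?thesis by (auto simp: exponential_density_def)
      qed
    qed
  qed
  also have "\<dots> = ennreal (exp (- \<rho> * c)) * (\<integral>\<^sup>+e. ?d e * g e \<partial>lborel)"
    by (rule nn_integral_cmult) measurable
  also have "(\<integral>\<^sup>+e. ?d e * g e \<partial>lborel) = (\<integral>\<^sup>+e. g e \<partial>Exp)"
    unfolding Exp_def by (rule nn_integral_density[symmetric]) auto
  finally show ?thesis .
qed

lemma case_nat_measurable: "(\<lambda>(x, \<omega>). case_nat x \<omega>) \<in> measurable (Q1 \<Otimes>\<^sub>M Q) Q"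
  unfolding Q_def by measurable

lemma nn_integral_Q_iter:
  assumes f: "f \<in> borel_measurable Q"
  shows "(\<integral>\<^sup>+\<omega>. f \<omega> \<partial>Q) = (\<integral>\<^sup>+e. \<integral>\<^sup>+v. \<integral>\<^sup>+\<omega>. f (case_nat (e, v) \<omega>) \<partial>Q \<partial>U \<partial>Exp)"
proof -
  have m: "(\<lambda>z. f (case_nat (fst z) (snd z))) \<in> borel_measurable (Q1 \<Otimes>\<^sub>M Q)"
    using measurable_compose[OF case_nat_measurable f] by (simp add: split_beta')
  have "(\<integral>\<^sup>+\<omega>. f \<omega> \<partial>Q) = (\<integral>\<^sup>+\<omega>. f \<omega> \<partial>distr (Q1 \<Otimes>\<^sub>M Q) Q (\<lambda>(x, \<omega>). case_nat x \<omega>))"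
    using seq.PiM_iter unfolding Q_def by simp
  also have "\<dots> = (\<integral>\<^sup>+z. f (case_nat (fst z) (snd z)) \<partial>(Q1 \<Otimes>\<^sub>M Q))"
    using nn_integral_distr[OF case_nat_measurable, of f] f by (simp add: split_beta')
  also have "\<dots> = (\<integral>\<^sup>+x. \<integral>\<^sup>+\<omega>. f (case_nat x \<omega>) \<partial>Q \<partial>Q1)"
    using Q.nn_integral_fst[OF m] by simp
  also have "\<dots> = (\<integral>\<^sup>+e. \<integral>\<^sup>+v. \<integral>\<^sup>+\<omega>. f (case_nat (e, v) \<omega>) \<partial>Q \<partial>U \<partial>Exp)"
  proof -
    have "(\<lambda>x. \<integral>\<^sup>+\<omega>. f (case_nat x \<omega>) \<partial>Q) \<in> borel_measurable Q1"
      using Q.borel_measurable_nn_integral[of "\<lambda>x \<omega>. f (case_nat x \<omega>)" Q1] m by (simp add: split_beta')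
    then have m2: "(\<lambda>x. \<integral>\<^sup>+\<omega>. f (case_nat x \<omega>) \<partial>Q) \<in> borel_measurable (Exp \<Otimes>\<^sub>M U)" by (simp add: Q1_def)
    show ?thesis unfolding Q1_def by (rule U.nn_integral_fst[OF m2, symmetric])
  qed
  finally show ?thesis .
qed

lemma red_measurable [measurable]: "red c \<in> measurable Q Q"
proof -
  have "(\<lambda>\<omega>. (\<bar>fst (\<omega> 0)\<bar> - c, snd (\<omega> 0))) \<in> measurable Q (borel \<Otimes>\<^sub>M M)" by measurable
  then have a: "(\<lambda>\<omega>. (\<bar>fst (\<omega> 0)\<bar> - c, snd (\<omega> 0))) \<in> measurable Q Q1"
    by (simp cong: measurable_cong_sets add: sets_Q1)
  have "(\<lambda>\<omega>. \<lambda>i\<in>UNIV. \<omega> (Suc i)) \<in> measurable Q (\<Pi>\<^sub>M i\<in>(UNIV::nat set). (borel \<Otimes>\<^sub>M M))"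
    by (rule measurable_restrict) (rule component_measurable)
  then have b: "(\<lambda>\<omega>. \<lambda>i. \<omega> (Suc i)) \<in> measurable Q Q"
    by (simp only: restrict_UNIV measurable_cong_sets[OF refl sets_Q])
  show ?thesis
    using measurable_compose[OF measurable_Pair[OF a b] case_nat_measurable] by (simp add: red_def[abs_def])
qed

text \<open>\<open>red\<close> touches the first entry alone, and splitting that entry off reduces
  the claim to one exponential variable. In words: given a first waiting time beyond
  \<open>c\<close>, the reduced sample is again distributed as \<open>Q\<close>.\<close>

lemma Q_memoryless:
  assumes c: "c \<ge> 0" and G: "G \<in> sets Q"
  shows "(\<integral>\<^sup>+\<omega>. indicator {\<omega>. c < \<bar>fst (\<omega> 0)\<bar>} \<omega> * indicator G (red c \<omega>) \<partial>Q) =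
    ennreal (exp (- \<rho> * c)) * emeasure Q G"
proof -
  define g where "g e = (\<integral>\<^sup>+v. \<integral>\<^sup>+\<omega>. indicator G (case_nat (e, v) \<omega>) \<partial>Q \<partial>U)" for e
  have m: "(\<lambda>z. indicator G (case_nat (fst z) (snd z)) :: ennreal) \<in> borel_measurable (Q1 \<Otimes>\<^sub>M Q)"
    using measurable_compose[OF case_nat_measurable borel_measurable_indicator[OF G]] by (simp add: split_beta')
  have "(\<lambda>x. \<integral>\<^sup>+\<omega>. indicator G (case_nat x \<omega>) \<partial>Q) \<in> borel_measurable Q1"
    using Q.borel_measurable_nn_integral[of "\<lambda>x \<omega>. indicator G (case_nat x \<omega>)" Q1] m by (simp add: split_beta')
  then have "(\<lambda>x. \<integral>\<^sup>+\<omega>. indicator G (case_nat x \<omega>) \<partial>Q) \<in> borel_measurable (borel \<Otimes>\<^sub>M U)"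
    by (simp add: Q1_def Exp_def cong: measurable_cong_sets sets_pair_measure_cong)
  then have g: "g \<in> borel_measurable borel"
    unfolding g_def[abs_def] by (intro U.borel_measurable_nn_integral) (simp add: split_beta')
  have ind: "indicator {\<omega>. c < \<bar>fst (\<omega> 0)\<bar>} (case_nat (e, v) \<omega>) * indicator G (red c (case_nat (e, v) \<omega>)) =
      (indicator {e. c < \<bar>e\<bar>} e * indicator G (case_nat (\<bar>e\<bar> - c, v) \<omega>) :: ennreal)" for e v \<omega>
    by (simp add: red_def indicator_def)
  have fm: "(\<lambda>\<omega>. indicator {\<omega>. c < \<bar>fst (\<omega> 0)\<bar>} \<omega> * indicator G (red c \<omega>) :: ennreal) \<in> borel_measurable Q"
    by (rule borel_measurable_times_ennreal[OF borel_measurable_indicator'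
          measurable_compose[OF red_measurable borel_measurable_indicator[OF G]]]) measurable
  have cm: "(\<lambda>\<omega>. indicator G (case_nat (e, v) \<omega>) :: ennreal) \<in> borel_measurable Q" if "v \<in> carrier R" for e v
    using measurable_compose[OF measurable_Pair1' m, of "(e, v)"] that
    by (simp add: Q1_def space_pair_measure Exp_def space_U)
  have "(\<integral>\<^sup>+\<omega>. indicator {\<omega>. c < \<bar>fst (\<omega> 0)\<bar>} \<omega> * indicator G (red c \<omega>) \<partial>Q) =
      (\<integral>\<^sup>+e. \<integral>\<^sup>+v. \<integral>\<^sup>+\<omega>. indicator {e. c < \<bar>e\<bar>} e * indicator G (case_nat (\<bar>e\<bar> - c, v) \<omega>) \<partial>Q \<partial>U \<partial>Exp)"
    unfolding nn_integral_Q_iter[OF fm] ind ..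
  also have "\<dots> = (\<integral>\<^sup>+e. indicator {e. c < \<bar>e\<bar>} e * g (\<bar>e\<bar> - c) \<partial>Exp)"
    by (intro nn_integral_cong) (auto simp: g_def split: split_indicator)
  also have "\<dots> = ennreal (exp (- \<rho> * c)) * (\<integral>\<^sup>+e. g e \<partial>Exp)" by (rule EX_memoryless[OF c g])
  also have "(\<integral>\<^sup>+e. g e \<partial>Exp) = (\<integral>\<^sup>+\<omega>. indicator G \<omega> \<partial>Q)"
    unfolding g_def using nn_integral_Q_iter[OF borel_measurable_indicator[OF G]] by simp
  finally show ?thesis using G by simp
qed

text \<open>Even more is almost sure: every bound is exceeded by some single waiting time. The
  waiting times are independent, and each stays below the bound with the same probability less than
  1.\<close>

lemma AE_nonexp: "AE \<omega> in Q. nonexp \<omega>"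
proof -
  have "AE \<omega> in Q. \<exists>i. real s < \<bar>fst (\<omega> i)\<bar>" for s :: nat
  proof -
    define A where "A = {x \<in> space Q1. \<bar>fst x\<bar> \<le> real s}"
    have A: "A \<in> sets Q1" unfolding A_def by measurable
    have eq: "A = (space Exp - {e. real s < \<bar>e\<bar>}) \<times> space U"
      by (auto simp: A_def Q1_def space_pair_measure Exp_def)
    have gt: "{e. real s < \<bar>e\<bar>} \<in> sets Exp" by (simp add: sets_EX)
    have "emeasure Q1 A = emeasure Exp (space Exp - {e. real s < \<bar>e\<bar>}) * emeasure U (space U)"
      unfolding eq Q1_def using gt by (intro U.emeasure_pair_measure_Times) auto
    then have "measure Q1 A = measure Exp (space Exp - {e. real s < \<bar>e\<bar>})"
      by (simp add: measure_def U.emeasure_space_1)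
    also have "\<dots> = 1 - exp (- \<rho> * s)"
      using Exp.prob_compl[OF gt] emeasure_EX_gt[of "real s"] by (simp add: measure_def)
    finally have mA: "measure Q1 A = 1 - exp (- \<rho> * s)" .
    have "(\<lambda>n. \<Prod>i\<le>n. measure Q1 A) \<longlonglongrightarrow> measure Q (Pi UNIV (\<lambda>i. A))"
      using seq.measure_PiM_countable[of "\<lambda>i. A"] A by (simp add: Q_def)
    moreover have "(\<lambda>n. \<Prod>i\<le>n. measure Q1 A) \<longlonglongrightarrow> 0"
    proof -
      have "(\<lambda>n. measure Q1 A ^ Suc n) \<longlonglongrightarrow> 0"
        using \<rho>_pos by (intro LIMSEQ_Suc LIMSEQ_power_zero) (simp add: mA abs_less_iff)
      then show ?thesis by simp
    qed
    ultimately have "measure Q (Pi UNIV (\<lambda>i. A)) = 0" by (rule LIMSEQ_unique)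
    then have null: "Pi UNIV (\<lambda>i. A) \<in> null_sets Q"
      using seq.infprod_in_sets[of "\<lambda>i. A"] A by (auto simp: null_sets_def Q.emeasure_eq_measure Q_def[symmetric])
    show ?thesis
    proof (rule AE_I'[OF null])
      have "\<omega> i \<in> space Q1" if "\<omega> \<in> space Q" for \<omega> i
        using that by (auto simp: Q_def space_PiM)
      then show "{\<omega> \<in> space Q. \<not> (\<exists>i. real s < \<bar>fst (\<omega> i)\<bar>)} \<subseteq> Pi UNIV (\<lambda>i. A)"
        by (auto simp: A_def not_less)
    qed
  qed
  then have "AE \<omega> in Q. \<forall>s::nat. \<exists>i. real s < \<bar>fst (\<omega> i)\<bar>" by (subst AE_all_countable) blast
  then show ?thesis
  proof eventually_elim
    fix \<omega> :: "nat \<Rightarrow> real \<times> 'a" assume *: "\<forall>s::nat. \<exists>i. real s < \<bar>fst (\<omega> i)\<bar>"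
    show "nonexp \<omega>" unfolding nonexp_def
    proof
      fix s
      obtain m :: nat where m: "s < real m" using reals_Archimedean2 by blast
      obtain i where "real m < \<bar>fst (\<omega> i)\<bar>" using * by blast
      then have "s < arr (Suc i) \<omega>" using m arr_nonneg[of i \<omega>] by (simp add: arr_Suc)
      then show "\<exists>n. s < arr n \<omega>" by blast
    qed
  qed
qed

text \<open>Given by invariance rather than by generators: membership depends on the path up to
  \<open>s\<close> alone. This allows the tail of a sample to be replaced in
  \<open>past_increment_n\<close>, and measurable conditions on \<open>cpp r\<close> with
  \<open>r\<close> in \<open>{0..s}\<close> belong to it by inspection.\<close>

definition past :: "real \<Rightarrow> (nat \<Rightarrow> real \<times> 'a) set set" where
  "past s = {A \<in> sets Q. \<forall>\<omega>\<in>space Q. \<forall>\<omega>'\<in>space Q. (\<forall>r\<in>{0..s}. cpp r \<omega> = cpp r \<omega>') \<longrightarrow> (\<omega> \<in> A \<longleftrightarrow> \<omega>' \<in> A)}"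

lemma comb_measurable: "(\<lambda>(\<omega>, \<omega>'). comb_seq n \<omega> \<omega>') \<in> measurable (Q \<Otimes>\<^sub>M Q) Q"
  unfolding Q_def by (rule measurable_comb_seq)

lemma nn_integral_Q_comb:
  assumes f: "f \<in> borel_measurable Q"
  shows "(\<integral>\<^sup>+\<omega>. f \<omega> \<partial>Q) = (\<integral>\<^sup>+\<omega>. \<integral>\<^sup>+\<omega>'. f (comb_seq n \<omega> \<omega>') \<partial>Q \<partial>Q)"
proof -
  have m: "(\<lambda>z. f (comb_seq n (fst z) (snd z))) \<in> borel_measurable (Q \<Otimes>\<^sub>M Q)"
    using measurable_compose[OF comb_measurable f] by (simp add: split_beta')
  have "(\<integral>\<^sup>+\<omega>. f \<omega> \<partial>Q) = (\<integral>\<^sup>+\<omega>. f \<omega> \<partial>distr (Q \<Otimes>\<^sub>M Q) Q (\<lambda>(\<omega>, \<omega>'). comb_seq n \<omega> \<omega>'))"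
    using seq.PiM_comb_seq[of n] unfolding Q_def by simp
  also have "\<dots> = (\<integral>\<^sup>+z. f (comb_seq n (fst z) (snd z)) \<partial>(Q \<Otimes>\<^sub>M Q))"
    using nn_integral_distr[OF comb_measurable, of f] f by (simp add: split_beta')
  also have "\<dots> = (\<integral>\<^sup>+\<omega>. \<integral>\<^sup>+\<omega>'. f (comb_seq n \<omega> \<omega>') \<partial>Q \<partial>Q)"
    using Q.nn_integral_fst[OF m] by simp
  finally show ?thesis .
qed

text \<open>Given \<open>n\<close> jumps up to time \<open>s\<close>, the past depends on the first \<open>n\<close> entries only, and by the
  memoryless property the future after \<open>s\<close> is a fresh sample.\<close>

lemma past_increment_n:
  assumes s: "s \<ge> 0" and t: "t \<ge> 0" and A: "A \<in> past s" and C: "C \<in> sets M"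
  shows "emeasure Q {\<omega>\<in>space Q. \<omega> \<in> A \<and> arr n \<omega> \<le> s \<and> s < arr (Suc n) \<omega> \<and> cpp (s + t) \<omega> \<ominus> cpp s \<omega> \<in> C} =
    emeasure Q {\<omega>\<in>space Q. cpp t \<omega> \<in> C} *
    (\<integral>\<^sup>+\<omega>. indicator {\<omega>. comb_seq n \<omega> (\<lambda>i. (s + 1, \<zero>)) \<in> A \<and> arr n \<omega> \<le> s} \<omega> * ennreal (exp (- \<rho> * (s - arr n \<omega>))) \<partial>Q)"
    (is "emeasure Q ?E = ?p * (\<integral>\<^sup>+\<omega>. indicator ?A \<omega> * ?w \<omega> \<partial>Q)")
proof -
  have AQ [measurable]: "A \<in> sets Q" using A by (simp add: past_def)
  have pA: "\<forall>\<omega>\<in>space Q. \<forall>\<omega>'\<in>space Q. (\<forall>r\<in>{0..s}. cpp r \<omega> = cpp r \<omega>') \<longrightarrow> (\<omega> \<in> A \<longleftrightarrow> \<omega>' \<in> A)"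
    using A unfolding past_def mem_Collect_eq by (rule conjunct2)
  have Aeq: "\<omega> \<in> A \<longleftrightarrow> \<omega>' \<in> A" if "\<omega> \<in> space Q" "\<omega>' \<in> space Q" "\<And>r. r \<in> {0..s} \<Longrightarrow> cpp r \<omega> = cpp r \<omega>'" for \<omega> \<omega>'
    using pA[rule_format, OF that(1,2)] that(3) by blast
  note C [measurable]
  define G where "G = {\<omega>\<in>space Q. cpp t \<omega> \<in> C}"
  have G: "G \<in> sets Q" unfolding G_def by measurable
  have E: "?E \<in> sets Q" by measurable
  \<comment> \<open>A tail whose first waiting time exceeds \<open>s\<close>. By
    \<open>cpp_freeze\<close> it stands for every tail without a further jump up to
    \<open>s\<close>, so that \<open>A\<close> becomes a condition on the first \<open>n\<close>
    entries.\<close>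
  let ?k = "\<lambda>i::nat. (s + 1, \<zero>)"
  have kQ: "?k \<in> space Q" by (simp add: space_Q vals_def)
  have inner: "(\<integral>\<^sup>+\<omega>'. indicator ?E (comb_seq n \<omega> \<omega>') \<partial>Q) = ?p * (indicator ?A \<omega> * ?w \<omega>)" if \<omega>: "\<omega> \<in> space Q" for \<omega>
  proof (cases "arr n \<omega> \<le> s")
    case True
    let ?c = "s - arr n \<omega>"
    have "(\<integral>\<^sup>+\<omega>'. indicator ?E (comb_seq n \<omega> \<omega>') \<partial>Q) =
        (\<integral>\<^sup>+\<omega>'. indicator ?A \<omega> * (indicator {\<omega>. ?c < \<bar>fst (\<omega> 0)\<bar>} \<omega>' * indicator G (red ?c \<omega>')) \<partial>Q)"
    proof (rule nn_integral_cong_AE)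
      show "AE \<omega>' in Q. indicator ?E (comb_seq n \<omega> \<omega>') =
        (indicator ?A \<omega> * (indicator {\<omega>. ?c < \<bar>fst (\<omega> 0)\<bar>} \<omega>' * indicator G (red ?c \<omega>')) :: ennreal)"
        using AE_nonexp AE_space[of Q]
      proof eventually_elim
        fix \<omega>' assume ne: "nonexp \<omega>'" and \<omega>': "\<omega>' \<in> space Q"
        have v: "vals \<omega>" "vals \<omega>'" using \<omega> \<omega>' by (auto simp: space_Q)
        have cQ: "comb_seq n \<omega> \<omega>' \<in> space Q" "comb_seq n \<omega> ?k \<in> space Q"
          using v kQ by (auto simp: space_Q vals_comb)
        have a1: "arr n (comb_seq n \<omega> \<omega>') = arr n \<omega>" "arr (Suc n) (comb_seq n \<omega> \<omega>') = arr n \<omega> + \<bar>fst (\<omega>' 0)\<bar>"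
          using arr_comb1[of n n \<omega> \<omega>'] arr_comb2[of n 1 \<omega> \<omega>'] by (simp_all add: arr_Suc)
        show "indicator ?E (comb_seq n \<omega> \<omega>') =
          (indicator ?A \<omega> * (indicator {\<omega>. ?c < \<bar>fst (\<omega> 0)\<bar>} \<omega>' * indicator G (red ?c \<omega>')) :: ennreal)"
        proof (cases "s < arr n \<omega> + \<bar>fst (\<omega>' 0)\<bar>")
          case lt: True
          have "comb_seq n \<omega> \<omega>' \<in> A \<longleftrightarrow> comb_seq n \<omega> ?k \<in> A"
            using True lt arr_nonneg[of n \<omega>] by (intro Aeq cQ cpp_freeze) auto
          moreover have "cpp (s + t) (comb_seq n \<omega> \<omega>') \<ominus> cpp s (comb_seq n \<omega> \<omega>') = cpp t (red ?c \<omega>')"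
            by (rule cpp_flow[OF v ne True lt t])
          moreover have "red ?c \<omega>' \<in> space Q" using v by (auto simp: space_Q vals_def red_def split: nat.split)
          ultimately show ?thesis using cQ a1 lt True by (auto simp: indicator_def G_def)
        next
          case False
          then show ?thesis using a1 by (auto simp: indicator_def)
        qed
      qed
    qed
    also have "\<dots> = indicator ?A \<omega> * (\<integral>\<^sup>+\<omega>'. indicator {\<omega>. ?c < \<bar>fst (\<omega> 0)\<bar>} \<omega>' * indicator G (red ?c \<omega>') \<partial>Q)"
    proof (rule nn_integral_cmult)
      show "(\<lambda>\<omega>'. indicator {\<omega>. ?c < \<bar>fst (\<omega> 0)\<bar>} \<omega>' * indicator G (red ?c \<omega>') :: ennreal) \<in> borel_measurable Q"
        by (rule borel_measurable_times_ennreal[OF borel_measurable_indicator'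
              measurable_compose[OF red_measurable borel_measurable_indicator[OF G]]]) measurable
    qed
    also have "\<dots> = ?p * (indicator ?A \<omega> * ?w \<omega>)"
      using True by (subst Q_memoryless[OF _ G]) (auto simp: G_def ac_simps)
    finally show ?thesis .
  next
    case False
    then have "indicator ?E (comb_seq n \<omega> \<omega>') = (0::ennreal)" for \<omega>'
      using arr_comb1[of n n \<omega> \<omega>'] by (simp add: indicator_def)
    then show ?thesis using False by simp
  qed
  have Am: "(\<lambda>\<omega>. indicator ?A \<omega> * ?w \<omega>) \<in> borel_measurable Q"
  proof -
    have "(\<lambda>\<omega>. comb_seq n \<omega> ?k) \<in> measurable Q Q"
      using measurable_compose[OF measurable_Pair2'[OF kQ] comb_measurable] by simp
    from measurable_sets[OF this AQ] have "{\<omega> \<in> space Q. comb_seq n \<omega> ?k \<in> A} \<in> sets Q"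
      by (simp add: vimage_def Int_def conj_commute)
    then have [measurable]: "Measurable.pred Q (\<lambda>\<omega>. comb_seq n \<omega> ?k \<in> A)" by (simp add: pred_def)
    have "{\<omega> \<in> space Q. comb_seq n \<omega> ?k \<in> A \<and> arr n \<omega> \<le> s} \<in> sets Q" by measurable
    then have "(indicator ?A :: _ \<Rightarrow> ennreal) \<in> borel_measurable Q"
      by (intro borel_measurable_indicator') (simp add: Int_def conj_commute)
    then show ?thesis by (intro borel_measurable_times_ennreal) auto
  qed
  have "emeasure Q ?E = (\<integral>\<^sup>+\<omega>. indicator ?E \<omega> \<partial>Q)" using E by simp
  also have "\<dots> = (\<integral>\<^sup>+\<omega>. \<integral>\<^sup>+\<omega>'. indicator ?E (comb_seq n \<omega> \<omega>') \<partial>Q \<partial>Q)"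
    by (rule nn_integral_Q_comb[OF borel_measurable_indicator[OF E]])
  also have "\<dots> = (\<integral>\<^sup>+\<omega>. ?p * (indicator ?A \<omega> * ?w \<omega>) \<partial>Q)" by (rule nn_integral_cong) (rule inner)
  also have "\<dots> = ?p * (\<integral>\<^sup>+\<omega>. indicator ?A \<omega> * ?w \<omega> \<partial>Q)" by (rule nn_integral_cmult[OF Am])
  finally show ?thesis .
qed

text \<open>Summing \<open>past_increment_n\<close> over the number of jumps leaves a factor free of
  \<open>C\<close>; taking the whole space for \<open>C\<close> identifies that factor with the
  measure of \<open>A\<close>.\<close>

lemma past_increment_indep:
  assumes s: "s \<ge> 0" and t: "t \<ge> 0" and A: "A \<in> past s" and C: "C \<in> sets M"
  shows "emeasure Q {\<omega>\<in>space Q. \<omega> \<in> A \<and> cpp (s + t) \<omega> \<ominus> cpp s \<omega> \<in> C} =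
    emeasure Q A * emeasure Q {\<omega>\<in>space Q. cpp t \<omega> \<in> C}"
proof -
  have AQ [measurable]: "A \<in> sets Q" using A by (simp add: past_def)
  define I where "I n = (\<integral>\<^sup>+\<omega>. indicator {\<omega>. comb_seq n \<omega> (\<lambda>i. (s + 1, \<zero>)) \<in> A \<and> arr n \<omega> \<le> s} \<omega> * ennreal (exp (- \<rho> * (s - arr n \<omega>))) \<partial>Q)" for n
  have *: "emeasure Q {\<omega>\<in>space Q. \<omega> \<in> A \<and> cpp (s + t) \<omega> \<ominus> cpp s \<omega> \<in> C} = emeasure Q {\<omega>\<in>space Q. cpp t \<omega> \<in> C} * (\<Sum>n. I n)"
    if [measurable]: "C \<in> sets M" for C
  proof -
    let ?E = "\<lambda>n. {\<omega>\<in>space Q. \<omega> \<in> A \<and> arr n \<omega> \<le> s \<and> s < arr (Suc n) \<omega> \<and> cpp (s + t) \<omega> \<ominus> cpp s \<omega> \<in> C}"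
    have "emeasure Q {\<omega>\<in>space Q. \<omega> \<in> A \<and> cpp (s + t) \<omega> \<ominus> cpp s \<omega> \<in> C} = emeasure Q (\<Union>n. ?E n)"
    proof (rule emeasure_eq_AE)
      show "AE \<omega> in Q. \<omega> \<in> {\<omega>\<in>space Q. \<omega> \<in> A \<and> cpp (s + t) \<omega> \<ominus> cpp s \<omega> \<in> C} \<longleftrightarrow> \<omega> \<in> (\<Union>n. ?E n)"
        using AE_nonexp
      proof eventually_elim
        fix \<omega> assume "nonexp \<omega>"
        from jumps_bounds[OF this s] show "\<omega> \<in> {\<omega>\<in>space Q. \<omega> \<in> A \<and> cpp (s + t) \<omega> \<ominus> cpp s \<omega> \<in> C} \<longleftrightarrow> \<omega> \<in> (\<Union>n. ?E n)"
          by blast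
      qed
    qed measurable
    also have "\<dots> = (\<Sum>n. emeasure Q (?E n))"
    proof (rule suminf_emeasure[symmetric])
      show "disjoint_family ?E"
        unfolding disjoint_family_on_def using jumps_eq by blast
      show "range ?E \<subseteq> sets Q"
      proof (rule image_subsetI)
        fix n show "?E n \<in> sets Q" by measurable
      qed
    qed
    also have "\<dots> = (\<Sum>n. emeasure Q {\<omega>\<in>space Q. cpp t \<omega> \<in> C} * I n)"
      unfolding I_def past_increment_n[OF s t A that] ..
    also have "\<dots> = emeasure Q {\<omega>\<in>space Q. cpp t \<omega> \<in> C} * (\<Sum>n. I n)" by (rule ennreal_suminf_cmult)
    finally show ?thesis .
  qed
  have sp: "{\<omega>\<in>space Q. \<omega> \<in> A \<and> cpp (s + t) \<omega> \<ominus> cpp s \<omega> \<in> space M} = A"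
    using sets.sets_into_space[OF AQ] cpp_closed by (auto simp: space_Q space_M)
  have sp2: "{\<omega>\<in>space Q. cpp t \<omega> \<in> space M} = space Q"
    using cpp_closed by (auto simp: space_Q space_M)
  have "emeasure Q A = (\<Sum>n. I n)"
    using *[OF sets.top[of M]] unfolding sp sp2 by (simp add: Q.emeasure_space_1)
  then show ?thesis using *[OF C] by (simp add: mult.commute)
qed

lemma emeasure_no_jump: assumes "t \<ge> 0" shows "emeasure Q {\<omega>\<in>space Q. t < \<bar>fst (\<omega> 0)\<bar>} = ennreal (exp (- \<rho> * t))"
proof -
  have "emeasure Q {\<omega>\<in>space Q. t < \<bar>fst (\<omega> 0)\<bar>} =
      (\<integral>\<^sup>+\<omega>. indicator {\<omega>. t < \<bar>fst (\<omega> 0)\<bar>} \<omega> * indicator (space Q) (red t \<omega>) \<partial>Q)"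
  proof (subst nn_integral_indicator[symmetric])
    show "(\<integral>\<^sup>+\<omega>. indicator {\<omega>\<in>space Q. t < \<bar>fst (\<omega> 0)\<bar>} \<omega> \<partial>Q) =
      (\<integral>\<^sup>+\<omega>. indicator {\<omega>. t < \<bar>fst (\<omega> 0)\<bar>} \<omega> * indicator (space Q) (red t \<omega>) \<partial>Q)"
      using measurable_space[OF red_measurable, of _ t]
      by (intro nn_integral_cong) (auto simp: indicator_def)
  qed measurable
  then show ?thesis using Q_memoryless[OF assms sets.top] by (simp add: Q.emeasure_space_1)
qed

lemma AE_supp:
  assumes supp: "AE v in U. v \<in> B m" shows "AE \<omega> in Q. \<forall>i. snd (\<omega> i) \<in> B m"
proof (subst AE_all_countable, rule allI)
  fix i
  have "AE x in Q1. snd x \<in> B m"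
  proof -
    have "AE e in Exp. AE v in U. snd (e, v) \<in> B m" using supp by simp
    moreover have "{x \<in> space (Exp \<Otimes>\<^sub>M U). snd x \<in> B m} \<in> sets (Exp \<Otimes>\<^sub>M U)" by measurable
    ultimately show ?thesis unfolding Q1_def by (intro EXU.AE_pair_measure) auto
  qed
  then show "AE \<omega> in Q. snd (\<omega> i) \<in> B m"
    unfolding Q_def by (intro AE_PiM_component[of UNIV _ i]) (auto intro: Q1.prob_space_axioms)
qed

text \<open>Given a jump by time \<open>t\<close>, \<open>cpp t\<close> is the first jump plus the
  later ones, whose sum lies in \<open>B m\<close>. By \<open>inv\<close> the first jump, being
  independent of the rest, absorbs this sum, so the law is \<open>U\<close> however many jumps there
  are.\<close>

lemma cpp_after_jump:
  assumes t: "t \<ge> 0" and C: "C \<in> sets M"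
    and supp: "AE v in U. v \<in> B m"
    and inv: "\<And>b. b \<in> B m \<Longrightarrow> emeasure U {v \<in> space U. v \<oplus> b \<in> C} = emeasure U C"
  shows "emeasure Q {\<omega>\<in>space Q. \<bar>fst (\<omega> 0)\<bar> \<le> t \<and> cpp t \<omega> \<in> C} = ennreal (1 - exp (- \<rho> * t)) * emeasure U C"
proof -
  note C [measurable]
  let ?E = "{\<omega>\<in>space Q. \<bar>fst (\<omega> 0)\<bar> \<le> t \<and> cpp t \<omega> \<in> C}"
  have E: "?E \<in> sets Q" by measurable
  note supp' = AE_supp[OF supp]
  \<comment> \<open>The first jump is integrated with its waiting time and the remaining sample held
    fixed, so the later jumps contribute a constant \<open>b\<close> of \<open>B m\<close>.\<close>
  have inner: "(\<integral>\<^sup>+v. indicator ?E (case_nat (e, v) \<omega>) \<partial>U) = indicator {e. \<bar>e\<bar> \<le> t} e * emeasure U C"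
    if \<omega>: "\<omega> \<in> space Q" "nonexp \<omega>" "\<forall>i. snd (\<omega> i) \<in> B m" for \<omega> e
  proof (cases "\<bar>e\<bar> \<le> t")
    case True
    define b where "b = cpp (t - \<bar>e\<bar>) \<omega>"
    have b: "b \<in> B m" unfolding b_def using \<omega>(3) by (intro cpp_mem_B) auto
    have bc: "b \<in> carrier R" using b by (rule B_carrier)
    have v: "vals \<omega>" using \<omega>(1) by (simp add: space_Q)
    have "(\<integral>\<^sup>+v. indicator ?E (case_nat (e, v) \<omega>) \<partial>U) = (\<integral>\<^sup>+v. indicator {v \<in> space U. v \<oplus> b \<in> C} v \<partial>U)"
    proof (rule nn_integral_cong)
      fix v assume vU: "v \<in> space U"
      then have vc: "v \<in> carrier R" by (simp add: space_U)
      have "vals (case_nat (e, v) \<omega>)" using v vc by (auto simp: vals_def split: nat.split)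
      then show "indicator ?E (case_nat (e, v) \<omega>) = (indicator {v \<in> space U. v \<oplus> b \<in> C} v :: ennreal)"
        using cpp_case_nat[of "(e, v)" \<omega> t] v vc \<omega>(2) True vU by (simp add: indicator_def space_Q b_def)
    qed
    also have "\<dots> = emeasure U {v \<in> space U. v \<oplus> b \<in> C}"
    proof (rule nn_integral_indicator)
      have "(\<lambda>v. v \<oplus> b) \<in> measurable U M"
        using measurable_radd[OF bc] by (simp cong: measurable_cong_sets add: sets_U)
      from measurable_sets[OF this C] show "{v \<in> space U. v \<oplus> b \<in> C} \<in> sets U"
        by (simp add: vimage_def Int_def conj_commute)
    qed
    finally show ?thesis using inv[OF b] True by simp
  qed (simp add: indicator_def)
  have "emeasure Q ?E = (\<integral>\<^sup>+e. \<integral>\<^sup>+v. \<integral>\<^sup>+\<omega>. indicator ?E (case_nat (e, v) \<omega>) \<partial>Q \<partial>U \<partial>Exp)"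
    using nn_integral_Q_iter[OF borel_measurable_indicator[OF E]] E by simp
  also have "\<dots> = (\<integral>\<^sup>+e. indicator {e. \<bar>e\<bar> \<le> t} e * emeasure U C \<partial>Exp)"
  proof (rule nn_integral_cong)
    fix e :: real
    have m: "(\<lambda>z. indicator ?E (case_nat (e, fst z) (snd z)) :: ennreal) \<in> borel_measurable (U \<Otimes>\<^sub>M Q)"
    proof -
      have "(\<lambda>z. ((e, fst z), snd z)) \<in> measurable (U \<Otimes>\<^sub>M Q) (Q1 \<Otimes>\<^sub>M Q)"
        unfolding Q1_def by (intro measurable_Pair) (auto simp: Exp_def)
      from measurable_compose[OF measurable_compose[OF this case_nat_measurable] borel_measurable_indicator[OF E]]
      show ?thesis by simp
    qed
    have "(\<integral>\<^sup>+v. \<integral>\<^sup>+\<omega>. indicator ?E (case_nat (e, v) \<omega>) \<partial>Q \<partial>U) = (\<integral>\<^sup>+\<omega>. \<integral>\<^sup>+v. indicator ?E (case_nat (e, v) \<omega>) \<partial>U \<partial>Q)"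
      using UQ.Fubini[OF m] by simp
    also have "\<dots> = (\<integral>\<^sup>+\<omega>. indicator {e. \<bar>e\<bar> \<le> t} e * emeasure U C \<partial>Q)"
    proof (rule nn_integral_cong_AE)
      show "AE \<omega> in Q. (\<integral>\<^sup>+v. indicator ?E (case_nat (e, v) \<omega>) \<partial>U) = indicator {e. \<bar>e\<bar> \<le> t} e * emeasure U C"
        using AE_nonexp supp' AE_space[of Q] by eventually_elim (rule inner)
    qed
    finally show "(\<integral>\<^sup>+v. \<integral>\<^sup>+\<omega>. indicator ?E (case_nat (e, v) \<omega>) \<partial>Q \<partial>U) = indicator {e. \<bar>e\<bar> \<le> t} e * emeasure U C"
      by (simp add: Q.emeasure_space_1)
  qed
  also have "\<dots> = emeasure U C * emeasure Exp {e. \<bar>e\<bar> \<le> t}"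
    by (subst nn_integral_multc) (auto simp: mult.commute sets_EX)
  also have "emeasure Exp {e. \<bar>e\<bar> \<le> t} = ennreal (1 - exp (- \<rho> * t))"
  proof -
    have gt: "{e. t < \<bar>e\<bar>} \<in> sets Exp" by (simp add: sets_EX)
    have "{e. \<bar>e\<bar> \<le> t} = space Exp - {e. t < \<bar>e\<bar>}" by (auto simp: Exp_def)
    then have "measure Exp {e. \<bar>e\<bar> \<le> t} = 1 - exp (- \<rho> * t)"
      using Exp.prob_compl[OF gt] emeasure_EX_gt[OF t] by (simp add: measure_def)
    then show ?thesis by (simp add: Exp.emeasure_eq_measure)
  qed
  finally show ?thesis by (simp add: mult.commute)
qed

end

section \<open>Convergent series in an ultrametric ring\<close>

context ultrametric_ring
begin

definition tends :: "(nat \<Rightarrow> 'a) \<Rightarrow> 'a \<Rightarrow> bool" where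
  "tends s z \<longleftrightarrow> z \<in> carrier R \<and> (\<forall>n. \<exists>K. \<forall>k\<ge>K. s k \<ominus> z \<in> B n)"

text \<open>The default value makes the limit total, so that measurability holds without an
  exceptional set.\<close>

definition ulim :: "(nat \<Rightarrow> 'a) \<Rightarrow> 'a" where
  "ulim s = (if \<exists>z. tends s z then SOME z. tends s z else \<zero>)"

lemma near_imp_eq:
  assumes "x \<in> carrier R" "y \<in> carrier R" "\<And>n. x \<ominus> y \<in> B n" shows "x = y"
proof -
  have "x \<ominus> y = \<zero>" using assms by (intro B_Inter) auto
  then show ?thesis using assms by simp
qed

lemma tends_bl: "tends s z \<Longrightarrow> (\<And>k. s k \<in> carrier R) \<Longrightarrow> \<exists>K. \<forall>k\<ge>K. s k \<in> bl z n"
  unfolding tends_def bl_iff by blast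

lemma tends_unique:
  assumes s: "\<And>k. s k \<in> carrier R" and z: "tends s z" "tends s z'" shows "z = z'"
proof (rule near_imp_eq)
  show c: "z \<in> carrier R" "z' \<in> carrier R" using z by (auto simp: tends_def)
  fix n
  obtain K K' where "\<forall>k\<ge>K. s k \<in> bl z n" "\<forall>k\<ge>K'. s k \<in> bl z' n" using tends_bl[OF z(1) s] tends_bl[OF z(2) s] by blast
  then have "s (max K K') \<in> bl z n" "s (max K K') \<in> bl z' n" by auto
  then have "z \<in> bl z' n" using bl_trans[OF c(2)] bl_sym[OF c(1)] by blast
  then show "z \<ominus> z' \<in> B n" by (simp add: bl_iff)
qed

lemma ulim_eqI: assumes "\<And>k. s k \<in> carrier R" "tends s z" shows "ulim s = z"
proof -
  have "tends s (SOME z. tends s z)" using assms(2) by (rule someI)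
  then show ?thesis using tends_unique[OF assms(1)] assms(2) by (auto simp: ulim_def)
qed

lemma ulim_closed: "ulim s \<in> carrier R"
  unfolding ulim_def using someI[of "tends s"] by (auto simp: tends_def)

text \<open>By completeness this is convergence without mention of the limit, in countably many
  conditions; that makes it a measurable event.\<close>

definition ucauchy :: "(nat \<Rightarrow> 'a) \<Rightarrow> bool" where
  "ucauchy s \<longleftrightarrow> (\<forall>n. \<exists>K. \<forall>k\<ge>K. \<forall>l\<ge>K. s k \<ominus> s l \<in> B n)"

lemma ucauchy_tends: assumes "\<And>k. s k \<in> carrier R" "ucauchy s" shows "\<exists>z. tends s z"
  using B_complete[of s] assms unfolding ucauchy_def tends_def by blast

lemma tends_ucauchy: assumes s: "\<And>k. s k \<in> carrier R" and z: "tends s z" shows "ucauchy s"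
  unfolding ucauchy_def
proof
  fix n
  have zc: "z \<in> carrier R" using z by (simp add: tends_def)
  obtain K where K: "\<forall>k\<ge>K. s k \<in> bl z n" using tends_bl[OF z s] by blast
  have "s k \<ominus> s l \<in> B n" if "k \<ge> K" "l \<ge> K" for k l
    using bl_trans[OF s, of z l n "s k"] bl_sym[OF zc, of "s l" n] K that by (simp add: bl_iff)
  then show "\<exists>K. \<forall>k\<ge>K. \<forall>l\<ge>K. s k \<ominus> s l \<in> B n" by blast
qed

lemma ulim_measurable:
  assumes s [measurable]: "\<And>k. (\<lambda>\<omega>. s k \<omega>) \<in> measurable N M"
  shows "(\<lambda>\<omega>. ulim (\<lambda>k. s k \<omega>)) \<in> measurable N M"
proof (rule measurable_ballI)
  fix a n assume a: "a \<in> carrier R"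
  have sc: "s k \<omega> \<in> carrier R" if "\<omega> \<in> space N" for k \<omega> using measurable_space[OF s that] by (simp add: space_M)
  have eq: "{\<omega> \<in> space N. ulim (\<lambda>k. s k \<omega>) \<in> bl a n} =
    {\<omega> \<in> space N. (ucauchy (\<lambda>k. s k \<omega>) \<and> (\<exists>K. \<forall>k\<ge>K. s k \<omega> \<in> bl a n)) \<or> (\<not> ucauchy (\<lambda>k. s k \<omega>) \<and> \<zero> \<in> bl a n)}"
  proof (intro Collect_cong conj_cong refl)
    fix \<omega> assume "\<omega> \<in> space N"
    note c = sc[OF this]
    show "ulim (\<lambda>k. s k \<omega>) \<in> bl a n \<longleftrightarrow>
      (ucauchy (\<lambda>k. s k \<omega>) \<and> (\<exists>K. \<forall>k\<ge>K. s k \<omega> \<in> bl a n)) \<or> (\<not> ucauchy (\<lambda>k. s k \<omega>) \<and> \<zero> \<in> bl a n)"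
    proof (cases "ucauchy (\<lambda>k. s k \<omega>)")
      case True
      obtain z where z: "tends (\<lambda>k. s k \<omega>) z" using ucauchy_tends[OF c True] by blast
      have zc: "z \<in> carrier R" using z by (simp add: tends_def)
      have u: "ulim (\<lambda>k. s k \<omega>) = z" by (rule ulim_eqI[OF c z])
      obtain K where K: "\<forall>k\<ge>K. s k \<omega> \<in> bl z n" using tends_bl[OF z c] by blast
      have "z \<in> bl a n \<longleftrightarrow> (\<exists>K. \<forall>k\<ge>K. s k \<omega> \<in> bl a n)"
      proof
        assume "z \<in> bl a n"
        then show "\<exists>K. \<forall>k\<ge>K. s k \<omega> \<in> bl a n" using K bl_trans[OF a] by blast
      next
        assume "\<exists>K. \<forall>k\<ge>K. s k \<omega> \<in> bl a n"
        then obtain K' where "\<forall>k\<ge>K'. s k \<omega> \<in> bl a n" by blast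
        then have "s (max K K') \<omega> \<in> bl a n" "s (max K K') \<omega> \<in> bl z n" using K by auto
        then show "z \<in> bl a n" using bl_trans[OF a] bl_sym[OF zc] by blast
      qed
      then show ?thesis using True u by simp
    next
      case False
      have "\<not> tends (\<lambda>k. s k \<omega>) z" for z using tends_ucauchy[of "\<lambda>k. s k \<omega>" z] c False by blast
      then show ?thesis using False by (simp add: ulim_def)
    qed
  qed
  have [measurable]: "Measurable.pred N (\<lambda>\<omega>. ucauchy (\<lambda>k. s k \<omega>))" unfolding ucauchy_def by measurable
  have [measurable]: "Measurable.pred N (\<lambda>\<omega>. s k \<omega> \<in> bl a n)" for k using bl_sets[OF a, of n] by measurable
  show "{\<omega> \<in> space N. ulim (\<lambda>k. s k \<omega>) \<in> bl a n} \<in> sets N" unfolding eq by measurable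
qed (rule ulim_closed)

text \<open>The levels are indexed by all integers, so partial sums run over growing symmetric
  ranges.\<close>

primrec ps :: "nat \<Rightarrow> (int \<Rightarrow> 'a) \<Rightarrow> 'a" where
  "ps 0 y = y 0"
| "ps (Suc k) y = ps k y \<oplus> (y (int (Suc k)) \<oplus> y (- int (Suc k)))"

definition series :: "(int \<Rightarrow> 'a) \<Rightarrow> 'a" where "series y = ulim (\<lambda>k. ps k y)"

text \<open>A criterion for convergence: terms of very negative index are small by membership in
  \<open>B m\<close>, those of large index vanish, and in a complete ultrametric group it suffices
  that the terms become small.\<close>

definition gv :: "(int \<Rightarrow> 'a) \<Rightarrow> bool" where
  "gv y \<longleftrightarrow> (\<forall>m. y m \<in> B m) \<and> (\<exists>K. \<forall>m>K. y m = \<zero>)"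

lemma gv_carrier: "gv y \<Longrightarrow> y m \<in> carrier R"
  using B_carrier by (auto simp: gv_def)

lemma ps_closed: "(\<And>m. y m \<in> carrier R) \<Longrightarrow> ps k y \<in> carrier R"
  by (induction k) auto

lemma series_closed: "series y \<in> carrier R"
  by (simp add: series_def ulim_closed)

lemma series_measurable:
  assumes y: "\<And>m. (\<lambda>\<omega>. y m \<omega>) \<in> measurable N M" shows "(\<lambda>\<omega>. series (\<lambda>m. y m \<omega>)) \<in> measurable N M"
proof -
  have "(\<lambda>\<omega>. ps k (\<lambda>m. y m \<omega>)) \<in> measurable N M" for k
  proof (induction k)
    case (Suc k)
    show ?case using measurable_rplus[OF Suc measurable_rplus[OF y y]] by simp
  qed (simp add: y)
  then show ?thesis unfolding series_def by (rule ulim_measurable)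
qed

lemma gv_tends: assumes y: "gv y" shows "tends (\<lambda>k. ps k y) (series y)"
proof -
  have yc: "y m \<in> carrier R" for m by (rule gv_carrier[OF y])
  note pc = ps_closed[of y, OF yc]
  have "ucauchy (\<lambda>k. ps k y)" unfolding ucauchy_def
  proof
    fix n
    obtain K where K: "\<And>m. m > K \<Longrightarrow> y m = \<zero>" using y by (auto simp: gv_def)
    \<comment> \<open>Past \<open>N\<close> the terms of positive index vanish and those of negative
      index lie in \<open>B n\<close>.\<close>
    define N where "N = nat (max K (- n))"
    have "ps (N + j) y \<in> bl (ps N y) n" for j
    proof (induction j)
      case (Suc j)
      have "K \<le> int N" unfolding N_def by linarith
      then have "y (int (Suc (N + j))) = \<zero>" by (intro K) simp
      moreover have "y (- int (Suc (N + j))) \<in> B n"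
        using y by (intro B_le[of _ "- int (Suc (N + j))" n]) (auto simp: gv_def N_def)
      ultimately have "y (int (Suc (N + j))) \<oplus> y (- int (Suc (N + j))) \<in> B n" by (intro B_add) auto
      then have "y (int (Suc (N + j))) \<oplus> y (- int (Suc (N + j))) \<in> bl \<zero> n" by (simp add: bl_zero)
      from bl_add[OF Suc this pc zero_closed] show ?case using pc by simp
    qed (use pc bl_self in simp)
    then have b: "ps k y \<in> bl (ps N y) n" if "k \<ge> N" for k using that le_Suc_ex by blast
    have "ps k y \<ominus> ps l y \<in> B n" if "k \<ge> N" "l \<ge> N" for k l
      using bl_trans[OF pc _ b[OF that(1)], of l] bl_sym[OF pc b[OF that(2)]] by (simp add: bl_iff)
    then show "\<exists>K. \<forall>k\<ge>K. \<forall>l\<ge>K. ps k y \<ominus> ps l y \<in> B n" by blast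
  qed
  then obtain z where z: "tends (\<lambda>k. ps k y) z" using ucauchy_tends[of "\<lambda>k. ps k y"] pc by blast
  then show ?thesis using ulim_eqI[OF pc z] by (simp add: series_def)
qed

lemma series_eqI: assumes y: "\<And>m. y m \<in> carrier R" and z: "tends (\<lambda>k. ps k y) z" shows "series y = z"
  unfolding series_def by (rule ulim_eqI[OF ps_closed[OF y] z])

text \<open>Balls are subgroups, so a bound on all termwise differences passes to partial sums and
  to the limit without loss. This is the locally uniform control on which the path properties
  rest.\<close>

lemma series_near:
  assumes y: "gv y" and y': "gv y'" and near: "\<And>m. y m \<ominus> y' m \<in> B n"
  shows "series y \<ominus> series y' \<in> B n"
proof -
  have c: "y m \<in> carrier R" "y' m \<in> carrier R" for m using gv_carrier y y' by auto
  note pc = ps_closed[of y, OF c(1)] ps_closed[of y', OF c(2)]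
  have b: "y m \<in> bl (y' m) n" for m using near c by (simp add: bl_iff)
  have p: "ps k y \<in> bl (ps k y') n" for k
  proof (induction k)
    case (Suc k)
    show ?case unfolding ps.simps by (intro bl_add Suc b pc c) (auto intro: c)
  qed (simp add: b)
  obtain K K' where K: "\<forall>k\<ge>K. ps k y \<in> bl (series y) n" "\<forall>k\<ge>K'. ps k y' \<in> bl (series y') n"
    using tends_bl[OF gv_tends[OF y] pc(1)] tends_bl[OF gv_tends[OF y'] pc(2)] by blast
  define k where "k = max K K'"
  have k: "ps k y \<in> bl (series y) n" "ps k y' \<in> bl (series y') n" using K by (auto simp: k_def)
  have "ps k y \<in> bl (series y') n" by (rule bl_trans[OF series_closed k(2) p])
  then have "series y \<in> bl (series y') n" using bl_trans[OF series_closed _ bl_sym[OF series_closed k(1)]] by blast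
  then show ?thesis by (simp add: bl_iff)
qed

lemma ps_add:
  assumes "\<And>m. y m \<in> carrier R" "\<And>m. y' m \<in> carrier R"
  shows "ps k (\<lambda>m. y m \<oplus> y' m) = ps k y \<oplus> ps k y'"
proof (induction k)
  case (Suc k)
  have c: "ps k y \<in> carrier R" "ps k y' \<in> carrier R" using ps_closed assms by auto
  show ?case unfolding ps.simps Suc using c assms by (simp add: a_ac)
qed simp

lemma series_add: assumes y: "gv y" "gv y'" shows "series (\<lambda>m. y m \<oplus> y' m) = series y \<oplus> series y'"
proof (rule series_eqI)
  have c: "y m \<in> carrier R" "y' m \<in> carrier R" for m using gv_carrier y by auto
  note pc = ps_closed[of y, OF c(1)] ps_closed[of y', OF c(2)]
  show "y m \<oplus> y' m \<in> carrier R" for m using c by simp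
  show "tends (\<lambda>k. ps k (\<lambda>m. y m \<oplus> y' m)) (series y \<oplus> series y')"
    unfolding tends_def
  proof (intro conjI allI)
    fix n
    obtain K K' where K: "\<forall>k\<ge>K. ps k y \<in> bl (series y) n" "\<forall>k\<ge>K'. ps k y' \<in> bl (series y') n"
      using tends_bl[OF gv_tends[OF y(1)] pc(1)] tends_bl[OF gv_tends[OF y(2)] pc(2)] by blast
    have "ps k (\<lambda>m. y m \<oplus> y' m) \<ominus> (series y \<oplus> series y') \<in> B n" if k: "k \<ge> max K K'" for k
      using bl_add[of "ps k y" "series y" n "ps k y'" "series y'"] K k series_closed ps_add[of y y' k, OF c]
      by (auto simp: bl_iff)
    then show "\<exists>K. \<forall>k\<ge>K. ps k (\<lambda>m. y m \<oplus> y' m) \<ominus> (series y \<oplus> series y') \<in> B n" by blast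
  qed (simp add: series_closed)
qed

lemma gv_zero: "gv (\<lambda>m. \<zero>)"
  by (simp add: gv_def)

lemma series_zero: "series (\<lambda>m. \<zero>) = \<zero>"
proof (rule series_eqI)
  have "ps k (\<lambda>m. \<zero>) = \<zero>" for k by (induction k) auto
  then show "tends (\<lambda>k. ps k (\<lambda>m. \<zero>)) \<zero>" by (simp add: tends_def)
qed simp

lemma series_mem_B: assumes y: "gv y" and z: "\<And>m. m > n \<Longrightarrow> y m = \<zero>" shows "series y \<in> B n"
proof -
  have "y m \<ominus> \<zero> \<in> B n" for m
    using z[of m] y B_le[of "y m" m n] gv_carrier[OF y, of m] by (cases "m > n") (auto simp: gv_def)
  then have "series y \<ominus> series (\<lambda>m. \<zero>) \<in> B n" by (intro series_near y gv_zero)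
  then show ?thesis by (simp add: series_zero series_closed)
qed

lemma series_single: assumes b: "b \<in> carrier R" shows "series (\<lambda>k. if k = m then b else \<zero>) = b"
proof (rule series_eqI)
  let ?y = "\<lambda>k. if k = m then b else \<zero>"
  have "ps k ?y = (if \<bar>m\<bar> \<le> int k then b else \<zero>)" for k
  proof (induction k)
    case (Suc k)
    consider "\<bar>m\<bar> \<le> int k" | "m = int (Suc k)" | "m = - int (Suc k)" | "\<bar>m\<bar> > int (Suc k)" by linarith
    then show ?case unfolding ps.simps Suc by cases (use b in auto)
  qed auto
  then have "\<forall>k\<ge>nat \<bar>m\<bar>. ps k ?y = b" by auto
  then show "tends (\<lambda>k. ps k ?y) b" unfolding tends_def using b by (metis B_zero minus_self)
qed (use b in auto)

text \<open>Isolates the level that is averaged over while the others are held fixed.\<close>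

lemma series_split:
  assumes y: "gv y" shows "series y = y m \<oplus> series (y(m := \<zero>))"
proof -
  let ?s = "\<lambda>k. if k = m then y m else \<zero>"
  have ym: "y m \<in> B m" using y by (simp add: gv_def)
  have s: "gv ?s" using ym by (auto simp: gv_def intro!: exI[of _ m])
  have r: "gv (y(m := \<zero>))" using y unfolding gv_def by (metis B_zero fun_upd_apply)
  have "y = (\<lambda>k. ?s k \<oplus> (y(m := \<zero>)) k)" using gv_carrier[OF y] by auto
  then have "series y = series ?s \<oplus> series (y(m := \<zero>))" using series_add[OF s r] by simp
  then show ?thesis using series_single[OF B_carrier[OF ym], of m] by simp
qed

end

section \<open>The jump process of the heat semigroup\<close>

context heat
begin

definition rlev :: "int \<Rightarrow> real" where "rlev m = rate (m - 1) - rate m"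

definition Ulev :: "int \<Rightarrow> 'a measure" where "Ulev m = uniform_measure M (B m)"

lemma sets_Ulev: "sets (Ulev m) = sets M"
  by (simp add: Ulev_def)

lemma emeasure_Ulev: "A \<in> sets M \<Longrightarrow> emeasure (Ulev m) A = emeasure M (B m \<inter> A) / ennreal (exp (\<psi> m))"
  by (simp add: Ulev_def emeasure_B)

lemma Ulev_prob: "prob_space (Ulev m)"
  unfolding Ulev_def by (rule prob_space_uniform_measure) (simp_all add: emeasure_B)

lemma Ulev_supp: "AE v in Ulev m. v \<in> B m"
  unfolding Ulev_def by (rule AE_uniform_measureI) auto

lemma Ulev_inv:
  assumes b: "b \<in> B m" and C: "C \<in> sets M"
  shows "emeasure (Ulev m) {v \<in> space (Ulev m). v \<oplus> b \<in> C} = emeasure (Ulev m) C"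
proof -
  have bc: "b \<in> carrier R" using b by (rule B_carrier)
  have sp: "space (Ulev m) = carrier R" using sets_eq_imp_space_eq[OF sets_Ulev] space_M by simp
  have S: "{v \<in> carrier R. v \<oplus> b \<in> C} \<in> sets M"
    using measurable_sets[OF measurable_radd[OF bc] C] by (simp add: vimage_def Int_def space_M conj_commute)
  have "B m \<inter> {v \<in> carrier R. v \<oplus> b \<in> C} = (\<lambda>v. v \<oplus> b) -` (B m \<inter> C) \<inter> space M"
  proof -
    have "v \<in> B m \<longleftrightarrow> v \<oplus> b \<in> B m" if v: "v \<in> carrier R" for v
    proof -
      have "v \<oplus> b \<ominus> b = v" using v bc by algebra
      then show ?thesis using B_add[of v m b] B_minus[of "v \<oplus> b" m b] b by auto
    qed
    then show ?thesis using B_carrier by (auto simp: space_M)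
  qed
  then have "emeasure M (B m \<inter> {v \<in> carrier R. v \<oplus> b \<in> C}) = emeasure (distr M M (\<lambda>v. v \<oplus> b)) (B m \<inter> C)"
    using measurable_radd[OF bc] C by (simp add: emeasure_distr)
  then show ?thesis using S C by (simp add: sp emeasure_Ulev distr_add[OF bc])
qed

text \<open>With \<open>m\<close> as a parameter of the interpretation, constants such as
  \<open>cp.Q\<close> and \<open>cp.past\<close> become families over the levels.\<close>

sublocale cp: compound_poisson R B ch \<psi> M D "rlev m" "Ulev m" for m
proof (intro compound_poisson.intro compound_poisson_axioms.intro ultrametric_ring_axioms)
  show "rlev m > 0" using rate_strict[of "m - 1" m] by (simp add: rlev_def)
  show "prob_space (Ulev m)" by (rule Ulev_prob)
  show "sets (Ulev m) = sets M" by (rule sets_Ulev)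
qed

abbreviation "Qm \<equiv> \<lambda>m. cp.Q m"

definition Om :: "(int \<Rightarrow> nat \<Rightarrow> real \<times> 'a) measure" where "Om = (\<Pi>\<^sub>M m\<in>UNIV. Qm m)"

sublocale OmP: product_prob_space "\<lambda>m. Qm m" "UNIV :: int set"
  by (intro product_prob_spaceI cp.Q_prob)

lemma Om_prob: "prob_space Om"
  unfolding Om_def by (rule OmP.P.prob_space_axioms)

sublocale Om: prob_space Om by (rule Om_prob)

lemma space_Om: "\<omega> \<in> space Om \<longleftrightarrow> (\<forall>m. vals (\<omega> m))"
  by (simp add: Om_def space_PiM cp.space_Q PiE_UNIV_domain Pi_iff)

lemma Om_component [measurable]: "(\<lambda>\<omega>. \<omega> m) \<in> measurable Om (Qm m)"
  unfolding Om_def by (rule measurable_component_singleton) simp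

lemma Om_cpp [measurable]: "(\<lambda>\<omega>. cpp t (\<omega> m)) \<in> measurable Om M"
  by (rule measurable_compose[OF Om_component cp.cpp_measurable])

definition Xp :: "real \<Rightarrow> (int \<Rightarrow> nat \<Rightarrow> real \<times> 'a) \<Rightarrow> 'a" where
  "Xp t \<omega> = series (\<lambda>m. cpp t (\<omega> m))"

lemma Xp_measurable [measurable]: "Xp t \<in> measurable Om M"
  unfolding Xp_def[abs_def] by (rule series_measurable) (rule Om_cpp)

text \<open>The clauses provide, in this order, levels that are locally constant in time, smallness
  of the low levels, the correct starting value, and silence of all sufficiently high levels in
  bounded time.\<close>

definition good :: "(int \<Rightarrow> nat \<Rightarrow> real \<times> 'a) \<Rightarrow> bool" where
  "good \<omega> \<longleftrightarrow> (\<forall>m. nonexp (\<omega> m)) \<and> (\<forall>m i. snd (\<omega> m i) \<in> B m) \<and> (\<forall>m. 0 < \<bar>fst (\<omega> m 0)\<bar>) \<and>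
     (\<forall>T::nat. \<exists>K::nat. \<forall>m>int K. real T < \<bar>fst (\<omega> m 0)\<bar>)"

text \<open>The levels from \<open>m + 1\<close> to \<open>m + j\<close> are independent, and their
  rates telescope to \<open>rate m - rate (m + j)\<close>; then \<open>j\<close> tends to
  infinity.\<close>

lemma emeasure_no_jump_above:
  assumes t: "t \<ge> 0"
  shows "emeasure Om {\<omega>\<in>space Om. \<forall>k>m. t < \<bar>fst (\<omega> k 0)\<bar>} = ennreal (exp (- t * rate m))"
proof -
  let ?A = "\<lambda>j::nat. {\<omega>\<in>space Om. \<forall>k\<in>{m<..m + int j}. t < \<bar>fst (\<omega> k 0)\<bar>}"
  have A: "emeasure Om (?A j) = ennreal (exp (- t * rate m + t * rate (m + int j)))" for j
  proof -
    have "?A j = {\<omega>\<in>space Om. \<forall>k\<in>{m<..m + int j}. \<omega> k \<in> {q\<in>space (Qm k). t < \<bar>fst (q 0)\<bar>}}"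
      by (auto simp: space_Om cp.space_Q)
    also have "emeasure Om \<dots> = (\<Prod>k\<in>{m<..m + int j}. emeasure (Qm k) {q\<in>space (Qm k). t < \<bar>fst (q 0)\<bar>})"
      unfolding Om_def by (rule OmP.emeasure_PiM_Collect) (auto simp del: cp.space_Q)
    also have "\<dots> = (\<Prod>k\<in>{m<..m + int j}. ennreal (exp (- rlev k * t)))"
      by (intro prod.cong refl cp.emeasure_no_jump t)
    also have "\<dots> = ennreal (\<Prod>k\<in>{m<..m + int j}. exp (- rlev k * t))" by (rule prod_ennreal) simp
    also have "(\<Prod>k\<in>{m<..m + int j}. exp (- rlev k * t)) = exp (\<Sum>k\<in>{m<..m + int j}. - rlev k * t)"
      by (simp add: exp_sum)
    also have "(\<Sum>k\<in>{m<..m + int j}. - rlev k * t) = (\<Sum>k\<in>{m + 1..m + int j}. (rate k - rate (k - 1))) * t"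
      unfolding sum_distrib_right by (rule sum.cong) (auto simp: rlev_def)
    also have "\<dots> = - t * rate m + t * rate (m + int j)"
      by (subst sum_int_telescope) (auto simp: algebra_simps)
    finally show ?thesis .
  qed
  have meas: "?A j \<in> sets Om" for j by measurable
  have "(\<lambda>j. measure Om (?A j)) \<longlonglongrightarrow> measure Om (\<Inter>j. ?A j)"
    by (rule Om.finite_Lim_measure_decseq) (auto simp: decseq_def intro: meas)
  moreover have "measure Om (?A j) = exp (- t * rate m + t * rate (m + int j))" for j
    using A[of j] by (simp add: measure_def)
  moreover have "(\<lambda>j. exp (- t * rate m + t * rate (m + int j))) \<longlonglongrightarrow> exp (- t * rate m + t * 0)"
  proof (intro tendsto_intros)
    show "(\<lambda>j. rate (m + int j)) \<longlonglongrightarrow> 0"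
    proof (rule tendsto_sandwich[OF _ _ tendsto_const])
      have "filterlim (\<lambda>j. nat (m + int j)) at_top sequentially"
        unfolding filterlim_at_top eventually_sequentially
      proof
        fix Z :: nat
        have "Z \<le> nat (m + int j)" if "nat (int Z - m) \<le> j" for j using that by linarith
        then show "\<exists>N. \<forall>j\<ge>N. Z \<le> nat (m + int j)" by blast
      qed
      from filterlim_compose[OF rate_tendsto_0 this] show "(\<lambda>j. rate (int (nat (m + int j)))) \<longlonglongrightarrow> 0" .
      show "\<forall>\<^sub>F j in sequentially. rate (m + int j) \<le> rate (int (nat (m + int j)))"
        unfolding eventually_sequentially by (rule exI[of _ "nat \<bar>m\<bar>"]) auto
    qed (use rate_pos in \<open>auto intro!: always_eventually less_imp_le\<close>)
  qed
  ultimately have "measure Om (\<Inter>j. ?A j) = exp (- t * rate m)" by (simp add: LIMSEQ_unique)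
  moreover have "(\<Inter>j. ?A j) = {\<omega>\<in>space Om. \<forall>k>m. t < \<bar>fst (\<omega> k 0)\<bar>}"
  proof (intro equalityI subsetI)
    fix \<omega> assume *: "\<omega> \<in> (\<Inter>j. ?A j)"
    have "t < \<bar>fst (\<omega> k 0)\<bar>" if "k > m" for k
    proof -
      have "\<omega> \<in> ?A (nat (k - m))" using * by blast
      then show ?thesis using that by auto
    qed
    then show "\<omega> \<in> {\<omega>\<in>space Om. \<forall>k>m. t < \<bar>fst (\<omega> k 0)\<bar>}" using * by blast
  qed auto
  ultimately show ?thesis by (simp add: Om.emeasure_eq_measure)
qed

lemma AE_good: "AE \<omega> in Om. good \<omega>"
proof -
  have c: "AE \<omega> in Om. P (\<omega> m)" if "AE q in Qm m. P q" for P m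
    unfolding Om_def by (rule AE_PiM_component) (use that cp.Q_prob in auto)
  have 1: "AE \<omega> in Om. \<forall>m. nonexp (\<omega> m)"
    by (subst AE_all_countable) (intro allI c cp.AE_nonexp)
  have 2: "AE \<omega> in Om. \<forall>m i. snd (\<omega> m i) \<in> B m"
    by (subst AE_all_countable, intro allI c cp.AE_supp Ulev_supp)
  have 3: "AE \<omega> in Om. \<forall>m. 0 < \<bar>fst (\<omega> m 0)\<bar>"
  proof (subst AE_all_countable, intro allI c)
    fix m
    have "measure (Qm m) {q\<in>space (Qm m). 0 < \<bar>fst (q 0)\<bar>} = 1"
      using cp.emeasure_no_jump[of 0 m] by (simp add: measure_def)
    then show "AE q in Qm m. 0 < \<bar>fst (q 0)\<bar>"
      by (subst (asm) cp.Q.prob_Collect_eq_1) auto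
  qed
  \<comment> \<open>With probability \<open>exp (- T * rate (int K))\<close> no level above
    \<open>K\<close> jumps up to time \<open>T\<close>, and this tends to 1 as \<open>K\<close>
    grows.\<close>
  have 4: "AE \<omega> in Om. \<forall>T::nat. \<exists>K::nat. \<forall>m>int K. real T < \<bar>fst (\<omega> m 0)\<bar>"
  proof (subst AE_all_countable, intro allI)
    fix T :: nat
    let ?A = "{\<omega>\<in>space Om. \<exists>K::nat. \<forall>m>int K. real T < \<bar>fst (\<omega> m 0)\<bar>}"
    have A: "?A \<in> sets Om" by measurable
    have "exp (- T * rate (int K)) \<le> measure Om ?A" for K
    proof -
      have "measure Om {\<omega>\<in>space Om. \<forall>m>int K. real T < \<bar>fst (\<omega> m 0)\<bar>} = exp (- T * rate (int K))"
        using emeasure_no_jump_above[of "real T" "int K"] by (simp add: measure_def)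
      moreover have "measure Om {\<omega>\<in>space Om. \<forall>m>int K. real T < \<bar>fst (\<omega> m 0)\<bar>} \<le> measure Om ?A"
        by (rule Om.finite_measure_mono[OF _ A]) auto
      ultimately show ?thesis by simp
    qed
    then have "1 \<le> measure Om ?A" using exp_rate_tendsto_1[of "real T"] by (intro LIMSEQ_le_const2) auto
    then have "measure Om ?A = 1" using Om.prob_le_1[of ?A] by linarith
    then show "AE \<omega> in Om. \<exists>K::nat. \<forall>m>int K. real T < \<bar>fst (\<omega> m 0)\<bar>"
      using A by (subst (asm) Om.prob_Collect_eq_1) auto
  qed
  show ?thesis using 1 2 3 4 by eventually_elim (simp add: good_def)
qed

lemma good_gv: assumes g: "good \<omega>" and t: "t \<ge> 0" shows "gv (\<lambda>m. cpp t (\<omega> m))"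
proof -
  obtain T :: nat where T: "t < real T" using reals_Archimedean2 by blast
  obtain K :: nat where K: "\<forall>m>int K. real T < \<bar>fst (\<omega> m 0)\<bar>" using g unfolding good_def by blast
  have "cpp t (\<omega> m) = \<zero>" if "m > int K" for m
    using K that T t by (intro cpp_before_first) (auto intro: less_trans)
  moreover have "cpp t (\<omega> m) \<in> B m" for m using g by (intro cpp_mem_B) (auto simp: good_def)
  ultimately show ?thesis unfolding gv_def by blast
qed

lemma Xp_zero: assumes g: "good \<omega>" shows "Xp 0 \<omega> = \<zero>"
proof -
  have "cpp 0 (\<omega> m) = \<zero>" for m using g by (intro cpp_before_first) (auto simp: good_def)
  then show ?thesis by (simp add: Xp_def series_zero)
qed

lemma Xp_closed: "Xp t \<omega> \<in> carrier R"
  by (simp add: Xp_def series_closed)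

lemma good_local:
  assumes g: "good \<omega>" and T: "T \<ge> 0"
  shows "\<exists>K::nat. \<forall>m>int K. \<forall>t\<in>{0..T}. cpp t (\<omega> m) = \<zero>"
proof -
  obtain N :: nat where N: "T < real N" using reals_Archimedean2 by blast
  obtain K :: nat where "\<forall>m>int K. real N < \<bar>fst (\<omega> m 0)\<bar>" using g unfolding good_def by blast
  then have "\<forall>m>int K. \<forall>t\<in>{0..T}. cpp t (\<omega> m) = \<zero>"
    using N by (auto intro!: cpp_before_first intro: le_less_trans less_trans)
  then show ?thesis by blast
qed

text \<open>To the precision of \<open>B n\<close> only finitely many levels matter: those up to
  \<open>n\<close> stay in \<open>B n\<close>, those above some \<open>K\<close> have not jumped
  yet, and each of the others is constant just after \<open>t\<close>.\<close>

lemma Xp_right_continuous: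
  assumes g: "good \<omega>" and t: "t \<ge> 0"
  shows "\<forall>\<^sub>F r in at_right t. Xp r \<omega> \<ominus> Xp t \<omega> \<in> B n"
proof -
  obtain K :: nat where K: "\<forall>m>int K. \<forall>t\<in>{0..t + 1}. cpp t (\<omega> m) = \<zero>" using good_local[OF g, of "t + 1"] t by auto
  have "\<forall>m\<in>{n<..int K}. \<forall>\<^sub>F r in at_right t. cpp r (\<omega> m) = cpp t (\<omega> m)"
    using g t by (intro ballI cpp_right_locally_constant) (auto simp: good_def)
  then have "\<forall>\<^sub>F r in at_right t. \<forall>m\<in>{n<..int K}. cpp r (\<omega> m) = cpp t (\<omega> m)"
    by (intro eventually_ball_finite) auto
  moreover have "\<forall>\<^sub>F r in at_right t. t < r \<and> r < t + 1"
    by (rule eventually_at_rightI[of t "t + 1"]) auto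
  ultimately show ?thesis
  proof eventually_elim
    fix r assume r: "\<forall>m\<in>{n<..int K}. cpp r (\<omega> m) = cpp t (\<omega> m)" "t < r \<and> r < t + 1"
    have gr: "gv (\<lambda>m. cpp r (\<omega> m))" "gv (\<lambda>m. cpp t (\<omega> m))" using good_gv[OF g] r t by auto
    have "cpp r (\<omega> m) \<ominus> cpp t (\<omega> m) \<in> B n" for m
    proof -
      consider "m \<le> n" | "m \<in> {n<..int K}" | "m > int K" by fastforce
      then show ?thesis
      proof cases
        case 1
        then show ?thesis using gr by (intro B_le[OF B_minus, of _ m]) (auto simp: gv_def)
      next
        case 2
        then show ?thesis using r(1) gv_carrier[OF gr(2), of m] by simp
      next
        case 3
        then show ?thesis using K r t by simp
      qed
    qed
    then show "Xp r \<omega> \<ominus> Xp t \<omega> \<in> B n" unfolding Xp_def by (intro series_near gr)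
  qed
qed

text \<open>The same localization: every level has a left limit, a partial sum of its jumps, and
  these limits satisfy \<open>gv\<close> again and can be summed.\<close>

lemma Xp_left_limit:
  assumes g: "good \<omega>" and t: "t > 0"
  shows "\<exists>l\<in>carrier R. \<forall>n. \<forall>\<^sub>F r in at_left t. Xp r \<omega> \<ominus> l \<in> B n"
proof -
  obtain K :: nat where K: "\<forall>m>int K. \<forall>s\<in>{0..t}. cpp s (\<omega> m) = \<zero>" using good_local[OF g, of t] t by auto
  have "\<forall>m. \<exists>i. \<forall>\<^sub>F r in at_left t. cpp r (\<omega> m) = psum i (\<omega> m)"
    using g t by (intro allI cpp_left_locally_constant) (auto simp: good_def)
  then obtain i where i: "\<And>m. \<forall>\<^sub>F r in at_left t. cpp r (\<omega> m) = psum (i m) (\<omega> m)" by metis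
  define y where "y m = psum (i m) (\<omega> m)" for m
  have pos: "\<forall>\<^sub>F r in at_left t. 0 < r \<and> r < t" using t by (intro eventually_at_leftI[of 0]) auto
  \<comment> \<open>At such a time the level already has its left limit, which therefore inherits
    membership in \<open>B m\<close> and, for high levels, vanishing.\<close>
  have ex: "\<exists>r. 0 < r \<and> r < t \<and> cpp r (\<omega> m) = y m" for m
    using eventually_happens'[OF _ eventually_conj[OF pos i[of m]]] by (auto simp: y_def)
  have y: "gv y"
    unfolding gv_def
  proof (intro conjI allI exI[of _ "int K"] impI)
    fix m
    obtain r where r: "0 < r" "r < t" "cpp r (\<omega> m) = y m" using ex by blast
    have "gv (\<lambda>m. cpp r (\<omega> m))" using r by (intro good_gv[OF g]) simp
    then show "y m \<in> B m" using r(3) by (metis gv_def)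
    assume "int K < m"
    then have "cpp r (\<omega> m) = \<zero>" using K r by simp
    then show "y m = \<zero>" using r(3) by simp
  qed
  have "\<forall>\<^sub>F r in at_left t. Xp r \<omega> \<ominus> series y \<in> B n" for n
  proof -
    have "\<forall>\<^sub>F r in at_left t. \<forall>m\<in>{n<..int K}. cpp r (\<omega> m) = y m"
      using i by (intro eventually_ball_finite) (auto simp: y_def)
    then show ?thesis using pos
    proof eventually_elim
      fix r assume r: "\<forall>m\<in>{n<..int K}. cpp r (\<omega> m) = y m" "0 < r \<and> r < t"
      have gr: "gv (\<lambda>m. cpp r (\<omega> m))" using good_gv[OF g] r by auto
      have "cpp r (\<omega> m) \<ominus> y m \<in> B n" for m
      proof -
        consider "m \<le> n" | "m \<in> {n<..int K}" | "m > int K" by fastforce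
        then show ?thesis
        proof cases
          case 1
          then show ?thesis using gr y by (intro B_le[OF B_minus, of _ m]) (auto simp: gv_def)
        next
          case 2
          then show ?thesis using r(1) gv_carrier[OF y, of m] by simp
        next
          case 3
          moreover have "y m = \<zero>"
          proof -
            obtain r' where "0 < r'" "r' < t" "cpp r' (\<omega> m) = y m" using ex by blast
            then show ?thesis using K 3 by (metis atLeastAtMost_iff less_imp_le)
          qed
          ultimately show ?thesis using K r by simp
        qed
      qed
      then show "Xp r \<omega> \<ominus> series y \<in> B n" unfolding Xp_def by (intro series_near gr y)
    qed
  qed
  then show ?thesis using series_closed by blast
qed

lemma Xp_locally_bounded:
  assumes g: "good \<omega>" and T: "T \<ge> 0" shows "\<exists>n. \<forall>t\<in>{0..T}. Xp t \<omega> \<in> B n"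
proof -
  obtain K :: nat where K: "\<forall>m>int K. \<forall>s\<in>{0..T}. cpp s (\<omega> m) = \<zero>" using good_local[OF g T] by blast
  have "Xp t \<omega> \<in> B (int K)" if "t \<in> {0..T}" for t
    unfolding Xp_def using K that good_gv[OF g] by (intro series_mem_B) auto
  then show ?thesis by blast
qed

end

section \<open>The law of the sum and the transition kernels\<close>

context heat
begin

text \<open>Resampling one coordinate leaves a product measure unchanged; this serves as
  conditioning on all other levels.\<close>

lemma nn_integral_Om_split:
  assumes f [measurable]: "f \<in> borel_measurable Om"
  shows "(\<integral>\<^sup>+\<omega>. f \<omega> \<partial>Om) = (\<integral>\<^sup>+\<omega>. \<integral>\<^sup>+q. f (fun_upd \<omega> m q) \<partial>Qm m \<partial>Om)"
proof -
  interpret P: pair_prob_space "Qm m" Om by unfold_locales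
  have eq: "distr (Qm m \<Otimes>\<^sub>M Om) Om (\<lambda>(q, \<omega>). (fun_upd \<omega> m q)) = Om"
    using distr_pair_PiM_eq_PiM[of "UNIV :: int set" Qm m] cp.Q_prob by (simp add: Om_def)
  have m: "(\<lambda>(q, \<omega>). (fun_upd \<omega> m q)) \<in> measurable (Qm m \<Otimes>\<^sub>M Om) Om"
    using measurable_fun_upd[of UNIV UNIV m snd "Qm m \<Otimes>\<^sub>M Om" Qm fst] by (simp add: Om_def split_beta')
  have fm: "(\<lambda>z. f ((snd z)(m := fst z))) \<in> borel_measurable (Qm m \<Otimes>\<^sub>M Om)"
    using measurable_compose[OF m f] by (simp add: split_beta')
  have "(\<integral>\<^sup>+\<omega>. f \<omega> \<partial>Om) = (\<integral>\<^sup>+\<omega>. f \<omega> \<partial>distr (Qm m \<Otimes>\<^sub>M Om) Om (\<lambda>(q, \<omega>). (fun_upd \<omega> m q)))" by (simp only: eq)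
  also have "\<dots> = (\<integral>\<^sup>+z. f ((snd z)(m := fst z)) \<partial>(Qm m \<Otimes>\<^sub>M Om))"
    using nn_integral_distr[OF m, of f] f by (simp add: split_beta')
  also have "\<dots> = (\<integral>\<^sup>+\<omega>. \<integral>\<^sup>+q. f (fun_upd \<omega> m q) \<partial>Qm m \<partial>Om)"
    using P.nn_integral_snd[of "\<lambda>z. f ((snd z)(m := fst z))"] fm by (simp add: split_beta')
  finally show ?thesis .
qed

lemma AE_jumps_in_B: "AE \<omega> in Om. \<forall>m i. snd (\<omega> m i) \<in> B m"
  using AE_good by eventually_elim (simp add: good_def)

text \<open>The largest level that has jumped up to time \<open>t\<close> makes \<open>Xp t\<close> uniform on its ball.\<close>

definition top_level :: "real \<Rightarrow> int \<Rightarrow> (int \<Rightarrow> nat \<Rightarrow> real \<times> 'a) \<Rightarrow> bool" where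
  "top_level t m \<omega> \<longleftrightarrow> (\<forall>k>m. t < \<bar>fst (\<omega> k 0)\<bar>) \<and> \<bar>fst (\<omega> m 0)\<bar> \<le> t"

lemma top_level_measurable [measurable]: "Measurable.pred Om (top_level t m)"
  unfolding top_level_def[abs_def] by measurable

lemma top_level_unique: "top_level t m \<omega> \<Longrightarrow> top_level t n \<omega> \<Longrightarrow> m = n"
  unfolding top_level_def by (metis not_le linorder_neqE)

text \<open>With the other levels fixed and the higher ones silent, \<open>Xp t\<close> is the value
  of level \<open>m\<close> plus some \<open>b\<close> in \<open>B m\<close>, so
  \<open>cpp_after_jump\<close> gives a uniform law. The probability that level \<open>m\<close> has
  jumped times the probability that no higher one has is \<open>weight t m\<close>.\<close>

lemma emeasure_top_level:
  assumes t: "t \<ge> 0" and A [measurable]: "A \<in> sets M"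
  shows "emeasure Om {\<omega>\<in>space Om. top_level t m \<omega> \<and> Xp t \<omega> \<in> A} = ennreal (weight t m) * emeasure (Ulev m) A"
proof -
  let ?E = "{\<omega>\<in>space Om. top_level t m \<omega> \<and> Xp t \<omega> \<in> A}" and ?N = "{\<omega>\<in>space Om. \<forall>k>m. t < \<bar>fst (\<omega> k 0)\<bar>}"
  let ?c = "ennreal (1 - exp (- rlev m * t)) * emeasure (Ulev m) A"
  have E: "?E \<in> sets Om" by measurable
  have N: "?N \<in> sets Om" by measurable
  have inner: "(\<integral>\<^sup>+q. indicator ?E (fun_upd \<omega> m q) \<partial>Qm m) = ?c * indicator ?N \<omega>"
    if \<omega>: "\<omega> \<in> space Om" and jB: "\<forall>k i. snd (\<omega> k i) \<in> B k" for \<omega>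
  proof (cases "\<forall>k>m. t < \<bar>fst (\<omega> k 0)\<bar>")
    case True
    define b where "b = series ((\<lambda>k. cpp t (\<omega> k))(m := \<zero>))"
    have gvu: "gv (\<lambda>k. cpp t ((fun_upd \<omega> m q) k))" if "\<forall>i. snd (q i) \<in> B m" for q
      unfolding gv_def
    proof (intro conjI allI exI[of _ m] impI)
      show "cpp t ((fun_upd \<omega> m q) k) \<in> B k" for k using jB that by (intro cpp_mem_B) auto
      show "cpp t ((fun_upd \<omega> m q) k) = \<zero>" if "m < k" for k
        using True that t by (intro cpp_before_first) auto
    qed
    have "gv ((\<lambda>k. cpp t (\<omega> k))(m := \<zero>))"
      unfolding gv_def
    proof (intro conjI allI exI[of _ m] impI)
      show "((\<lambda>k. cpp t (\<omega> k))(m := \<zero>)) k \<in> B k" for k using jB cpp_mem_B by auto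
      show "((\<lambda>k. cpp t (\<omega> k))(m := \<zero>)) k = \<zero>" if "m < k" for k
        using True that t cpp_before_first by auto
    qed
    then have b: "b \<in> B m" unfolding b_def
      by (rule series_mem_B) (use True t cpp_before_first in auto)
    have bc: "b \<in> carrier R" by (rule B_carrier[OF b])
    define C where "C = {v \<in> space M. v \<oplus> b \<in> A}"
    have C: "C \<in> sets M"
      using measurable_sets[OF measurable_radd[OF bc] A] by (simp add: C_def vimage_def Int_def conj_commute)
    have "AE q in Qm m. \<forall>i. snd (q i) \<in> B m" by (rule cp.AE_supp[OF Ulev_supp])
    then have "AE q in Qm m. indicator ?E (fun_upd \<omega> m q) =
      (indicator {q\<in>space (Qm m). \<bar>fst (q 0)\<bar> \<le> t \<and> cpp t q \<in> C} q :: ennreal)"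
      using AE_space[of "Qm m"]
    proof eventually_elim
      fix q assume q: "q \<in> space (Qm m)" "\<forall>i. snd (q i) \<in> B m"
      have sp: "(fun_upd \<omega> m q) \<in> space Om" using \<omega> q by (simp add: space_Om cp.space_Q)
      have "(\<lambda>k. cpp t ((fun_upd \<omega> m q) k))(m := \<zero>) = (\<lambda>k. cpp t (\<omega> k))(m := \<zero>)" by auto
      then have X: "Xp t (fun_upd \<omega> m q) = cpp t q \<oplus> b"
        using series_split[OF gvu[OF q(2)], of m] by (simp add: Xp_def b_def)
      have T: "top_level t m (fun_upd \<omega> m q) \<longleftrightarrow> \<bar>fst (q 0)\<bar> \<le> t" using True by (auto simp: top_level_def)
      have "cpp t q \<in> space M" using q cpp_closed by (simp add: cp.space_Q space_M)
      then show "indicator ?E (fun_upd \<omega> m q) = (indicator {q\<in>space (Qm m). \<bar>fst (q 0)\<bar> \<le> t \<and> cpp t q \<in> C} q :: ennreal)"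
        using sp q(1) by (simp add: indicator_def X T C_def)
    qed
    then have "(\<integral>\<^sup>+q. indicator ?E (fun_upd \<omega> m q) \<partial>Qm m) =
      (\<integral>\<^sup>+q. indicator {q\<in>space (Qm m). \<bar>fst (q 0)\<bar> \<le> t \<and> cpp t q \<in> C} q \<partial>Qm m)"
      by (rule nn_integral_cong_AE)
    also have "\<dots> = emeasure (Qm m) {q\<in>space (Qm m). \<bar>fst (q 0)\<bar> \<le> t \<and> cpp t q \<in> C}"
    proof (rule nn_integral_indicator)
      note C [measurable]
      show "{q\<in>space (Qm m). \<bar>fst (q 0)\<bar> \<le> t \<and> cpp t q \<in> C} \<in> sets (Qm m)" by measurable
    qed
    also have "\<dots> = ennreal (1 - exp (- rlev m * t)) * emeasure (Ulev m) C"
      by (rule cp.cpp_after_jump[OF t C Ulev_supp Ulev_inv[OF _ C]])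
    also have "emeasure (Ulev m) C = emeasure (Ulev m) A"
      using Ulev_inv[OF b A] sets_eq_imp_space_eq[OF sets_Ulev[of m]] by (simp add: C_def)
    finally have *: "(\<integral>\<^sup>+q. indicator ?E (fun_upd \<omega> m q) \<partial>Qm m) = ?c" .
    have "indicator ?N \<omega> = (1 :: ennreal)" using True \<omega> by simp
    then show ?thesis unfolding * by simp
  next
    case False
    then have "\<not> top_level t m (fun_upd \<omega> m q)" for q by (auto simp: top_level_def)
    then show ?thesis using False by simp
  qed
  have "emeasure Om ?E = (\<integral>\<^sup>+\<omega>. indicator ?E \<omega> \<partial>Om)" using E by simp
  also have "\<dots> = (\<integral>\<^sup>+\<omega>. \<integral>\<^sup>+q. indicator ?E (fun_upd \<omega> m q) \<partial>Qm m \<partial>Om)"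
    by (rule nn_integral_Om_split[OF borel_measurable_indicator[OF E]])
  also have "\<dots> = (\<integral>\<^sup>+\<omega>. ?c * indicator ?N \<omega> \<partial>Om)"
    by (intro nn_integral_cong_AE, use AE_space[of Om] AE_jumps_in_B in eventually_elim) (rule inner)
  also have "\<dots> = ?c * ennreal (exp (- t * rate m))"
    using N emeasure_no_jump_above[OF t, of m] by (simp add: nn_integral_cmult_indicator)
  also have "\<dots> = ennreal ((1 - exp (- rlev m * t)) * exp (- t * rate m)) * emeasure (Ulev m) A"
    by (subst ennreal_mult'') (simp_all add: mult_ac)
  also have "(1 - exp (- rlev m * t)) * exp (- t * rate m) = weight t m"
    by (simp add: weight_def rlev_def left_diff_distrib mult_exp_exp algebra_simps)
  finally show ?thesis .
qed

text \<open>The events that \<open>m\<close> is the top level are disjoint, and their total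
  probability over \<open>{- int k..int k}\<close> tends to 1, so restricting to them costs an error
  tending to 0.\<close>

lemma Xp_law:
  assumes t: "t > 0" and A [measurable]: "A \<in> sets M"
  shows "(\<lambda>k. \<Sum>m\<in>{- int k..int k}. weight t m * measure (Ulev m) A)
    \<longlonglongrightarrow> measure Om {\<omega>\<in>space Om. Xp t \<omega> \<in> A}"
proof -
  have U: "(\<Sum>m\<in>{- int k..int k}. weight t m * measure (Ulev m) A) =
    measure Om (\<Union>m\<in>{- int k..int k}. {\<omega>\<in>space Om. top_level t m \<omega> \<and> Xp t \<omega> \<in> A})" if [measurable]: "A \<in> sets M" for A k
  proof -
    have "measure Om (\<Union>m\<in>{- int k..int k}. {\<omega>\<in>space Om. top_level t m \<omega> \<and> Xp t \<omega> \<in> A}) =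
      (\<Sum>m\<in>{- int k..int k}. measure Om {\<omega>\<in>space Om. top_level t m \<omega> \<and> Xp t \<omega> \<in> A})"
    proof (rule Om.finite_measure_finite_Union)
      show "(\<lambda>m. {\<omega>\<in>space Om. top_level t m \<omega> \<and> Xp t \<omega> \<in> A}) ` {- int k..int k} \<subseteq> sets Om"
      proof (rule image_subsetI)
        fix m show "{\<omega>\<in>space Om. top_level t m \<omega> \<and> Xp t \<omega> \<in> A} \<in> sets Om" by measurable
      qed
      show "disjoint_family_on (\<lambda>m. {\<omega>\<in>space Om. top_level t m \<omega> \<and> Xp t \<omega> \<in> A}) {- int k..int k}"
        unfolding disjoint_family_on_def using top_level_unique by blast
    qed simp
    also have "\<dots> = (\<Sum>m\<in>{- int k..int k}. weight t m * measure (Ulev m) A)"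
      using emeasure_top_level[OF less_imp_le[OF t] that] weight_nonneg[of t] t
      by (intro sum.cong) (auto simp: measure_def enn2real_mult)
    finally show ?thesis by simp
  qed
  let ?V = "\<lambda>A k. \<Union>m\<in>{- int k..int k}. {\<omega>\<in>space Om. top_level t m \<omega> \<and> Xp t \<omega> \<in> A}"
  let ?X = "{\<omega>\<in>space Om. Xp t \<omega> \<in> A}" and ?w = "\<lambda>k::nat. \<Sum>m\<in>{- int k..int k}. weight t m"
  have VS: "?V A k \<in> sets Om" if [measurable]: "A \<in> sets M" for A k
    by (intro sets.finite_UN) auto
  have XS: "?X \<in> sets Om" by measurable
  have one: "measure (Ulev m) (space M) = 1" for m
    using prob_space.prob_space[OF Ulev_prob, of m] sets_eq_imp_space_eq[OF sets_Ulev[of m]] by simp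
  have w: "?w k = measure Om (?V (space M) k)" for k
    using U[OF sets.top, of k] by (simp add: one)
  have le: "measure Om (?V A k) \<le> measure Om ?X" for k
    by (intro Om.finite_measure_mono XS) auto
  have ge: "measure Om ?X - (1 - ?w k) \<le> measure Om (?V A k)" for k
  proof -
    have "?X \<subseteq> ?V A k \<union> (space Om - ?V (space M) k)" using Xp_closed by (auto simp: space_M)
    then have "measure Om ?X \<le> measure Om (?V A k \<union> (space Om - ?V (space M) k))"
      using VS by (intro Om.finite_measure_mono) auto
    also have "\<dots> \<le> measure Om (?V A k) + measure Om (space Om - ?V (space M) k)"
      using VS by (intro measure_Un_le) auto
    also have "measure Om (space Om - ?V (space M) k) = 1 - ?w k"
      using VS w by (subst Om.prob_compl) auto
    finally show ?thesis by simp
  qed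
  have "?w k = exp (- t * rate (int k)) - exp (- t * rate (- int (Suc k)))" for k
  proof -
    have "- int (Suc k) = - int k - 1" by simp
    then show ?thesis by (simp only:) (rule sum_weight, simp)
  qed
  moreover have "(\<lambda>k. exp (- t * rate (int k)) - exp (- t * rate (- int (Suc k)))) \<longlonglongrightarrow> 1 - 0"
    by (intro tendsto_diff exp_rate_tendsto_1 LIMSEQ_Suc[OF exp_rate_tendsto_0[OF t]])
  ultimately have "?w \<longlonglongrightarrow> 1" by simp
  then have low: "(\<lambda>k. measure Om ?X - (1 - ?w k)) \<longlonglongrightarrow> measure Om ?X - (1 - 1)" by (intro tendsto_intros)
  have "(\<lambda>k. measure Om (?V A k)) \<longlonglongrightarrow> measure Om ?X"
  proof (rule tendsto_sandwich)
    show "(\<lambda>k. measure Om ?X - (1 - ?w k)) \<longlonglongrightarrow> measure Om ?X" using low by simp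
    show "(\<lambda>k. measure Om ?X) \<longlonglongrightarrow> measure Om ?X" by (rule tendsto_const)
    show "\<forall>\<^sub>F k in sequentially. measure Om ?X - (1 - ?w k) \<le> measure Om (?V A k)"
      by (rule always_eventually, rule allI, rule ge)
    show "\<forall>\<^sub>F k in sequentially. measure Om (?V A k) \<le> measure Om ?X"
      by (rule always_eventually, rule allI, rule le)
  qed
  then show ?thesis unfolding U[OF A] .
qed

text \<open>Taken from the process, so that it is a probability measure by construction;
  \<open>measure_kern\<close> identifies its density with the heat kernel.\<close>

definition kern :: "real \<Rightarrow> 'a \<Rightarrow> 'a measure" where
  "kern t x = distr Om M (\<lambda>\<omega>. x \<oplus> Xp t \<omega>)"

lemma measurable_add_Xp: "x \<in> carrier R \<Longrightarrow> (\<lambda>\<omega>. x \<oplus> Xp t \<omega>) \<in> measurable Om M"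
  by (intro measurable_rplus measurable_const_carrier Xp_measurable)

lemma sets_kern [simp]: "sets (kern t x) = sets M"
  by (simp add: kern_def)

lemma emeasure_kern:
  "x \<in> carrier R \<Longrightarrow> A \<in> sets M \<Longrightarrow> emeasure (kern t x) A = emeasure Om {\<omega>\<in>space Om. x \<oplus> Xp t \<omega> \<in> A}"
  unfolding kern_def by (subst emeasure_distr[OF measurable_add_Xp]) (auto simp: vimage_def Int_def conj_commute)

lemma kern_prob: "x \<in> carrier R \<Longrightarrow> prob_space (kern t x)"
  unfolding kern_def by (intro Om.prob_space_distr measurable_add_Xp)

lemma kern_measurable [measurable]: "kern t \<in> measurable M (prob_algebra M)"
  unfolding kern_def[abs_def]
proof (rule measurable_distr_prob_space2)
  show "(\<lambda>x. Om) \<in> measurable M (prob_algebra Om)" using Om_prob by (simp add: space_prob_algebra)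
  have "(\<lambda>z. fst z \<oplus> Xp t (snd z)) \<in> measurable (M \<Otimes>\<^sub>M Om) M"
    by (intro measurable_rplus measurable_fst measurable_compose[OF measurable_snd Xp_measurable])
  then show "(\<lambda>(x, \<omega>). x \<oplus> Xp t \<omega>) \<in> measurable (M \<Otimes>\<^sub>M Om) M" by (simp add: split_beta')
qed

text \<open>Both sides are limits of the same sums, obtained from the density in
  \<open>kernel_mass\<close> and from the process in \<open>Xp_law\<close>.\<close>

lemma measure_kern:
  assumes t: "t > 0" and x: "x \<in> carrier R" and A [measurable]: "A \<in> sets M"
  shows "measure (kern t x) A = (LINT y|M. indicator A y * Z t (x \<ominus> y))"
proof -
  define A' where "A' = {v \<in> space M. v \<oplus> x \<in> A}"
  have A': "A' \<in> sets M"
    using measurable_sets[OF measurable_radd[OF x] A] by (simp add: A'_def vimage_def Int_def conj_commute)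
  have c: "x \<oplus> Xp t \<omega> = Xp t \<omega> \<oplus> x" for \<omega> using x Xp_closed by (simp add: a_comm)
  have "measure (kern t x) A = measure Om {\<omega>\<in>space Om. Xp t \<omega> \<in> A'}"
    using emeasure_kern[OF x A, of t] Xp_closed by (simp add: measure_def A'_def c space_M)
  moreover have "measure (Ulev m) A' = measure M (bl x m \<inter> A) / exp (\<psi> m)" for m
  proof -
    have "(\<lambda>v. v \<oplus> x) -` (bl x m \<inter> A) \<inter> space M = B m \<inter> A'"
    proof -
      have "v \<oplus> x \<ominus> x = v" if "v \<in> carrier R" for v using that x by algebra
      then show ?thesis using x B_carrier by (auto simp: A'_def bl_iff space_M)
    qed
    then have "emeasure M (B m \<inter> A') = emeasure M (bl x m \<inter> A)"
      using emeasure_distr[OF measurable_radd[OF x], of "bl x m \<inter> A"] bl_sets[OF x, of m] by (simp add: distr_add[OF x])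
    moreover have "emeasure M (bl x m \<inter> A) = ennreal (measure M (bl x m \<inter> A))"
    proof (rule emeasure_eq_ennreal_measure)
      have "emeasure M (bl x m \<inter> A) \<le> emeasure M (bl x m)" by (intro emeasure_mono bl_sets x) auto
      then show "emeasure M (bl x m \<inter> A) \<noteq> Orderings.top" using emeasure_ball[OF x, of m] by (auto simp: top_unique)
    qed
    ultimately have "emeasure (Ulev m) A' = ennreal (measure M (bl x m \<inter> A) / exp (\<psi> m))"
      using A' by (simp add: emeasure_Ulev divide_ennreal)
    then show ?thesis by (simp add: measure_def)
  qed
  ultimately show ?thesis
    using LIMSEQ_unique[OF kernel_mass(1)[OF t x A]] Xp_law[OF t A'] by simp
qed

section \<open>Independence of the increments from the joint past of the levels\<close>

definition boxes :: "real \<Rightarrow> (int \<Rightarrow> nat \<Rightarrow> real \<times> 'a) set set" where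
  "boxes s = {{\<omega>\<in>space Om. \<forall>m\<in>J. \<omega> m \<in> A m} | J A. finite J \<and> (\<forall>m\<in>J. A m \<in> cp.past m s)}"

text \<open>The joint past of the levels. It makes every \<open>Xp r\<close> with \<open>r\<close>
  in \<open>{0..s}\<close> measurable, while its generators are stable under intersection and let
  independence factor over the levels.\<close>

definition hist :: "real \<Rightarrow> (int \<Rightarrow> nat \<Rightarrow> real \<times> 'a) measure" where
  "hist s = sigma (space Om) (boxes s)"

lemma cp_past_sets: "A \<in> cp.past m s \<Longrightarrow> A \<in> sets (Qm m)"
  by (simp add: cp.past_def)

lemma boxes_sets: assumes "G \<in> boxes s" shows "G \<in> sets Om"
proof -
  obtain J A where J: "finite J" "\<forall>m\<in>J. A m \<in> cp.past m s" and G: "G = {\<omega>\<in>space Om. \<forall>m\<in>J. \<omega> m \<in> A m}"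
    using assms by (auto simp: boxes_def)
  have "{\<omega>\<in>space Om. \<omega> m \<in> A m} \<in> sets Om" if "m \<in> J" for m
    using measurable_sets[OF Om_component cp_past_sets, of "A m" m s] J that
    by (simp add: vimage_def Int_def conj_commute)
  then show ?thesis unfolding G using J(1) by (intro sets.sets_Collect_finite_All) auto
qed

lemma boxes_Pow: "boxes s \<subseteq> Pow (space Om)"
  by (auto simp: boxes_def)

lemma space_hist [simp]: "space (hist s) = space Om"
  by (simp add: hist_def boxes_Pow)

lemma sets_hist: "sets (hist s) = sigma_sets (space Om) (boxes s)"
  by (simp add: hist_def boxes_Pow)

lemma hist_subalgebra: "subalgebra Om (hist s)"
  unfolding subalgebra_def sets_hist using boxes_sets sets.sigma_sets_subset[of "boxes s" Om] by auto

lemma boxes_Int_stable: "Int_stable (boxes s)"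
  unfolding Int_stable_def
proof (intro ballI)
  fix G G' assume "G \<in> boxes s" "G' \<in> boxes s"
  then obtain J A J' A' where J: "finite J" "\<forall>m\<in>J. A m \<in> cp.past m s" "finite J'" "\<forall>m\<in>J'. A' m \<in> cp.past m s"
    and G: "G = {\<omega>\<in>space Om. \<forall>m\<in>J. \<omega> m \<in> A m}" "G' = {\<omega>\<in>space Om. \<forall>m\<in>J'. \<omega> m \<in> A' m}"
    unfolding boxes_def by blast
  let ?A = "\<lambda>m. if m \<in> J then if m \<in> J' then A m \<inter> A' m else A m else A' m"
  have "A m \<inter> A' m \<in> cp.past m s" if "m \<in> J" "m \<in> J'" for m
    using bspec[OF J(2) that(1)] bspec[OF J(4) that(2)] unfolding cp.past_def by blast
  then have "\<forall>m\<in>J \<union> J'. ?A m \<in> cp.past m s" using J by auto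
  moreover have "G \<inter> G' = {\<omega>\<in>space Om. \<forall>m\<in>J \<union> J'. \<omega> m \<in> ?A m}"
  proof -
    have "(\<forall>m\<in>J \<union> J'. \<omega> m \<in> ?A m) \<longleftrightarrow> (\<forall>m\<in>J. \<omega> m \<in> A m) \<and> (\<forall>m\<in>J'. \<omega> m \<in> A' m)" for \<omega>
      unfolding ball_Un by (auto split: if_splits)
    then show ?thesis unfolding G by blast
  qed
  ultimately show "G \<inter> G' \<in> boxes s" unfolding boxes_def using J(1,3)
    by (intro CollectI exI[of _ "J \<union> J'"] exI[of _ ?A]) simp
qed

lemma hist_Xp: assumes r: "0 \<le> r" "r \<le> s" shows "Xp r \<in> measurable (hist s) M"
  unfolding Xp_def[abs_def]
proof (rule series_measurable)
  fix m
  show "(\<lambda>\<omega>. cpp r (\<omega> m)) \<in> measurable (hist s) M"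
  proof (rule measurableI)
    fix \<omega> assume "\<omega> \<in> space (hist s)"
    then show "cpp r (\<omega> m) \<in> space M" using cpp_closed by (simp add: space_Om space_M)
  next
    fix A assume A [measurable]: "A \<in> sets M"
    have "{q\<in>space (Qm m). cpp r q \<in> A} \<in> sets (Qm m)" by measurable
    then have "{q\<in>space (Qm m). cpp r q \<in> A} \<in> cp.past m s" using r by (auto simp: cp.past_def)
    then have "{\<omega>\<in>space Om. \<forall>k\<in>{m}. \<omega> k \<in> {q\<in>space (Qm m). cpp r q \<in> A}} \<in> boxes s"
      unfolding boxes_def by (intro CollectI exI[of _ "{m}"] exI[of _ "\<lambda>_. {q\<in>space (Qm m). cpp r q \<in> A}"]) auto
    moreover have "(\<lambda>\<omega>. cpp r (\<omega> m)) -` A \<inter> space (hist s) = {\<omega>\<in>space Om. \<forall>k\<in>{m}. \<omega> k \<in> {q\<in>space (Qm m). cpp r q \<in> A}}"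
      by (auto simp: space_Om cp.space_Q)
    ultimately show "(\<lambda>\<omega>. cpp r (\<omega> m)) -` A \<inter> space (hist s) \<in> sets (hist s)"
      unfolding sets_hist by (simp add: sigma_sets.Basic)
  qed
qed

definition incr :: "real \<Rightarrow> real \<Rightarrow> (int \<Rightarrow> nat \<Rightarrow> real \<times> 'a) \<Rightarrow> int \<Rightarrow> 'a" where
  "incr s t \<omega> m = cpp (s + t) (\<omega> m) \<ominus> cpp s (\<omega> m)"

abbreviation "MM \<equiv> \<Pi>\<^sub>M m\<in>(UNIV::int set). M"

lemma incr_measurable: "incr s t \<in> measurable Om MM"
proof (rule measurable_PiM_single')
  show "(\<lambda>\<omega>. incr s t \<omega> m) \<in> measurable Om M" for m
    unfolding incr_def by (intro measurable_rminus Om_cpp)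
  show "incr s t \<in> space Om \<rightarrow> (\<Pi>\<^sub>E i\<in>UNIV. space M)"
    using cpp_closed by (auto simp: space_Om incr_def space_M)
qed

lemma levels_measurable: "(\<lambda>\<omega> m. cpp t (\<omega> m)) \<in> measurable Om MM"
proof (rule measurable_PiM_single')
  show "(\<lambda>\<omega>. cpp t (\<omega> m)) \<in> measurable Om M" for m by (rule Om_cpp)
  show "(\<lambda>\<omega> m. cpp t (\<omega> m)) \<in> space Om \<rightarrow> (\<Pi>\<^sub>E i\<in>UNIV. space M)"
    using cpp_closed by (auto simp: space_Om space_M)
qed

text \<open>In \<open>C\<close>, both sides are finite measures on families indexed by the levels.
  On cylinders they factor over the levels, where \<open>past_increment_indep\<close> applies, and
  cylinders determine a finite measure.\<close>

lemma box_incr_indep: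
  assumes s: "s \<ge> 0" and t: "t \<ge> 0" and G: "G \<in> boxes s" and C: "C \<in> sets MM"
  shows "emeasure Om {\<omega>\<in>space Om. \<omega> \<in> G \<and> incr s t \<omega> \<in> C} =
    emeasure Om G * emeasure Om {\<omega>\<in>space Om. (\<lambda>m. cpp t (\<omega> m)) \<in> C}"
proof -
  obtain J A where J: "finite J" "\<forall>m\<in>J. A m \<in> cp.past m s" and Geq: "G = {\<omega>\<in>space Om. \<forall>m\<in>J. \<omega> m \<in> A m}"
    using G by (auto simp: boxes_def)
  have GS: "G \<in> sets Om" by (rule boxes_sets[OF G])
  let ?P = "distr (density Om (indicator G)) MM (incr s t)"
  let ?Q = "scale_measure (emeasure Om G) (distr Om MM (\<lambda>\<omega> m. cpp t (\<omega> m)))"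
  have im: "incr s t \<in> measurable (density Om (indicator G)) MM" using incr_measurable by simp
  have P: "emeasure ?P C = emeasure Om {\<omega>\<in>space Om. \<omega> \<in> G \<and> incr s t \<omega> \<in> C}" if C: "C \<in> sets MM" for C
  proof -
    have S: "incr s t -` C \<inter> space Om \<in> sets Om" by (rule measurable_sets[OF incr_measurable C])
    have "emeasure ?P C = emeasure (density Om (indicator G)) (incr s t -` C \<inter> space Om)"
      using emeasure_distr[OF im C] by simp
    also have "\<dots> = (\<integral>\<^sup>+\<omega>. indicator G \<omega> * indicator (incr s t -` C \<inter> space Om) \<omega> \<partial>Om)"
      using GS S by (subst emeasure_density) auto
    also have "\<dots> = (\<integral>\<^sup>+\<omega>. indicator (G \<inter> (incr s t -` C \<inter> space Om)) \<omega> \<partial>Om)"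
      by (simp add: indicator_inter_arith)
    also have "\<dots> = emeasure Om (G \<inter> (incr s t -` C \<inter> space Om))"
      using GS S by (intro nn_integral_indicator) auto
    also have "G \<inter> (incr s t -` C \<inter> space Om) = {\<omega>\<in>space Om. \<omega> \<in> G \<and> incr s t \<omega> \<in> C}" by auto
    finally show ?thesis .
  qed
  have Q: "emeasure ?Q C = emeasure Om G * emeasure Om {\<omega>\<in>space Om. (\<lambda>m. cpp t (\<omega> m)) \<in> C}" if "C \<in> sets MM" for C
    using emeasure_distr[OF levels_measurable that, of t] by (simp add: vimage_def Int_def conj_commute)
  have "?P = ?Q"
  proof (rule measure_eqI_PiM_infinite)
    show "finite_measure ?P"
    proof
      show "emeasure ?P (space ?P) \<noteq> \<infinity>" using P[OF sets.top] Om.emeasure_finite by simp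
    qed
    fix C :: "int \<Rightarrow> 'a set" and K assume K: "finite K" "\<And>i. i \<in> K \<Longrightarrow> C i \<in> sets M"
    \<comment> \<open>Filling up both families with the whole space lets them run over the common
      index set \<open>J \<union> K\<close>.\<close>
    define A' where "A' m = (if m \<in> J then A m else space (Qm m))" for m
    define C' where "C' m = (if m \<in> K then C m else space M)" for m
    have spp: "space (Qm m) \<in> cp.past m s" for m by (simp add: cp.past_def)
    have A': "A' m \<in> cp.past m s" for m using J(2) spp by (simp add: A'_def)
    have C': "C' m \<in> sets M" for m using K by (simp add: C'_def)
    let ?F = "J \<union> K"
    have E: "prod_emb UNIV (\<lambda>_. M) K (Pi\<^sub>E K C) = {y\<in>space MM. \<forall>m\<in>K. y m \<in> C m}"
      using K sets.sets_into_space by (auto simp: prod_emb_def space_PiM PiE_iff extensional_def)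
    have ES: "{y\<in>space MM. \<forall>m\<in>K. y m \<in> C m} \<in> sets MM"
      using K unfolding E[symmetric] by (intro sets_PiM_I) auto
    have comp: "\<omega> \<in> space Om \<Longrightarrow> \<omega> m \<in> space (Qm m)" for \<omega> m by (simp add: space_Om cp.space_Q)
    have cl: "\<omega> \<in> space Om \<Longrightarrow> incr s t \<omega> \<in> space MM" "\<omega> \<in> space Om \<Longrightarrow> (\<lambda>m. cpp t (\<omega> m)) \<in> space MM" for \<omega>
      using measurable_space[OF incr_measurable] measurable_space[OF levels_measurable] by auto
    have cl': "\<omega> \<in> space Om \<Longrightarrow> cpp (s + t) (\<omega> m) \<ominus> cpp s (\<omega> m) \<in> space M" "\<omega> \<in> space Om \<Longrightarrow> cpp t (\<omega> m) \<in> space M" for \<omega> m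
      using cpp_closed by (auto simp: space_Om space_M)
    have S1: "{q\<in>space (Qm m). q \<in> A' m \<and> cpp (s + t) q \<ominus> cpp s q \<in> C' m} \<in> sets (Qm m)" for m
    proof -
      have [measurable]: "C' m \<in> sets M" "A' m \<in> sets (Qm m)" using C' cp_past_sets[OF A'] by auto
      show ?thesis by measurable
    qed
    have S2: "{q\<in>space (Qm m). cpp t q \<in> C' m} \<in> sets (Qm m)" for m
    proof -
      have [measurable]: "C' m \<in> sets M" by (rule C')
      show ?thesis by measurable
    qed
    have "emeasure ?P (prod_emb UNIV (\<lambda>_. M) K (Pi\<^sub>E K C)) =
        emeasure Om {\<omega>\<in>space Om. \<forall>m\<in>?F. \<omega> m \<in> {q\<in>space (Qm m). q \<in> A' m \<and> cpp (s + t) q \<ominus> cpp s q \<in> C' m}}"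
      unfolding E P[OF ES] using cl cl' comp
      by (intro arg_cong[of _ _ "emeasure Om"]) (auto simp: Geq A'_def C'_def incr_def split: if_splits)
    also have "\<dots> = (\<Prod>m\<in>?F. emeasure (Qm m) {q\<in>space (Qm m). q \<in> A' m \<and> cpp (s + t) q \<ominus> cpp s q \<in> C' m})"
      unfolding Om_def using J K S1 by (intro OmP.emeasure_PiM_Collect) auto
    also have "\<dots> = (\<Prod>m\<in>?F. emeasure (Qm m) (A' m) * emeasure (Qm m) {q\<in>space (Qm m). cpp t q \<in> C' m})"
      by (intro prod.cong refl cp.past_increment_indep s t A' C')
    also have "\<dots> = (\<Prod>m\<in>?F. emeasure (Qm m) (A' m)) * (\<Prod>m\<in>?F. emeasure (Qm m) {q\<in>space (Qm m). cpp t q \<in> C' m})"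
      by (rule prod.distrib)
    also have "(\<Prod>m\<in>?F. emeasure (Qm m) (A' m)) = emeasure Om {\<omega>\<in>space Om. \<forall>m\<in>?F. \<omega> m \<in> A' m}"
      unfolding Om_def using J K cp_past_sets[OF A'] by (intro OmP.emeasure_PiM_Collect[symmetric]) auto
    also have "{\<omega>\<in>space Om. \<forall>m\<in>?F. \<omega> m \<in> A' m} = G" using comp by (auto simp: Geq A'_def)
    also have "(\<Prod>m\<in>?F. emeasure (Qm m) {q\<in>space (Qm m). cpp t q \<in> C' m}) =
        emeasure Om {\<omega>\<in>space Om. \<forall>m\<in>?F. \<omega> m \<in> {q\<in>space (Qm m). cpp t q \<in> C' m}}"
      unfolding Om_def using J K S2 by (intro OmP.emeasure_PiM_Collect[symmetric]) auto
    also have "{\<omega>\<in>space Om. \<forall>m\<in>?F. \<omega> m \<in> {q\<in>space (Qm m). cpp t q \<in> C' m}} =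
        {\<omega>\<in>space Om. (\<lambda>m. cpp t (\<omega> m)) \<in> {y\<in>space MM. \<forall>m\<in>K. y m \<in> C m}}"
      using cl cl' comp by (auto simp: C'_def split: if_splits)
    finally show "emeasure ?P (prod_emb UNIV (\<lambda>_. M) K (Pi\<^sub>E K C)) = emeasure ?Q (prod_emb UNIV (\<lambda>_. M) K (Pi\<^sub>E K C))"
      unfolding E Q[OF ES] .
  qed simp_all
  then show ?thesis using P[OF C] Q[OF C] by simp
qed

text \<open>Dynkin's argument from the stable generator; the box \<open>space Om\<close> supplies
  the total mass for complements.\<close>

lemma hist_incr_indep:
  assumes s: "s \<ge> 0" and t: "t \<ge> 0" and G: "G \<in> sets (hist s)" and C: "C \<in> sets MM"
  shows "emeasure Om {\<omega>\<in>space Om. \<omega> \<in> G \<and> incr s t \<omega> \<in> C} =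
    emeasure Om G * emeasure Om {\<omega>\<in>space Om. (\<lambda>m. cpp t (\<omega> m)) \<in> C}"
proof -
  let ?I = "{\<omega>\<in>space Om. incr s t \<omega> \<in> C}" and ?p = "emeasure Om {\<omega>\<in>space Om. (\<lambda>m. cpp t (\<omega> m)) \<in> C}"
  have I: "?I \<in> sets Om"
    using measurable_sets[OF incr_measurable C] by (simp add: vimage_def Int_def conj_commute)
  have *: "emeasure Om (G \<inter> ?I) = emeasure Om G * ?p" if "G \<in> sigma_sets (space Om) (boxes s)" for G
    using boxes_Int_stable boxes_Pow that
  proof (induction rule: sigma_sets_induct_disjoint)
    case (basic A)
    have "{\<omega>\<in>space Om. \<omega> \<in> A \<and> incr s t \<omega> \<in> C} = A \<inter> ?I" by auto
    then show ?case using box_incr_indep[OF s t basic C] by simp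
  next
    case empty
    show ?case by simp
  next
    case (compl A)
    have A: "A \<in> sets Om" using compl(1) hist_subalgebra[of s] by (auto simp: subalgebra_def sets_hist)
    have "space Om \<in> boxes s" unfolding boxes_def by (rule CollectI, rule exI[of _ "{}"]) auto
    then have top: "emeasure Om ?I = ?p" using box_incr_indep[OF s t _ C, of "space Om"] by (simp add: Om.emeasure_space_1)
    let ?q = "measure Om {\<omega>\<in>space Om. (\<lambda>m. cpp t (\<omega> m)) \<in> C}"
    have "measure Om (?I - A \<inter> ?I) = measure Om ?I - measure Om (A \<inter> ?I)"
      using A I by (intro Om.finite_measure_Diff) auto
    moreover have "?I - A \<inter> ?I = (space Om - A) \<inter> ?I" by auto
    moreover have "measure Om (A \<inter> ?I) = measure Om A * ?q" "measure Om ?I = ?q"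
      using compl(2) top by (simp_all add: measure_def enn2real_mult)
    ultimately have "measure Om ((space Om - A) \<inter> ?I) = (1 - measure Om A) * ?q"
      by (simp add: left_diff_distrib)
    then have "measure Om ((space Om - A) \<inter> ?I) = measure Om (space Om - A) * ?q"
      unfolding Om.prob_compl[OF A] .
    then show ?case by (simp add: Om.emeasure_eq_measure ennreal_mult)
  next
    case (union A)
    have A: "range A \<subseteq> sets Om" using union(2) hist_subalgebra[of s] by (auto simp: subalgebra_def sets_hist)
    have "emeasure Om ((\<Union>i. A i) \<inter> ?I) = emeasure Om (\<Union>i. A i \<inter> ?I)" by (intro arg_cong[of _ _ "emeasure Om"]) auto
    also have "\<dots> = (\<Sum>i. emeasure Om (A i \<inter> ?I))"
      using A I union(1) by (intro suminf_emeasure[symmetric]) (auto simp: disjoint_family_on_def)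
    also have "\<dots> = (\<Sum>i. emeasure Om (A i)) * ?p" using union(3) by simp
    also have "(\<Sum>i. emeasure Om (A i)) = emeasure Om (\<Union>i. A i)" by (rule suminf_emeasure[OF A union(1)])
    finally show ?case .
  qed
  have "{\<omega>\<in>space Om. \<omega> \<in> G \<and> incr s t \<omega> \<in> C} = G \<inter> ?I" by auto
  then show ?thesis using * G by (simp add: sets_hist)
qed

lemma series_MM: "series \<in> measurable MM M"
  by (rule series_measurable[of "\<lambda>m y. y m"]) simp

lemma Xp_add:
  assumes g: "good \<omega>" and s: "s \<ge> 0" and t: "t \<ge> 0" shows "Xp (s + t) \<omega> = Xp s \<omega> \<oplus> series (incr s t \<omega>)"
proof -
  note gs = good_gv[OF g s] and gst = good_gv[OF g, of "s + t"]
  have gst: "gv (\<lambda>m. cpp (s + t) (\<omega> m))" using s t by (intro good_gv[OF g]) auto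
  have i: "gv (incr s t \<omega>)"
  proof -
    obtain K K' where "\<forall>m>K. cpp s (\<omega> m) = \<zero>" "\<forall>m>K'. cpp (s + t) (\<omega> m) = \<zero>" using gs gst unfolding gv_def by blast
    then have "\<forall>m>max K K'. incr s t \<omega> m = \<zero>" by (simp add: incr_def)
    moreover have "incr s t \<omega> m \<in> B m" for m using gs gst by (auto simp: incr_def gv_def intro!: B_minus)
    ultimately show ?thesis unfolding gv_def by blast
  qed
  have "cpp (s + t) (\<omega> m) = cpp s (\<omega> m) \<oplus> incr s t \<omega> m" for m
  proof -
    have "cpp (s + t) (\<omega> m) \<in> carrier R" "cpp s (\<omega> m) \<in> carrier R" using gv_carrier[OF gs] gv_carrier[OF gst] by auto
    then show ?thesis unfolding incr_def by algebra
  qed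
  then show ?thesis unfolding Xp_def using series_add[OF gs i] by simp
qed

text \<open>Independence makes the joint law of the past and the summed increment a product, and the
  increment is distributed as \<open>Xp t\<close>; the rest is Fubini.\<close>

lemma nn_integral_freeze:
  assumes s: "s \<ge> 0" and t: "t \<ge> 0" and f: "f \<in> borel_measurable (hist s \<Otimes>\<^sub>M M)"
  shows "(\<integral>\<^sup>+\<omega>. f (\<omega>, series (incr s t \<omega>)) \<partial>Om) = (\<integral>\<^sup>+\<omega>. \<integral>\<^sup>+\<omega>'. f (\<omega>, Xp t \<omega>') \<partial>Om \<partial>Om)"
proof -
  let ?F = "restr_to_subalg Om (hist s)" and ?L = "distr Om M (Xp t)"
  have F: "prob_space ?F" by (rule prob_space_restr_to_subalg[OF hist_subalgebra Om_prob])
  have L: "prob_space ?L" by (intro Om.prob_space_distr Xp_measurable)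
  interpret F: prob_space ?F by (rule F)
  interpret L: prob_space ?L by (rule L)
  interpret FL: pair_prob_space ?F ?L ..
  have sF: "sets ?F = sets (hist s)" by (rule sets_restr_to_subalg[OF hist_subalgebra])
  have id: "(\<lambda>\<omega>. \<omega>) \<in> measurable Om (hist s)"
    by (rule measurable_from_subalg[OF hist_subalgebra[of s]]) simp
  have sm: "(\<lambda>\<omega>. series (incr s t \<omega>)) \<in> measurable Om M" by (rule measurable_compose[OF incr_measurable series_MM])
  have pm: "(\<lambda>\<omega>. (\<omega>, series (incr s t \<omega>))) \<in> measurable Om (hist s \<Otimes>\<^sub>M M)" by (rule measurable_Pair[OF id sm])
  have sFL: "sets (?F \<Otimes>\<^sub>M ?L) = sets (hist s \<Otimes>\<^sub>M M)" by (intro sets_pair_measure_cong sF) simp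
  have "?F \<Otimes>\<^sub>M ?L = distr Om (hist s \<Otimes>\<^sub>M M) (\<lambda>\<omega>. (\<omega>, series (incr s t \<omega>)))"
  proof (rule pair_measure_eqI)
    show "sigma_finite_measure ?F" "sigma_finite_measure ?L" by unfold_locales
    show "sets (?F \<Otimes>\<^sub>M ?L) = sets (distr Om (hist s \<Otimes>\<^sub>M M) (\<lambda>\<omega>. (\<omega>, series (incr s t \<omega>))))" using sFL by simp
    fix G C assume "G \<in> sets ?F" "C \<in> sets ?L"
    then have G: "G \<in> sets (hist s)" and C: "C \<in> sets M" by (auto simp: sF)
    have C': "{y\<in>space MM. series y \<in> C} \<in> sets MM"
      using measurable_sets[OF series_MM C] by (simp add: vimage_def Int_def conj_commute)
    have "emeasure ?F G * emeasure ?L C = emeasure Om G * emeasure Om {\<omega>\<in>space Om. (\<lambda>m. cpp t (\<omega> m)) \<in> {y\<in>space MM. series y \<in> C}}"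
      using emeasure_restr_to_subalg[OF hist_subalgebra G] emeasure_distr[OF Xp_measurable C, of t]
        measurable_space[OF levels_measurable, of _ t]
      by (simp add: Xp_def vimage_def Int_def conj_commute cong: conj_cong)
    also have "\<dots> = emeasure Om {\<omega>\<in>space Om. \<omega> \<in> G \<and> incr s t \<omega> \<in> {y\<in>space MM. series y \<in> C}}"
      by (rule hist_incr_indep[OF s t G C', symmetric])
    also have "{\<omega>\<in>space Om. \<omega> \<in> G \<and> incr s t \<omega> \<in> {y\<in>space MM. series y \<in> C}} = (\<lambda>\<omega>. (\<omega>, series (incr s t \<omega>))) -` (G \<times> C) \<inter> space Om"
      using measurable_space[OF incr_measurable, of _ s t] by auto
    also have "emeasure Om \<dots> = emeasure (distr Om (hist s \<Otimes>\<^sub>M M) (\<lambda>\<omega>. (\<omega>, series (incr s t \<omega>)))) (G \<times> C)"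
      using G C by (intro emeasure_distr[OF pm, symmetric]) auto
    finally show "emeasure ?F G * emeasure ?L C = emeasure (distr Om (hist s \<Otimes>\<^sub>M M) (\<lambda>\<omega>. (\<omega>, series (incr s t \<omega>)))) (G \<times> C)" .
  qed
  then have "(\<integral>\<^sup>+\<omega>. f (\<omega>, series (incr s t \<omega>)) \<partial>Om) = (\<integral>\<^sup>+z. f z \<partial>(?F \<Otimes>\<^sub>M ?L))"
    by (simp add: nn_integral_distr[OF pm] f)
  also have "\<dots> = (\<integral>\<^sup>+\<omega>. \<integral>\<^sup>+y. f (\<omega>, y) \<partial>?L \<partial>?F)"
    by (rule L.nn_integral_fst[symmetric]) (use f sFL in \<open>simp cong: measurable_cong_sets\<close>)
  also have "\<dots> = (\<integral>\<^sup>+\<omega>. \<integral>\<^sup>+y. f (\<omega>, y) \<partial>?L \<partial>Om)"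
  proof (rule nn_integral_subalgebra2[OF hist_subalgebra])
    show "(\<lambda>\<omega>. \<integral>\<^sup>+y. f (\<omega>, y) \<partial>?L) \<in> borel_measurable (hist s)"
      by (rule L.borel_measurable_nn_integral_fst) (use f in \<open>simp cong: measurable_cong_sets sets_pair_measure_cong\<close>)
  qed
  also have "\<dots> = (\<integral>\<^sup>+\<omega>. \<integral>\<^sup>+\<omega>'. f (\<omega>, Xp t \<omega>') \<partial>Om \<partial>Om)"
  proof (rule nn_integral_cong)
    fix \<omega> assume \<omega>: "\<omega> \<in> space Om"
    have "(\<lambda>y. f (\<omega>, y)) \<in> borel_measurable M"
      using measurable_compose[OF measurable_Pair1'[of \<omega> "hist s" M] f] \<omega> by simp
    then show "(\<integral>\<^sup>+y. f (\<omega>, y) \<partial>?L) = (\<integral>\<^sup>+\<omega>'. f (\<omega>, Xp t \<omega>') \<partial>Om)" by (simp add: nn_integral_distr[OF Xp_measurable])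
  qed
  finally show ?thesis .
qed

text \<open>The Markov property in integrated form, before any conditional expectation. With
  \<open>G\<close> the whole space it is Chapman-Kolmogorov, with \<open>G\<close> a past event it
  is the core of \<open>path_markov_property\<close>.\<close>

lemma freeze:
  assumes s: "s \<ge> 0" and t: "t \<ge> 0" and x: "x \<in> carrier R" and G: "G \<in> sets (hist s)" and C: "C \<in> sets M"
  shows "(\<integral>\<^sup>+\<omega>. indicator G \<omega> * indicator C (x \<oplus> Xp (s + t) \<omega>) \<partial>Om) =
    (\<integral>\<^sup>+\<omega>. indicator G \<omega> * emeasure (kern t (x \<oplus> Xp s \<omega>)) C \<partial>Om)"
proof -
  let ?f = "\<lambda>(\<omega>, y). indicator G \<omega> * indicator C ((x \<oplus> Xp s \<omega>) \<oplus> y) :: ennreal"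
  have fm: "?f \<in> borel_measurable (hist s \<Otimes>\<^sub>M M)"
  proof -
    have "(\<lambda>z. (x \<oplus> Xp s (fst z)) \<oplus> snd z) \<in> measurable (hist s \<Otimes>\<^sub>M M) M"
      by (intro measurable_rplus measurable_const_carrier x measurable_snd measurable_compose[OF measurable_fst hist_Xp] s order_refl)
    from measurable_compose[OF this borel_measurable_indicator[OF C]]
      measurable_compose[OF measurable_fst borel_measurable_indicator[OF G], of M]
    show ?thesis unfolding split_beta' by (intro borel_measurable_times_ennreal)
  qed
  have "(\<integral>\<^sup>+\<omega>. indicator G \<omega> * indicator C (x \<oplus> Xp (s + t) \<omega>) \<partial>Om) = (\<integral>\<^sup>+\<omega>. ?f (\<omega>, series (incr s t \<omega>)) \<partial>Om)"
  proof (intro nn_integral_cong_AE, use AE_good in eventually_elim)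
    fix \<omega> assume "good \<omega>"
    then show "indicator G \<omega> * indicator C (x \<oplus> Xp (s + t) \<omega>) = ?f (\<omega>, series (incr s t \<omega>))"
      using Xp_closed[of s \<omega>] series_closed x by (simp add: Xp_add[OF _ s t] a_assoc)
  qed
  also have "\<dots> = (\<integral>\<^sup>+\<omega>. \<integral>\<^sup>+\<omega>'. ?f (\<omega>, Xp t \<omega>') \<partial>Om \<partial>Om)" by (rule nn_integral_freeze[OF s t fm])
  also have "\<dots> = (\<integral>\<^sup>+\<omega>. indicator G \<omega> * emeasure (kern t (x \<oplus> Xp s \<omega>)) C \<partial>Om)"
  proof (rule nn_integral_cong)
    fix \<omega>
    have c: "x \<oplus> Xp s \<omega> \<in> carrier R" using x Xp_closed by simp
    have m: "(\<lambda>\<omega>'. indicator C ((x \<oplus> Xp s \<omega>) \<oplus> Xp t \<omega>') :: ennreal) \<in> borel_measurable Om"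
      by (rule measurable_compose[OF measurable_add_Xp[OF c] borel_measurable_indicator[OF C]])
    have "(\<integral>\<^sup>+\<omega>'. indicator C ((x \<oplus> Xp s \<omega>) \<oplus> Xp t \<omega>') \<partial>Om) = emeasure (kern t (x \<oplus> Xp s \<omega>)) C"
      using nn_integral_distr[OF measurable_add_Xp[OF c], of "indicator C" t] C
      by (simp add: kern_def)
    then show "(\<integral>\<^sup>+\<omega>'. ?f (\<omega>, Xp t \<omega>') \<partial>Om) = indicator G \<omega> * emeasure (kern t (x \<oplus> Xp s \<omega>)) C"
      using nn_integral_cmult[OF m, of "indicator G \<omega>"] by simp
  qed
  finally show ?thesis .
qed

lemma kern_transition_function: "transition_function M kern"
  unfolding transition_function_def
proof (intro conjI allI impI ballI)
  show "kern t \<in> measurable M (prob_algebra M)" for t by measurable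
next
  fix x assume "x \<in> space M"
  then have x: "x \<in> carrier R" by (simp add: space_M)
  have "kern 0 x = distr Om M (\<lambda>\<omega>. x)"
    unfolding kern_def
  proof (rule distr_cong_AE[OF refl refl])
    show "AE \<omega> in Om. x \<oplus> Xp 0 \<omega> = x" using AE_good by eventually_elim (simp add: Xp_zero x)
  qed (use x measurable_add_Xp in \<open>auto simp: space_M\<close>)
  also have "\<dots> = return M x" using x by (intro Om.distr_const) (simp add: space_M)
  finally show "kern 0 x = return M x" .
next
  fix s t :: real and x assume s: "0 \<le> s" and t: "0 \<le> t" and "x \<in> space M"
  then have x: "x \<in> carrier R" by (simp add: space_M)
  have sp: "kern s x \<in> space (prob_algebra M)" using kern_prob[OF x] by (simp add: space_prob_algebra)
  show "kern (s + t) x = kern s x \<bind> kern t"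
  proof (rule measure_eqI)
    show "sets (kern (s + t) x) = sets (kern s x \<bind> kern t)" using sets_bind'[OF sp kern_measurable] by simp
    fix C assume "C \<in> sets (kern (s + t) x)"
    then have C: "C \<in> sets M" by simp
    have "emeasure (kern s x \<bind> kern t) C = (\<integral>\<^sup>+y. emeasure (kern t y) C \<partial>kern s x)"
      by (rule emeasure_bind_prob_algebra[OF sp kern_measurable C])
    also have "\<dots> = (\<integral>\<^sup>+\<omega>. emeasure (kern t (x \<oplus> Xp s \<omega>)) C \<partial>Om)"
      unfolding kern_def[of s x]
      using measurable_compose[OF measurable_prob_algebraD[OF kern_measurable] measurable_emeasure_subprob_algebra[OF C]]
      by (intro nn_integral_distr measurable_add_Xp x) simp
    also have "\<dots> = (\<integral>\<^sup>+\<omega>. indicator (space Om) \<omega> * emeasure (kern t (x \<oplus> Xp s \<omega>)) C \<partial>Om)"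
      by (intro nn_integral_cong) simp
    also have "\<dots> = (\<integral>\<^sup>+\<omega>. indicator (space Om) \<omega> * indicator C (x \<oplus> Xp (s + t) \<omega>) \<partial>Om)"
      using sets.top[of "hist s"] by (intro freeze[OF s t x _ C, symmetric]) simp
    also have "\<dots> = (\<integral>\<^sup>+\<omega>. indicator {\<omega>\<in>space Om. x \<oplus> Xp (s + t) \<omega> \<in> C} \<omega> \<partial>Om)"
      by (intro nn_integral_cong) (simp add: indicator_def)
    also have "\<dots> = emeasure (kern (s + t) x) C"
      using measurable_sets[OF measurable_add_Xp[OF x] C, of "s + t"]
      by (simp add: emeasure_kern[OF x C] vimage_def Int_def conj_commute)
    finally show "emeasure (kern (s + t) x) C = emeasure (kern s x \<bind> kern t) C" by simp
  qed
qed

section \<open>Regular paths as the sample space\<close>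

definition paths :: "(real \<Rightarrow> 'a) set" where
  "paths = {w. (\<forall>t. w t \<in> carrier R) \<and>
     (\<forall>t\<ge>0. \<forall>n. \<forall>\<^sub>F r in at_right t. w r \<ominus> w t \<in> B n) \<and>
     (\<forall>t>0. \<exists>l\<in>carrier R. \<forall>n. \<forall>\<^sub>F r in at_left t. w r \<ominus> l \<in> B n) \<and>
     (\<forall>T\<ge>0. \<exists>n. \<forall>t\<in>{0..T}. w t \<in> B n)}"

definition path_space :: "(real \<Rightarrow> 'a) measure" where
  "path_space = sigma paths {{w\<in>paths. w t \<in> A} | t A. A \<in> sets M}"

text \<open>The constant path on exceptional samples keeps all values in \<open>paths\<close>; the
  maximum extends the path to negative times, since time is a real number in
  \<open>markov_process\<close>.\<close>

definition path_map :: "'a \<Rightarrow> (int \<Rightarrow> nat \<Rightarrow> real \<times> 'a) \<Rightarrow> real \<Rightarrow> 'a" where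
  "path_map x \<omega> t = (if good \<omega> then x \<oplus> Xp (max 0 t) \<omega> else x)"

lemma space_path_space: "space path_space = paths"
  unfolding path_space_def by (rule space_measure_of) auto

lemma sets_path_space: "sets path_space = sigma_sets paths {{w\<in>paths. w t \<in> A} | t A. A \<in> sets M}"
  unfolding path_space_def by (rule sets_measure_of) auto

lemma path_eval_measurable: "(\<lambda>w. w t) \<in> measurable path_space M"
proof (rule measurableI)
  show "w t \<in> space M" if "w \<in> space path_space" for w
    using that by (simp add: space_path_space paths_def space_M)
  show "(\<lambda>w. w t) -` A \<inter> space path_space \<in> sets path_space" if "A \<in> sets M" for A
  proof -
    have "(\<lambda>w. w t) -` A \<inter> space path_space = {w\<in>paths. w t \<in> A}" by (auto simp: space_path_space)
    then show ?thesis unfolding sets_path_space using that by (auto intro!: sigma_sets.Basic)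
  qed
qed

lemma path_map_paths: assumes x: "x \<in> carrier R" shows "path_map x \<omega> \<in> paths"
proof (cases "good \<omega>")
  case False
  then have "path_map x \<omega> = (\<lambda>t. x)" by (auto simp: path_map_def)
  then show ?thesis using x B_Union[OF x] unfolding paths_def by (auto intro!: bexI[of _ x])
next
  case g: True
  have p: "path_map x \<omega> = (\<lambda>t. x \<oplus> Xp (max 0 t) \<omega>)" using g by (auto simp: path_map_def)
  have cancel: "(x \<oplus> a) \<ominus> (x \<oplus> b) = a \<ominus> b" if "a \<in> carrier R" "b \<in> carrier R" for a b
    using x that by algebra
  show ?thesis
    unfolding paths_def p mem_Collect_eq
  proof (intro conjI allI impI)
    show "x \<oplus> Xp (max 0 t) \<omega> \<in> carrier R" for t using x Xp_closed by simp
    show "\<forall>\<^sub>F r in at_right t. (x \<oplus> Xp (max 0 r) \<omega>) \<ominus> (x \<oplus> Xp (max 0 t) \<omega>) \<in> B n" if t: "t \<ge> 0" for t n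
    proof -
      have "\<forall>\<^sub>F r in at_right t. t < r" by (rule eventually_at_right_less)
      with Xp_right_continuous[OF g t, of n] show ?thesis
        by eventually_elim (use t in \<open>simp add: cancel Xp_closed max_def\<close>)
    qed
    show "\<exists>l\<in>carrier R. \<forall>n. \<forall>\<^sub>F r in at_left t. (x \<oplus> Xp (max 0 r) \<omega>) \<ominus> l \<in> B n" if t: "t > 0" for t
    proof -
      obtain l where l: "l \<in> carrier R" "\<And>n. \<forall>\<^sub>F r in at_left t. Xp r \<omega> \<ominus> l \<in> B n" using Xp_left_limit[OF g t] by blast
      have pos: "\<forall>\<^sub>F r in at_left t. 0 < r" by (rule eventually_at_leftI[OF _ t]) auto
      have "\<forall>\<^sub>F r in at_left t. (x \<oplus> Xp (max 0 r) \<omega>) \<ominus> (x \<oplus> l) \<in> B n" for n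
        using l(2)[of n] pos by eventually_elim (simp add: cancel Xp_closed l(1) max_def)
      then show ?thesis using x l(1) by (intro bexI[of _ "x \<oplus> l"]) auto
    qed
    show "\<exists>n. \<forall>t\<in>{0..T}. x \<oplus> Xp (max 0 t) \<omega> \<in> B n" if T: "T \<ge> 0" for T
    proof -
      obtain k n where "x \<in> B k" "\<forall>t\<in>{0..T}. Xp t \<omega> \<in> B n" using B_Union[OF x] Xp_locally_bounded[OF g T] by blast
      then have "x \<oplus> Xp t \<omega> \<in> B (max k n)" if "t \<in> {0..T}" for t
        using that by (intro B_add B_le[of x k "max k n"] B_le[of "Xp t \<omega>" n "max k n"]) auto
      then show ?thesis by (intro exI[of _ "max k n"]) (auto simp: max_def)
    qed
  qed
qed

lemma good_measurable: "{\<omega>\<in>space Om. good \<omega>} \<in> sets Om"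
proof -
  have [measurable]: "Measurable.pred Om (\<lambda>\<omega>. nonexp (\<omega> m))" for m
    by (rule measurable_compose[OF Om_component cp.nonexp_sets])
  have [measurable]: "(\<lambda>\<omega>. snd (\<omega> m i)) \<in> measurable Om M" for m i
    by (rule measurable_compose[OF Om_component cp.snd_component])
  show ?thesis unfolding good_def by measurable
qed

lemma path_map_measurable: assumes x: "x \<in> carrier R" shows "path_map x \<in> measurable Om path_space"
  unfolding path_space_def
proof (rule measurable_measure_of)
  show "{{w\<in>paths. w t \<in> A} | t A. A \<in> sets M} \<subseteq> Pow paths" by auto
  show "path_map x \<in> space Om \<rightarrow> paths" using path_map_paths[OF x] by auto
  fix Y assume "Y \<in> {{w\<in>paths. w t \<in> A} | t A. A \<in> sets M}"
  then obtain t A where A: "A \<in> sets M" and Y: "Y = {w\<in>paths. w t \<in> A}" by blast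
  have "(\<lambda>\<omega>. if good \<omega> then x \<oplus> Xp (max 0 t) \<omega> else x) \<in> measurable Om M"
    using good_measurable by (intro measurable_If measurable_add_Xp measurable_const_carrier x)
  from measurable_sets[OF this A]
  show "path_map x -` Y \<inter> space Om \<in> sets Om"
    using path_map_paths[OF x] by (simp add: Y vimage_def path_map_def)
qed

definition path_law :: "'a \<Rightarrow> (real \<Rightarrow> 'a) measure" where
  "path_law x = distr Om path_space (path_map x)"

abbreviation "path_past \<equiv> past_algebra path_space M (\<lambda>t w. w t)"

lemma past_gen_sets:
  "(\<Union>r\<in>{0..s}. {(\<lambda>w. w r) -` A \<inter> space path_space | A. A \<in> sets M}) \<subseteq> sets path_space"
  using measurable_sets[OF path_eval_measurable] by blast

lemma sets_path_past:
  "sets (path_past s) = sigma_sets paths (\<Union>r\<in>{0..s}. {(\<lambda>w. w r) -` A \<inter> paths | A. A \<in> sets M})"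
  using past_gen_sets[of s] sets.space_closed[of path_space]
  unfolding past_algebra_def space_path_space by (intro sets_measure_of) blast

lemma path_past_subalgebra: "subalgebra path_space (path_past s)"
  unfolding subalgebra_def
proof
  show "space (path_past s) = space path_space" unfolding past_algebra_def by (simp add: space_measure_of_conv)
  show "sets (path_past s) \<subseteq> sets path_space"
    unfolding sets_path_past using sets.sigma_sets_subset[OF past_gen_sets] by (simp add: space_path_space)
qed

lemma path_eval_past: assumes "0 \<le> r" "r \<le> s" shows "(\<lambda>w. w r) \<in> measurable (path_past s) M"
proof (rule measurableI)
  have sp: "space (path_past s) = paths" unfolding past_algebra_def by (simp add: space_measure_of_conv space_path_space)
  show "w r \<in> space M" if "w \<in> space (path_past s)" for w
    using that unfolding sp by (simp add: paths_def space_M)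
  show "(\<lambda>w. w r) -` A \<inter> space (path_past s) \<in> sets (path_past s)" if "A \<in> sets M" for A
    unfolding sp sets_path_past using assms that by (intro sigma_sets.Basic UN_I[of r]) auto
qed

text \<open>The correspondence is confined to good samples because \<open>good\<close> involves the
  whole future and need not be an event of \<open>hist s\<close>. The exceptional samples form a
  null set, which suffices under integrals.\<close>

lemma path_past_hist:
  assumes x: "x \<in> carrier R" and A: "A \<in> sets (path_past s)"
  shows "\<exists>G\<in>sets (hist s). \<forall>\<omega>\<in>space Om. good \<omega> \<longrightarrow> (path_map x \<omega> \<in> A \<longleftrightarrow> \<omega> \<in> G)"
  using A unfolding sets_path_past
proof (induction rule: sigma_sets.induct)
  case (Basic A)
  then obtain r C where r: "0 \<le> r" "r \<le> s" and C: "C \<in> sets M" and A: "A = (\<lambda>w. w r) -` C \<inter> paths" by auto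
  have m: "(\<lambda>\<omega>. x \<oplus> Xp r \<omega>) \<in> measurable (hist s) M"
    by (intro measurable_rplus measurable_const_carrier x hist_Xp r)
  show ?case
  proof (rule bexI[OF _ measurable_sets[OF m C]])
    show "\<forall>\<omega>\<in>space Om. good \<omega> \<longrightarrow> (path_map x \<omega> \<in> A \<longleftrightarrow> \<omega> \<in> (\<lambda>\<omega>. x \<oplus> Xp r \<omega>) -` C \<inter> space (hist s))"
      using path_map_paths[OF x] r by (auto simp: A path_map_def)
  qed
next
  case Empty
  show ?case by (rule bexI[of _ "{}"]) auto
next
  case (Compl A)
  then obtain G where G: "G \<in> sets (hist s)" "\<forall>\<omega>\<in>space Om. good \<omega> \<longrightarrow> (path_map x \<omega> \<in> A \<longleftrightarrow> \<omega> \<in> G)" by blast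
  then show ?case
    using path_map_paths[OF x] sets.compl_sets[OF G(1)] by (intro bexI[of _ "space Om - G"]) auto
next
  case (Union A)
  then have "\<forall>i. \<exists>G. G \<in> sets (hist s) \<and> (\<forall>\<omega>\<in>space Om. good \<omega> \<longrightarrow> (path_map x \<omega> \<in> A i \<longleftrightarrow> \<omega> \<in> G))" by blast
  from choice[OF this] obtain G where "\<forall>i. G i \<in> sets (hist s) \<and> (\<forall>\<omega>\<in>space Om. good \<omega> \<longrightarrow> (path_map x \<omega> \<in> A i \<longleftrightarrow> \<omega> \<in> G i))"
    by blast
  then show ?case by (intro bexI[of _ "\<Union>i. G i"]) auto
qed

lemma kern_measure_measurable: "C \<in> sets M \<Longrightarrow> (\<lambda>y. measure (kern t y) C) \<in> borel_measurable M"
  by (rule measurable_compose[OF kern_measurable measurable_measure_prob_algebra])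

text \<open>The conditional expectation is characterized by its integrals over past events; both
  integrals are transported to \<open>Om\<close>, where \<open>freeze\<close> equates them.\<close>

lemma path_markov_property:
  assumes x: "x \<in> carrier R" and s: "s \<ge> 0" and t: "t \<ge> 0" and C: "C \<in> sets M"
  shows "AE w in path_law x. real_cond_exp (path_law x) (path_past s) (\<lambda>v. indicator C (v (s + t))) w = measure (kern t (w s)) C"
proof -
  have pm: "path_map x \<in> measurable Om path_space" by (rule path_map_measurable[OF x])
  have sP: "sets (path_law x) = sets path_space" "space (path_law x) = space path_space" by (auto simp: path_law_def)
  interpret P: prob_space "path_law x" unfolding path_law_def by (intro Om.prob_space_distr pm)
  interpret F: finite_measure_subalgebra "path_law x" "path_past s"
    by unfold_locales (use path_past_subalgebra[of s] in \<open>simp add: subalgebra_def sP\<close>)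
  let ?f = "\<lambda>w. indicator C (w (s + t)) :: real" and ?g = "\<lambda>w. measure (kern t (w s)) C"
  have fm: "?f \<in> borel_measurable path_space"
    by (rule measurable_compose[OF path_eval_measurable borel_measurable_indicator[OF C]])
  have gm: "?g \<in> borel_measurable (path_past s)"
    by (rule measurable_compose[OF path_eval_past[OF s order_refl] kern_measure_measurable[OF C]])
  have gm': "?g \<in> borel_measurable path_space"
    by (rule measurable_compose[OF path_eval_measurable kern_measure_measurable[OF C]])
  have g1: "cmod (of_real (?g w)) \<le> 1" "?g w \<le> 1" if "w \<in> space path_space" for w
  proof -
    have "w s \<in> carrier R" using that by (simp add: space_path_space paths_def)
    then interpret K: prob_space "kern t (w s)" by (rule kern_prob)
    show "?g w \<le> 1" "cmod (of_real (?g w)) \<le> 1" by auto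
  qed
  have fi: "integrable (path_law x) ?f"
    by (rule P.integrable_const_bound[of _ 1]) (use fm sP in \<open>auto simp: indicator_def cong: measurable_cong_sets\<close>)
  have gi: "integrable (path_law x) ?g"
  proof (rule P.integrable_const_bound[of _ 1])
    show "AE w in path_law x. norm (?g w) \<le> 1" using g1 sP by (intro AE_I2) auto
    show "?g \<in> borel_measurable (path_law x)" using gm' by (simp add: path_law_def)
  qed
  show ?thesis
  proof (rule F.real_cond_exp_charact[OF _ fi gi gm])
    fix A assume A: "A \<in> sets (path_past s)"
    obtain G where G: "G \<in> sets (hist s)" and eq: "\<forall>\<omega>\<in>space Om. good \<omega> \<longrightarrow> (path_map x \<omega> \<in> A \<longleftrightarrow> \<omega> \<in> G)"
      using path_past_hist[OF x A] by blast
    have A': "A \<in> sets path_space" using A path_past_subalgebra[of s] by (auto simp: subalgebra_def)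
    have transfer: "ennreal (set_lebesgue_integral (path_law x) A h) = (\<integral>\<^sup>+\<omega>. ennreal (indicator G \<omega> * h' \<omega>) \<partial>Om)"
      if h: "h \<in> borel_measurable path_space" "\<And>w. w \<in> space path_space \<Longrightarrow> 0 \<le> h w \<and> h w \<le> 1"
        and h': "\<And>\<omega>. good \<omega> \<Longrightarrow> h (path_map x \<omega>) = h' \<omega>" for h h' :: "_ \<Rightarrow> real"
    proof -
      have m: "(\<lambda>w. indicator A w * h w) \<in> borel_measurable path_space" using A' h(1) by (intro borel_measurable_times borel_measurable_indicator)
      have i: "integrable (path_law x) (\<lambda>w. indicator A w * h w)"
        by (rule P.integrable_const_bound[of _ 1])
          (use m h(2) sP in \<open>auto intro!: AE_I2 simp: indicator_def path_law_def\<close>)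
      have "ennreal (set_lebesgue_integral (path_law x) A h) = (\<integral>\<^sup>+w. ennreal (indicator A w * h w) \<partial>path_law x)"
        unfolding set_lebesgue_integral_def real_scaleR_def
        by (rule nn_integral_eq_integral[symmetric, OF i]) (use h(2) sP in \<open>auto intro!: AE_I2\<close>)
      also have "\<dots> = (\<integral>\<^sup>+\<omega>. ennreal (indicator A (path_map x \<omega>) * h (path_map x \<omega>)) \<partial>Om)"
        unfolding path_law_def using m by (subst nn_integral_distr[OF pm]) auto
      also have "\<dots> = (\<integral>\<^sup>+\<omega>. ennreal (indicator G \<omega> * h' \<omega>) \<partial>Om)"
      proof (rule nn_integral_cong_AE)
        show "AE \<omega> in Om. ennreal (indicator A (path_map x \<omega>) * h (path_map x \<omega>)) = ennreal (indicator G \<omega> * h' \<omega>)"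
          using AE_good AE_space[of Om] by eventually_elim (use eq h' in \<open>simp add: indicator_def\<close>)
      qed
      finally show ?thesis .
    qed
    have "ennreal (set_lebesgue_integral (path_law x) A ?f) = (\<integral>\<^sup>+\<omega>. ennreal (indicator G \<omega> * indicator C (x \<oplus> Xp (s + t) \<omega>)) \<partial>Om)"
      using s t by (intro transfer fm) (auto simp: path_map_def)
    also have "\<dots> = (\<integral>\<^sup>+\<omega>. indicator G \<omega> * indicator C (x \<oplus> Xp (s + t) \<omega>) \<partial>Om)"
      by (intro nn_integral_cong) (simp add: indicator_def)
    also have "\<dots> = (\<integral>\<^sup>+\<omega>. indicator G \<omega> * emeasure (kern t (x \<oplus> Xp s \<omega>)) C \<partial>Om)" by (rule freeze[OF s t x G C])
    also have "\<dots> = (\<integral>\<^sup>+\<omega>. ennreal (indicator G \<omega> * measure (kern t (x \<oplus> Xp s \<omega>)) C) \<partial>Om)"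
    proof (rule nn_integral_cong)
      fix \<omega>
      have "x \<oplus> Xp s \<omega> \<in> carrier R" using x Xp_closed by simp
      then interpret K: prob_space "kern t (x \<oplus> Xp s \<omega>)" by (rule kern_prob)
      show "indicator G \<omega> * emeasure (kern t (x \<oplus> Xp s \<omega>)) C = ennreal (indicator G \<omega> * measure (kern t (x \<oplus> Xp s \<omega>)) C)"
        by (simp add: K.emeasure_eq_measure indicator_def)
    qed
    also have "\<dots> = ennreal (set_lebesgue_integral (path_law x) A ?g)"
      using s g1 by (intro transfer[symmetric] gm') (auto simp: path_map_def)
    finally have "ennreal (set_lebesgue_integral (path_law x) A ?f) = ennreal (set_lebesgue_integral (path_law x) A ?g)" .
    moreover have "0 \<le> set_lebesgue_integral (path_law x) A ?f" "0 \<le> set_lebesgue_integral (path_law x) A ?g"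
      unfolding set_lebesgue_integral_def by (auto intro!: integral_nonneg_AE AE_I2)
    ultimately show "set_lebesgue_integral (path_law x) A ?f = set_lebesgue_integral (path_law x) A ?g"
      by (simp add: ennreal_inj)
  qed
qed

lemma path_markov_process: "markov_process M kern path_space path_law (\<lambda>t w. w t)"
  unfolding markov_process_def
proof (intro conjI allI impI ballI)
  show "(\<lambda>w. w t) \<in> measurable path_space M" for t by (rule path_eval_measurable)
next
  fix x assume "x \<in> space M"
  then have x: "x \<in> carrier R" by (simp add: space_M)
  show "prob_space (path_law x)" unfolding path_law_def by (intro Om.prob_space_distr path_map_measurable x)
  show "sets (path_law x) = sets path_space" by (simp add: path_law_def)
  \<comment> \<open>Countably many balls pin down the starting point, so the event is
    measurable.\<close>
  have S: "{w\<in>space path_space. w 0 = x} \<in> sets path_space"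
  proof -
    have "{w\<in>space path_space. w 0 = x} = (\<Inter>k::nat. (\<lambda>w. w 0) -` bl x (- int k) \<inter> space path_space)"
    proof (intro equalityI subsetI)
      fix w assume w: "w \<in> (\<Inter>k::nat. (\<lambda>w. w 0) -` bl x (- int k) \<inter> space path_space)"
      then have wc: "w 0 \<in> carrier R" "w \<in> space path_space" by (auto simp: bl_iff)
      have "w 0 \<ominus> x \<in> B n" for n
      proof (rule B_le)
        have "w 0 \<in> bl x (- int (nat \<bar>n\<bar>))" using w by blast
        then show "w 0 \<ominus> x \<in> B (- int (nat \<bar>n\<bar>))" unfolding bl_iff by (rule conjunct2)
      qed simp
      then show "w \<in> {w\<in>space path_space. w 0 = x}" using near_imp_eq wc x by auto
    qed (use x bl_self in auto)
    moreover have "(\<Inter>k::nat. (\<lambda>w. w 0) -` bl x (- int k) \<inter> space path_space) \<in> sets path_space"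
      by (intro sets.countable_INT image_subsetI measurable_sets[OF path_eval_measurable bl_sets[OF x]]) simp
    ultimately show ?thesis by simp
  qed
  show "AE w in path_law x. w 0 = x"
    unfolding path_law_def
    by (subst AE_distr_iff[OF path_map_measurable[OF x] S])
      (use AE_good in eventually_elim, simp add: path_map_def Xp_zero x)
  show "AE w in path_law x. real_cond_exp (path_law x) (path_past s) (\<lambda>v. indicator C (v (s + t))) w = measure (kern t (w s)) C"
    if "0 \<le> s" "0 \<le> t" "C \<in> sets M" for s t C
    by (rule path_markov_property[OF x that])
qed

end

section \<open>The heat equation on \<open>Q\<^sub>S\<close>\<close>

lemma prob_algebra_sets_cong: "sets M = sets N \<Longrightarrow> prob_algebra M = prob_algebra N"
  unfolding prob_algebra_def by (simp cong: subprob_algebra_cong)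

text \<open>The processes are built over the Haar measure, while the theorem speaks of
  \<open>QS_borel\<close>; the two share their measurable sets, and nothing else enters.\<close>

lemma transition_function_cong:
  assumes s: "sets N = sets N'" and k: "transition_function N \<kappa>" shows "transition_function N' \<kappa>"
  using k unfolding transition_function_def prob_algebra_sets_cong[OF s]
    measurable_cong_sets[OF s refl] sets_eq_imp_space_eq[OF s] return_sets_cong[OF s] .

lemma markov_process_cong:
  assumes s: "sets N = sets N'" and m: "markov_process N \<kappa> W Pr X" shows "markov_process N' \<kappa> W Pr X"
proof -
  have p: "past_algebra W N X = past_algebra W N' X" by (simp add: past_algebra_def fun_eq_iff s)
  have w: "X t \<in> measurable W N \<longleftrightarrow> X t \<in> measurable W N'" for t using measurable_cong_sets[OF refl s] by blast
  show ?thesis using m sets_eq_imp_space_eq[OF s] s unfolding markov_process_def p w by simp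
qed

locale heat_QS = haar_QS +
  fixes \<alpha> :: real
  assumes alpha_pos: "\<alpha> > 0"
begin

lemma coset_ball_eq_cball: "coset_ball (QS S) (QS_ball S) a n = cball a n"
  by (simp add: coset_ball_def cball_def)

sublocale H: heat "QS S" "QS_ball S" "QS_char S" "psi S" \<mu> QS_dense "QS_norm S" \<alpha>
proof (intro heat.intro ultrametric_ring.intro ultrametric_ring_axioms.intro heat_axioms.intro cring_QS)
  show "psi S n + ln 2 \<le> psi S (n + 1)" for n
    using prime_ge_2_nat[OF prime_S[OF step_prime_mem[of n]]] by (simp add: psi_step)
  show "sets \<mu> = sigma_sets (carrier (QS S)) {coset_ball (QS S) (QS_ball S) a n | a n. a \<in> carrier (QS S)}"
    unfolding coset_ball_eq_cball by (rule sets_mu)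
  show "emeasure \<mu> (coset_ball (QS S) (QS_ball S) a n) = ennreal (exp (psi S n))" if "a \<in> carrier (QS S)" for a n
    unfolding coset_ball_eq_cball by (rule emeasure_cball[OF that])
qed (fact additive_subgroup_ball QS_ball_mono QS_ball_Inter QS_ball_Union QS_complete QS_ball_mult
  countable_QS_dense QS_dense_carrier QS_dense QS_char_add norm_QS_char QS_char_ball_0 QS_char_nontrivial
  psi_minus QS_norm_0 QS_norm_eq alpha_pos)+

lemma fourier_eq: "fourier S \<mu> f = H.ft f"
  by (simp add: fun_eq_iff fourier_def H.ft_def)

lemma is_fourier_L2_eq: "is_fourier_L2 S \<mu> f g \<longleftrightarrow> H.isF f g"
  unfolding is_fourier_L2_def H.isF_def fourier_eq ..

lemma isF_fourier_L2: "f \<in> L2 \<mu> \<Longrightarrow> H.isF f (fourier_L2 S \<mu> f)"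
  unfolding fourier_L2_def is_fourier_L2_eq by (rule someI_ex[of "H.isF f"]) (rule H.isF_exists)

text \<open>The choice in \<open>inv_fourier_L2\<close> is over a nonempty set by surjectivity and
  fixes the transform up to null sets, which \<open>isF_cong_AE\<close> tolerates.\<close>

lemma isF_inv_fourier_L2:
  assumes g: "g \<in> L2 \<mu>" shows "H.isF (inv_fourier_L2 S \<mu> g) g"
proof -
  obtain h where h: "H.isF h g" using H.isF_surj[OF g] by blast
  let ?P = "\<lambda>h. h \<in> L2 \<mu> \<and> (AE \<xi> in \<mu>. fourier_L2 S \<mu> h \<xi> = g \<xi>)"
  have "?P h"
    using H.isF_unique[OF isF_fourier_L2 h] H.isF_L2(1)[OF h] by blast
  then have "?P (inv_fourier_L2 S \<mu> g)" unfolding inv_fourier_L2_def by (rule someI[of ?P])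
  then show ?thesis
    by (intro H.isF_cong_AE[OF isF_fourier_L2] L2_measurable[OF g]) (auto intro: L2_measurable)
qed

lemma heat_kernel_eq: "heat_kernel S \<mu> \<alpha> x t = H.ft (H.E t) (\<ominus>\<^bsub>QS S\<^esub> x)"
  by (simp add: heat_kernel_def H.ft_def H.E_def H.symb_def mult.commute)

lemma D_mult_eq: "D_mult S \<mu> \<alpha> f = (\<lambda>\<xi>. complex_of_real (H.symb \<xi>) * fourier_L2 S \<mu> f \<xi>)"
  by (simp add: D_mult_def H.symb_def)

text \<open>Every \<open>u t\<close>, with \<open>t = 0\<close> included, has transform
  \<open>g * E t\<close>, so \<open>D_op\<close> of it has transform \<open>symb * g * E t\<close>,
  and its negative is the candidate for the derivative. The limits required are those already proved
  on the Fourier side.\<close>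

lemma classical_solution_exists:
  assumes f: "f \<in> D_dom S \<mu> \<alpha>"
  shows "classical_solution S \<mu> \<alpha> f
    (\<lambda>t. if t = 0 then f else QS_convolution S \<mu> (\<lambda>z. heat_kernel S \<mu> \<alpha> z t) f)" (is "classical_solution S \<mu> \<alpha> f ?u")
proof -
  define g where "g = fourier_L2 S \<mu> f"
  have fL: "f \<in> L2 \<mu>" and mg: "(\<lambda>\<xi>. H.symb \<xi> * g \<xi>) \<in> L2 \<mu>" using f by (auto simp: D_dom_def D_mult_eq g_def)
  have fg: "H.isF f g" unfolding g_def by (rule isF_fourier_L2[OF fL])
  have u: "H.isF (?u t) (\<lambda>\<xi>. g \<xi> * H.E t \<xi>)" if "t \<ge> 0" for t
  proof (cases "t = 0")
    case False
    then have "t > 0" using that by simp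
    then show ?thesis
      by (intro H.isF_convolution[OF fg] H.E_L2 H.E_integrable H.E_le_1) (auto simp: QS_convolution_def heat_kernel_eq)
  qed (simp add: fg)
  have wL: "(\<lambda>\<xi>. H.symb \<xi> * g \<xi> * H.E t \<xi>) \<in> L2 \<mu>" if "t \<ge> 0" for t
    by (rule L2_mult_bounded[OF mg H.E_measurable H.E_le_1[OF that]])
  have eq: "AE \<xi> in \<mu>. H.symb \<xi> * g \<xi> * H.E t \<xi> = D_mult S \<mu> \<alpha> (?u t) \<xi>" if t: "t \<ge> 0" for t
    using H.isF_unique[OF isF_fourier_L2[OF H.isF_L2(1)[OF u[OF t]]] u[OF t]]
    unfolding D_mult_eq by eventually_elim simp
  have Dm: "D_mult S \<mu> \<alpha> (?u t) \<in> L2 \<mu>" if t: "t \<ge> 0" for t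
  proof (rule L2_cong_AE[OF wL[OF t] _ eq[OF t]])
    have "fourier_L2 S \<mu> (?u t) \<in> borel_measurable \<mu>"
      by (rule L2_measurable[OF H.isF_L2(2)[OF isF_fourier_L2[OF H.isF_L2(1)[OF u[OF t]]]]])
    then show "D_mult S \<mu> \<alpha> (?u t) \<in> borel_measurable \<mu>"
      unfolding D_mult_eq
      by (intro borel_measurable_times measurable_compose[OF H.symb_measurable borel_measurable_of_real]) auto
  qed
  have v: "H.isF (D_op S \<mu> \<alpha> (?u t)) (\<lambda>\<xi>. H.symb \<xi> * g \<xi> * H.E t \<xi>)" if t: "t \<ge> 0" for t
  proof (rule H.isF_cong_AE)
    show "H.isF (D_op S \<mu> \<alpha> (?u t)) (D_mult S \<mu> \<alpha> (?u t))"
      unfolding D_op_def by (rule isF_inv_fourier_L2[OF Dm[OF t]])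
    from H.isF_L2(1)[OF this] show "D_op S \<mu> \<alpha> (?u t) \<in> borel_measurable \<mu>" by (rule L2_measurable)
    show "(\<lambda>\<xi>. H.symb \<xi> * g \<xi> * H.E t \<xi>) \<in> borel_measurable \<mu>" by (rule L2_measurable[OF wL[OF t]])
    show "AE \<xi> in \<mu>. D_mult S \<mu> \<alpha> (?u t) \<xi> = H.symb \<xi> * g \<xi> * H.E t \<xi>" using eq[OF t] by eventually_elim simp
  qed simp
  show ?thesis
    unfolding classical_solution_def
  proof (intro conjI exI[of _ "\<lambda>t x. - D_op S \<mu> \<alpha> (?u t) x"] allI impI)
    fix t :: real assume t: "0 \<le> t"
    show "?u t \<in> D_dom S \<mu> \<alpha>" using H.isF_L2(1)[OF u[OF t]] Dm[OF t] by (simp add: D_dom_def)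
    show "(\<lambda>x. - D_op S \<mu> \<alpha> (?u t) x) \<in> L2 \<mu>" by (rule L2_uminus[OF H.isF_L2(1)[OF v[OF t]]])
    show "((\<lambda>s. L2_norm \<mu> (\<lambda>x. (?u s x - ?u t x) / complex_of_real (s - t) - - D_op S \<mu> \<alpha> (?u t) x)) \<longlongrightarrow> 0) (at t within {0..})"
      by (rule H.heat_solution_differentiable[OF H.isF_L2(2)[OF fg] mg t u v[OF t]])
    show "((\<lambda>s. L2_norm \<mu> (\<lambda>x. - D_op S \<mu> \<alpha> (?u s) x - - D_op S \<mu> \<alpha> (?u t) x)) \<longlongrightarrow> 0) (at t within {0..})"
      by (rule H.heat_solution_derivative_continuous[OF mg t v])
    show "AE x in \<mu>. - D_op S \<mu> \<alpha> (?u t) x + D_op S \<mu> \<alpha> (?u t) x = 0" by simp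
  qed simp
qed

lemma kern_heat_transition:
  assumes t: "t \<ge> 0" and x: "x \<in> carrier (QS S)" and A: "A \<in> sets \<mu>"
  shows "complex_of_real (measure (H.kern t x) A) = heat_transition S \<mu> \<alpha> t x A"
proof (cases "t = 0")
  case True
  have "H.kern 0 x = return \<mu> x" using H.kern_transition_function x by (simp add: transition_function_def H.space_M)
  then show ?thesis using True A by (simp add: heat_transition_def measure_return indicator_def)
next
  case False
  then have t: "t > 0" using t by simp
  have "heat_transition S \<mu> \<alpha> t x A = (LINT y|\<mu>. complex_of_real (indicator A y * H.Z t (x \<ominus>\<^bsub>QS S\<^esub> y)))"
    unfolding heat_transition_def set_lebesgue_integral_def using False x
    by (auto intro!: Bochner_Integration.integral_cong simp: heat_kernel_eq H.zk_tendsto_Z(2)[OF t] H.space_M scaleR_conv_of_real)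
  then show ?thesis using H.measure_kern[OF t x A]  by (simp only: integral_complex_of_real)
qed

lemma coset_sets:
  assumes h: "h \<in> carrier (QS S)" and A: "A \<in> sets \<mu>" shows "A +>\<^bsub>QS S\<^esub> h \<in> sets \<mu>"
    and "A +>\<^bsub>QS S\<^esub> h = {y \<in> carrier (QS S). y \<ominus>\<^bsub>QS S\<^esub> h \<in> A}"
proof -
  have Ac: "A \<subseteq> carrier (QS S)" using sets.sets_into_space[OF A] by (simp add: H.space_M)
  have 1: "(a \<oplus>\<^bsub>QS S\<^esub> h) \<ominus>\<^bsub>QS S\<^esub> h = a" "a = (a \<ominus>\<^bsub>QS S\<^esub> h) \<oplus>\<^bsub>QS S\<^esub> h" if "a \<in> carrier (QS S)" for a
    using that h by algebra+
  show *: "A +>\<^bsub>QS S\<^esub> h = {y \<in> carrier (QS S). y \<ominus>\<^bsub>QS S\<^esub> h \<in> A}"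
  proof (intro Set.set_eqI iffI)
    fix y assume "y \<in> A +>\<^bsub>QS S\<^esub> h"
    then obtain a where a: "a \<in> A" "y = a \<oplus>\<^bsub>QS S\<^esub> h" by (auto simp: a_r_coset_def')
    then have "a \<in> carrier (QS S)" using Ac by auto
    then show "y \<in> {y \<in> carrier (QS S). y \<ominus>\<^bsub>QS S\<^esub> h \<in> A}" using a h 1(1)[of a] by simp
  next
    fix y assume "y \<in> {y \<in> carrier (QS S). y \<ominus>\<^bsub>QS S\<^esub> h \<in> A}"
    then show "y \<in> A +>\<^bsub>QS S\<^esub> h" using 1(2)[of y] unfolding a_r_coset_def' by blast
  qed
  have "(\<lambda>y. y \<ominus>\<^bsub>QS S\<^esub> h) \<in> measurable \<mu> \<mu>"
    by (intro H.measurable_rminus H.measurable_const_carrier h measurable_ident_sets) simp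
  from measurable_sets[OF this A] show "A +>\<^bsub>QS S\<^esub> h \<in> sets \<mu>"
    unfolding * by (simp add: vimage_def Int_def H.space_M conj_commute)
qed

text \<open>Read off from the process: \<open>x \<oplus> Xp t\<close> moves along with
  \<open>x\<close>, and the kernels have \<open>heat_transition\<close> as their values.\<close>

lemma space_homogeneous_heat_transition: "space_homogeneous S (heat_transition S \<mu> \<alpha>)"
  unfolding space_homogeneous_def
proof (intro allI impI ballI)
  fix t :: real and x h A
  assume t: "0 \<le> t" and x: "x \<in> carrier (QS S)" and h: "h \<in> carrier (QS S)" and "A \<in> sets (QS_borel S)"
  then have A: "A \<in> sets \<mu>" using haar by (simp add: haar_measure_def)
  have xh: "x \<oplus>\<^bsub>QS S\<^esub> h \<in> carrier (QS S)" using x h by simp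
  have "((x \<oplus>\<^bsub>QS S\<^esub> h) \<oplus>\<^bsub>QS S\<^esub> v) \<ominus>\<^bsub>QS S\<^esub> h = x \<oplus>\<^bsub>QS S\<^esub> v" if "v \<in> carrier (QS S)" for v
    using x h that by algebra
  then have "emeasure (H.kern t (x \<oplus>\<^bsub>QS S\<^esub> h)) (A +>\<^bsub>QS S\<^esub> h) = emeasure (H.kern t x) A"
    using xh H.Xp_closed
    by (simp only: H.emeasure_kern[OF xh coset_sets(1)[OF h A]] H.emeasure_kern[OF x A]) (simp add: coset_sets(2)[OF h A])
  then show "heat_transition S \<mu> \<alpha> t (x \<oplus>\<^bsub>QS S\<^esub> h) (A +>\<^bsub>QS S\<^esub> h) = heat_transition S \<mu> \<alpha> t x A"
    unfolding kern_heat_transition[OF t x A, symmetric] kern_heat_transition[OF t xh coset_sets(1)[OF h A], symmetric]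
    by (simp add: measure_def)
qed

lemma path_regularity:
  assumes w: "w \<in> space H.path_space"
  shows "right_continuous_path S w" "has_left_limits S w" "locally_bounded_path S w"
proof -
  have c: "w t \<in> carrier (QS S)" for t using w by (simp add: H.space_path_space H.paths_def)
  have rc: "\<forall>t\<ge>0. \<forall>n. \<forall>\<^sub>F r in at_right t. w r \<ominus>\<^bsub>QS S\<^esub> w t \<in> QS_ball S n"
    and ll: "\<forall>t>0. \<exists>l\<in>carrier (QS S). \<forall>n. \<forall>\<^sub>F r in at_left t. w r \<ominus>\<^bsub>QS S\<^esub> l \<in> QS_ball S n"
    and lb: "\<forall>T\<ge>0. \<exists>n. \<forall>t\<in>{0..T}. w t \<in> QS_ball S n"
    using w by (simp_all add: H.space_path_space H.paths_def)
  show "right_continuous_path S w" using rc limitin_QS_iff[OF c, of w, OF c] by (simp add: right_continuous_path_def)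
  show "has_left_limits S w" unfolding has_left_limits_def using ll limitin_QS_iff[of _ w, OF _ c] by blast
  show "locally_bounded_path S w" unfolding locally_bounded_path_def using lb H.nrm_le_iff[OF c] by blast
qed

end

theorem theorem4p9:
  fixes S :: "nat set" and \<mu> :: "qs measure" and \<alpha> :: real
  assumes "finite S" and "S \<noteq> {}" and "\<forall>p\<in>S. prime p"
    and "haar_measure S \<mu>"
    and "\<alpha> > 0"
  shows
    "(\<forall>f\<in>D_dom S \<mu> \<alpha>. \<exists>u. classical_solution S \<mu> \<alpha> f u \<and>
        (\<forall>t>0. \<forall>x\<in>carrier (QS S).
           u t x = QS_convolution S \<mu> (\<lambda>z. heat_kernel S \<mu> \<alpha> z t) f x) \<and>
        (\<forall>x\<in>carrier (QS S). u 0 x = f x))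
     \<and> (\<exists>\<kappa>. transition_function (QS_borel S) \<kappa> \<and>
        (\<forall>t\<ge>0. \<forall>x\<in>carrier (QS S). \<forall>B\<in>sets (QS_borel S).
           complex_of_real (measure (\<kappa> t x) B) = heat_transition S \<mu> \<alpha> t x B) \<and>
        space_homogeneous S (heat_transition S \<mu> \<alpha>) \<and>
        (\<exists>(W :: (real \<Rightarrow> qs) measure) Pr X. markov_process (QS_borel S) \<kappa> W Pr X \<and>
           (\<forall>w\<in>space W. right_continuous_path S (\<lambda>t. X t w) \<and>
              has_left_limits S (\<lambda>t. X t w) \<and> locally_bounded_path S (\<lambda>t. X t w))))"
proof -
  interpret heat_QS S \<mu> \<alpha>
    using assms by unfold_locales auto
  have s: "sets \<mu> = sets (QS_borel S)" using assms(4) by (simp add: haar_measure_def)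
  show ?thesis
  proof (intro conjI ballI exI[of _ H.kern])
    fix f assume f: "f \<in> D_dom S \<mu> \<alpha>"
    show "\<exists>u. classical_solution S \<mu> \<alpha> f u \<and>
        (\<forall>t>0. \<forall>x\<in>carrier (QS S). u t x = QS_convolution S \<mu> (\<lambda>z. heat_kernel S \<mu> \<alpha> z t) f x) \<and>
        (\<forall>x\<in>carrier (QS S). u 0 x = f x)"
      by (rule exI, intro conjI, rule classical_solution_exists[OF f]) auto
  next
    show "transition_function (QS_borel S) H.kern" by (rule transition_function_cong[OF s H.kern_transition_function])
    show "\<forall>t\<ge>0. \<forall>x\<in>carrier (QS S). \<forall>B\<in>sets (QS_borel S). complex_of_real (measure (H.kern t x) B) = heat_transition S \<mu> \<alpha> t x B"
      using kern_heat_transition s by simp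
    show "space_homogeneous S (heat_transition S \<mu> \<alpha>)" by (rule space_homogeneous_heat_transition)
    show "\<exists>(W :: (real \<Rightarrow> qs) measure) Pr X. markov_process (QS_borel S) H.kern W Pr X \<and>
       (\<forall>w\<in>space W. right_continuous_path S (\<lambda>t. X t w) \<and> has_left_limits S (\<lambda>t. X t w) \<and> locally_bounded_path S (\<lambda>t. X t w))"
      using markov_process_cong[OF s H.path_markov_process] path_regularity
      by (intro exI[of _ H.path_space] exI[of _ H.path_law] exI[of _ "\<lambda>t w. w t"]) simp
  qed
qed

end
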